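(* Assume that conditions $\mathcal{C}_2(\boldsymbol{\gamma},\boldsymbol{\rho},\boldsymbol{A})$ and $\mathcal{J}(\boldsymbol{R})$ (stated in the context) hold with $\boldsymbol{\gamma}=\gamma\boldsymbol{1}$, $\rho_j<0$ and $A_j(t)=\gamma\beta_jt^{\rho_j}$ for all $j$. Suppose, without loss of generality, that $n_1\leq\cdots\leq n_m$ and that, for any $j\in\{1,\ldots,m\}$, as $n\to\infty$: $k_j=k_j(n)\to\infty$, $k_j/n_j\to0$, $n_1/n_j\to b_j\in(0,1]$, $k_1/k_j\to c_j\in(0,\infty)$ (with $c_1=1$ and $b_m\leq\cdots\leq b_1=1$) and $\sqrt{k_j}A_j(n_j/k_j)\to\lambda_j=0$. Assume that the matrix $\mathbf{V}$ defined in the context is positive definite. Assume further that, for all $j$, $\widehat{\beta}_j$ is a consistent estimator of $\beta_j$ and $(\widehat{\rho}_j-\rho_j)\log n_j=\operatorname{o}_{\mathbb{P}}(1)$. Let $k=\sum_{j=1}^mk_j$ and let $p=p(n)\to0$ be such that $k/(np)\to\infty$ and $\sqrt{k}/\log(k/(np))\to\infty$ as $n\to\infty$. Consider $(\mathcal{H})$: for any $j\neq\ell$ in $\{1,\ldots,m\}$, $U_j(t)/U_\ell(t)\to1$ as $t\to\infty$; versus $(\mathcal{H}')$: there are $j\neq\ell$ in $\{1,\ldots,m\}$ with $\lim_{\tau\uparrow1}q_j(\tau)/q_\ell(\tau)\neq1$. Let $\alpha\in(0,1)$ and let $\chi^2_{m-1,1-\alpha}$ be the $(1-\alpha)$th quantile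 of the chi-square distribution with $m-1$ degrees of freedom. Then, as $n\to\infty$, $\mathbb{P}(L_n(p)>\chi^2_{m-1,1-\alpha})\to\alpha$ under $(\mathcal{H})$, and $L_n(p)\stackrel{\mathbb{P}}{\longrightarrow}+\infty$ under $(\mathcal{H}')$. Moreover, under $(\mathcal{H})$, if $\widehat{\boldsymbol{\omega}}_n^\top\boldsymbol{1}=1$ with $\widehat{\boldsymbol{\omega}}_n\stackrel{\mathbb{P}}{\longrightarrow}\boldsymbol{\omega}$ then, for any $\alpha\in(0,1)$ and $j\in\{1,\ldots,m\}$, $$\lim_{n\to\infty}\mathbb{P}\left(q_j(1-p)\in\left[\widehat{q}_n^\star(1-p|\widehat{\boldsymbol{\omega}}_n)\exp\left(\pm z_{1-\alpha/2}\log\left[\frac{k}{np}\right]\sqrt{\frac{\widehat{\boldsymbol{\omega}}_n^\top\widehat{\mathbf{V}}_{\boldsymbol{c}}\widehat{\boldsymbol{\omega}}_n}{k}}\right)\right]\right)=1-\alpha,$$ where $z_{1-\alpha/2}$ is the $(1-\alpha/2)$th quantile of the standard Gaussian distribution.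
   Context: Setting: $m$ is a fixed integer, $\boldsymbol{X}=(X_1,\ldots,X_m)^\top$ is a random vector and $\boldsymbol{X}_i=(X_{i,1},\ldots,X_{i,m})^\top$, $i\geq1$, are independent copies of $\boldsymbol{X}$. The data are the $X_{i,j}$ for $1\leq j\leq m$, $1\leq i\leq n_j=n_j(n)$, with $n=\sum_{j=1}^m n_j$ and $n_j\to\infty$ as $n\to\infty$. Each $X_j$ has a continuous distribution function $F_j$, $\overline{F}_j=1-F_j$, quantile function $q_j$ and tail quantile function $U_j(t)=\inf\{x\in\mathbb{R}:1/\overline{F}_j(x)\geq t\}$, so $q_j(1-p)=U_j(1/p)$. Condition $\mathcal{C}_2(\boldsymbol{\gamma},\boldsymbol{\rho},\boldsymbol{A})$, with $\boldsymbol{\gamma}=(\gamma_1,\ldots,\gamma_m)^\top$: for every $j$, $\gamma_j>0$, $\rho_j\leq0$, $A_j$ has constant sign and converges to $0$ at infinity, and for all $x>0$, $\lim_{t\to\infty}\frac{1}{A_j(t)}\left[\frac{U_j(tx)}{U_j(t)}-x^{\gamma_j}\right]=x^{\gamma_j}\frac{x^{\rho_j}-1}{\rho_j}$ (read as $x^{\gamma_j}\log x$ if $\rho_j=0$). Condition $\mathcal{J}(\boldsymbol{R})$: with $\overline{C}_{j,\ell}(u,v)=\mathbb{P}(\overline{F}_j(X_j)\leq u,\overline{F}_\ell(X_\ell)\leq v)$, for any $j\neq\ell$ there is a function $R_{j,\ell}$ on $[0,\infty]^2\setminus\{(\infty,\infty)\}$ such that $\lim_{s\to\infty}s\,\overline{C}_{j,\ell}(x_j/s,x_\ell/s)=R_{j,\ell}(x_j,x_\ell)$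 for all $(x_j,x_\ell)$ in this set. $\mathbf{V}$ is the symmetric matrix with $\mathbf{V}_{j,j}=\gamma_j^2$ and $\mathbf{V}_{j,\ell}=\gamma_j\gamma_\ell\sqrt{c_j/c_\ell}\,R_{j,\ell}(c_\ell/c_j,b_\ell/b_j)$ for $j<\ell$. Estimators: with $X_{1:n_j,j}\leq\cdots\leq X_{n_j:n_j,j}$ the order statistics of the $j$th sample, $\widehat{\gamma}_j(k_j)=k_j^{-1}\sum_{i=1}^{k_j}\log(X_{n_j-i+1:n_j,j}/X_{n_j-k_j:n_j,j})$, $\widehat{\gamma}_n(\boldsymbol{\omega})=\sum_{j=1}^m\omega_j\widehat{\gamma}_j(k_j)$, $\widehat{q}_j^\star(1-p|k_j)=(k_j/(n_jp))^{\widehat{\gamma}_j(k_j)}X_{n_j-k_j:n_j,j}$ and $\widehat{q}_n^\star(1-p|\boldsymbol{\omega})=\prod_{j=1}^m[\widehat{q}_j^\star(1-p|k_j)]^{\omega_j}$. $\boldsymbol{1}$ is the vector of ones in $\mathbb{R}^m$, and $\widehat{\boldsymbol{\omega}}_n$ denotes a possibly random weight vector. $\widehat{\beta}_j$ and $\widehat{\rho}_j$ are estimators of $\beta_j$ and $\rho_j$. Let $n_{j,\ell}=\min(n_j,n_\ell)$, $k_{j,\ell}=k_j$ if $n_j<n_\ell$ and $k_{j,\ell}=k_\ell$ otherwise, and $$\widehat{R}_{j,\ell}(u,v)=\frac{1}{k_{j,\ell}}\sum_{i=1}^{n_{j,\ell}}\mathbb{1}\left\{\frac{n_{j,\ell}+1-r_{n_{j,\ell},i,j}}{k_{j,\ell}(n_{j,\ell}+1)/n_{j,\ell}}\leq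 u,\ \frac{n_{j,\ell}+1-r_{n_{j,\ell},i,\ell}}{k_{j,\ell}(n_{j,\ell}+1)/n_{j,\ell}}\leq v\right\},$$ where $r_{n_{j,\ell},i,j}$ (resp. $r_{n_{j,\ell},i,\ell}$) is the rank of $X_{i,j}$ among $X_{1,j},\ldots,X_{n_{j,\ell},j}$ (resp. of $X_{i,\ell}$ among $X_{1,\ell},\ldots,X_{n_{j,\ell},\ell}$). $\overline{\mathbf{V}}_{\boldsymbol{c}}$ is the symmetric matrix with $[\overline{\mathbf{V}}_{\boldsymbol{c}}]_{j,j}=k\,\widehat{\gamma}_j^2(k_j)/k_j$ and $[\overline{\mathbf{V}}_{\boldsymbol{c}}]_{j,\ell}=k\,\widehat{\gamma}_j(k_j)\widehat{\gamma}_\ell(k_\ell)k_j^{-1}\widehat{R}_{j,\ell}(k_j/k_\ell,n_j/n_\ell)$ for $j<\ell$. With $\boldsymbol{Z}_n(p)=(\log\widehat{q}_1^\star(1-p|k_1),\ldots,\log\widehat{q}_m^\star(1-p|k_m))^\top$ and $\overline{z}_n=\frac{\boldsymbol{1}^\top\overline{\mathbf{V}}_{\boldsymbol{c}}^{-1}\boldsymbol{Z}_n(p)}{\boldsymbol{1}^\top\overline{\mathbf{V}}_{\boldsymbol{c}}^{-1}\boldsymbol{1}}$, the test statistic is $$L_n(p)=\frac{k}{\log^2(k/(np))}(\boldsymbol{Z}_n(p)-\overline{z}_n\boldsymbol{1})^\top\overline{\mathbf{V}}_{\boldsymbol{c}}^{-1}(\boldsymbol{Z}_n(p)-\overline{z}_n\boldsymbol{1}).$$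 $\widehat{\mathbf{V}}_{\boldsymbol{c}}$ is the symmetric matrix with $[\widehat{\mathbf{V}}_{\boldsymbol{c}}]_{j,j}=k\,\widehat{\gamma}_n^2(\boldsymbol{\omega}_0)/k_j$ and $[\widehat{\mathbf{V}}_{\boldsymbol{c}}]_{j,\ell}=k\,\widehat{\gamma}_n^2(\boldsymbol{\omega}_0)k_j^{-1}\widehat{R}_{j,\ell}(k_j/k_\ell,n_j/n_\ell)$ for $j<\ell$, where $\boldsymbol{\omega}_0$ is an arbitrary fixed (pilot) weight vector with $\boldsymbol{\omega}_0^\top\boldsymbol{1}=1$. *)

theory Defs
  imports "HOL-Probability.Probability"
begin

definition marginal_cdf :: "'a measure \<Rightarrow> ('a \<Rightarrow> real ^ 'm) \<Rightarrow> 'm \<Rightarrow> real \<Rightarrow> real" where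
  "marginal_cdf M Y j = cdf (distr M borel (\<lambda>\<xi>. Y \<xi> $ j))"

definition quantile :: "(real \<Rightarrow> real) \<Rightarrow> real \<Rightarrow> real" where
  "quantile F \<tau> = Inf {x. \<tau> \<le> F x}"

(* The first disjunct renders the convention 1/0 = \<infinity>. *)
definition tail_quantile :: "(real \<Rightarrow> real) \<Rightarrow> real \<Rightarrow> real" where
  "tail_quantile F t = Inf {x. 1 - F x = 0 \<or> t \<le> 1 / (1 - F x)}"

definition std_normal :: "real measure" where
  "std_normal = density lborel (\<lambda>x. ennreal (std_normal_density x))"

(* Law of the sum of squares of d independent standard Gaussian variables. *)
definition chi_square :: "nat \<Rightarrow> real measure" where
  "chi_square d = distr (Pi\<^sub>M {..<d} (\<lambda>_. std_normal)) borel (\<lambda>z. \<Sum>i<d. (z i)\<^sup>2)"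

definition tendsto_in_prob ::
    "'a measure \<Rightarrow> (nat \<Rightarrow> 'a \<Rightarrow> 'b::metric_space) \<Rightarrow> 'b \<Rightarrow> bool" where
  "tendsto_in_prob M Y c \<longleftrightarrow>
     (\<forall>\<epsilon>>0. (\<lambda>N. measure M {\<xi> \<in> space M. \<epsilon> < dist (Y N \<xi>) c}) \<longlonglongrightarrow> 0)"

definition diverges_in_prob :: "'a measure \<Rightarrow> (nat \<Rightarrow> 'a \<Rightarrow> real) \<Rightarrow> bool" where
  "diverges_in_prob M Y \<longleftrightarrow>
     (\<forall>B. (\<lambda>N. measure M {\<xi> \<in> space M. B < Y N \<xi>}) \<longlonglongrightarrow> 1)"

definition cond_C2 ::
    "('m \<Rightarrow> real \<Rightarrow> real) \<Rightarrow> ('m \<Rightarrow> real) \<Rightarrow> ('m \<Rightarrow> real) \<Rightarrow> ('m \<Rightarrow> real \<Rightarrow> real) \<Rightarrow> bool" where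
  "cond_C2 U \<gamma> \<rho> A \<longleftrightarrow>
     (\<forall>j. 0 < \<gamma> j \<and> \<rho> j \<le> 0 \<and>
          ((\<forall>t>0. 0 \<le> A j t) \<or> (\<forall>t>0. A j t \<le> 0)) \<and>
          (A j \<longlongrightarrow> 0) at_top \<and>
          (\<forall>x>0. ((\<lambda>t. 1 / A j t * (U j (t * x) / U j t - x powr \<gamma> j)) \<longlongrightarrow>
                    x powr \<gamma> j * (if \<rho> j = 0 then ln x else (x powr \<rho> j - 1) / \<rho> j)) at_top))"

definition survival_copula ::
    "'a measure \<Rightarrow> ('a \<Rightarrow> real ^ 'm) \<Rightarrow> 'm \<Rightarrow> 'm \<Rightarrow> ennreal \<Rightarrow> ennreal \<Rightarrow> real" where
  "survival_copula M Y j l u v =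
     measure M {\<xi> \<in> space M. ennreal (1 - marginal_cdf M Y j (Y \<xi> $ j)) \<le> u \<and>
                            ennreal (1 - marginal_cdf M Y l (Y \<xi> $ l)) \<le> v}"

definition cond_J ::
    "'a measure \<Rightarrow> ('a \<Rightarrow> real ^ 'm) \<Rightarrow> ('m \<Rightarrow> 'm \<Rightarrow> ennreal \<Rightarrow> ennreal \<Rightarrow> real) \<Rightarrow> bool" where
  "cond_J M Y R \<longleftrightarrow>
     (\<forall>j l. j \<noteq> l \<longrightarrow> (\<forall>x y. (x, y) \<noteq> (\<infinity>, \<infinity>) \<longrightarrow>
        ((\<lambda>s. s * survival_copula M Y j l (x / ennreal s) (y / ennreal s)) \<longlongrightarrow> R j l x y) at_top))"

definition tails_equivalent :: "('m \<Rightarrow> real \<Rightarrow> real) \<Rightarrow> bool" where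
  "tails_equivalent U \<longleftrightarrow> (\<forall>j l. j \<noteq> l \<longrightarrow> ((\<lambda>t. U j t / U l t) \<longlongrightarrow> 1) at_top)"

(* "The limit differs from 1" includes infinite limits. Under cond_C2 with negative second-order
   indices and a common \<gamma>, the limit of q j / q l exists, so non-convergence to 1 says the same. *)
definition tails_different :: "('m \<Rightarrow> real \<Rightarrow> real) \<Rightarrow> bool" where
  "tails_different q \<longleftrightarrow> (\<exists>j l. j \<noteq> l \<and> \<not> ((\<lambda>\<tau>. q j \<tau> / q l \<tau>) \<longlongrightarrow> 1) (at_left 1))"

definition sym_matrix ::
    "('m \<Rightarrow> real) \<Rightarrow> ('m \<Rightarrow> 'm \<Rightarrow> real) \<Rightarrow> real ^ ('m::{finite,linorder}) ^ ('m::{finite,linorder})" where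
  "sym_matrix d f = (\<chi> j l. if j = l then d j else if j < l then f j l else f l j)"

definition positive_definite :: "real ^ 'm ^ 'm \<Rightarrow> bool" where
  "positive_definite A \<longleftrightarrow> transpose A = A \<and> (\<forall>x. x \<noteq> 0 \<longrightarrow> 0 < x \<bullet> (A *v x))"

definition V_matrix ::
    "('m \<Rightarrow> real) \<Rightarrow> ('m \<Rightarrow> real) \<Rightarrow> ('m \<Rightarrow> real) \<Rightarrow> ('m \<Rightarrow> 'm \<Rightarrow> ennreal \<Rightarrow> ennreal \<Rightarrow> real)
     \<Rightarrow> real ^ ('m::{finite,linorder}) ^ ('m::{finite,linorder})" where
  "V_matrix \<gamma> c b R =
     sym_matrix (\<lambda>j. (\<gamma> j)\<^sup>2)
       (\<lambda>j l. \<gamma> j * \<gamma> l * sqrt (c j / c l) * R j l (ennreal (c l / c j)) (ennreal (b l / b j)))"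

text \<open>
  A univariate sample of size \<open>n\<close> is \<open>x 1, \<dots>, x n\<close>. In multivariate data the
  observation of the \<open>j\<close>th coordinate of the \<open>i\<close>th vector is \<open>x i $ j\<close>, used only for
  \<open>1 \<le> i \<le> n j\<close>; \<open>k j\<close> is the effective sample size in the \<open>j\<close>th sample.
\<close>

definition order_stat :: "(nat \<Rightarrow> real) \<Rightarrow> nat \<Rightarrow> nat \<Rightarrow> real" where
  "order_stat x n i = sort (map x [1..<Suc n]) ! (i - 1)"

definition rank_of :: "(nat \<Rightarrow> real) \<Rightarrow> nat \<Rightarrow> nat \<Rightarrow> nat" where
  "rank_of x n i = card {i' \<in> {1..n}. x i' \<le> x i}"

definition hill :: "(nat \<Rightarrow> real) \<Rightarrow> nat \<Rightarrow> nat \<Rightarrow> real" where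
  "hill x n k =
     1 / real k * (\<Sum>i=1..k. ln (order_stat x n (n - i + 1) / order_stat x n (n - k)))"

definition weissman :: "(nat \<Rightarrow> real) \<Rightarrow> nat \<Rightarrow> nat \<Rightarrow> real \<Rightarrow> real" where
  "weissman x n k p = (real k / (real n * p)) powr hill x n k * order_stat x n (n - k)"

definition hill_at :: "(nat \<Rightarrow> real ^ 'm) \<Rightarrow> ('m \<Rightarrow> nat) \<Rightarrow> ('m \<Rightarrow> nat) \<Rightarrow> 'm \<Rightarrow> real" where
  "hill_at x n k j = hill (\<lambda>i. x i $ j) (n j) (k j)"

definition weissman_at ::
    "(nat \<Rightarrow> real ^ 'm) \<Rightarrow> ('m \<Rightarrow> nat) \<Rightarrow> ('m \<Rightarrow> nat) \<Rightarrow> real \<Rightarrow> 'm \<Rightarrow> real" where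
  "weissman_at x n k p j = weissman (\<lambda>i. x i $ j) (n j) (k j) p"

definition pooled_hill ::
    "(nat \<Rightarrow> real ^ 'm) \<Rightarrow> ('m \<Rightarrow> nat) \<Rightarrow> ('m \<Rightarrow> nat) \<Rightarrow> real ^ 'm \<Rightarrow> real" where
  "pooled_hill x n k \<omega> = (\<Sum>j\<in>UNIV. \<omega> $ j * hill_at x n k j)"

definition pooled_weissman ::
    "(nat \<Rightarrow> real ^ 'm) \<Rightarrow> ('m \<Rightarrow> nat) \<Rightarrow> ('m \<Rightarrow> nat) \<Rightarrow> real \<Rightarrow> real ^ 'm \<Rightarrow> real" where
  "pooled_weissman x n k p \<omega> = (\<Prod>j\<in>UNIV. weissman_at x n k p j powr (\<omega> $ j))"

definition R_hat ::
    "(nat \<Rightarrow> real ^ 'm) \<Rightarrow> ('m \<Rightarrow> nat) \<Rightarrow> ('m \<Rightarrow> nat) \<Rightarrow> 'm \<Rightarrow> 'm \<Rightarrow> real \<Rightarrow> real \<Rightarrow> real" where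
  "R_hat x n k j l u v =
     (let n' = min (n j) (n l);
          k' = (if n j < n l then k j else k l);
          r = (\<lambda>h i. (real n' + 1 - real (rank_of (\<lambda>i. x i $ h) n' i)) /
                     (real k' * (real n' + 1) / real n'))
      in 1 / real k' * (\<Sum>i=1..n'. if r j i \<le> u \<and> r l i \<le> v then 1 else 0))"

abbreviation total :: "('m::finite \<Rightarrow> nat) \<Rightarrow> nat" where
  "total n \<equiv> (\<Sum>j\<in>UNIV. n j)"

definition V_bar ::
    "(nat \<Rightarrow> real ^ ('m::{finite,linorder})) \<Rightarrow> ('m \<Rightarrow> nat) \<Rightarrow> ('m \<Rightarrow> nat)
     \<Rightarrow> real ^ ('m::{finite,linorder}) ^ ('m::{finite,linorder})" where
  "V_bar x n k =
     sym_matrix (\<lambda>j. real (total k) * (hill_at x n k j)\<^sup>2 / real (k j))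
       (\<lambda>j l. real (total k) * hill_at x n k j * hill_at x n k l / real (k j) *
              R_hat x n k j l (real (k j) / real (k l)) (real (n j) / real (n l)))"

definition V_hat ::
    "(nat \<Rightarrow> real ^ ('m::{finite,linorder})) \<Rightarrow> ('m \<Rightarrow> nat) \<Rightarrow> ('m \<Rightarrow> nat) \<Rightarrow> real ^ ('m::{finite,linorder})
     \<Rightarrow> real ^ ('m::{finite,linorder}) ^ ('m::{finite,linorder})" where
  "V_hat x n k \<omega>\<^sub>0 =
     sym_matrix (\<lambda>j. real (total k) * (pooled_hill x n k \<omega>\<^sub>0)\<^sup>2 / real (k j))
       (\<lambda>j l. real (total k) * (pooled_hill x n k \<omega>\<^sub>0)\<^sup>2 / real (k j) *
              R_hat x n k j l (real (k j) / real (k l)) (real (n j) / real (n l)))"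

definition L_stat ::
    "(nat \<Rightarrow> real ^ ('m::{finite,linorder})) \<Rightarrow> ('m \<Rightarrow> nat) \<Rightarrow> ('m \<Rightarrow> nat) \<Rightarrow> real \<Rightarrow> real" where
  "L_stat x n k p =
     (let W = matrix_inv (V_bar x n k);
          Z = (\<chi> j. ln (weissman_at x n k p j));
          z = (1 \<bullet> (W *v Z)) / (1 \<bullet> (W *v 1));
          D = Z - z *\<^sub>R 1
      in real (total k) / (ln (real (total k) / (real (total n) * p)))\<^sup>2 * (D \<bullet> (W *v D)))"

definition conf_interval ::
    "(nat \<Rightarrow> real ^ ('m::{finite,linorder})) \<Rightarrow> ('m \<Rightarrow> nat) \<Rightarrow> ('m \<Rightarrow> nat) \<Rightarrow> real
     \<Rightarrow> real ^ ('m::{finite,linorder}) \<Rightarrow> real ^ ('m::{finite,linorder}) \<Rightarrow> real \<Rightarrow> real set" where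
  "conf_interval x n k p \<omega>\<^sub>0 \<omega> \<alpha> =
     (let h = quantile (cdf std_normal) (1 - \<alpha> / 2) *
              ln (real (total k) / (real (total n) * p)) *
              sqrt ((\<omega> \<bullet> (V_hat x n k \<omega>\<^sub>0 *v \<omega>)) / real (total k))
      in {pooled_weissman x n k p \<omega> * exp (- h) .. pooled_weissman x n k p \<omega> * exp h})"

end

theory Submission
  imports Defs
begin

text \<open>
  Write \<open>W = 1 - F j (X j)\<close>, which is uniform, so that \<open>E = - ln W\<close> is standard exponential. Integrating
  the second-order condition along dyadic sequences gives \<open>ln (X j) = lc j + \<gamma> E + O (exp (\<rho> j E))\<close> for
  large \<open>E\<close>, and the bias condition makes the error negligible; the tails are equivalent exactly when the
  constants \<open>lc j\<close> agree. For exponential variables, Bahadur's representation of the intermediate order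
  statistic linearises the Hill estimator into \<open>(max 0 (E - t) - indicator {t<..} E)\<close>-scores at the
  deterministic threshold \<open>t = ln (n / k)\<close>. Lyapunov's theorem gives the limiting characteristic function of
  linear combinations of the scores; their covariances converge to values of \<open>R\<close>, by Euler's identity for
  the homogeneous function \<open>R\<close>.

  No weak convergence in several dimensions is needed. Both limit laws concern a sum of squares of
  asymptotically independent standard Gaussian variables; its Laplace transform is a Gaussian average of
  characteristic functions, and by Weierstrass' theorem applied to \<open>exp (- x)\<close> Laplace transforms at the
  natural numbers determine the limit law. Under the null hypothesis the test statistic is the squared
  length of the Gaussian limit in an orthonormal system of the hyperplane orthogonal to the vector of ones,
  and the confidence interval is the event that a single such square does not exceed \<open>z\<^sup>2\<close>.
\<close>

section \<open>Convergence in probability\<close>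

text \<open>Why only the Hill estimators matter: the logarithm of a Weissman estimator is the
  log-threshold plus the Hill estimate times \<open>ln (k j / (n j * p))\<close>. The first error is
  of order \<open>1 / sqrt k\<close>, the second is larger by a diverging logarithm. After
  multiplication by \<open>sqrt k / ln (k / (n * p))\<close> the threshold error and the differences
  between the factors \<open>k j / (n j * p)\<close> vanish, and the rescaled Hill errors remain.
  The quadratic form of the test is unchanged by adding multiples of the vector of ones, so a common
  centre drops out under the null hypothesis, while unequal constants \<open>lc j\<close> survive
  and are multiplied by the squared normalisation. Unequal sample sizes are handled by one array
  over \<open>{1..N}\<close> whose coefficients vanish beyond \<open>n N j\<close>; the overlap of
  two samples then enters the covariance by counting. \<open>matrix_inv\<close>, \<open>ln\<close>
  and \<open>powr\<close> are total functions with default values, and the statistics behave well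
  only on events of probability tending to one. Hence limits are taken along a filter of such
  events, and measurability is claimed separately, for large \<open>N\<close>.\<close>

lemma integrable_mult_squares:
  fixes f g :: "'a \<Rightarrow> real"
  assumes [measurable]: "f \<in> borel_measurable M" "g \<in> borel_measurable M"
    and "integrable M (\<lambda>x. (f x)\<^sup>2)" "integrable M (\<lambda>x. (g x)\<^sup>2)"
  shows "integrable M (\<lambda>x. f x * g x)"
proof (rule Bochner_Integration.integrable_bound)
  show "integrable M (\<lambda>x. (f x)\<^sup>2 + (g x)\<^sup>2)" using assms(3,4) by simp
  have "\<bar>a * b\<bar> \<le> a\<^sup>2 + b\<^sup>2" for a b :: real
  proof -
    have "2 * (\<bar>a\<bar> * \<bar>b\<bar>) \<le> a\<^sup>2 + b\<^sup>2"
      using sum_squares_bound[of "\<bar>a\<bar>" "\<bar>b\<bar>"] by (simp add: mult.assoc)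
    moreover have "0 \<le> \<bar>a\<bar> * \<bar>b\<bar>" by simp
    ultimately show ?thesis unfolding abs_mult by linarith
  qed
  then show "AE x in M. norm (f x * g x) \<le> norm ((f x)\<^sup>2 + (g x)\<^sup>2)"
    by (auto intro: order_trans[OF _ abs_ge_self])
qed measurable

context prob_space begin

text \<open>Convergence in probability is convergence along this filter, which makes the limit calculus of
  the library available for it.\<close>

definition high_prob :: "(nat \<times> 'a) filter" where
  "high_prob = Abs_filter (\<lambda>P. \<exists>A. (\<forall>N. A N \<in> events \<and> (\<forall>\<xi>\<in>A N. P (N, \<xi>))) \<and>
     (\<lambda>N. prob (A N)) \<longlonglongrightarrow> 1)"

text \<open>Bonferroni's inequality; it keeps events of high probability closed under intersection,
  both for the filter and for tightness.\<close>

lemma prob_Int_ge: "A \<in> events \<Longrightarrow> B \<in> events \<Longrightarrow> prob A + prob B - 1 \<le> prob (A \<inter> B)"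
  using finite_measure_Union'[of A B] finite_measure_Diff'[of B A] prob_le_1[of "A \<union> B"]
  by (simp add: Int_commute)

text \<open>The events \<open>A N\<close> are asked to be measurable because the property
  \<open>P\<close> itself may fail to be. A conjunction is witnessed by the intersections, whose
  probability is controlled by \<open>prob_Int_ge\<close>.\<close>

lemma eventually_high_prob:
  "eventually P high_prob \<longleftrightarrow> (\<exists>A. (\<forall>N. A N \<in> events \<and> (\<forall>\<xi>\<in>A N. P (N, \<xi>))) \<and>
     (\<lambda>N. prob (A N)) \<longlonglongrightarrow> 1)"
  unfolding high_prob_def
proof (rule eventually_Abs_filter, rule is_filter.intro)
  show "\<exists>A. (\<forall>N. A N \<in> events \<and> (\<forall>\<xi>\<in>A N. True)) \<and> (\<lambda>N. prob (A N)) \<longlonglongrightarrow> 1"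
    by (rule exI[of _ "\<lambda>N. space M"]) (auto simp: prob_space)
next
  fix P Q
  assume "\<exists>A. (\<forall>N. A N \<in> events \<and> (\<forall>\<xi>\<in>A N. P (N, \<xi>))) \<and> (\<lambda>N. prob (A N)) \<longlonglongrightarrow> 1"
    and "\<exists>A. (\<forall>N. A N \<in> events \<and> (\<forall>\<xi>\<in>A N. Q (N, \<xi>))) \<and> (\<lambda>N. prob (A N)) \<longlonglongrightarrow> 1"
  then obtain A B where A: "\<And>N. A N \<in> events" "\<And>N \<xi>. \<xi> \<in> A N \<Longrightarrow> P (N, \<xi>)"
      "(\<lambda>N. prob (A N)) \<longlonglongrightarrow> 1"
    and B: "\<And>N. B N \<in> events" "\<And>N \<xi>. \<xi> \<in> B N \<Longrightarrow> Q (N, \<xi>)" "(\<lambda>N. prob (B N)) \<longlonglongrightarrow> 1"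
    by metis
  have "(\<lambda>N. prob (A N \<inter> B N)) \<longlonglongrightarrow> 1"
  proof (rule tendsto_sandwich)
    show "(\<lambda>N. prob (A N) + prob (B N) - 1) \<longlonglongrightarrow> 1"
      using A(3) B(3) by (auto intro!: tendsto_eq_intros)
    show "\<forall>\<^sub>F N in sequentially. prob (A N) + prob (B N) - 1 \<le> prob (A N \<inter> B N)"
      using prob_Int_ge A(1) B(1) by simp
  qed (auto intro!: tendsto_eq_intros)
  then show "\<exists>A. (\<forall>N. A N \<in> events \<and> (\<forall>\<xi>\<in>A N. P (N, \<xi>) \<and> Q (N, \<xi>))) \<and>
      (\<lambda>N. prob (A N)) \<longlonglongrightarrow> 1"
    using A(1,2) B(1,2) by (intro exI[of _ "\<lambda>N. A N \<inter> B N"]) auto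
next
  fix P Q :: "nat \<times> 'a \<Rightarrow> bool"
  assume "\<forall>x. P x \<longrightarrow> Q x"
    and "\<exists>A. (\<forall>N. A N \<in> events \<and> (\<forall>\<xi>\<in>A N. P (N, \<xi>))) \<and> (\<lambda>N. prob (A N)) \<longlonglongrightarrow> 1"
  then show "\<exists>A. (\<forall>N. A N \<in> events \<and> (\<forall>\<xi>\<in>A N. Q (N, \<xi>))) \<and> (\<lambda>N. prob (A N)) \<longlonglongrightarrow> 1"
    by blast
qed

text \<open>A diagonal argument: for each \<open>N\<close> an almost optimal measurable event inside
  the property is fixed once, so that the bounds \<open>1 - \<eta>\<close> for all
  \<open>\<eta>\<close> are met by the same sequence of events.\<close>

lemma eventually_high_probI:
  assumes "\<And>\<eta>. 0 < \<eta> \<Longrightarrow>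
    \<forall>\<^sub>F N in sequentially. \<exists>A\<in>events. (\<forall>\<xi>\<in>A. P (N, \<xi>)) \<and> 1 - \<eta> \<le> prob A"
  shows "eventually P high_prob"
proof -
  define \<A> where "\<A> N = {A \<in> events. \<forall>\<xi>\<in>A. P (N, \<xi>)}" for N
  define s where "s N = (SUP A\<in>\<A> N. prob A)" for N
  have bdd: "bdd_above (prob ` \<A> N)" for N
    by (rule bdd_aboveI2[of _ _ 1]) simp
  have ne: "\<A> N \<noteq> {}" for N
    by (auto simp: \<A>_def intro!: exI[of _ "{}"])
  \<comment> \<open>The supremum may fail to be attained; a slack that tends to zero is
    harmless.\<close>
  have "\<exists>A\<in>\<A> N. s N - 1 / real (Suc N) < prob A" for N
    using less_cSUP_iff[OF ne[of N] bdd[of N], of "s N - 1 / real (Suc N)"] by (simp add: s_def)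
  then obtain A where A: "\<And>N. A N \<in> \<A> N" "\<And>N. s N - 1 / real (Suc N) < prob (A N)"
    by metis
  have "(\<lambda>N. prob (A N)) \<longlonglongrightarrow> 1"
  proof (rule order_tendstoI)
    fix a :: real assume "a < 1"
    then have \<eta>: "0 < (1 - a) / 2" by simp
    have "\<forall>\<^sub>F N in sequentially. 1 / real (Suc N) < (1 - a) / 2"
      using \<eta> LIMSEQ_inverse_real_of_nat
      by (intro order_tendstoD(2)[where y = 0]) (auto simp: inverse_eq_divide)
    with assms[OF \<eta>] show "\<forall>\<^sub>F N in sequentially. a < prob (A N)"
    proof eventually_elim
      case (elim N)
      then obtain B where B: "B \<in> \<A> N" "1 - (1 - a) / 2 \<le> prob B"
        by (auto simp: \<A>_def)
      then have "prob B \<le> s N"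
        unfolding s_def by (intro cSUP_upper bdd)
      then have "1 - (1 - a) / 2 \<le> s N"
        using B(2) by simp
      moreover have "1 - (1 - a) / 2 = a + (1 - a) / 2"
        by (simp add: field_simps)
      ultimately show ?case using A(2)[of N] elim(2) by linarith
    qed
  next
    fix a :: real assume "1 < a"
    then show "\<forall>\<^sub>F N in sequentially. prob (A N) < a"
      by (intro always_eventually allI) (meson le_less_trans prob_le_1)
  qed
  then show ?thesis
    using A(1) unfolding eventually_high_prob \<A>_def by blast
qed

text \<open>Leads back from the filter to concrete events. Measurability is asked only eventually
  because the order statistics have valid indices only for large \<open>N\<close>.\<close>

lemma high_prob_tendsto_1:
  assumes "eventually P high_prob"
    and "\<forall>\<^sub>F N in sequentially. E N \<in> events"
    and "\<And>N \<xi>. \<xi> \<in> space M \<Longrightarrow> P (N, \<xi>) \<Longrightarrow> \<xi> \<in> E N"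
  shows "(\<lambda>N. prob (E N)) \<longlonglongrightarrow> 1"
proof -
  obtain A where A: "\<And>N. A N \<in> events" "\<And>N \<xi>. \<xi> \<in> A N \<Longrightarrow> P (N, \<xi>)"
      "(\<lambda>N. prob (A N)) \<longlonglongrightarrow> 1"
    using assms(1) unfolding eventually_high_prob by metis
  show ?thesis
  proof (rule tendsto_sandwich[OF _ _ A(3)])
    show "\<forall>\<^sub>F N in sequentially. prob (A N) \<le> prob (E N)"
      using assms(2)
    proof eventually_elim
      case (elim N)
      have "A N \<subseteq> E N" using A(1,2) assms(3) sets.sets_into_space by blast
      then show ?case using elim by (intro finite_measure_mono) auto
    qed
  qed (auto intro!: tendsto_eq_intros)
qed

lemma filterlim_fst_high_prob: "filterlim fst sequentially high_prob"
  unfolding filterlim_iff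
proof safe
  fix P assume "\<forall>\<^sub>F N in sequentially. P N"
  then obtain N0 where N0: "\<And>N. N0 \<le> N \<Longrightarrow> P N" by (auto simp: eventually_sequentially)
  show "\<forall>\<^sub>F z in high_prob. P (fst z)"
    unfolding eventually_high_prob
  proof (intro exI conjI)
    let ?A = "\<lambda>N. if N0 \<le> N then space M else {}"
    show "\<forall>N. ?A N \<in> events \<and> (\<forall>\<xi>\<in>?A N. P (fst (N, \<xi>)))"
      using N0 by simp
    show "(\<lambda>N. prob (?A N)) \<longlonglongrightarrow> 1"
      by (rule tendsto_eventually, rule eventually_sequentiallyI[of N0]) (simp add: prob_space)
  qed
qed

lemma eventually_fst_high_prob:
  "eventually P sequentially \<Longrightarrow> eventually (\<lambda>z. P (fst z)) high_prob"
  using filterlim_fst_high_prob by (simp add: filterlim_iff)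

lemma filterlim_fst:
  "filterlim a F sequentially \<Longrightarrow> filterlim (\<lambda>z. a (fst z)) F high_prob"
  by (rule filterlim_compose[OF _ filterlim_fst_high_prob])

lemma AE_high_prob:
  assumes "\<And>N. AE \<xi> in M. P N \<xi>"
  shows "eventually (\<lambda>z. P (fst z) (snd z)) high_prob"
proof (rule eventually_high_probI)
  fix \<eta> :: real assume "0 < \<eta>"
  show "\<forall>\<^sub>F N in sequentially. \<exists>A\<in>events. (\<forall>\<xi>\<in>A. P (fst (N, \<xi>)) (snd (N, \<xi>))) \<and> 1 - \<eta> \<le> prob A"
  proof (intro always_eventually allI)
    fix N
    obtain B where B: "{\<xi>\<in>space M. \<not> P N \<xi>} \<subseteq> B" "B \<in> null_sets M"
      using assms[of N] by (auto simp: eventually_ae_filter)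
    then have "prob (space M - B) = 1"
      by (subst prob_compl) (auto simp: measure_eq_0_null_sets)
    then show "\<exists>A\<in>events. (\<forall>\<xi>\<in>A. P (fst (N, \<xi>)) (snd (N, \<xi>))) \<and> 1 - \<eta> \<le> prob A"
      using B \<open>0 < \<eta>\<close> by (intro bexI[of _ "space M - B"]) auto
  qed
qed

lemma space_high_prob: "eventually (\<lambda>z. snd z \<in> space M) high_prob"
  by (rule AE_high_prob) simp

lemma tendsto_high_probI:
  fixes Y :: "nat \<Rightarrow> 'a \<Rightarrow> 'b::{metric_space, second_countable_topology}"
  assumes "tendsto_in_prob M Y c" and [measurable]: "\<And>N. Y N \<in> borel_measurable M"
  shows "((\<lambda>z. Y (fst z) (snd z)) \<longlongrightarrow> c) high_prob"
proof (rule tendstoI)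
  fix e :: real assume "0 < e"
  \<comment> \<open>The definition bounds strict exceedances, so the complement gives a weak
    inequality; half of \<open>e\<close> makes it strict.\<close>
  then have lim: "(\<lambda>N. prob {\<xi> \<in> space M. e / 2 < dist (Y N \<xi>) c}) \<longlonglongrightarrow> 0"
    using assms(1)[unfolded tendsto_in_prob_def, rule_format, of "e / 2"] by simp
  show "\<forall>\<^sub>F z in high_prob. dist (Y (fst z) (snd z)) c < e"
    unfolding eventually_high_prob
  proof (intro exI conjI allI)
    let ?A = "\<lambda>N. {\<xi> \<in> space M. \<not> e / 2 < dist (Y N \<xi>) c}"
    show "?A N \<in> events" for N by measurable
    show "\<forall>\<xi>\<in>?A N. dist (Y (fst (N, \<xi>)) (snd (N, \<xi>))) c < e" for N
      using \<open>0 < e\<close> by auto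
    have "prob (?A N) = 1 - prob {\<xi> \<in> space M. e / 2 < dist (Y N \<xi>) c}" for N
      by (subst prob_neg) auto
    then show "(\<lambda>N. prob (?A N)) \<longlonglongrightarrow> 1"
      using tendsto_diff[OF tendsto_const lim, of 1] by simp
  qed
qed

text \<open>Boundedness in probability for almost all \<open>N\<close>. The inner event
  \<open>A\<close> lets the notion apply to quantities without a measurability assumption and makes
  it inherited by high-probability bounds.\<close>

definition tight :: "(nat \<times> 'a \<Rightarrow> 'b::real_normed_vector) \<Rightarrow> bool" where
  "tight Z \<longleftrightarrow> (\<forall>\<eta>>0. \<exists>B. \<forall>\<^sub>F N in sequentially.
     \<exists>A\<in>events. 1 - \<eta> \<le> prob A \<and> (\<forall>\<xi>\<in>A. norm (Z (N, \<xi>)) \<le> B))"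

lemma tightE:
  assumes "tight Z" "0 < \<eta>"
  obtains B where "\<forall>\<^sub>F N in sequentially.
    \<exists>A\<in>events. 1 - \<eta> \<le> prob A \<and> (\<forall>\<xi>\<in>A. norm (Z (N, \<xi>)) \<le> B)"
  using assms unfolding tight_def by blast

text \<open>Lets a proof of a high-probability statement treat a tight sequence as bounded by a
  constant: half of the tolerance pays for the bound, the other half for the statement under the
  bound.\<close>

lemma tight_cases:
  assumes "tight Z" and "\<And>B. \<forall>\<^sub>F z in high_prob. norm (Z z) \<le> B \<longrightarrow> P z"
  shows "eventually P high_prob"
proof (rule eventually_high_probI)
  fix \<eta> :: real assume "0 < \<eta>"
  then obtain B where B: "\<forall>\<^sub>F N in sequentially.
     \<exists>A\<in>events. 1 - \<eta> / 2 \<le> prob A \<and> (\<forall>\<xi>\<in>A. norm (Z (N, \<xi>)) \<le> B)"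
    using tightE[OF assms(1) half_gt_zero] by blast
  obtain C where C: "\<And>N. C N \<in> events" "\<And>N \<xi>. \<xi> \<in> C N \<Longrightarrow> norm (Z (N, \<xi>)) \<le> B \<longrightarrow> P (N, \<xi>)"
      "(\<lambda>N. prob (C N)) \<longlonglongrightarrow> 1"
    using assms(2)[of B] unfolding eventually_high_prob by metis
  have "\<forall>\<^sub>F N in sequentially. 1 - \<eta> / 2 < prob (C N)"
    using C(3) \<open>0 < \<eta>\<close> by (auto intro: order_tendstoD)
  with B show "\<forall>\<^sub>F N in sequentially. \<exists>A\<in>events. (\<forall>\<xi>\<in>A. P (N, \<xi>)) \<and> 1 - \<eta> \<le> prob A"
  proof eventually_elim
    case (elim N)
    then obtain A where A: "A \<in> events" "1 - \<eta> / 2 \<le> prob A" "\<And>\<xi>. \<xi> \<in> A \<Longrightarrow> norm (Z (N, \<xi>)) \<le> B"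
      by blast
    have "1 - \<eta> \<le> prob (A \<inter> C N)"
      using prob_Int_ge[OF A(1) C(1)[of N]] A(2) elim(2) by linarith
    then show ?case
      using A(1,3) C(1,2) by (intro bexI[of _ "A \<inter> C N"]) auto
  qed
qed

lemma tight_mono:
  assumes "tight Y" and "\<forall>\<^sub>F z in high_prob. norm (Z z) \<le> norm (Y z)"
  shows "tight Z"
  unfolding tight_def
proof safe
  fix \<eta> :: real assume "0 < \<eta>"
  then obtain B where B: "\<forall>\<^sub>F N in sequentially.
     \<exists>A\<in>events. 1 - \<eta> / 2 \<le> prob A \<and> (\<forall>\<xi>\<in>A. norm (Y (N, \<xi>)) \<le> B)"
    using tightE[OF assms(1) half_gt_zero] by blast
  obtain C where C: "\<And>N. C N \<in> events" "\<And>N \<xi>. \<xi> \<in> C N \<Longrightarrow> norm (Z (N, \<xi>)) \<le> norm (Y (N, \<xi>))"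
      "(\<lambda>N. prob (C N)) \<longlonglongrightarrow> 1"
    using assms(2) unfolding eventually_high_prob by metis
  have "\<forall>\<^sub>F N in sequentially. 1 - \<eta> / 2 < prob (C N)"
    using C(3) \<open>0 < \<eta>\<close> by (auto intro: order_tendstoD)
  with B have "\<forall>\<^sub>F N in sequentially. \<exists>A\<in>events. 1 - \<eta> \<le> prob A \<and> (\<forall>\<xi>\<in>A. norm (Z (N, \<xi>)) \<le> B)"
  proof eventually_elim
    case (elim N)
    then obtain A where A: "A \<in> events" "1 - \<eta> / 2 \<le> prob A" "\<And>\<xi>. \<xi> \<in> A \<Longrightarrow> norm (Y (N, \<xi>)) \<le> B"
      by blast
    have "1 - \<eta> \<le> prob (A \<inter> C N)"
      using prob_Int_ge[OF A(1) C(1)[of N]] A(2) elim(2) by linarith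
    then show ?case
      using A(1,3) C(1) by (intro bexI[of _ "A \<inter> C N"]) (auto intro: order_trans[OF C(2)])
  qed
  then show "\<exists>B. \<forall>\<^sub>F N in sequentially. \<exists>A\<in>events. 1 - \<eta> \<le> prob A \<and> (\<forall>\<xi>\<in>A. norm (Z (N, \<xi>)) \<le> B)"
    by blast
qed

lemma tight_const: "tight (\<lambda>z. c)"
  unfolding tight_def
  by (intro allI impI exI[of _ "norm c"] always_eventually bexI[of _ "space M"])
    (auto simp: prob_space)

lemma tight_add:
  assumes "tight Y" "tight Z"
  shows "tight (\<lambda>z. Y z + Z z)"
  unfolding tight_def
proof safe
  fix \<eta> :: real assume "0 < \<eta>"
  obtain B where B: "\<forall>\<^sub>F N in sequentially.
     \<exists>A\<in>events. 1 - \<eta> / 2 \<le> prob A \<and> (\<forall>\<xi>\<in>A. norm (Y (N, \<xi>)) \<le> B)"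
    using tightE[OF assms(1) half_gt_zero[OF \<open>0 < \<eta>\<close>]] by blast
  obtain C where C: "\<forall>\<^sub>F N in sequentially.
     \<exists>A\<in>events. 1 - \<eta> / 2 \<le> prob A \<and> (\<forall>\<xi>\<in>A. norm (Z (N, \<xi>)) \<le> C)"
    using tightE[OF assms(2) half_gt_zero[OF \<open>0 < \<eta>\<close>]] by blast
  from B C have "\<forall>\<^sub>F N in sequentially.
    \<exists>A\<in>events. 1 - \<eta> \<le> prob A \<and> (\<forall>\<xi>\<in>A. norm (Y (N, \<xi>) + Z (N, \<xi>)) \<le> B + C)"
  proof eventually_elim
    case (elim N)
    then obtain A A' where A: "A \<in> events" "1 - \<eta> / 2 \<le> prob A" "\<And>\<xi>. \<xi> \<in> A \<Longrightarrow> norm (Y (N, \<xi>)) \<le> B"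
      and A': "A' \<in> events" "1 - \<eta> / 2 \<le> prob A'" "\<And>\<xi>. \<xi> \<in> A' \<Longrightarrow> norm (Z (N, \<xi>)) \<le> C"
      by blast
    have "1 - \<eta> \<le> prob (A \<inter> A')"
      using prob_Int_ge[OF A(1) A'(1)] A(2) A'(2) by linarith
    then show ?case
      using A(1,3) A'(1,3) by (intro bexI[of _ "A \<inter> A'"]) (auto intro!: norm_triangle_mono)
  qed
  then show "\<exists>D. \<forall>\<^sub>F N in sequentially.
      \<exists>A\<in>events. 1 - \<eta> \<le> prob A \<and> (\<forall>\<xi>\<in>A. norm (Y (N, \<xi>) + Z (N, \<xi>)) \<le> D)"
    by blast
qed

lemma tight_scaleR_tendsto_0:
  fixes Y :: "nat \<times> 'a \<Rightarrow> real"
  assumes "tight Z" "(Y \<longlongrightarrow> 0) high_prob"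
  shows "((\<lambda>z. Y z *\<^sub>R Z z) \<longlongrightarrow> 0) high_prob"
proof (rule tendstoI)
  fix e :: real assume e: "0 < e"
  show "\<forall>\<^sub>F z in high_prob. dist (Y z *\<^sub>R Z z) 0 < e"
  proof (rule tight_cases[OF assms(1)])
    fix B :: real
    \<comment> \<open>\<open>B\<close> is an arbitrary real here; \<open>|B| + 1\<close> is a
      positive bound in every case.\<close>
    have "0 < e / (\<bar>B\<bar> + 1)" using e by simp
    from tendstoD[OF assms(2) this]
    show "\<forall>\<^sub>F z in high_prob. norm (Z z) \<le> B \<longrightarrow> dist (Y z *\<^sub>R Z z) 0 < e"
    proof (eventually_elim, safe)
      fix z assume z: "dist (Y z) 0 < e / (\<bar>B\<bar> + 1)" "norm (Z z) \<le> B"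
      have "\<bar>Y z\<bar> * norm (Z z) \<le> \<bar>Y z\<bar> * (\<bar>B\<bar> + 1)"
        using z by (intro mult_left_mono) auto
      also have "\<dots> < e"
        using z(1) by (simp add: field_simps)
      finally show "dist (Y z *\<^sub>R Z z) 0 < e" by simp
    qed
  qed
qed

lemma tendsto_imp_tight:
  assumes "(Z \<longlongrightarrow> c) high_prob"
  shows "tight Z"
proof (rule tight_mono[OF tight_const[of "norm c + 1"]])
  show "\<forall>\<^sub>F z in high_prob. norm (Z z) \<le> norm (norm c + 1)"
    using tendstoD[OF assms zero_less_one]
  proof eventually_elim
    case (elim z)
    have "norm (Z z) \<le> norm c + norm (Z z - c)"
      using norm_triangle_ineq[of c "Z z - c"] by simp
    then show ?case using elim by (simp add: dist_norm)
  qed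
qed

text \<open>Splits the factor into its limit, which only rescales the bound, and a null sequence,
  whose product with a tight sequence tends to zero.\<close>

lemma tight_bounded_mult:
  fixes Y Z :: "nat \<times> 'a \<Rightarrow> real"
  assumes "tight Y" "(Z \<longlongrightarrow> c) high_prob"
  shows "tight (\<lambda>z. Z z * Y z)"
proof -
  have 1: "tight (\<lambda>z. c * Y z)"
    unfolding tight_def
  proof safe
    fix \<eta> :: real assume "0 < \<eta>"
    then obtain B where "\<forall>\<^sub>F N in sequentially.
        \<exists>A\<in>events. 1 - \<eta> \<le> prob A \<and> (\<forall>\<xi>\<in>A. norm (Y (N, \<xi>)) \<le> B)"
      using assms(1) unfolding tight_def by blast
    then have "\<forall>\<^sub>F N in sequentially.
        \<exists>A\<in>events. 1 - \<eta> \<le> prob A \<and> (\<forall>\<xi>\<in>A. norm (c * Y (N, \<xi>)) \<le> \<bar>c\<bar> * B)"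
      by eventually_elim (auto simp: abs_mult intro!: mult_left_mono)
    then show "\<exists>B. \<forall>\<^sub>F N in sequentially.
        \<exists>A\<in>events. 1 - \<eta> \<le> prob A \<and> (\<forall>\<xi>\<in>A. norm (c * Y (N, \<xi>)) \<le> B)" by blast
  qed
  have "((\<lambda>z. (Z z - c) *\<^sub>R Y z) \<longlongrightarrow> 0) high_prob"
    by (rule tight_scaleR_tendsto_0[OF assms(1)]) (use assms(2) in \<open>simp add: LIM_zero\<close>)
  from tight_add[OF 1 tendsto_imp_tight[OF this]] show ?thesis
    by (simp add: algebra_simps)
qed

lemma tight_vec:
  fixes Z :: "nat \<times> 'a \<Rightarrow> real ^ 'n"
  assumes "\<And>j. tight (\<lambda>z. Z z $ j)"
  shows "tight Z"
proof -
  have "tight (\<lambda>z. \<Sum>j\<in>J. \<bar>Z z $ j\<bar>)" if "finite J" for J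
    using that
  proof induction
    case empty
    show ?case using tight_const[of "0::real"] by simp
  next
    case (insert j J)
    have "tight (\<lambda>z. \<bar>Z z $ j\<bar>)" by (rule tight_mono[OF assms[of j]]) simp
    from tight_add[OF this insert.IH] show ?case using insert by simp
  qed
  from this[of UNIV] show ?thesis
    by (rule tight_mono) (auto simp: sum_nonneg norm_le_l1_cart)
qed

lemma second_moment_tendsto_0:
  fixes Z :: "nat \<Rightarrow> 'a \<Rightarrow> real"
  assumes [measurable]: "\<And>N. Z N \<in> borel_measurable M"
    and int: "\<And>N. integrable M (\<lambda>\<xi>. (Z N \<xi>)\<^sup>2)"
    and lim: "(\<lambda>N. expectation (\<lambda>\<xi>. (Z N \<xi>)\<^sup>2)) \<longlonglongrightarrow> 0"
  shows "((\<lambda>z. Z (fst z) (snd z)) \<longlongrightarrow> 0) high_prob"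
proof (rule tendsto_high_probI)
  show "tendsto_in_prob M Z 0"
    unfolding tendsto_in_prob_def
  proof safe
    fix e :: real assume "0 < e"
    show "(\<lambda>N. prob {\<xi> \<in> space M. e < dist (Z N \<xi>) 0}) \<longlonglongrightarrow> 0"
    proof (rule tendsto_sandwich[where f = "\<lambda>_. 0"])
      show "\<forall>\<^sub>F N in sequentially. prob {\<xi> \<in> space M. e < dist (Z N \<xi>) 0}
          \<le> expectation (\<lambda>\<xi>. (Z N \<xi>)\<^sup>2) / e\<^sup>2"
      proof (intro always_eventually allI)
        fix N
        have "prob {\<xi> \<in> space M. e < dist (Z N \<xi>) 0} \<le> prob {\<xi> \<in> space M. e\<^sup>2 \<le> (Z N \<xi>)\<^sup>2}"
          using \<open>0 < e\<close> by (intro finite_measure_mono) (auto simp: abs_le_square_iff[symmetric])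
        also have "\<dots> \<le> expectation (\<lambda>\<xi>. (Z N \<xi>)\<^sup>2) / e\<^sup>2"
          using \<open>0 < e\<close> by (intro integral_Markov_inequality_measure[where A = "{}"] int) auto
        finally show "prob {\<xi> \<in> space M. e < dist (Z N \<xi>) 0} \<le> expectation (\<lambda>\<xi>. (Z N \<xi>)\<^sup>2) / e\<^sup>2" .
      qed
      show "(\<lambda>N. expectation (\<lambda>\<xi>. (Z N \<xi>)\<^sup>2) / e\<^sup>2) \<longlonglongrightarrow> 0"
        using tendsto_divide[OF lim tendsto_const, of "e\<^sup>2"] \<open>0 < e\<close> by simp
    qed auto
  qed
qed simp

lemma second_moment_tight:
  fixes Z :: "nat \<Rightarrow> 'a \<Rightarrow> real"
  assumes [measurable]: "\<And>N. Z N \<in> borel_measurable M"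
    and int: "\<And>N. integrable M (\<lambda>\<xi>. (Z N \<xi>)\<^sup>2)"
    and bound: "\<forall>\<^sub>F N in sequentially. expectation (\<lambda>\<xi>. (Z N \<xi>)\<^sup>2) \<le> C"
  shows "tight (\<lambda>z. Z (fst z) (snd z))"
  unfolding tight_def
proof safe
  fix \<eta> :: real assume "0 < \<eta>"
  \<comment> \<open>Chosen so that Chebyshev's bound \<open>C / B\<^sup>2\<close> is at most
    \<open>\<eta>\<close>; the added 1 keeps \<open>B\<close> positive.\<close>
  define B where "B = sqrt ((\<bar>C\<bar> + 1) / \<eta>)"
  have "0 < (\<bar>C\<bar> + 1) / \<eta>" using \<open>0 < \<eta>\<close> by (intro divide_pos_pos) auto
  then have B: "0 < B" "B\<^sup>2 = (\<bar>C\<bar> + 1) / \<eta>" by (simp_all add: B_def)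
  show "\<exists>B. \<forall>\<^sub>F N in sequentially.
    \<exists>A\<in>events. 1 - \<eta> \<le> prob A \<and> (\<forall>\<xi>\<in>A. norm (Z (fst (N, \<xi>)) (snd (N, \<xi>))) \<le> B)"
  proof (rule exI[of _ B], use bound in eventually_elim)
    case (elim N)
    have "prob {\<xi> \<in> space M. B\<^sup>2 \<le> (Z N \<xi>)\<^sup>2} \<le> expectation (\<lambda>\<xi>. (Z N \<xi>)\<^sup>2) / B\<^sup>2"
      using B(1) by (intro integral_Markov_inequality_measure[where A = "{}"] int) auto
    also have "\<dots> \<le> (\<bar>C\<bar> + 1) / B\<^sup>2"
      using elim B(1) by (intro divide_right_mono) auto
    also have "\<dots> = \<eta>"
    proof -
      have "0 < \<bar>C\<bar> + 1" by (simp add: add_nonneg_pos)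
      then show ?thesis using \<open>0 < \<eta>\<close> unfolding B(2) by simp
    qed
    finally have *: "prob {\<xi> \<in> space M. B\<^sup>2 \<le> (Z N \<xi>)\<^sup>2} \<le> \<eta>" .
    have "prob {\<xi> \<in> space M. \<not> B\<^sup>2 \<le> (Z N \<xi>)\<^sup>2} = 1 - prob {\<xi> \<in> space M. B\<^sup>2 \<le> (Z N \<xi>)\<^sup>2}"
      by (subst prob_neg) auto
    with * show ?case
      using B(1) by (intro bexI[of _ "{\<xi> \<in> space M. \<not> B\<^sup>2 \<le> (Z N \<xi>)\<^sup>2}"])
        (auto simp: not_le intro: power2_le_imp_le less_imp_le)
  qed
qed

text \<open>Slutsky's theorem: a compactness argument replaces joint weak convergence.\<close>

lemma tendsto_continuous_tight:
  fixes f :: "'b::metric_space \<times> 'c::euclidean_space \<Rightarrow> real"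
  assumes X: "(X \<longlongrightarrow> x0) high_prob" and Y: "tight Y"
    and f: "\<And>y. isCont f (x0, y)"
  shows "((\<lambda>z. f (X z, Y z) - f (x0, Y z)) \<longlongrightarrow> 0) high_prob"
proof (rule tendstoI)
  fix e :: real assume "0 < e"
  show "\<forall>\<^sub>F z in high_prob. dist (f (X z, Y z) - f (x0, Y z)) 0 < e"
  proof (rule tight_cases[OF Y])
    fix B :: real
    \<comment> \<open>Continuity is made uniform over the ball \<open>norm y \<le> B\<close>.
      Compactness acts on the second coordinate alone; the first is driven to \<open>x0\<close> by
      the choice \<open>1 / (i + 1)\<close>.\<close>
    have "\<exists>d>0. \<forall>x y. dist x x0 < d \<and> norm y \<le> B \<longrightarrow> \<bar>f (x, y) - f (x0, y)\<bar> < e"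
    proof (rule ccontr)
      assume "\<not> ?thesis"
      then have far: "\<forall>d>0. \<exists>x y. dist x x0 < d \<and> norm y \<le> B \<and> \<not> \<bar>f (x, y) - f (x0, y)\<bar> < e"
        by blast
      have "\<forall>i. \<exists>v. dist (fst v) x0 < 1 / real (Suc i) \<and> norm (snd v) \<le> B \<and>
          \<not> \<bar>f (fst v, snd v) - f (x0, snd v)\<bar> < e"
        using far[rule_format, of "1 / real (Suc i)" for i] by simp
      from choice[OF this] obtain v where v: "\<forall>i. dist (fst (v i)) x0 < 1 / real (Suc i) \<and>
          norm (snd (v i)) \<le> B \<and> \<not> \<bar>f (fst (v i), snd (v i)) - f (x0, snd (v i))\<bar> < e" ..
      define x y where "x i = fst (v i)" and "y i = snd (v i)" for i
      have xy: "\<And>i. dist (x i) x0 < 1 / real (Suc i)" "\<And>i. norm (y i) \<le> B"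
        "\<And>i. \<not> \<bar>f (x i, y i) - f (x0, y i)\<bar> < e"
        using v by (simp_all add: x_def y_def)
      have "y i \<in> cball 0 B" for i using xy(2) by simp
      then have "\<exists>l\<in>cball 0 B. \<exists>r. strict_mono r \<and> (y \<circ> r) \<longlonglongrightarrow> l"
        by (intro compact_cball[of "0::'c" B, unfolded compact_def, THEN spec, THEN mp]) simp
      then obtain l r where r: "strict_mono r" "(y \<circ> r) \<longlonglongrightarrow> l"
        by blast
      have "x \<longlonglongrightarrow> x0"
        by (rule tendsto_dist_iff[THEN iffD2], rule Lim_null_comparison[where g = "\<lambda>i. 1 / real (Suc i)"])
          (use xy(1) LIMSEQ_inverse_real_of_nat in \<open>auto simp: inverse_eq_divide less_imp_le\<close>)
      then have "(x \<circ> r) \<longlonglongrightarrow> x0" using r(1) by (rule LIMSEQ_subseq_LIMSEQ)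
      then have "(\<lambda>i. ((x \<circ> r) i, (y \<circ> r) i)) \<longlonglongrightarrow> (x0, l)" "(\<lambda>i. (x0, (y \<circ> r) i)) \<longlonglongrightarrow> (x0, l)"
        using tendsto_Pair[OF _ r(2), of "x \<circ> r" x0] tendsto_Pair[OF tendsto_const r(2)]
        by blast+
      then have "(\<lambda>i. f ((x \<circ> r) i, (y \<circ> r) i)) \<longlonglongrightarrow> f (x0, l)" "(\<lambda>i. f (x0, (y \<circ> r) i)) \<longlonglongrightarrow> f (x0, l)"
        by (auto intro: isCont_tendsto_compose[OF f])
      then have "(\<lambda>i. f ((x \<circ> r) i, (y \<circ> r) i) - f (x0, (y \<circ> r) i)) \<longlonglongrightarrow> 0"
        by (auto intro!: tendsto_eq_intros)
      from tendstoD[OF this \<open>0 < e\<close>] obtain i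
        where "dist (f ((x \<circ> r) i, (y \<circ> r) i) - f (x0, (y \<circ> r) i)) 0 < e"
        using eventually_happens'[OF sequentially_bot] by blast
      then show False using xy(3)[of "r i"] by simp
    qed
    then obtain d where d: "0 < d" "\<And>x y. dist x x0 < d \<Longrightarrow> norm y \<le> B \<Longrightarrow> \<bar>f (x, y) - f (x0, y)\<bar> < e"
      by blast
    show "\<forall>\<^sub>F z in high_prob. norm (Y z) \<le> B \<longrightarrow> dist (f (X z, Y z) - f (x0, Y z)) 0 < e"
      using tendstoD[OF X d(1)]
    proof eventually_elim
      case (elim z)
      then show ?case using d(2)[of "X z" "Y z"] by simp
    qed
  qed
qed

section \<open>Second moments and weak laws for sums of independent variables\<close>

lemma second_moment_sum:
  fixes X :: "'i \<Rightarrow> 'a \<Rightarrow> real"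
  assumes "finite I" "indep_vars (\<lambda>_. borel) X I"
    and "\<And>i. i \<in> I \<Longrightarrow> integrable M (\<lambda>\<xi>. (X i \<xi>)\<^sup>2)"
    and "\<And>i. i \<in> I \<Longrightarrow> expectation (X i) = 0"
  shows "integrable M (\<lambda>\<xi>. (\<Sum>i\<in>I. X i \<xi>)\<^sup>2) \<and>
    expectation (\<lambda>\<xi>. (\<Sum>i\<in>I. X i \<xi>)\<^sup>2) = (\<Sum>i\<in>I. expectation (\<lambda>\<xi>. (X i \<xi>)\<^sup>2))"
  using assms
proof (induction I)
  case empty
  then show ?case by simp
next
  case (insert i I)
  have rv: "random_variable borel (X j)" if "j \<in> insert i I" for j
    using insert.prems(1) that by (auto simp: indep_vars_def)
  have indI: "indep_vars (\<lambda>_. borel) X I"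
    by (rule indep_vars_subset[OF insert.prems(1)]) auto
  have IH: "integrable M (\<lambda>\<xi>. (\<Sum>i\<in>I. X i \<xi>)\<^sup>2)"
    "expectation (\<lambda>\<xi>. (\<Sum>i\<in>I. X i \<xi>)\<^sup>2) = (\<Sum>i\<in>I. expectation (\<lambda>\<xi>. (X i \<xi>)\<^sup>2))"
    using insert.IH[OF indI] insert.prems by auto
  have iv: "indep_var borel (X i) borel (\<lambda>\<xi>. \<Sum>i\<in>I. X i \<xi>)"
    by (rule indep_vars_sum[OF insert.hyps insert.prems(1)])
  have int: "integrable M (X j)" if "j \<in> insert i I" for j
    by (rule square_integrable_imp_integrable[OF rv[OF that] insert.prems(2)[OF that]])
  have ints: "integrable M (\<lambda>\<xi>. \<Sum>i\<in>I. X i \<xi>)" using int by auto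
  \<comment> \<open>Independence of the new summand from the partial sum, together with its zero
    mean, removes the cross term.\<close>
  have prod: "integrable M (\<lambda>\<xi>. X i \<xi> * (\<Sum>i\<in>I. X i \<xi>))"
    "expectation (\<lambda>\<xi>. X i \<xi> * (\<Sum>i\<in>I. X i \<xi>)) = 0"
    using indep_var_integrable[OF iv int ints] indep_var_lebesgue_integral[OF iv int ints]
      insert.prems(3) by auto
  have eq: "(\<Sum>j\<in>insert i I. X j \<xi>)\<^sup>2 =
      (X i \<xi>)\<^sup>2 + (2 * (X i \<xi> * (\<Sum>i\<in>I. X i \<xi>)) + (\<Sum>i\<in>I. X i \<xi>)\<^sup>2)" for \<xi>
    using insert.hyps by (simp add: power2_sum algebra_simps)
  have i2: "integrable M (\<lambda>\<xi>. (X i \<xi>)\<^sup>2)" using insert.prems by auto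
  show ?case
    unfolding eq using i2 prod IH insert.hyps by auto
qed

lemma second_moment_centred_sum_le:
  fixes X :: "'i \<Rightarrow> 'a \<Rightarrow> real"
  assumes I: "finite I" "indep_vars (\<lambda>_. borel) X I"
    and X: "\<And>i. i \<in> I \<Longrightarrow> integrable M (\<lambda>\<xi>. (X i \<xi>)\<^sup>2)"
  shows "integrable M (\<lambda>\<xi>. ((\<Sum>i\<in>I. X i \<xi>) - (\<Sum>i\<in>I. expectation (X i)))\<^sup>2)"
    and "expectation (\<lambda>\<xi>. ((\<Sum>i\<in>I. X i \<xi>) - (\<Sum>i\<in>I. expectation (X i)))\<^sup>2)
      \<le> (\<Sum>i\<in>I. expectation (\<lambda>\<xi>. (X i \<xi>)\<^sup>2))"
proof -
  define Y where "Y i \<xi> = X i \<xi> - expectation (X i)" for i \<xi>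
  have rv: "random_variable borel (X j)" if "j \<in> I" for j
    using I(2) that by (auto simp: indep_vars_def)
  have int: "integrable M (X j)" if "j \<in> I" for j
    by (rule square_integrable_imp_integrable[OF rv[OF that] X[OF that]])
  have indY: "indep_vars (\<lambda>_. borel) Y I"
    unfolding Y_def by (rule indep_vars_compose2[OF I(2), where Y = "\<lambda>i x. x - expectation (X i)"]) simp
  have Y2: "integrable M (\<lambda>\<xi>. (Y i \<xi>)\<^sup>2)" if "i \<in> I" for i
    using int[OF that] X[OF that] by (auto simp: Y_def power2_diff)
  have Y0: "expectation (Y i) = 0" if "i \<in> I" for i
    using int[OF that] by (simp add: Y_def[abs_def] prob_space)
  have eq: "(\<Sum>i\<in>I. X i \<xi>) - (\<Sum>i\<in>I. expectation (X i)) = (\<Sum>i\<in>I. Y i \<xi>)" for \<xi>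
    by (simp add: Y_def sum_subtractf)
  note * = second_moment_sum[OF I(1) indY Y2 Y0]
  show "integrable M (\<lambda>\<xi>. ((\<Sum>i\<in>I. X i \<xi>) - (\<Sum>i\<in>I. expectation (X i)))\<^sup>2)"
    unfolding eq using * by blast
  have "expectation (\<lambda>\<xi>. (Y i \<xi>)\<^sup>2) \<le> expectation (\<lambda>\<xi>. (X i \<xi>)\<^sup>2)" if "i \<in> I" for i
    using variance_eq[OF int[OF that] X[OF that]] by (simp add: Y_def)
  then show "expectation (\<lambda>\<xi>. ((\<Sum>i\<in>I. X i \<xi>) - (\<Sum>i\<in>I. expectation (X i)))\<^sup>2)
      \<le> (\<Sum>i\<in>I. expectation (\<lambda>\<xi>. (X i \<xi>)\<^sup>2))"
    unfolding eq using * by (auto intro!: sum_mono)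
qed

lemma centred_sum_tendsto_0:
  fixes X :: "nat \<Rightarrow> nat \<Rightarrow> 'a \<Rightarrow> real"
  assumes ind: "\<And>N. indep_vars (\<lambda>_. borel) (X N) {1..n N}"
    and X2: "\<And>N i. i \<in> {1..n N} \<Longrightarrow> integrable M (\<lambda>\<xi>. (X N i \<xi>)\<^sup>2)"
    and lim: "(\<lambda>N. \<Sum>i\<in>{1..n N}. expectation (\<lambda>\<xi>. (X N i \<xi>)\<^sup>2)) \<longlonglongrightarrow> 0"
  shows "((\<lambda>z. (\<Sum>i\<in>{1..n (fst z)}. X (fst z) i (snd z)) -
    (\<Sum>i\<in>{1..n (fst z)}. expectation (X (fst z) i))) \<longlongrightarrow> 0) high_prob"
proof (rule second_moment_tendsto_0)
  have [measurable]: "i \<in> {1..n N} \<Longrightarrow> X N i \<in> borel_measurable M" for N i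
    using ind[of N] by (auto simp: indep_vars_def)
  show "(\<lambda>\<xi>. (\<Sum>i\<in>{1..n N}. X N i \<xi>) - (\<Sum>i\<in>{1..n N}. expectation (X N i))) \<in> borel_measurable M" for N
    by measurable
  note moment = second_moment_centred_sum_le[OF finite_atLeastAtMost ind X2]
  show "integrable M (\<lambda>\<xi>. ((\<Sum>i\<in>{1..n N}. X N i \<xi>) - (\<Sum>i\<in>{1..n N}. expectation (X N i)))\<^sup>2)" for N
    by (rule moment(1))
  show "(\<lambda>N. expectation (\<lambda>\<xi>. ((\<Sum>i\<in>{1..n N}. X N i \<xi>) - (\<Sum>i\<in>{1..n N}. expectation (X N i)))\<^sup>2)) \<longlonglongrightarrow> 0"
  proof (rule tendsto_sandwich[OF _ _ tendsto_const lim])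
    show "\<forall>\<^sub>F N in sequentially. 0 \<le>
        expectation (\<lambda>\<xi>. ((\<Sum>i\<in>{1..n N}. X N i \<xi>) - (\<Sum>i\<in>{1..n N}. expectation (X N i)))\<^sup>2)"
      by simp
    show "\<forall>\<^sub>F N in sequentially.
        expectation (\<lambda>\<xi>. ((\<Sum>i\<in>{1..n N}. X N i \<xi>) - (\<Sum>i\<in>{1..n N}. expectation (X N i)))\<^sup>2)
        \<le> (\<Sum>i\<in>{1..n N}. expectation (\<lambda>\<xi>. (X N i \<xi>)\<^sup>2))"
      by (intro always_eventually allI moment(2))
  qed
qed

lemma centred_sum_tight:
  fixes X :: "nat \<Rightarrow> nat \<Rightarrow> 'a \<Rightarrow> real"
  assumes ind: "\<And>N. indep_vars (\<lambda>_. borel) (X N) {1..n N}"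
    and X2: "\<And>N i. i \<in> {1..n N} \<Longrightarrow> integrable M (\<lambda>\<xi>. (X N i \<xi>)\<^sup>2)"
    and bound: "\<forall>\<^sub>F N in sequentially. (\<Sum>i\<in>{1..n N}. expectation (\<lambda>\<xi>. (X N i \<xi>)\<^sup>2)) \<le> C"
  shows "tight (\<lambda>z. (\<Sum>i\<in>{1..n (fst z)}. X (fst z) i (snd z)) -
    (\<Sum>i\<in>{1..n (fst z)}. expectation (X (fst z) i)))"
proof (rule second_moment_tight)
  have [measurable]: "i \<in> {1..n N} \<Longrightarrow> X N i \<in> borel_measurable M" for N i
    using ind[of N] by (auto simp: indep_vars_def)
  show "(\<lambda>\<xi>. (\<Sum>i\<in>{1..n N}. X N i \<xi>) - (\<Sum>i\<in>{1..n N}. expectation (X N i))) \<in> borel_measurable M" for N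
    by measurable
  note moment = second_moment_centred_sum_le[OF finite_atLeastAtMost ind X2]
  show "integrable M (\<lambda>\<xi>. ((\<Sum>i\<in>{1..n N}. X N i \<xi>) - (\<Sum>i\<in>{1..n N}. expectation (X N i)))\<^sup>2)" for N
    by (rule moment(1))
  show "\<forall>\<^sub>F N in sequentially. expectation (\<lambda>\<xi>. ((\<Sum>i\<in>{1..n N}. X N i \<xi>) - (\<Sum>i\<in>{1..n N}. expectation (X N i)))\<^sup>2) \<le> C"
    using bound by eventually_elim (rule order_trans[OF moment(2)])
qed

end

section \<open>Chi-square limits from characteristic functions\<close>

lemma std_normal_eq: "std_normal = std_normal_distribution"
  by (simp add: std_normal_def)

lemma prob_space_std_normal: "prob_space std_normal"
  unfolding std_normal_eq using real_dist_normal_dist real_distribution_def by blast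

interpretation std_normal: prob_space std_normal by (rule prob_space_std_normal)

lemma sets_std_normal[measurable_cong, simp]: "sets std_normal = sets borel"
  and space_std_normal[simp]: "space std_normal = UNIV"
  by (simp_all add: std_normal_def)

interpretation gauss: product_sigma_finite "\<lambda>_::nat. std_normal" ..

lemma prob_space_gauss: "prob_space (Pi\<^sub>M {..<d::nat} (\<lambda>_. std_normal))"
  by (rule prob_space_PiM) (rule prob_space_std_normal)

lemma prob_space_chi_square: "prob_space (chi_square d)"
proof -
  interpret G: prob_space "Pi\<^sub>M {..<d::nat} (\<lambda>_. std_normal)" by (rule prob_space_gauss)
  show ?thesis unfolding chi_square_def by (rule G.prob_space_distr) measurable
qed

lemma sets_chi_square[measurable_cong, simp]: "sets (chi_square d) = sets borel"
  by (simp add: chi_square_def)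

lemma char_std_normal: "(CLINT y|std_normal. iexp (t * y)) = complex_of_real (exp (- t\<^sup>2 / 2))"
  using char_std_normal_distribution by (simp add: char_def std_normal_eq fun_eq_iff)

lemma integrable_iexp_prob:
  assumes "prob_space N" and [measurable]: "f \<in> borel_measurable N"
  shows "integrable N (\<lambda>x. iexp (f x))"
proof -
  interpret prob_space N by fact
  show ?thesis by (rule integrable_const_bound[of _ 1]) auto
qed

text \<open>Gaussian linearisation of a square, known as the Hubbard-Stratonovich identity. The
  factor \<open>sqrt (2 * s)\<close> is fixed by \<open>char_std_normal\<close>: its square is
  halved in the exponent and leaves \<open>s\<close>.\<close>

lemma exp_sum_squares_eq_gauss:
  fixes z :: "nat \<Rightarrow> real"
  assumes "0 \<le> s"
  shows "(CLINT g|Pi\<^sub>M {..<d} (\<lambda>_. std_normal). iexp (\<Sum>r<d. sqrt (2 * s) * g r * z r))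
    = complex_of_real (exp (- s * (\<Sum>r<d. (z r)\<^sup>2)))"
proof -
  have "(CLINT g|Pi\<^sub>M {..<d} (\<lambda>_. std_normal). iexp (\<Sum>r<d. sqrt (2 * s) * g r * z r)) =
      (CLINT g|Pi\<^sub>M {..<d} (\<lambda>_. std_normal). (\<Prod>r<d. iexp ((sqrt (2 * s) * z r) * g r)))"
    by (intro Bochner_Integration.integral_cong refl)
      (simp add: exp_sum[symmetric] sum_distrib_left mult_ac)
  also have "\<dots> = (\<Prod>r<d. CLINT y|std_normal. iexp ((sqrt (2 * s) * z r) * y))"
    by (intro gauss.product_integral_prod integrable_iexp_prob prob_space_std_normal)
      (auto simp: std_normal_def)
  also have "\<dots> = (\<Prod>r<d. complex_of_real (exp (- s * (z r)\<^sup>2)))"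
  proof (intro prod.cong refl)
    fix r
    show "(CLINT y|std_normal. iexp ((sqrt (2 * s) * z r) * y)) = complex_of_real (exp (- s * (z r)\<^sup>2))"
      unfolding char_std_normal using assms by (simp add: power_mult_distrib)
  qed
  also have "\<dots> = complex_of_real (exp (- s * (\<Sum>r<d. (z r)\<^sup>2)))"
    by (simp add: exp_sum[symmetric] sum_distrib_left flip: of_real_prod)
  finally show ?thesis .
qed

text \<open>The last coordinate is integrated first: given the others, the equation confines it to
  at most two values, a null set for \<open>std_normal\<close>. For \<open>d = 0\<close> the law is
  the point mass at 0, hence the assumption.\<close>

lemma chi_square_singleton:
  assumes "0 < d"
  shows "measure (chi_square d) {x} = 0"
proof -
  obtain d' where d: "d = Suc d'" using assms by (cases d) auto
  have null: "emeasure std_normal {y. s + y\<^sup>2 = x} = 0" for s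
  proof -
    have "finite {y. s + y\<^sup>2 = x}"
    proof (rule finite_subset)
      show "{y. s + y\<^sup>2 = x} \<subseteq> {sqrt (x - s), - sqrt (x - s)}"
      proof
        fix y assume "y \<in> {y. s + y\<^sup>2 = x}"
        then have "x - s = y\<^sup>2" by auto
        then have "sqrt (x - s) = \<bar>y\<bar>" by simp
        then show "y \<in> {sqrt (x - s), - sqrt (x - s)}" by (auto simp: abs_if split: if_splits)
      qed
    qed simp
    then have "{y. s + y\<^sup>2 = x} \<in> null_sets lborel" by (rule finite_imp_null_set_lborel)
    moreover have "absolutely_continuous lborel std_normal"
      unfolding std_normal_def by (rule absolutely_continuousI_density) simp
    ultimately show ?thesis by (auto simp: absolutely_continuous_def)
  qed
  have "emeasure (chi_square d) {x} =
      emeasure (Pi\<^sub>M {..<d} (\<lambda>_. std_normal)) {z \<in> space (Pi\<^sub>M {..<d} (\<lambda>_. std_normal)). (\<Sum>i<d. (z i)\<^sup>2) = x}"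
    unfolding chi_square_def by (subst emeasure_distr) (auto intro!: arg_cong2[where f = emeasure])
  also have "\<dots> = (\<integral>\<^sup>+ z. indicator {z. (\<Sum>i<d. (z i)\<^sup>2) = x} z \<partial>Pi\<^sub>M {..<d} (\<lambda>_. std_normal))"
    by (subst nn_integral_indicator[symmetric])
      (simp, intro nn_integral_cong, simp add: indicator_def)
  also have "\<dots> = (\<integral>\<^sup>+ z. indicator {z. (\<Sum>i<d. (z i)\<^sup>2) = x} z \<partial>Pi\<^sub>M (insert d' {..<d'}) (\<lambda>_. std_normal))"
    by (simp add: d lessThan_Suc)
  also have "\<dots> = (\<integral>\<^sup>+ z. (\<integral>\<^sup>+ y. indicator {z. (\<Sum>i<d. (z i)\<^sup>2) = x} (z(d' := y)) \<partial>std_normal)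
      \<partial>Pi\<^sub>M {..<d'} (\<lambda>_. std_normal))"
    by (rule gauss.product_nn_integral_insert) (auto simp: d lessThan_Suc)
  also have "\<dots> = (\<integral>\<^sup>+ z. 0 \<partial>Pi\<^sub>M {..<d'} (\<lambda>_. std_normal))"
  proof (rule nn_integral_cong)
    fix z :: "nat \<Rightarrow> real"
    have "(\<integral>\<^sup>+ y. indicator {z. (\<Sum>i<d. (z i)\<^sup>2) = x} (z(d' := y)) \<partial>std_normal) =
        (\<integral>\<^sup>+ y. indicator {y. (\<Sum>i<d'. (z i)\<^sup>2) + y\<^sup>2 = x} y \<partial>std_normal)"
      by (intro nn_integral_cong) (auto simp: indicator_def d)
    also have "\<dots> = emeasure std_normal {y. (\<Sum>i<d'. (z i)\<^sup>2) + y\<^sup>2 = x}"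
      by (intro nn_integral_indicator) simp
    finally show "(\<integral>\<^sup>+ y. indicator {z. (\<Sum>i<d. (z i)\<^sup>2) = x} (z(d' := y)) \<partial>std_normal) = 0"
      using null by simp
  qed
  finally show ?thesis by (simp add: measure_def)
qed

lemma chi_square_nonneg: "AE x in chi_square d. 0 \<le> x"
  unfolding chi_square_def by (subst AE_distr_iff) (auto intro!: AE_I2 sum_nonneg)

text \<open>Weierstrass' theorem applies because \<open>exp (- real i * x)\<close> is the \<open>i\<close>th power of \<open>exp (- x) \<in> {0..1}\<close>.\<close>

lemma laplace_tendsto_imp_continuous:
  fixes \<mu> :: "real measure" and Q :: "nat \<Rightarrow> 'a \<Rightarrow> real" and f :: "real \<Rightarrow> real"
  assumes "prob_space M" "prob_space \<mu>" and [measurable_cong]: "sets \<mu> = sets borel"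
    and [measurable]: "\<And>N. Q N \<in> borel_measurable M"
    and Q_nn: "\<And>N \<xi>. 0 \<le> Q N \<xi>" and \<mu>_nn: "AE x in \<mu>. 0 \<le> x"
    and lap: "\<And>i::nat. (\<lambda>N. \<integral>\<xi>. exp (- real i * Q N \<xi>) \<partial>M) \<longlonglongrightarrow> (\<integral>x. exp (- real i * x) \<partial>\<mu>)"
    and f: "continuous_on {0..1} f" and [measurable]: "f \<in> borel_measurable borel"
  shows "(\<lambda>N. \<integral>\<xi>. f (exp (- Q N \<xi>)) \<partial>M) \<longlonglongrightarrow> (\<integral>x. f (exp (- x)) \<partial>\<mu>)"
proof (rule tendstoI)
  interpret M: prob_space M by fact
  interpret \<mu>: prob_space \<mu> by fact
  fix e :: real assume "0 < e"
  \<comment> \<open>Three errors occur: replacing \<open>f\<close> by the polynomial under each of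
    the two measures, and the convergence of the polynomial integrals.\<close>
  then have e4: "0 < e / 4" by simp
  obtain g where g: "real_polynomial_function g" "\<And>x. x \<in> {0..1} \<Longrightarrow> \<bar>f x - g x\<bar> < e / 4"
    using Stone_Weierstrass_real_polynomial_function[OF compact_Icc f e4] by blast
  then have g2: "\<bar>f x - g x\<bar> \<le> e / 4" if "x \<in> {0..1}" for x
    using that by (simp add: less_imp_le)
  obtain a n where gs: "g = (\<lambda>x. \<Sum>i\<le>n. a i * x ^ i)"
    using g(1) unfolding real_polynomial_function_iff_sum by blast
  have ig: "exp (- y) ^ i = exp (- real i * y)" for i and y :: real
    by (simp add: exp_of_nat_mult[symmetric])
  have intM: "integrable M (\<lambda>\<xi>. exp (- real i * Q N \<xi>))" for i N
    by (rule M.integrable_const_bound[of _ 1]) (auto simp: Q_nn)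
  have int\<mu>: "integrable \<mu> (\<lambda>x. exp (- real i * x))" for i
    by (rule \<mu>.integrable_const_bound[of _ 1]) (use \<mu>_nn in auto)
  have gM: "(\<integral>\<xi>. g (exp (- Q N \<xi>)) \<partial>M) = (\<Sum>i\<le>n. a i * (\<integral>\<xi>. exp (- real i * Q N \<xi>) \<partial>M))" for N
    unfolding gs ig using intM by simp
  have g\<mu>: "(\<integral>x. g (exp (- x)) \<partial>\<mu>) = (\<Sum>i\<le>n. a i * (\<integral>x. exp (- real i * x) \<partial>\<mu>))"
    unfolding gs ig using int\<mu> by simp
  have igM: "integrable M (\<lambda>\<xi>. g (exp (- Q N \<xi>)))" for N unfolding gs ig using intM by simp
  have ig\<mu>: "integrable \<mu> (\<lambda>x. g (exp (- x)))" unfolding gs ig using int\<mu> by simp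
  obtain C where "\<forall>y\<in>f ` {0..1}. norm y \<le> C"
    using compact_imp_bounded[OF compact_continuous_image[OF f compact_Icc]]
    unfolding bounded_iff by blast
  then have C: "\<bar>f x\<bar> \<le> C" if "x \<in> {0..1}" for x
    using that by force
  have ifM: "integrable M (\<lambda>\<xi>. f (exp (- Q N \<xi>)))" for N
    by (rule M.integrable_const_bound[of _ C]) (auto simp: Q_nn C)
  have if\<mu>: "integrable \<mu> (\<lambda>x. f (exp (- x)))"
    by (rule \<mu>.integrable_const_bound[of _ C]) (use \<mu>_nn in \<open>auto simp: C\<close>)
  have dM: "\<bar>(\<integral>\<xi>. f (exp (- Q N \<xi>)) \<partial>M) - (\<integral>\<xi>. g (exp (- Q N \<xi>)) \<partial>M)\<bar> \<le> e / 4" for N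
  proof -
    have "\<bar>(\<integral>\<xi>. f (exp (- Q N \<xi>)) \<partial>M) - (\<integral>\<xi>. g (exp (- Q N \<xi>)) \<partial>M)\<bar> =
        \<bar>\<integral>\<xi>. f (exp (- Q N \<xi>)) - g (exp (- Q N \<xi>)) \<partial>M\<bar>" using ifM igM by simp
    also have "\<dots> \<le> (\<integral>\<xi>. \<bar>f (exp (- Q N \<xi>)) - g (exp (- Q N \<xi>))\<bar> \<partial>M)" by (rule integral_abs_bound)
    also have "\<dots> \<le> (\<integral>\<xi>. e / 4 \<partial>M)"
      by (intro integral_mono integrable_abs Bochner_Integration.integrable_diff ifM igM)
        (simp, rule g2, simp add: Q_nn)
    finally show ?thesis by (simp add: M.prob_space)
  qed
  have d\<mu>: "\<bar>(\<integral>x. f (exp (- x)) \<partial>\<mu>) - (\<integral>x. g (exp (- x)) \<partial>\<mu>)\<bar> \<le> e / 4"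
  proof -
    have "\<bar>(\<integral>x. f (exp (- x)) \<partial>\<mu>) - (\<integral>x. g (exp (- x)) \<partial>\<mu>)\<bar> =
        \<bar>\<integral>x. f (exp (- x)) - g (exp (- x)) \<partial>\<mu>\<bar>" using if\<mu> ig\<mu> by simp
    also have "\<dots> \<le> (\<integral>x. \<bar>f (exp (- x)) - g (exp (- x))\<bar> \<partial>\<mu>)" by (rule integral_abs_bound)
    also have "\<dots> \<le> (\<integral>x. e / 4 \<partial>\<mu>)"
      by (intro integral_mono_AE integrable_abs Bochner_Integration.integrable_diff if\<mu> ig\<mu>)
        (use \<mu>_nn in \<open>simp, elim eventually_mono, intro g2, simp\<close>)
    finally show ?thesis by (simp add: \<mu>.prob_space)
  qed
  have "(\<lambda>N. \<integral>\<xi>. g (exp (- Q N \<xi>)) \<partial>M) \<longlonglongrightarrow> (\<integral>x. g (exp (- x)) \<partial>\<mu>)"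
    unfolding gM g\<mu> by (intro tendsto_intros lap)
  from tendstoD[OF this e4]
  show "\<forall>\<^sub>F N in sequentially. dist (\<integral>\<xi>. f (exp (- Q N \<xi>)) \<partial>M) (\<integral>x. f (exp (- x)) \<partial>\<mu>) < e"
  proof eventually_elim
    case (elim N)
    show ?case using elim dM[of N] d\<mu> \<open>0 < e\<close> unfolding dist_real_def by linarith
  qed
qed

text \<open>The indicator of a half-line is squeezed against a continuous ramp. Two thresholds
  \<open>x < y\<close> give the ramp room to descend, so the bounds hold for every such pair, even
  if \<open>\<mu>\<close> has atoms there.\<close>

lemma laplace_tendsto_imp_bounds:
  fixes \<mu> :: "real measure" and Q :: "nat \<Rightarrow> 'a \<Rightarrow> real"
  assumes "prob_space M" "prob_space \<mu>" and [measurable_cong]: "sets \<mu> = sets borel"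
    and [measurable]: "\<And>N. Q N \<in> borel_measurable M"
    and Q_nn: "\<And>N \<xi>. 0 \<le> Q N \<xi>" and \<mu>_nn: "AE x in \<mu>. 0 \<le> x"
    and lap: "\<And>i::nat. (\<lambda>N. \<integral>\<xi>. exp (- real i * Q N \<xi>) \<partial>M) \<longlonglongrightarrow> (\<integral>x. exp (- real i * x) \<partial>\<mu>)"
    and xy: "x < y" and \<eta>: "0 < \<eta>"
  shows "\<forall>\<^sub>F N in sequentially. measure M {\<xi> \<in> space M. y < Q N \<xi>} < measure \<mu> {x<..} + \<eta>"
    and "\<forall>\<^sub>F N in sequentially. measure \<mu> {y<..} - \<eta> < measure M {\<xi> \<in> space M. x < Q N \<xi>}"
proof -
  interpret M: prob_space M by fact
  interpret \<mu>: prob_space \<mu> by fact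
  define u v where "u = exp (- y)" and "v = exp (- x)"
  have uv: "u < v" "0 < u" using xy by (auto simp: u_def v_def)
  \<comment> \<open>In the variable \<open>exp (- z)\<close> the order is reversed: the ramp is 1 up
    to \<open>u = exp (- y)\<close> and 0 from \<open>v = exp (- x)\<close> on.\<close>
  define f where "f w = max 0 (min 1 ((v - w) / (v - u)))" for w
  have cf: "continuous_on A f" for A
    unfolding f_def using uv by (intro continuous_intros) auto
  then have [measurable]: "f \<in> borel_measurable borel"
    by (intro borel_measurable_continuous_onI) auto
  have f01: "0 \<le> f w" "f w \<le> 1" for w by (auto simp: f_def)
  have f1: "f (exp (- z)) = 1" if "y < z" for z
    using that uv(1) by (auto simp: f_def u_def divide_simps)
  have f0: "f (exp (- z)) = 0" if "z \<le> x" for z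
  proof -
    have "v \<le> exp (- z)" using that by (simp add: v_def)
    then have "(v - exp (- z)) / (v - u) \<le> 0" using uv(1) by (simp add: divide_nonpos_pos)
    then show ?thesis by (simp add: f_def)
  qed
  have lo: "indicator {y<..} z \<le> f (exp (- z))" and hi: "f (exp (- z)) \<le> indicator {x<..} z" for z :: real
    using f0[of z] f1[of z] f01[of "exp (- z)"] by (auto simp: indicator_def)
  have iM: "integrable M (\<lambda>\<xi>. f (exp (- Q N \<xi>)))" for N
    by (rule M.integrable_const_bound[of _ 1]) (auto simp: f01)
  have i\<mu>: "integrable \<mu> (\<lambda>z. f (exp (- z)))"
    by (rule \<mu>.integrable_const_bound[of _ 1]) (auto simp: f01)
  have indM: "measure M {\<xi> \<in> space M. t < Q N \<xi>} = (\<integral>\<xi>. indicator {t<..} (Q N \<xi>) \<partial>M)" for t N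
  proof -
    have "(\<integral>\<xi>. indicator {t<..} (Q N \<xi>) \<partial>M) = (\<integral>\<xi>. indicat_real {\<xi> \<in> space M. t < Q N \<xi>} \<xi> \<partial>M)"
      by (intro Bochner_Integration.integral_cong) (auto simp: indicator_def)
    then show ?thesis by simp
  qed
  have iiM: "integrable M (\<lambda>\<xi>. indicator {t<..} (Q N \<xi>) :: real)" for t N
    by (rule M.integrable_const_bound[of _ 1]) (auto simp: indicator_def)
  have ii\<mu>: "integrable \<mu> (indicator {t<..} :: real \<Rightarrow> real)" for t
    by (rule \<mu>.integrable_const_bound[of _ 1]) (auto simp: indicator_def)
  have M1: "measure M {\<xi> \<in> space M. y < Q N \<xi>} \<le> (\<integral>\<xi>. f (exp (- Q N \<xi>)) \<partial>M)"
    and M2: "(\<integral>\<xi>. f (exp (- Q N \<xi>)) \<partial>M) \<le> measure M {\<xi> \<in> space M. x < Q N \<xi>}" for N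
    unfolding indM by (intro integral_mono iM iiM lo hi)+
  have \<mu>s: "space \<mu> = UNIV" using sets_eq_imp_space_eq[OF assms(3)] by simp
  have mi: "measure \<mu> {t<..} = (\<integral>z. indicator {t<..} z \<partial>\<mu>)" for t by (simp add: \<mu>s)
  have \<mu>1: "measure \<mu> {y<..} \<le> (\<integral>z. f (exp (- z)) \<partial>\<mu>)"
    and \<mu>2: "(\<integral>z. f (exp (- z)) \<partial>\<mu>) \<le> measure \<mu> {x<..}"
    unfolding mi by (intro integral_mono i\<mu> ii\<mu> lo hi)+
  have lim: "(\<lambda>N. \<integral>\<xi>. f (exp (- Q N \<xi>)) \<partial>M) \<longlonglongrightarrow> (\<integral>z. f (exp (- z)) \<partial>\<mu>)"
    by (rule laplace_tendsto_imp_continuous[OF assms(1-7) cf]) measurable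
  have "\<forall>\<^sub>F N in sequentially. (\<integral>\<xi>. f (exp (- Q N \<xi>)) \<partial>M) < (\<integral>z. f (exp (- z)) \<partial>\<mu>) + \<eta>"
    by (rule order_tendstoD(2)[OF lim]) (use \<eta> in simp)
  then show "\<forall>\<^sub>F N in sequentially. measure M {\<xi> \<in> space M. y < Q N \<xi>} < measure \<mu> {x<..} + \<eta>"
    by eventually_elim (use M1 \<mu>2 in \<open>smt (verit)\<close>)
  have "\<forall>\<^sub>F N in sequentially. (\<integral>z. f (exp (- z)) \<partial>\<mu>) - \<eta> < (\<integral>\<xi>. f (exp (- Q N \<xi>)) \<partial>M)"
    by (rule order_tendstoD(1)[OF lim]) (use \<eta> in simp)
  then show "\<forall>\<^sub>F N in sequentially. measure \<mu> {y<..} - \<eta> < measure M {\<xi> \<in> space M. x < Q N \<xi>}"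
    by eventually_elim (use M2 \<mu>1 in \<open>smt (verit)\<close>)
qed

context prob_space begin

lemma laplace_sum_squares:
  fixes Z :: "nat \<Rightarrow> nat \<Rightarrow> 'a \<Rightarrow> real"
  assumes [measurable]: "\<And>N r. Z N r \<in> borel_measurable M"
    and char: "\<And>a :: nat \<Rightarrow> real. (\<lambda>N. CLINT \<xi>|M. iexp (\<Sum>r<d. a r * Z N r \<xi>))
      \<longlonglongrightarrow> complex_of_real (exp (- (\<Sum>r<d. (a r)\<^sup>2) / 2))"
    and s: "0 \<le> s"
  shows "(\<lambda>N. expectation (\<lambda>\<xi>. exp (- s * (\<Sum>r<d. (Z N r \<xi>)\<^sup>2))))
    \<longlonglongrightarrow> (\<integral>x. exp (- s * x) \<partial>chi_square d)"
proof -
  let ?G = "Pi\<^sub>M {..<d} (\<lambda>_. std_normal)"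
  interpret G: prob_space ?G by (rule prob_space_gauss)
  interpret P: pair_prob_space M ?G ..
  define \<phi> where "\<phi> N g = (CLINT \<xi>|M. iexp (\<Sum>r<d. (sqrt (2 * s) * g r) * Z N r \<xi>))"
    for N and g :: "nat \<Rightarrow> real"
  have meas[measurable]: "(\<lambda>z. iexp (\<Sum>r<d. sqrt (2 * s) * snd z r * Z N r (fst z)))
      \<in> borel_measurable (M \<Otimes>\<^sub>M ?G)" for N
    by measurable
  have int: "integrable (M \<Otimes>\<^sub>M ?G) (\<lambda>(\<xi>, g). iexp (\<Sum>r<d. sqrt (2 * s) * g r * Z N r \<xi>))" for N
    by (rule P.integrable_const_bound[of _ 1]) (use meas[of N] in \<open>auto simp: split_beta\<close>)
  have eq: "complex_of_real (expectation (\<lambda>\<xi>. exp (- s * (\<Sum>r<d. (Z N r \<xi>)\<^sup>2)))) =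
      (CLINT g|?G. \<phi> N g)" for N
  proof -
    have "complex_of_real (expectation (\<lambda>\<xi>. exp (- s * (\<Sum>r<d. (Z N r \<xi>)\<^sup>2)))) =
        (CLINT \<xi>|M. CLINT g|?G. iexp (\<Sum>r<d. sqrt (2 * s) * g r * Z N r \<xi>))"
      unfolding exp_sum_squares_eq_gauss[OF s] by (rule integral_complex_of_real[symmetric])
    also have "\<dots> = (CLINT g|?G. CLINT \<xi>|M. iexp (\<Sum>r<d. sqrt (2 * s) * g r * Z N r \<xi>))"
      using P.Fubini_integral[OF int[of N]] by simp
    finally show ?thesis by (simp add: \<phi>_def)
  qed
  \<comment> \<open>The inner integral is a characteristic function at a random argument; its
    modulus is at most 1, so a constant dominates.\<close>
  have "(\<lambda>N. CLINT g|?G. \<phi> N g) \<longlonglongrightarrow>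
      (CLINT g|?G. complex_of_real (exp (- (\<Sum>r<d. (sqrt (2 * s) * g r)\<^sup>2) / 2)))"
  proof (rule integral_dominated_convergence[where w = "\<lambda>_. 1"])
    show "\<phi> N \<in> borel_measurable ?G" for N
      unfolding \<phi>_def[abs_def] by measurable
    show "AE g in ?G. norm (\<phi> N g) \<le> 1" for N
    proof (rule AE_I2)
      fix g
      have "norm (\<phi> N g) \<le> expectation (\<lambda>\<xi>. norm (iexp (\<Sum>r<d. (sqrt (2 * s) * g r) * Z N r \<xi>)))"
        unfolding \<phi>_def by (rule integral_norm_bound)
      then show "norm (\<phi> N g) \<le> 1" by (simp add: prob_space)
    qed
    show "AE g in ?G. (\<lambda>N. \<phi> N g) \<longlonglongrightarrow> complex_of_real (exp (- (\<Sum>r<d. (sqrt (2 * s) * g r)\<^sup>2) / 2))"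
      unfolding \<phi>_def by (intro AE_I2 char)
  qed auto
  also have "(CLINT g|?G. complex_of_real (exp (- (\<Sum>r<d. (sqrt (2 * s) * g r)\<^sup>2) / 2))) =
      complex_of_real (\<integral>g. exp (- s * (\<Sum>r<d. (g r)\<^sup>2)) \<partial>?G)"
    unfolding integral_complex_of_real[symmetric] using s
    by (intro Bochner_Integration.integral_cong refl)
      (simp add: power_mult_distrib sum_distrib_left[symmetric] sum_divide_distrib[symmetric])
  \<comment> \<open>The limiting characteristic function is again an exponential of a sum of
    squares, now of \<open>g\<close>, so its Gaussian average is the Laplace transform of
    \<open>chi_square\<close> straight from the definition.\<close>
  also have "(\<integral>g. exp (- s * (\<Sum>r<d. (g r)\<^sup>2)) \<partial>?G) = (\<integral>x. exp (- s * x) \<partial>chi_square d)"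
    unfolding chi_square_def by (subst integral_distr) auto
  finally show ?thesis unfolding eq[symmetric] by (simp add: tendsto_of_real_iff)
qed

text \<open>The measurable event \<open>E N\<close> agrees with \<open>x < Y\<close> only with high
  probability, which is all that an asymptotic expansion of a statistic delivers. The limit law has
  no atom at \<open>x\<close> because \<open>0 < d\<close>, so perturbing the threshold is
  harmless.\<close>

lemma chi_square_limit:
  fixes Z :: "nat \<Rightarrow> nat \<Rightarrow> 'a \<Rightarrow> real" and Y :: "nat \<times> 'a \<Rightarrow> real"
  assumes [measurable]: "\<And>N r. Z N r \<in> borel_measurable M"
    and char: "\<And>a :: nat \<Rightarrow> real. (\<lambda>N. CLINT \<xi>|M. iexp (\<Sum>r<d. a r * Z N r \<xi>))
      \<longlonglongrightarrow> complex_of_real (exp (- (\<Sum>r<d. (a r)\<^sup>2) / 2))"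
    and d: "0 < d"
    and Y: "((\<lambda>z. Y z - (\<Sum>r<d. (Z (fst z) r (snd z))\<^sup>2)) \<longlongrightarrow> 0) high_prob"
    and E: "\<forall>\<^sub>F N in sequentially. E N \<in> events"
    and EY: "\<forall>\<^sub>F z in high_prob. snd z \<in> E (fst z) \<longleftrightarrow> x < Y z"
  shows "(\<lambda>N. prob (E N)) \<longlonglongrightarrow> measure (chi_square d) {x<..}"
proof -
  interpret C: prob_space "chi_square d" by (rule prob_space_chi_square)
  interpret C: real_distribution "chi_square d" by standard simp
  define Q where "Q N \<xi> = (\<Sum>r<d. (Z N r \<xi>)\<^sup>2)" for N \<xi>
  have [measurable]: "Q N \<in> borel_measurable M" for N unfolding Q_def by measurable
  have Q0: "0 \<le> Q N \<xi>" for N \<xi> unfolding Q_def by (intro sum_nonneg) auto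
  have lap: "(\<lambda>N. \<integral>\<xi>. exp (- real i * Q N \<xi>) \<partial>M) \<longlonglongrightarrow> (\<integral>x. exp (- real i * x) \<partial>chi_square d)" for i
    unfolding Q_def by (rule laplace_sum_squares[OF assms(1) char]) auto
  note bounds = laplace_tendsto_imp_bounds[OF prob_space_axioms C.prob_space_axioms sets_chi_square
      \<open>\<And>N. Q N \<in> borel_measurable M\<close> Q0 chi_square_nonneg lap]
  have cont: "((\<lambda>t. measure (chi_square d) {t<..}) \<longlongrightarrow> measure (chi_square d) {x<..}) (at x)"
  proof -
    have *: "measure (chi_square d) {t<..} = 1 - cdf (chi_square d) t" for t
    proof -
      have "{t<..} = space (chi_square d) - {..t}" by (auto simp: chi_square_def)
      then show ?thesis using C.prob_compl[of "{..t}"] by (simp only: cdf_def) simp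
    qed
    have "isCont (cdf (chi_square d)) x" using chi_square_singleton[OF d] by (simp add: C.isCont_cdf)
    then show ?thesis unfolding * by (intro tendsto_intros) (simp add: isCont_def)
  qed
  have near: "\<exists>\<delta>>0. \<forall>t. \<bar>t - x\<bar> \<le> \<delta> \<longrightarrow> \<bar>measure (chi_square d) {t<..} - measure (chi_square d) {x<..}\<bar> < e"
    if "0 < e" for e
  proof -
    from tendstoD[OF cont that] obtain \<delta> where \<delta>: "0 < \<delta>"
      "\<And>t. t \<noteq> x \<Longrightarrow> dist t x < \<delta> \<Longrightarrow> dist (measure (chi_square d) {t<..}) (measure (chi_square d) {x<..}) < e"
      unfolding eventually_at by auto
    show ?thesis
    proof (intro exI[of _ "\<delta> / 2"] conjI allI impI)
      fix t assume "\<bar>t - x\<bar> \<le> \<delta> / 2"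
      then show "\<bar>measure (chi_square d) {t<..} - measure (chi_square d) {x<..}\<bar> < e"
        using \<delta>(1) \<delta>(2)[of t] that by (cases "t = x") (auto simp: dist_real_def)
    qed (use \<delta> in simp)
  qed
  have hp: "\<exists>A. (\<forall>N. A N \<in> events \<and> (\<forall>\<xi>\<in>A N. \<bar>Y (N, \<xi>) - Q N \<xi>\<bar> < \<delta> \<and> (\<xi> \<in> E N \<longleftrightarrow> x < Y (N, \<xi>)))) \<and>
      (\<lambda>N. prob (A N)) \<longlonglongrightarrow> 1" if "0 < \<delta>" for \<delta>
  proof -
    have "\<forall>\<^sub>F z in high_prob. \<bar>Y z - Q (fst z) (snd z)\<bar> < \<delta> \<and> (snd z \<in> E (fst z) \<longleftrightarrow> x < Y z)"
      using tendstoD[OF Y that] EY by eventually_elim (simp add: Q_def)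
    then show ?thesis unfolding eventually_high_prob by simp
  qed
  show ?thesis
  proof (rule tendstoI)
    fix e :: real assume "0 < e"
    then have e4: "0 < e / 4" by simp
    from near[OF e4] obtain \<delta> where \<delta>: "0 < \<delta>"
      "\<And>t. \<bar>t - x\<bar> \<le> \<delta> \<Longrightarrow> \<bar>measure (chi_square d) {t<..} - measure (chi_square d) {x<..}\<bar> < e / 4"
      by blast
    obtain A where A: "\<And>N. A N \<in> events"
      "\<And>N \<xi>. \<xi> \<in> A N \<Longrightarrow> \<bar>Y (N, \<xi>) - Q N \<xi>\<bar> < \<delta> / 2 \<and> (\<xi> \<in> E N \<longleftrightarrow> x < Y (N, \<xi>))"
      "(\<lambda>N. prob (A N)) \<longlonglongrightarrow> 1" using hp[OF half_gt_zero[OF \<delta>(1)]] by blast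
    have A1: "\<forall>\<^sub>F N in sequentially. 1 - e / 4 < prob (A N)"
      using A(3) e4 by (auto intro: order_tendstoD)
    \<comment> \<open>Of the margin \<open>\<delta>\<close>, one half absorbs the difference between
      \<open>Y\<close> and \<open>Q\<close>, the other half is the gap between thresholds that
      \<open>bounds\<close> requires.\<close>
    have b1: "\<forall>\<^sub>F N in sequentially. prob {\<xi> \<in> space M. x - \<delta> / 2 < Q N \<xi>} <
        measure (chi_square d) {x - \<delta><..} + e / 4"
      by (rule bounds(1)) (use \<delta>(1) e4 in auto)
    have b2: "\<forall>\<^sub>F N in sequentially. measure (chi_square d) {x + \<delta><..} - e / 4 <
        prob {\<xi> \<in> space M. x + \<delta> / 2 < Q N \<xi>}"
      by (rule bounds(2)) (use \<delta>(1) e4 in auto)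
    from A1 b1 b2 E show "\<forall>\<^sub>F N in sequentially. dist (prob (E N)) (measure (chi_square d) {x<..}) < e"
    proof eventually_elim
      case (elim N)
      have cA: "prob (space M - A N) = 1 - prob (A N)" using A(1) by (simp add: prob_compl)
      have "E N \<subseteq> {\<xi> \<in> space M. x - \<delta> / 2 < Q N \<xi>} \<union> (space M - A N)"
      proof
        fix \<xi> assume "\<xi> \<in> E N"
        then have "\<xi> \<in> space M" using sets.sets_into_space[OF elim(4)] by blast
        then show "\<xi> \<in> {\<xi> \<in> space M. x - \<delta> / 2 < Q N \<xi>} \<union> (space M - A N)"
        proof (cases "\<xi> \<in> A N")
          case True
          then have "\<bar>Y (N, \<xi>) - Q N \<xi>\<bar> < \<delta> / 2" "x < Y (N, \<xi>)"
            using A(2) \<open>\<xi> \<in> E N\<close> by blast+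
          then have "x - \<delta> / 2 < Q N \<xi>" by linarith
          then show ?thesis using \<open>\<xi> \<in> space M\<close> by simp
        qed (use \<open>\<xi> \<in> space M\<close> in simp)
      qed
      then have "prob (E N) \<le> prob ({\<xi> \<in> space M. x - \<delta> / 2 < Q N \<xi>} \<union> (space M - A N))"
        using A(1) by (intro finite_measure_mono) auto
      also have "\<dots> \<le> prob {\<xi> \<in> space M. x - \<delta> / 2 < Q N \<xi>} + prob (space M - A N)"
        using A(1) by (intro measure_Un_le) auto
      finally have up: "prob (E N) \<le> prob {\<xi> \<in> space M. x - \<delta> / 2 < Q N \<xi>} + (1 - prob (A N))"
        using cA by simp
      have "{\<xi> \<in> space M. x + \<delta> / 2 < Q N \<xi>} \<subseteq> E N \<union> (space M - A N)"
      proof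
        fix \<xi> assume "\<xi> \<in> {\<xi> \<in> space M. x + \<delta> / 2 < Q N \<xi>}"
        then show "\<xi> \<in> E N \<union> (space M - A N)"
        proof (cases "\<xi> \<in> A N")
          case True
          assume "\<xi> \<in> {\<xi> \<in> space M. x + \<delta> / 2 < Q N \<xi>}"
          then have "x + \<delta> / 2 < Q N \<xi>" by simp
          moreover have "\<bar>Y (N, \<xi>) - Q N \<xi>\<bar> < \<delta> / 2" using A(2) True by blast
          ultimately have "x < Y (N, \<xi>)" by linarith
          then show ?thesis using A(2) True by blast
        qed simp
      qed
      then have "prob {\<xi> \<in> space M. x + \<delta> / 2 < Q N \<xi>} \<le> prob (E N \<union> (space M - A N))"
        using A(1) elim(4) by (intro finite_measure_mono) auto
      also have "\<dots> \<le> prob (E N) + prob (space M - A N)"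
        using A(1) elim(4) by (intro measure_Un_le) auto
      finally have lo: "prob {\<xi> \<in> space M. x + \<delta> / 2 < Q N \<xi>} \<le> prob (E N) + (1 - prob (A N))"
        using cA by simp
      have n1: "\<bar>measure (chi_square d) {x - \<delta><..} - measure (chi_square d) {x<..}\<bar> < e / 4"
        and n2: "\<bar>measure (chi_square d) {x + \<delta><..} - measure (chi_square d) {x<..}\<bar> < e / 4"
        using \<delta> by auto
      show ?case using elim(1-3) up lo n1 n2 unfolding dist_real_def by linarith
    qed
  qed
qed

end

section \<open>Triangular arrays\<close>

context prob_space begin

text \<open>Both the characteristic function of the sum and the Gaussian limit are compared as
  products. The factors lie in the unit disc, so the products differ by at most the sum of the
  factorwise errors: a third moment, and a squared variance that is at most
  \<open>\<delta> N\<close> times the variance. The argument 1 of the characteristic function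
  suffices because scalars can be absorbed into the array.\<close>

lemma triangular_array_clt:
  fixes \<eta> :: "nat \<Rightarrow> nat \<Rightarrow> 'a \<Rightarrow> real" and \<delta> :: "nat \<Rightarrow> real"
  assumes indep: "\<And>N. indep_vars (\<lambda>_. borel) (\<eta> N) {1..m N}"
    and int3: "\<And>N i. i \<in> {1..m N} \<Longrightarrow> integrable M (\<lambda>\<xi>. \<bar>\<eta> N i \<xi>\<bar> ^ 3)"
    and mean: "\<And>N i. i \<in> {1..m N} \<Longrightarrow> expectation (\<eta> N i) = 0"
    and var: "(\<lambda>N. \<Sum>i\<in>{1..m N}. expectation (\<lambda>\<xi>. (\<eta> N i \<xi>)\<^sup>2)) \<longlonglongrightarrow> v"
    and small: "\<And>N i. i \<in> {1..m N} \<Longrightarrow> expectation (\<lambda>\<xi>. (\<eta> N i \<xi>)\<^sup>2) \<le> \<delta> N" "\<delta> \<longlonglongrightarrow> 0"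
    and lyap: "(\<lambda>N. \<Sum>i\<in>{1..m N}. expectation (\<lambda>\<xi>. \<bar>\<eta> N i \<xi>\<bar> ^ 3)) \<longlonglongrightarrow> 0"
  shows "(\<lambda>N. CLINT \<xi>|M. iexp (\<Sum>i\<in>{1..m N}. \<eta> N i \<xi>)) \<longlonglongrightarrow> complex_of_real (exp (- v / 2))"
proof -
  define \<sigma> where "\<sigma> N i = expectation (\<lambda>\<xi>. (\<eta> N i \<xi>)\<^sup>2)" for N i
  define \<kappa> where "\<kappa> N i = expectation (\<lambda>\<xi>. \<bar>\<eta> N i \<xi>\<bar> ^ 3)" for N i
  have rv: "random_variable borel (\<eta> N i)" if "i \<in> {1..m N}" for N i
    using indep[of N] that by (auto simp: indep_vars_def)
  have int2: "integrable M (\<lambda>\<xi>. (\<eta> N i \<xi>)\<^sup>2)" if i: "i \<in> {1..m N}" for N i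
  proof (rule Bochner_Integration.integrable_bound)
    show "integrable M (\<lambda>\<xi>. 1 + \<bar>\<eta> N i \<xi>\<bar> ^ 3)" using int3[OF i] by simp
    show "(\<lambda>\<xi>. (\<eta> N i \<xi>)\<^sup>2) \<in> borel_measurable M" using rv[OF i] by simp
    have "x\<^sup>2 \<le> 1 + \<bar>x\<bar> ^ 3" for x :: real
    proof (cases "\<bar>x\<bar> \<le> 1")
      case True
      then have "x\<^sup>2 \<le> 1" by (simp add: abs_square_le_1)
      then show ?thesis by (simp add: add_increasing2)
    next
      case False
      then have "\<bar>x\<bar>\<^sup>2 \<le> \<bar>x\<bar> ^ 3" by (intro power_increasing) auto
      then show ?thesis by simp
    qed
    then show "AE \<xi> in M. norm ((\<eta> N i \<xi>)\<^sup>2) \<le> norm (1 + \<bar>\<eta> N i \<xi>\<bar> ^ 3)"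
      by (auto intro: order_trans[OF _ abs_ge_self])
  qed
  have int1: "integrable M (\<eta> N i)" if i: "i \<in> {1..m N}" for N i
    by (rule square_integrable_imp_integrable[OF rv[OF i] int2[OF i]])
  have \<sigma>0: "0 \<le> \<sigma> N i" for N i by (simp add: \<sigma>_def)
  have bound: "cmod (char (distr M borel (\<eta> N i)) 1 - exp (- \<sigma> N i / 2)) \<le> \<kappa> N i / 6 + \<delta> N * \<sigma> N i / 4"
    if i: "i \<in> {1..m N}" for N i
  proof -
    have "cmod (char (distr M borel (\<eta> N i)) 1 - (1 - 1\<^sup>2 * \<sigma> N i / 2)) \<le>
        (1\<^sup>2 / 6) * expectation (\<lambda>\<xi>. min (6 * (\<eta> N i \<xi>)\<^sup>2) (\<bar>1\<bar> * \<bar>\<eta> N i \<xi>\<bar> ^ 3))"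
      by (rule char_approx3'[OF rv[OF i] int1[OF i] int2[OF i] mean[OF i] _ refl])
        (simp add: mean[OF i] \<sigma>_def)
    also have "\<dots> \<le> \<kappa> N i / 6"
    proof -
      have "expectation (\<lambda>\<xi>. min (6 * (\<eta> N i \<xi>)\<^sup>2) (\<bar>1\<bar> * \<bar>\<eta> N i \<xi>\<bar> ^ 3)) \<le> \<kappa> N i"
        unfolding \<kappa>_def using int3[OF i] int2[OF i] by (intro integral_mono) auto
      then show ?thesis by simp
    qed
    finally have 1: "cmod (char (distr M borel (\<eta> N i)) 1 - (1 - \<sigma> N i / 2)) \<le> \<kappa> N i / 6" by simp
    \<comment> \<open>The lower side is \<open>1 - x \<le> exp (- x)\<close>; the upper side passes
      through \<open>1 / (1 + x)\<close>.\<close>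
    have e: "\<bar>(1 - x) - exp (- x)\<bar> \<le> x\<^sup>2" if "0 \<le> x" for x :: real
    proof -
      have "exp (- x) \<le> 1 / (1 + x)"
        using exp_ge_add_one_self[of x] that by (simp add: exp_minus field_simps)
      also have "\<dots> \<le> 1 - x + x\<^sup>2"
      proof -
        have "1 \<le> (1 - x + x\<^sup>2) * (1 + x)"
          using that by (simp add: algebra_simps power2_eq_square)
        then show ?thesis using that by (simp add: pos_divide_le_eq)
      qed
      finally show ?thesis using exp_ge_add_one_self[of "- x"] by simp
    qed
    have "cmod (complex_of_real (1 - \<sigma> N i / 2) - exp (- \<sigma> N i / 2)) = \<bar>(1 - \<sigma> N i / 2) - exp (- (\<sigma> N i / 2))\<bar>"
      unfolding of_real_diff[symmetric] norm_of_real by simp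
    also have "\<dots> \<le> (\<sigma> N i / 2)\<^sup>2" using \<sigma>0[of N i] by (intro e) simp
    also have "\<dots> = \<sigma> N i * \<sigma> N i / 4" by (simp add: power2_eq_square)
    also have "\<dots> \<le> \<delta> N * \<sigma> N i / 4"
      using small(1)[OF i] \<sigma>0[of N i] by (intro divide_right_mono mult_right_mono) (auto simp: \<sigma>_def)
    finally have 2: "cmod (complex_of_real (1 - \<sigma> N i / 2) - exp (- \<sigma> N i / 2)) \<le> \<delta> N * \<sigma> N i / 4" .
    have "cmod (char (distr M borel (\<eta> N i)) 1 - exp (- \<sigma> N i / 2)) \<le>
      cmod (char (distr M borel (\<eta> N i)) 1 - complex_of_real (1 - \<sigma> N i / 2)) +
      cmod (complex_of_real (1 - \<sigma> N i / 2) - exp (- \<sigma> N i / 2))"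
      using norm_triangle_ineq[of "char (distr M borel (\<eta> N i)) 1 - complex_of_real (1 - \<sigma> N i / 2)"
         "complex_of_real (1 - \<sigma> N i / 2) - exp (- \<sigma> N i / 2)"] by simp
    then show ?thesis using 1 2 by simp
  qed
  have eq: "(CLINT \<xi>|M. iexp (\<Sum>i\<in>{1..m N}. \<eta> N i \<xi>)) = (\<Prod>i\<in>{1..m N}. char (distr M borel (\<eta> N i)) 1)" for N
  proof -
    have "(\<lambda>\<xi>. \<Sum>i\<in>{1..m N}. \<eta> N i \<xi>) \<in> borel_measurable M" using rv by (intro borel_measurable_sum) auto
    then have "(CLINT \<xi>|M. iexp (\<Sum>i\<in>{1..m N}. \<eta> N i \<xi>)) = char (distr M borel (\<lambda>\<xi>. \<Sum>i\<in>{1..m N}. \<eta> N i \<xi>)) 1"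
      unfolding char_def by (subst integral_distr) auto
    then show ?thesis using char_distr_sum[OF indep[of N], of 1] by simp
  qed
  have diff: "cmod ((\<Prod>i\<in>{1..m N}. char (distr M borel (\<eta> N i)) 1) - (\<Prod>i\<in>{1..m N}. complex_of_real (exp (- \<sigma> N i / 2))))
      \<le> (\<Sum>i\<in>{1..m N}. \<kappa> N i) / 6 + \<delta> N * (\<Sum>i\<in>{1..m N}. \<sigma> N i) / 4" for N
  proof -
    have "cmod ((\<Prod>i\<in>{1..m N}. char (distr M borel (\<eta> N i)) 1) - (\<Prod>i\<in>{1..m N}. complex_of_real (exp (- \<sigma> N i / 2))))
      \<le> (\<Sum>i\<in>{1..m N}. cmod (char (distr M borel (\<eta> N i)) 1 - complex_of_real (exp (- \<sigma> N i / 2))))"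
    proof (rule norm_prod_diff)
      fix i assume i: "i \<in> {1..m N}"
      interpret D: real_distribution "distr M borel (\<eta> N i)" using rv[OF i] by (rule real_distribution_distr)
      show "cmod (char (distr M borel (\<eta> N i)) 1) \<le> 1" by (rule D.cmod_char_le_1)
      show "cmod (complex_of_real (exp (- \<sigma> N i / 2))) \<le> 1" using \<sigma>0[of N i] by simp
    qed
    also have "\<dots> \<le> (\<Sum>i\<in>{1..m N}. \<kappa> N i / 6 + \<delta> N * \<sigma> N i / 4)"
      using bound by (intro sum_mono) simp
    also have "\<dots> = (\<Sum>i\<in>{1..m N}. \<kappa> N i) / 6 + \<delta> N * (\<Sum>i\<in>{1..m N}. \<sigma> N i) / 4"
      by (simp add: sum.distrib sum_divide_distrib sum_distrib_left)
    finally show ?thesis .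
  qed
  have "(\<lambda>N. (\<Sum>i\<in>{1..m N}. \<kappa> N i) / 6 + \<delta> N * (\<Sum>i\<in>{1..m N}. \<sigma> N i) / 4) \<longlonglongrightarrow> 0 / 6 + 0 * v / 4"
    unfolding \<kappa>_def \<sigma>_def by (intro tendsto_intros lyap var small(2)) auto
  then have d0: "(\<lambda>N. (\<Prod>i\<in>{1..m N}. char (distr M borel (\<eta> N i)) 1) - (\<Prod>i\<in>{1..m N}. complex_of_real (exp (- \<sigma> N i / 2)))) \<longlonglongrightarrow> 0"
    by (intro Lim_null_comparison[OF always_eventually[OF allI[OF diff]]]) simp
  have "(\<Prod>i\<in>{1..m N}. complex_of_real (exp (- \<sigma> N i / 2))) = complex_of_real (exp (- (\<Sum>i\<in>{1..m N}. \<sigma> N i) / 2))" for N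
    by (simp add: exp_sum[symmetric] sum_negf sum_divide_distrib flip: of_real_prod)
  moreover have "(\<lambda>N. complex_of_real (exp (- (\<Sum>i\<in>{1..m N}. \<sigma> N i) / 2))) \<longlonglongrightarrow> complex_of_real (exp (- v / 2))"
    unfolding \<sigma>_def by (intro tendsto_intros var) auto
  ultimately have "(\<lambda>N. \<Prod>i\<in>{1..m N}. complex_of_real (exp (- \<sigma> N i / 2))) \<longlonglongrightarrow> complex_of_real (exp (- v / 2))"
    by simp
  from tendsto_add[OF d0 this] show ?thesis unfolding eq by simp
qed

end

section \<open>Quantiles and tail expansions\<close>

locale distribution_fun =
  fixes F :: "real \<Rightarrow> real"
  assumes mono_F: "mono F"
    and F_at_bot: "(F \<longlongrightarrow> 0) at_bot" and F_at_top: "(F \<longlongrightarrow> 1) at_top"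
    and cont_F: "\<And>x. isCont F x"
begin

lemma F_le_1: "F x \<le> 1"
  by (rule tendsto_lowerbound[OF F_at_top]) (auto simp: eventually_at_top_linorder intro!: exI[of _ x] monoD[OF mono_F])

lemma F_nonneg: "0 \<le> F x"
  by (rule tendsto_upperbound[OF F_at_bot]) (auto simp: eventually_at_bot_linorder intro!: exI[of _ x] monoD[OF mono_F])

lemma quantile_set:
  assumes "0 < \<tau>" "\<tau> < 1"
  shows "{x. \<tau> \<le> F x} \<noteq> {}" "bdd_below {x. \<tau> \<le> F x}"
proof -
  obtain x where "\<tau> < F x"
    using order_tendstoD(1)[OF F_at_top assms(2)] eventually_happens'[OF trivial_limit_at_top_linorder] by blast
  then show "{x. \<tau> \<le> F x} \<noteq> {}" by (auto intro: less_imp_le)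
  obtain y where y: "F y < \<tau>"
    using order_tendstoD(2)[OF F_at_bot assms(1)] eventually_happens'[OF trivial_limit_at_bot_linorder] by blast
  show "bdd_below {x. \<tau> \<le> F x}"
  proof (rule bdd_belowI[of _ y])
    fix x assume "x \<in> {x. \<tau> \<le> F x}"
    then show "y \<le> x" using y monoD[OF mono_F, of x y] by (cases "x \<le> y") auto
  qed
qed

lemma quantile_le: "0 < \<tau> \<Longrightarrow> \<tau> < 1 \<Longrightarrow> \<tau> \<le> F y \<Longrightarrow> quantile F \<tau> \<le> y"
  unfolding quantile_def by (rule cInf_lower) (auto simp: quantile_set)

lemma le_quantile:
  assumes "0 < \<tau>" "\<tau> < 1" "F y < \<tau>"
  shows "y \<le> quantile F \<tau>"
  unfolding quantile_def
proof (rule cInf_greatest)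
  fix x assume "x \<in> {x. \<tau> \<le> F x}"
  then show "y \<le> x" using assms(3) monoD[OF mono_F, of x y] by (cases "x \<le> y") auto
qed (use quantile_set assms in auto)

text \<open>Continuity supplies both inequalities: the superlevel set is closed and so contains its
  infimum, and a value of \<open>F\<close> above \<open>\<tau>\<close> at the infimum would persist
  slightly to the left of it.\<close>

lemma F_quantile:
  assumes "0 < \<tau>" "\<tau> < 1"
  shows "F (quantile F \<tau>) = \<tau>"
proof (rule antisym)
  show "\<tau> \<le> F (quantile F \<tau>)"
  proof -
    have "continuous_on UNIV F" using cont_F by (simp add: continuous_on_eq_continuous_at)
    then have "closed {x. \<tau> \<le> F x}" by (intro closed_Collect_le continuous_on_const)
    then have "Inf {x. \<tau> \<le> F x} \<in> {x. \<tau> \<le> F x}"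
      using quantile_set[OF assms] by (intro closed_contains_Inf) auto
    then show ?thesis by (simp add: quantile_def)
  qed
  show "F (quantile F \<tau>) \<le> \<tau>"
  proof (rule ccontr)
    assume *: "\<not> ?thesis"
    have "(F \<longlongrightarrow> F (quantile F \<tau>)) (at_left (quantile F \<tau>))"
      using cont_F[of "quantile F \<tau>"] unfolding isCont_def by (rule filterlim_mono) (auto simp: at_le)
    from order_tendstoD(1)[OF this, of \<tau>] * obtain b where b: "b < quantile F \<tau>"
      "\<And>y. b < y \<Longrightarrow> y < quantile F \<tau> \<Longrightarrow> \<tau> < F y"
      by (auto simp: eventually_at_left[of "quantile F \<tau> - 1"])
    obtain y where y: "b < y" "y < quantile F \<tau>" using dense[OF b(1)] by blast
    then show False using quantile_le[OF assms, of y] b(2)[OF y] by simp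
  qed
qed

lemma quantile_mono: "0 < \<tau> \<Longrightarrow> \<tau> \<le> \<tau>' \<Longrightarrow> \<tau>' < 1 \<Longrightarrow> quantile F \<tau> \<le> quantile F \<tau>'"
  by (rule quantile_le) (auto simp: F_quantile)

text \<open>The case \<open>F x = 1\<close> is the one for the first disjunct of
  \<open>tail_quantile\<close>: there \<open>1 / 0 = 0\<close> in HOL would wrongly exclude the
  point.\<close>

lemma tail_quantile_eq: "0 < t \<Longrightarrow> tail_quantile F t = quantile F (1 - 1 / t)"
proof -
  assume t: "0 < t"
  have "(1 - F x = 0 \<or> t \<le> 1 / (1 - F x)) \<longleftrightarrow> 1 - 1 / t \<le> F x" for x
    using F_le_1[of x] t by (cases "F x = 1") (auto simp: field_simps)
  then show ?thesis by (simp add: tail_quantile_def quantile_def)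
qed

lemma tail_quantile_mono: "1 < s \<Longrightarrow> s \<le> t \<Longrightarrow> tail_quantile F s \<le> tail_quantile F t"
  by (auto simp: tail_quantile_eq field_simps intro!: quantile_mono)

end

text \<open>For \<open>\<rho> < 0\<close> the second-order condition says that
  \<open>ln (U t) - \<gamma> * ln t\<close> converges at rate \<open>t powr \<rho>\<close>. The rate
  is extracted at \<open>x = 2\<close> only; the other values of \<open>x\<close> enter through
  first-order regular variation, to show that all starting points of dyadic sequences lead to the
  same constant. Monotonicity secures the positivity of \<open>U\<close> far out.\<close>

lemma log_tail_expansion:
  fixes U :: "real \<Rightarrow> real"
  assumes mono: "\<And>s t. 1 < s \<Longrightarrow> s \<le> t \<Longrightarrow> U s \<le> U t"
    and \<gamma>: "0 < \<gamma>" and \<rho>: "\<rho> < 0"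
    and A: "\<And>t. 0 < t \<Longrightarrow> A t = a * t powr \<rho>"
    and lim: "\<And>x. 0 < x \<Longrightarrow> ((\<lambda>t. 1 / A t * (U (t * x) / U t - x powr \<gamma>)) \<longlongrightarrow>
        x powr \<gamma> * ((x powr \<rho> - 1) / \<rho>)) at_top"
  shows "a \<noteq> 0" "\<exists>c K t0. 1 < t0 \<and> 0 \<le> K \<and> (\<forall>t\<ge>t0. 0 < U t \<and> \<bar>ln (U t) - c - \<gamma> * ln t\<bar> \<le> K * t powr \<rho>)"
proof -
  show a: "a \<noteq> 0"
  proof
    \<comment> \<open>Then \<open>1 / A t\<close> is 0 by the division convention, while the
      prescribed limit at \<open>x = 2\<close> is nonzero.\<close>
    assume "a = 0"
    have "((\<lambda>t::real. 0::real) \<longlongrightarrow> 2 powr \<gamma> * ((2 powr \<rho> - 1) / \<rho>)) at_top"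
    proof (rule Lim_transform_eventually)
      show "((\<lambda>t. 1 / A t * (U (t * 2) / U t - 2 powr \<gamma>)) \<longlongrightarrow> 2 powr \<gamma> * ((2 powr \<rho> - 1) / \<rho>)) at_top"
        by (rule lim) simp
      show "\<forall>\<^sub>F t in at_top. 1 / A t * (U (t * 2) / U t - 2 powr \<gamma>) = 0"
        using eventually_gt_at_top[of 0] by eventually_elim (simp add: A \<open>a = 0\<close>)
    qed
    then have "2 powr \<gamma> * ((2 powr \<rho> - 1) / \<rho>) = 0"
      using tendsto_unique[OF trivial_limit_at_top_linorder _ tendsto_const] by metis
    moreover have "2 powr \<rho> < 1" using powr_less_mono[of \<rho> 0 2] \<rho> by simp
    ultimately show False using \<rho> by simp
  qed
  have t\<rho>: "((\<lambda>t::real. t powr \<rho>) \<longlongrightarrow> 0) at_top"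
    using tendsto_neg_powr[OF \<rho> filterlim_ident] .
  have ratio: "((\<lambda>t. U (t * x) / U t) \<longlongrightarrow> x powr \<gamma>) at_top" if x: "0 < x" for x
  proof -
    have "((\<lambda>t. (a * t powr \<rho>) * (1 / A t * (U (t * x) / U t - x powr \<gamma>)) + x powr \<gamma>) \<longlongrightarrow>
        (a * 0) * (x powr \<gamma> * ((x powr \<rho> - 1) / \<rho>)) + x powr \<gamma>) at_top"
      by (intro tendsto_intros t\<rho> lim x)
    then have "((\<lambda>t. (a * t powr \<rho>) * (1 / A t * (U (t * x) / U t - x powr \<gamma>)) + x powr \<gamma>) \<longlongrightarrow> x powr \<gamma>) at_top"
      by simp
    then show ?thesis
    proof (rule Lim_transform_eventually)
      show "\<forall>\<^sub>F t in at_top. (a * t powr \<rho>) * (1 / A t * (U (t * x) / U t - x powr \<gamma>)) + x powr \<gamma> = U (t * x) / U t"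
        using eventually_gt_at_top[of 0]
      proof eventually_elim
        case (elim t)
        have "a * t powr \<rho> \<noteq> 0" using a elim by simp
        then show ?case unfolding A[OF elim] by (simp only: mult.assoc[symmetric]) simp
      qed
    qed
  qed
  define L where "L = 2 powr \<gamma> * ((2 powr \<rho> - 1) / \<rho>)"
  define K1 where "K1 = \<bar>a\<bar> * (\<bar>L\<bar> + 1)"
  have K1: "0 \<le> K1" by (simp add: K1_def)
  have "\<forall>\<^sub>F t in at_top. \<bar>1 / A t * (U (t * 2) / U t - 2 powr \<gamma>) - L\<bar> < 1"
    using tendstoD[OF lim[of 2] zero_less_one] by (simp add: L_def dist_real_def)
  then have dyadic: "\<forall>\<^sub>F t in at_top. \<bar>U (t * 2) / U t - 2 powr \<gamma>\<bar> \<le> K1 * t powr \<rho>"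
    using eventually_gt_at_top[of 0]
  proof eventually_elim
    case (elim t)
    have "a * t powr \<rho> \<noteq> 0" using a elim by simp
    then have "\<bar>U (t * 2) / U t - 2 powr \<gamma>\<bar> = \<bar>a * t powr \<rho>\<bar> * \<bar>1 / A t * (U (t * 2) / U t - 2 powr \<gamma>)\<bar>"
      unfolding A[OF elim(2)] abs_mult[symmetric] by simp
    also have "\<dots> \<le> \<bar>a * t powr \<rho>\<bar> * (\<bar>L\<bar> + 1)"
      using elim(1) by (intro mult_left_mono) auto
    also have "\<dots> = K1 * t powr \<rho>" by (simp add: K1_def abs_mult)
    finally show ?case .
  qed
  have "\<forall>\<^sub>F t in at_top. 1 < U (t * 2) / U t"
    using order_tendstoD(1)[OF ratio[of 2], of 1] \<gamma> by simp
  moreover have "\<forall>\<^sub>F t in at_top. K1 * t powr \<rho> < 1 / 2"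
    using order_tendstoD(2)[OF tendsto_mult_left[OF t\<rho>, of K1], of "1 / 2"] by simp
  ultimately have "\<forall>\<^sub>F t in at_top. \<bar>U (t * 2) / U t - 2 powr \<gamma>\<bar> \<le> K1 * t powr \<rho> \<and> 1 < U (t * 2) / U t \<and> K1 * t powr \<rho> < 1 / 2"
    using dyadic by eventually_elim simp
  then obtain t1 where t1: "\<And>t. t1 \<le> t \<Longrightarrow> \<bar>U (t * 2) / U t - 2 powr \<gamma>\<bar> \<le> K1 * t powr \<rho>"
    "\<And>t. t1 \<le> t \<Longrightarrow> 1 < U (t * 2) / U t" "\<And>t. t1 \<le> t \<Longrightarrow> K1 * t powr \<rho> < 1 / 2"
    by (auto simp: eventually_at_top_linorder)
  define t0 where "t0 = max t1 2"
  have t0: "1 < t0" "t1 \<le> t0" by (auto simp: t0_def)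
  \<comment> \<open>If \<open>U t\<close> were negative, a ratio above 1 would put
    \<open>U (t * 2)\<close> below \<open>U t\<close>, against monotonicity; the value 0 is excluded
    since the ratio would be 0.\<close>
  have pos: "0 < U t" if t: "t0 \<le> t" for t
  proof (rule ccontr)
    assume "\<not> 0 < U t"
    moreover have gt: "1 < U (t * 2) / U t" using t t0 by (intro t1(2)) simp
    ultimately have neg: "U t < 0" by (cases "U t = 0") auto
    then have "U (t * 2) < U t" using gt by (simp add: less_divide_eq)
    moreover have "U t \<le> U (t * 2)" using t t0 by (intro mono) auto
    ultimately show False by simp
  qed
  define \<psi> where "\<psi> t = ln (U t) - \<gamma> * ln t" for t
  have step: "\<bar>\<psi> (t * 2) - \<psi> t\<bar> \<le> (3 * K1) * t powr \<rho>" if t: "t0 \<le> t" for t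
  proof -
    define y where "y = U (t * 2) / U t / 2 powr \<gamma> - 1"
    have p: "0 < U t" "0 < U (t * 2)" "0 < t" using t t0 by (auto intro!: pos)
    have g1: "1 \<le> 2 powr \<gamma>" using \<gamma> by (simp add: ge_one_powr_ge_zero)
    have "y = (U (t * 2) / U t - 2 powr \<gamma>) / 2 powr \<gamma>"
      unfolding y_def by (subst diff_divide_distrib) simp
    then have "\<bar>y\<bar> = \<bar>U (t * 2) / U t - 2 powr \<gamma>\<bar> / 2 powr \<gamma>"
      by (simp only: abs_divide) simp
    also have "\<dots> \<le> \<bar>U (t * 2) / U t - 2 powr \<gamma>\<bar> / 1"
      using g1 by (intro divide_left_mono) auto
    also have "\<dots> \<le> K1 * t powr \<rho>" using t1(1)[of t] t t0 by simp
    finally have y: "\<bar>y\<bar> \<le> K1 * t powr \<rho>" .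
    then have yh: "\<bar>y\<bar> \<le> 1 / 2" using t1(3)[of t] t t0 by simp
    \<comment> \<open>The constant 3 in \<open>step\<close> is 1 + 2: the linear term plus a
      quadratic remainder that is itself at most \<open>2 * |y|\<close>.\<close>
    have "\<bar>ln (1 + y) - y\<bar> \<le> 2 * y\<^sup>2" using abs_ln_one_plus_x_minus_x_bound[OF yh] .
    moreover have "y\<^sup>2 \<le> \<bar>y\<bar>"
    proof -
      have "\<bar>y\<bar> * \<bar>y\<bar> \<le> \<bar>y\<bar> * 1" using yh by (intro mult_left_mono) auto
      then show ?thesis by (simp add: power2_eq_square)
    qed
    ultimately have "\<bar>ln (1 + y)\<bar> \<le> 3 * \<bar>y\<bar>" by linarith
    moreover have "ln (1 + y) = \<psi> (t * 2) - \<psi> t"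
      using p by (simp add: y_def \<psi>_def ln_div ln_mult ln_powr algebra_simps)
    ultimately show ?thesis using y by simp
  qed
  define r where "r = (2::real) powr \<rho>"
  have r: "0 < r" "r < 1" using powr_less_mono[of \<rho> 0 2] \<rho> by (auto simp: r_def)
  \<comment> \<open>The dyadic increments are dominated by a geometric series of ratio
    \<open>r\<close>, which \<open>K\<close> sums.\<close>
  define K where "K = 3 * K1 / (1 - r)"
  have K: "0 \<le> K" using K1 r by (simp add: K_def)
  have dy: "t * 2 ^ i * 2 = t * 2 ^ Suc i" for t :: real and i by simp
  have lim\<psi>: "\<exists>c. (\<lambda>i. \<psi> (t * 2 ^ i)) \<longlonglongrightarrow> c \<and> \<bar>\<psi> t - c\<bar> \<le> K * t powr \<rho>" if t: "t0 \<le> t" for t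
  proof -
    define d where "d i = \<psi> (t * 2 ^ Suc i) - \<psi> (t * 2 ^ i)" for i :: nat
    have ti: "t0 \<le> t * 2 ^ i" for i :: nat
    proof -
      have "t * 1 \<le> t * 2 ^ i" using t t0 by (intro mult_left_mono) auto
      then show ?thesis using t by simp
    qed
    have d: "\<bar>d i\<bar> \<le> (3 * K1 * t powr \<rho>) * r ^ i" for i
    proof -
      have "(t * 2 ^ i) powr \<rho> = t powr \<rho> * r ^ i"
        using t t0 by (simp add: powr_mult r_def powr_realpow[symmetric] powr_powr mult.commute)
      then show ?thesis using step[OF ti[of i]] unfolding dy d_def by (simp add: mult.assoc)
    qed
    have geo: "(\<lambda>i. (3 * K1 * t powr \<rho>) * r ^ i) sums ((3 * K1 * t powr \<rho>) * (1 / (1 - r)))"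
      using r by (intro sums_mult geometric_sums) auto
    have sd: "summable (\<lambda>i. \<bar>d i\<bar>)"
      by (rule summable_comparison_test'[OF sums_summable[OF geo], of 0]) (use d in simp)
    have "\<psi> (t * 2 ^ i) = \<psi> t + (\<Sum>j<i. d j)" for i
      unfolding d_def by (subst sum_lessThan_telescope) simp
    moreover have "(\<lambda>i. \<psi> t + (\<Sum>j<i. d j)) \<longlonglongrightarrow> \<psi> t + suminf d"
      using summable_LIMSEQ[OF summable_rabs_cancel[OF sd]] by (intro tendsto_intros)
    ultimately have "(\<lambda>i. \<psi> (t * 2 ^ i)) \<longlonglongrightarrow> \<psi> t + suminf d" by simp
    moreover have "\<bar>suminf d\<bar> \<le> K * t powr \<rho>"
    proof -
      have "\<bar>suminf d\<bar> \<le> (\<Sum>i. \<bar>d i\<bar>)" by (rule summable_rabs[OF sd])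
      also have "\<dots> \<le> (\<Sum>i. (3 * K1 * t powr \<rho>) * r ^ i)"
        by (rule suminf_le[OF d sd sums_summable[OF geo]])
      also have "\<dots> = K * t powr \<rho>" using sums_unique[OF geo] by (simp add: K_def)
      finally show ?thesis .
    qed
    ultimately show ?thesis by (intro exI[of _ "\<psi> t + suminf d"]) simp
  qed
  obtain c where c: "(\<lambda>i. \<psi> (t0 * 2 ^ i)) \<longlonglongrightarrow> c" using lim\<psi>[of t0] by auto
  have "\<bar>\<psi> t - c\<bar> \<le> K * t powr \<rho>" if t: "t0 \<le> t" for t
  proof -
    obtain c' where c': "(\<lambda>i. \<psi> (t * 2 ^ i)) \<longlonglongrightarrow> c'" "\<bar>\<psi> t - c'\<bar> \<le> K * t powr \<rho>" using lim\<psi>[OF t] by auto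
    \<comment> \<open>The dyadic sequences from \<open>t\<close> and from \<open>t0\<close> keep the
      constant ratio \<open>x\<close>, so regular variation at \<open>x\<close> forces their limits
      to agree.\<close>
    define x where "x = t / t0"
    have x: "0 < x" using t t0 by (simp add: x_def)
    have lt: "filterlim (\<lambda>i. t0 * 2 ^ i) at_top sequentially"
    proof (rule filterlim_tendsto_pos_mult_at_top[OF tendsto_const])
      show "filterlim (\<lambda>i. 2 ^ i :: real) at_top sequentially"
        by (rule filterlim_at_top_mono[OF filterlim_real_sequentially])
          (auto intro!: always_eventually less_imp_le[OF of_nat_less_two_power])
    qed (use t0 in simp)
    have "(\<lambda>i. ln (U (t0 * 2 ^ i * x) / U (t0 * 2 ^ i)) - \<gamma> * ln x) \<longlonglongrightarrow> ln (x powr \<gamma>) - \<gamma> * ln x"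
      using x by (intro tendsto_intros filterlim_compose[OF ratio[OF x] lt]) auto
    moreover have "ln (U (t0 * 2 ^ i * x) / U (t0 * 2 ^ i)) - \<gamma> * ln x = \<psi> (t * 2 ^ i) - \<psi> (t0 * 2 ^ i)" for i :: nat
    proof -
      have e: "t0 * 2 ^ i * x = t * 2 ^ i" using t0 by (simp add: x_def)
      have "t0 \<le> s \<Longrightarrow> t0 \<le> s * 2 ^ i" for s
      proof -
        assume s: "t0 \<le> s"
        have "s * 1 \<le> s * 2 ^ i" using s t0 by (intro mult_left_mono) auto
        then show ?thesis using s by simp
      qed
      then have "0 < U (t * 2 ^ i)" "0 < U (t0 * 2 ^ i)" using t by (auto intro!: pos)
      then show ?thesis unfolding e using t t0 by (simp add: \<psi>_def ln_div ln_mult x_def algebra_simps)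
    qed
    ultimately have "(\<lambda>i. \<psi> (t * 2 ^ i) - \<psi> (t0 * 2 ^ i)) \<longlonglongrightarrow> 0" using x by (simp add: ln_powr)
    from LIMSEQ_unique[OF this tendsto_diff[OF c'(1) c]] have "c' = c" by simp
    then show ?thesis using c'(2) by simp
  qed
  then show "\<exists>c K t0. 1 < t0 \<and> 0 \<le> K \<and> (\<forall>t\<ge>t0. 0 < U t \<and> \<bar>ln (U t) - c - \<gamma> * ln t\<bar> \<le> K * t powr \<rho>)"
    using pos t0 K by (intro exI[of _ c] exI[of _ K] exI[of _ t0]) (auto simp: \<psi>_def algebra_simps)
qed

text \<open>The quantile function only sandwiches an observation \<open>y\<close>, between the values at
  \<open>1 / (1 - F y)\<close> and just above; continuity of the bound closes the gap.\<close>

lemma (in distribution_fun) log_observation_expansion: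
  assumes \<rho>: "\<rho> < 0" and K: "0 \<le> K" and t0: "1 < t0"
    and U: "\<And>t. t0 \<le> t \<Longrightarrow> 0 < tail_quantile F t \<and> \<bar>ln (tail_quantile F t) - c - \<gamma> * ln t\<bar> \<le> K * t powr \<rho>"
    and y: "0 < 1 - F y" "1 - F y \<le> 1 / t0"
  shows "0 < y" "\<bar>ln y - c + \<gamma> * ln (1 - F y)\<bar> \<le> K * (1 - F y) powr (- \<rho>)"
proof -
  define t where "t = 1 / (1 - F y)"
  have "t0 \<le> t" using y t0 by (simp add: t_def field_simps)
  with t0 have t: "t0 \<le> t" "1 < t" by simp_all
  have t1: "1 / t = 1 - F y" by (simp add: t_def)
  have "1 / t0 < 1" using t0 by simp
  then have Fy: "0 < F y" "F y < 1" using y by linarith+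
  have "tail_quantile F t \<le> y"
    unfolding tail_quantile_eq[OF order.strict_trans[OF zero_less_one t(2)]]
    using t Fy by (intro quantile_le) (auto simp: t1)
  then show y0: "0 < y" using U[OF t(1)] by linarith
  have lo: "ln (tail_quantile F t) \<le> ln y" using \<open>tail_quantile F t \<le> y\<close> U[OF t(1)] y0 by simp
  have up: "ln y \<le> c + \<gamma> * ln s + K * s powr \<rho>" if s: "t < s" for s
  proof -
    have "1 / s < 1 / t" using s t by (intro divide_strict_left_mono) auto
    then have "y \<le> tail_quantile F s"
      unfolding tail_quantile_eq[OF order.strict_trans[OF zero_less_one order.strict_trans[OF t(2) s]]]
      using s t by (intro le_quantile) (auto simp: t1)
    then have "ln y \<le> ln (tail_quantile F s)" using U[of s] s t y0 by simp
    then show ?thesis using U[of s] s t by linarith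
  qed
  have "((\<lambda>s. c + \<gamma> * ln s + K * s powr \<rho>) \<longlongrightarrow> c + \<gamma> * ln t + K * t powr \<rho>) (at_right t)"
    using t by (intro tendsto_intros) auto
  then have "ln y \<le> c + \<gamma> * ln t + K * t powr \<rho>"
  proof (rule tendsto_lowerbound)
    show "\<forall>\<^sub>F s in at_right t. ln y \<le> c + \<gamma> * ln s + K * s powr \<rho>"
      unfolding eventually_at_right[OF less_add_one[of t]]
      by (intro exI[of _ "t + 1"]) (use up in auto)
  qed simp
  then have "\<bar>ln y - c - \<gamma> * ln t\<bar> \<le> K * t powr \<rho>"
    using lo U[OF t(1)] by linarith
  then show "\<bar>ln y - c + \<gamma> * ln (1 - F y)\<bar> \<le> K * (1 - F y) powr (- \<rho>)"
    using y by (simp add: t_def ln_div powr_divide powr_minus_divide)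
qed

section \<open>Order statistics\<close>

lemma length_filter_map_upt:
  "length (filter P (map x [1..<Suc n])) = card {i \<in> {1..n}. P (x i)}"
proof -
  have "length (filter P (map x [1..<Suc n])) = length (filter (P \<circ> x) [1..<Suc n])"
    by (simp add: filter_map)
  also have "\<dots> = card (set (filter (P \<circ> x) [1..<Suc n]))"
    by (rule distinct_card[symmetric]) simp
  also have "set (filter (P \<circ> x) [1..<Suc n]) = {i \<in> {1..n}. P (x i)}"
    by auto
  finally show ?thesis .
qed

lemma order_stat_le_iff:
  assumes "1 \<le> i" "i \<le> n"
  shows "order_stat x n i \<le> t \<longleftrightarrow> i \<le> card {l \<in> {1..n}. x l \<le> t}"
proof -
  define xs where "xs = sort (map x [1..<Suc n])"
  have len: "length xs = n" by (simp add: xs_def)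
  have "card {l \<in> {1..n}. x l \<le> t} = length (filter (\<lambda>y. y \<le> t) (map x [1..<Suc n]))"
    by (rule length_filter_map_upt[symmetric])
  also have "\<dots> = size (filter_mset (\<lambda>y. y \<le> t) (mset xs))"
    unfolding xs_def mset_sort by (metis mset_filter size_mset)
  also have "\<dots> = length (filter (\<lambda>y. y \<le> t) xs)"
    by (metis mset_filter size_mset)
  also have "\<dots> = card {l. l < n \<and> xs ! l \<le> t}"
    by (simp add: length_filter_conv_card len)
  finally have card: "card {l \<in> {1..n}. x l \<le> t} = card {l. l < n \<and> xs ! l \<le> t}" .
  have mono: "xs ! l \<le> xs ! l'" if "l \<le> l'" "l' < n" for l l'
    using that by (intro sorted_nth_mono) (auto simp: xs_def)
  show ?thesis
  proof
    assume "order_stat x n i \<le> t"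
    then have "xs ! (i - 1) \<le> t" by (simp add: order_stat_def xs_def)
    then have "{..<i} \<subseteq> {l. l < n \<and> xs ! l \<le> t}"
      using assms by (auto intro: order_trans[OF mono[of _ "i - 1"]])
    from card_mono[OF _ this] show "i \<le> card {l \<in> {1..n}. x l \<le> t}" unfolding card by simp
  next
    assume *: "i \<le> card {l \<in> {1..n}. x l \<le> t}"
    show "order_stat x n i \<le> t"
    proof (rule ccontr)
      assume "\<not> order_stat x n i \<le> t"
      then have "t < xs ! (i - 1)" by (simp add: order_stat_def xs_def)
      then have "{l. l < n \<and> xs ! l \<le> t} \<subseteq> {..<i - 1}"
        using mono[of "i - 1"] by (force simp: not_less[symmetric])
      from card_mono[OF _ this] * show False unfolding card using assms by simp
    qed
  qed
qed

text \<open>Translates the threshold order statistic into a number of exceedances, which is a sum of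
  independent indicators when the sample is random.\<close>

lemma order_stat_top_le_iff:
  assumes "1 \<le> k" "k < n"
  shows "order_stat x n (n - k) \<le> t \<longleftrightarrow> card {l \<in> {1..n}. t < x l} \<le> k"
proof -
  have "card {l \<in> {1..n}. x l \<le> t} + card {l \<in> {1..n}. t < x l} = card {1..n}"
  proof -
    have "{1..n} = {l \<in> {1..n}. x l \<le> t} \<union> {l \<in> {1..n}. t < x l}" by auto
    then show ?thesis by (metis (no_types, lifting) card_Un_disjoint disjoint_iff finite_Un finite_atLeastAtMost
          mem_Collect_eq not_less)
  qed
  then show ?thesis using assms by (subst order_stat_le_iff) auto
qed

lemma sum_order_stat:
  "(\<Sum>l\<in>{1..n}. f (x l)) = (\<Sum>i<n. f (order_stat x n (Suc i)))" for f :: "real \<Rightarrow> real"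
proof -
  define xs where "xs = sort (map x [1..<Suc n])"
  have len: "length xs = n" by (simp add: xs_def)
  have "(\<Sum>l\<in>{1..n}. f (x l)) = sum_list (map f (map x [1..<Suc n]))"
  proof -
    have "set [1..<Suc n] = {1..n}" by auto
    then show ?thesis using sum_list_distinct_conv_sum_set[of "[1..<Suc n]" "f \<circ> x"]
      by (simp add: comp_def del: upt_Suc)
  qed
  also have "\<dots> = sum_mset (image_mset f (mset xs))"
    unfolding xs_def mset_sort by (simp only: sum_mset_sum_list[symmetric] mset_map)
  also have "\<dots> = sum_list (map f xs)" by (simp only: sum_mset_sum_list[symmetric] mset_map)
  also have "\<dots> = (\<Sum>i<n. f (xs ! i))"
    by (simp add: sum_list_sum_nth len atLeast0LessThan)
  finally show ?thesis by (simp add: order_stat_def xs_def)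
qed

lemma order_stat_mono: "1 \<le> i \<Longrightarrow> i \<le> l \<Longrightarrow> l \<le> n \<Longrightarrow> order_stat x n i \<le> order_stat x n l"
  unfolding order_stat_def by (intro sorted_nth_mono) auto

lemma order_stat_in: "1 \<le> i \<Longrightarrow> i \<le> n \<Longrightarrow> order_stat x n i \<in> x ` {1..n}"
proof -
  assume "1 \<le> i" "i \<le> n"
  then have "order_stat x n i \<in> set (sort (map x [1..<Suc n]))"
    unfolding order_stat_def by (intro nth_mem) auto
  then show ?thesis by (auto simp: image_iff)
qed

text \<open>Monotonicity is asked on the sample values only. This matters for
  \<open>\<epsilon>\<close>: since \<open>ln 0 = 0\<close>, it would fall back to 0 at points where
  the tail probability vanishes.\<close>

lemma order_stat_comp:
  assumes g: "mono_on (x ` {1..n}) g" and i: "1 \<le> i" "i \<le> n"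
  shows "order_stat (\<lambda>l. g (x l)) n i = g (order_stat x n i)"
proof -
  have set: "set (sort (map x [1..<Suc n])) = x ` {1..n}" by auto
  have "sort (map (\<lambda>l. g (x l)) [1..<Suc n]) = map g (sort (map x [1..<Suc n]))"
  proof (rule properties_for_sort)
    show "mset (map g (sort (map x [1..<Suc n]))) = mset (map (\<lambda>l. g (x l)) [1..<Suc n])"
      by (simp add: multiset.map_comp comp_def)
    show "sorted (map g (sort (map x [1..<Suc n])))"
      unfolding sorted_iff_nth_mono
    proof safe
      fix a b assume ab: "a \<le> b" "b < length (map g (sort (map x [1..<Suc n])))"
      then have "sort (map x [1..<Suc n]) ! a \<le> sort (map x [1..<Suc n]) ! b"
        by (intro sorted_nth_mono) auto
      moreover have "sort (map x [1..<Suc n]) ! a \<in> x ` {1..n}" "sort (map x [1..<Suc n]) ! b \<in> x ` {1..n}"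
        using ab unfolding set[symmetric] by (auto intro!: nth_mem simp del: set_sort)
      ultimately show "map g (sort (map x [1..<Suc n])) ! a \<le> map g (sort (map x [1..<Suc n])) ! b"
        using ab mono_onD[OF g] by simp
    qed
  qed
  then show ?thesis using i by (simp add: order_stat_def)
qed

lemma borel_measurable_order_stat:
  assumes [measurable]: "\<And>i. i \<in> {1..n} \<Longrightarrow> x i \<in> borel_measurable M" and i: "1 \<le> i" "i \<le> n"
  shows "(\<lambda>\<xi>. order_stat (\<lambda>i. x i \<xi>) n i) \<in> borel_measurable M"
proof (rule borel_measurable_iff_le[THEN iffD2], safe)
  fix a :: real
  have "{\<xi> \<in> space M. order_stat (\<lambda>i. x i \<xi>) n i \<le> a} =
      {\<xi> \<in> space M. real i \<le> (\<Sum>l\<in>{1..n}. indicator {..a} (x l \<xi>))}"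
  proof -
    have "(\<Sum>l\<in>{1..n}. indicator {..a} (x l \<xi>)) = real (card {l \<in> {1..n}. x l \<xi> \<le> a})" for \<xi>
    proof -
      have "(\<Sum>l\<in>{1..n}. indicator {..a} (x l \<xi>)) = (\<Sum>l\<in>{1..n}. if x l \<xi> \<le> a then 1 else 0 :: real)"
        by (intro sum.cong) (auto simp: indicator_def)
      also have "\<dots> = real (card {l \<in> {1..n}. x l \<xi> \<le> a})"
        by (simp add: sum.If_cases Int_def)
      finally show ?thesis .
    qed
    then show ?thesis using order_stat_le_iff[OF i] by simp
  qed
  also have "\<dots> \<in> sets M" by measurable
  finally show "{\<xi> \<in> space M. order_stat (\<lambda>i. x i \<xi>) n i \<le> a} \<in> sets M" .
qed

text \<open>The sum of the \<open>k\<close> top excesses, shifted by \<open>k\<close> times its threshold, is the minimum of the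
  convex function \<open>t \<mapsto> (\<Sum>l. max 0 (x l - t)) + k t\<close>, so replacing the random threshold by a
  deterministic one is an error of second order.\<close>

lemma top_excess_threshold:
  fixes x :: "nat \<Rightarrow> real"
  assumes "1 \<le> k" "k < n"
  defines "T \<equiv> order_stat x n (n - k)"
  defines "S \<equiv> \<Sum>i=1..k. order_stat x n (n - i + 1) - T"
  shows "\<bar>(S + real k * (T - t)) - (\<Sum>l\<in>{1..n}. max 0 (x l - t))\<bar>
    \<le> \<bar>real (card {l \<in> {1..n}. t < x l}) - real k\<bar> * \<bar>T - t\<bar>"
proof -
  have top: "(\<Sum>i=1..k. g (order_stat x n (n - i + 1))) = (\<Sum>i\<in>{n - k..<n}. g (order_stat x n (Suc i)))" for g :: "real \<Rightarrow> real"
    using assms(1,2) by (intro sum.reindex_bij_witness[of _ "\<lambda>i. n - i" "\<lambda>i. n - i"]) auto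
  have split: "(\<Sum>l\<in>{1..n}. g (x l)) = (\<Sum>i<n - k. g (order_stat x n (Suc i))) + (\<Sum>i=1..k. g (order_stat x n (n - i + 1)))" for g :: "real \<Rightarrow> real"
  proof -
    have "{..<n} = {..<n - k} \<union> {n - k..<n}" using assms(1,2) by auto
    then show ?thesis unfolding sum_order_stat top
      by (simp only:) (rule sum.union_disjoint, simp, simp, simp add: ivl_disj_int)
  qed
  have "(\<Sum>i=1..k. max 0 (order_stat x n (n - i + 1) - T)) = S"
    unfolding S_def
  proof (intro sum.cong refl)
    fix i assume "i \<in> {1..k}"
    then have "T \<le> order_stat x n (n - i + 1)"
      unfolding T_def using assms(1,2) by (intro order_stat_mono) auto
    then show "max 0 (order_stat x n (n - i + 1) - T) = order_stat x n (n - i + 1) - T" by simp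
  qed
  moreover have "(\<Sum>i<n - k. max 0 (order_stat x n (Suc i) - T)) = 0"
  proof (intro sum.neutral ballI)
    fix i assume "i \<in> {..<n - k}"
    then have "order_stat x n (Suc i) \<le> T"
      unfolding T_def using assms(1,2) by (intro order_stat_mono) auto
    then show "max 0 (order_stat x n (Suc i) - T) = 0" by simp
  qed
  ultimately have HT: "(\<Sum>l\<in>{1..n}. max 0 (x l - T)) = S"
    using split[of "\<lambda>y. max 0 (y - T)"] by simp
  have upper: "S + real k * (T - t) \<le> (\<Sum>l\<in>{1..n}. max 0 (x l - t))"
  proof -
    have "S + real k * (T - t) = (\<Sum>i=1..k. order_stat x n (n - i + 1) - t)"
      by (simp add: S_def sum_subtractf algebra_simps)
    also have "\<dots> \<le> (\<Sum>i=1..k. max 0 (order_stat x n (n - i + 1) - t))" by (intro sum_mono) simp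
    also have "\<dots> \<le> (\<Sum>l\<in>{1..n}. max 0 (x l - t))"
      unfolding split[of "\<lambda>y. max 0 (y - t)"] by (simp add: sum_nonneg)
    finally show ?thesis .
  qed
  \<comment> \<open>Termwise convexity: as a function of the threshold, each positive part lies
    above its tangent at \<open>t\<close>, evaluated here at \<open>T\<close>.\<close>
  have "(\<Sum>l\<in>{1..n}. max 0 (x l - t)) - real (card {l \<in> {1..n}. t < x l}) * (T - t) =
      (\<Sum>l\<in>{1..n}. max 0 (x l - t) - (if t < x l then T - t else 0))"
    by (simp add: sum_subtractf sum.If_cases Int_def)
  also have "\<dots> \<le> (\<Sum>l\<in>{1..n}. max 0 (x l - T))"
    by (intro sum_mono) (auto simp: max_def)
  finally have lower: "(\<Sum>l\<in>{1..n}. max 0 (x l - t)) - real (card {l \<in> {1..n}. t < x l}) * (T - t) \<le> S"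
    unfolding HT .
  have "- ((S + real k * (T - t)) - (\<Sum>l\<in>{1..n}. max 0 (x l - t))) \<le>
      (real (card {l \<in> {1..n}. t < x l}) - real k) * (T - t)"
    using lower by (simp add: algebra_simps)
  also have "\<dots> \<le> \<bar>real (card {l \<in> {1..n}. t < x l}) - real k\<bar> * \<bar>T - t\<bar>"
    unfolding abs_mult[symmetric] by (rule abs_ge_self)
  finally show ?thesis using upper by linarith
qed

text \<open>The influence function of the Hill estimator at a fixed threshold. It is centred for
  standard exponential \<open>x\<close>: by memorylessness the mean excess over \<open>t\<close> is
  1, which the indicator subtracts.\<close>

definition hill_score :: "real \<Rightarrow> real \<Rightarrow> real" where
  "hill_score t x = max 0 (x - t) - (if t < x then 1 else 0)"

lemma borel_measurable_hill_score[measurable]: "hill_score t \<in> borel_measurable borel"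
  unfolding hill_score_def[abs_def] by measurable

lemma has_bochner_integral_power_exp:
  "has_bochner_integral lborel (\<lambda>x. x ^ p * exp (- x) * indicator {0::real..} x) (fact p)"
proof (rule has_bochner_integral_nn_integral)
  have "(\<integral>\<^sup>+ x. ennreal (x ^ p * exp (- x) * indicator {0..} x) \<partial>lborel) =
      (\<integral>\<^sup>+ x. ennreal (x ^ p * exp (- x)) * indicator {0..} x \<partial>lborel)"
    by (intro nn_integral_cong) (auto simp: indicator_def)
  then show "(\<integral>\<^sup>+ x. ennreal (x ^ p * exp (- x) * indicator {0..} x) \<partial>lborel) = ennreal (fact p)"
    by (simp add: nn_intergal_power_times_exp_Ici)
qed (auto simp: indicator_def)

context prob_space begin

text \<open>Memorylessness: the density factors beyond \<open>t\<close>, so the excess is again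
  standard exponential, with total mass \<open>exp (- t)\<close>.\<close>

lemma exponential_memoryless_integral:
  fixes h :: "real \<Rightarrow> real"
  assumes e: "distributed M lborel e (exponential_density 1)" and t: "0 \<le> t"
    and [measurable]: "h \<in> borel_measurable borel"
    and I: "has_bochner_integral lborel (\<lambda>u. h u * exp (- u) * indicator {0..} u) I"
  shows "has_bochner_integral M (\<lambda>\<xi>. indicator {t<..} (e \<xi>) * h (e \<xi> - t)) (exp (- t) * I)"
proof -
  define g where "g x = indicator {t<..} x * h (x - t)" for x
  have [measurable]: "g \<in> borel_measurable lborel" unfolding g_def[abs_def] by measurable
  have "has_bochner_integral lborel (\<lambda>x. h (x - t) * exp (- (x - t)) * indicator {0..} (x - t)) I"
    using lborel_has_bochner_integral_real_affine_iff[of 1 "\<lambda>u. h u * exp (- u) * indicator {0..} u" I "- t"] I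
    by simp
  then have "has_bochner_integral lborel (\<lambda>x. exp (- t) * (h (x - t) * exp (- (x - t)) * indicator {0..} (x - t))) (exp (- t) * I)"
    by (rule has_bochner_integral_mult_right)
  then have 1: "has_bochner_integral lborel (\<lambda>x. exponential_density 1 x * g x) (exp (- t) * I)"
  proof (rule has_bochner_integral_cong_AE[THEN iffD1, rotated -1])
    show "AE x in lborel. exp (- t) * (h (x - t) * exp (- (x - t)) * indicator {0..} (x - t)) =
        exponential_density 1 x * g x"
      using AE_lborel_singleton[of t]
      by eventually_elim
        (use t in \<open>auto simp: exponential_density_def g_def indicator_def exp_add[symmetric]\<close>)
  qed measurable
  have "integrable M (\<lambda>\<xi>. g (e \<xi>))"
    using distributed_integrable[OF e, of g] 1
    by (auto simp: exponential_density_nonneg has_bochner_integral_iff)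
  moreover have "expectation (\<lambda>\<xi>. g (e \<xi>)) = exp (- t) * I"
    using distributed_integral[OF e, of g] 1
    by (auto simp: exponential_density_nonneg has_bochner_integral_iff)
  ultimately show ?thesis by (simp add: g_def has_bochner_integral_iff)
qed

lemma exponential_excess_moments:
  assumes e: "distributed M lborel e (exponential_density 1)" and t: "0 \<le> t"
  shows "has_bochner_integral M (\<lambda>\<xi>. indicator {t<..} (e \<xi>) * (e \<xi> - t) ^ p) (exp (- t) * fact p)"
  by (rule exponential_memoryless_integral[OF e t _ has_bochner_integral_power_exp]) simp

lemma hill_score_moments:
  assumes e: "distributed M lborel e (exponential_density 1)" and t: "0 \<le> t"
  shows "has_bochner_integral M (\<lambda>\<xi>. hill_score t (e \<xi>)) 0"
    and "has_bochner_integral M (\<lambda>\<xi>. (hill_score t (e \<xi>))\<^sup>2) (exp (- t))"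
    and "integrable M (\<lambda>\<xi>. \<bar>hill_score t (e \<xi>)\<bar> ^ 3)"
    and "expectation (\<lambda>\<xi>. \<bar>hill_score t (e \<xi>)\<bar> ^ 3) \<le> 16 * exp (- t)"
    and "has_bochner_integral M (\<lambda>\<xi>. indicator {t<..} (e \<xi>) :: real) (exp (- t))"
proof -
  have [measurable]: "e \<in> borel_measurable M" using e by (auto dest: distributed_measurable)
  define m where "m p \<xi> = indicator {t<..} (e \<xi>) * (e \<xi> - t) ^ p" for p \<xi>
  have m: "has_bochner_integral M (m p) (exp (- t) * fact p)" for p
    unfolding m_def[abs_def] by (rule exponential_excess_moments[OF e t])
  have h1: "hill_score t (e \<xi>) = m 1 \<xi> - m 0 \<xi>" for \<xi>
    by (simp add: hill_score_def m_def indicator_def)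
  show "has_bochner_integral M (\<lambda>\<xi>. hill_score t (e \<xi>)) 0"
    unfolding h1 using has_bochner_integral_diff[OF m[of 1] m[of 0]] by simp
  have h2: "(hill_score t (e \<xi>))\<^sup>2 = m 2 \<xi> - 2 * m 1 \<xi> + m 0 \<xi>" for \<xi>
    by (simp add: hill_score_def m_def indicator_def power2_eq_square algebra_simps)
  have "has_bochner_integral M (\<lambda>\<xi>. m 2 \<xi> - 2 * m 1 \<xi> + m 0 \<xi>)
      (exp (- t) * fact 2 - 2 * (exp (- t) * fact 1) + exp (- t) * fact 0)"
    by (intro has_bochner_integral_add has_bochner_integral_diff has_bochner_integral_mult_right m)
  then show "has_bochner_integral M (\<lambda>\<xi>. (hill_score t (e \<xi>))\<^sup>2) (exp (- t))"
    unfolding h2 by (simp add: fact_numeral)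
  \<comment> \<open>The crude bound \<open>(u + 1) ^ 3\<close> on the excess \<open>u\<close> has
    exponential moment 6 + 3 * 2 + 3 + 1 = 16, which is the constant in the statement.\<close>
  have h3: "\<bar>hill_score t (e \<xi>)\<bar> ^ 3 \<le> m 3 \<xi> + 3 * m 2 \<xi> + 3 * m 1 \<xi> + m 0 \<xi>" for \<xi>
  proof (cases "t < e \<xi>")
    case True
    then have "\<bar>hill_score t (e \<xi>)\<bar> ^ 3 \<le> ((e \<xi> - t) + 1) ^ 3"
      by (intro power_mono) (auto simp: hill_score_def)
    also have "\<dots> = m 3 \<xi> + 3 * m 2 \<xi> + 3 * m 1 \<xi> + m 0 \<xi>"
      using True by (simp add: m_def power3_eq_cube power2_eq_square algebra_simps)
    finally show ?thesis .
  qed (auto simp: hill_score_def m_def)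
  have i3: "has_bochner_integral M (\<lambda>\<xi>. m 3 \<xi> + 3 * m 2 \<xi> + 3 * m 1 \<xi> + m 0 \<xi>)
      (exp (- t) * fact 3 + 3 * (exp (- t) * fact 2) + 3 * (exp (- t) * fact 1) + exp (- t) * fact 0)"
    by (intro has_bochner_integral_add has_bochner_integral_mult_right m)
  show i: "integrable M (\<lambda>\<xi>. \<bar>hill_score t (e \<xi>)\<bar> ^ 3)"
  proof (rule Bochner_Integration.integrable_bound[OF integrable.intros[OF i3]])
    show "AE \<xi> in M. norm (\<bar>hill_score t (e \<xi>)\<bar> ^ 3) \<le> norm (m 3 \<xi> + 3 * m 2 \<xi> + 3 * m 1 \<xi> + m 0 \<xi>)"
      using order_trans[OF h3 abs_ge_self] by simp
  qed measurable
  have "expectation (\<lambda>\<xi>. \<bar>hill_score t (e \<xi>)\<bar> ^ 3) \<le> expectation (\<lambda>\<xi>. m 3 \<xi> + 3 * m 2 \<xi> + 3 * m 1 \<xi> + m 0 \<xi>)"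
    using i integrable.intros[OF i3] h3 by (intro integral_mono) auto
  also have "\<dots> = 16 * exp (- t)"
    using has_bochner_integral_integral_eq[OF i3] by (simp add: fact_numeral)
  finally show "expectation (\<lambda>\<xi>. \<bar>hill_score t (e \<xi>)\<bar> ^ 3) \<le> 16 * exp (- t)" .
  show "has_bochner_integral M (\<lambda>\<xi>. indicator {t<..} (e \<xi>) :: real) (exp (- t))"
    using m[of 0] by (simp add: m_def[abs_def])
qed

end

section \<open>Intermediate order statistics of an exponential sample\<close>

locale exponential_sample = prob_space +
  fixes e :: "nat \<Rightarrow> 'a \<Rightarrow> real" and n k :: "nat \<Rightarrow> nat"
  assumes indep: "indep_vars (\<lambda>_. borel) e {1..}"
    and dist: "\<And>i. 1 \<le> i \<Longrightarrow> distributed M lborel (e i) (exponential_density 1)"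
    and n_top: "filterlim n at_top sequentially"
    and k_top: "filterlim k at_top sequentially"
    and k_n: "(\<lambda>N. real (k N) / real (n N)) \<longlonglongrightarrow> 0"
begin

text \<open>The quantile of order \<open>1 - k / n\<close> of the standard exponential law: the
  expected number of exceedances is exactly \<open>k\<close>.\<close>

definition t where "t N = ln (real (n N) / real (k N))"
definition T where "T N \<xi> = order_stat (\<lambda>i. e i \<xi>) (n N) (n N - k N)"
definition count where "count N s \<xi> = real (card {l \<in> {1..n N}. t N + s / sqrt (real (k N)) < e l \<xi>})"
definition score where
  "score N \<xi> = (\<Sum>i\<in>{1..n N}. hill_score (t N) (e i \<xi>)) / sqrt (real (k N))"

lemma e_measurable: "1 \<le> i \<Longrightarrow> e i \<in> borel_measurable M"
  using dist[of i] by (auto dest: distributed_measurable)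

lemma eventually_kn: "\<forall>\<^sub>F N in sequentially. 1 \<le> k N \<and> k N < n N"
proof -
  have "\<forall>\<^sub>F N in sequentially. real (k N) / real (n N) < 1"
    using order_tendstoD(2)[OF k_n] by simp
  moreover have "\<forall>\<^sub>F N in sequentially. 1 \<le> k N" "\<forall>\<^sub>F N in sequentially. 1 \<le> n N"
    using k_top n_top by (auto simp: filterlim_at_top)
  ultimately show ?thesis by eventually_elim (simp add: field_simps)
qed

lemma sqrt_k_top: "filterlim (\<lambda>N. sqrt (real (k N))) at_top sequentially"
  by (rule filterlim_compose[OF sqrt_at_top filterlim_compose[OF filterlim_real_sequentially k_top]])

lemma n_over_k_top: "filterlim (\<lambda>N. real (n N) / real (k N)) at_top sequentially"
proof -
  have "filterlim (\<lambda>N. inverse (real (k N) / real (n N))) at_top sequentially"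
    by (rule filterlim_inverse_at_top[OF k_n]) (use eventually_kn in eventually_elim, simp)
  then show ?thesis by simp
qed

lemma t_top: "filterlim t at_top sequentially"
  unfolding t_def[abs_def] by (rule filterlim_compose[OF ln_at_top n_over_k_top])

lemma exp_t: "1 \<le> k N \<and> k N < n N \<Longrightarrow> exp (- t N) = real (k N) / real (n N)"
  by (simp add: t_def exp_minus)

lemma prob_greater:
  assumes "1 \<le> i" "0 \<le> s"
  shows "has_bochner_integral M (\<lambda>\<xi>. indicator {s<..} (e i \<xi>) :: real) (exp (- s))"
  by (rule hill_score_moments(5)[OF dist[OF assms(1)] assms(2)])

lemma indep_sum: "indep_vars (\<lambda>_. borel) e {1..n N}"
  by (rule indep_vars_subset[OF indep]) auto

lemma count_eq: "count N s \<xi> = (\<Sum>i\<in>{1..n N}. indicator {t N + s / sqrt (real (k N))<..} (e i \<xi>))"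
  by (simp add: count_def indicator_def sum.If_cases Int_def)

text \<open>Moving the threshold by \<open>s / sqrt k\<close> changes about
  \<open>s * sqrt k\<close> of the exceedances. After division by \<open>sqrt k\<close> the mean
  tends to \<open>- s\<close>, while the variance vanishes because the two indicators differ only on
  a thin strip.\<close>

lemma count_increment:
  "((\<lambda>z. (count (fst z) s (snd z) - count (fst z) 0 (snd z)) / sqrt (real (k (fst z)))) \<longlongrightarrow> - s) high_prob"
proof -
  define u where "u N = t N + s / sqrt (real (k N))" for N
  define X where "X N i \<xi> = (indicator {u N<..} (e i \<xi>) - indicator {t N<..} (e i \<xi>)) / sqrt (real (k N))"
    for N i \<xi>
  have indX: "indep_vars (\<lambda>_. borel) (X N) {1..n N}" for N
    unfolding X_def[abs_def]
    by (rule indep_vars_compose2[OF indep_sum, where Y = "\<lambda>i x. (indicator {u N<..} x - indicator {t N<..} x) / sqrt (real (k N))"])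
      measurable
  have [measurable]: "i \<in> {1..n N} \<Longrightarrow> X N i \<in> borel_measurable M" for N i
    using indX[of N] by (auto simp: indep_vars_def)
  have X2: "integrable M (\<lambda>\<xi>. (X N i \<xi>)\<^sup>2)" if "i \<in> {1..n N}" for N i
  proof (rule integrable_const_bound)
    show "AE \<xi> in M. norm ((X N i \<xi>)\<^sup>2) \<le> 1 / real (k N)"
      by (auto simp: X_def indicator_def power_divide)
  qed (use that in measurable)
  have lim_s: "(\<lambda>N. s / sqrt (real (k N))) \<longlonglongrightarrow> 0"
    by (rule real_tendsto_divide_at_top[OF tendsto_const sqrt_k_top])
  have ev_u: "\<forall>\<^sub>F N in sequentially. 0 \<le> u N \<and> 0 \<le> t N"
  proof -
    have "\<forall>\<^sub>F N in sequentially. 1 \<le> t N" using t_top by (simp add: filterlim_at_top)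
    moreover have "\<forall>\<^sub>F N in sequentially. - 1 < s / sqrt (real (k N))"
      using order_tendstoD(1)[OF lim_s] by simp
    ultimately show ?thesis by eventually_elim (simp add: u_def)
  qed
  define m where "m N = (\<Sum>i\<in>{1..n N}. expectation (X N i))" for N
  define Z where "Z N \<xi> = (\<Sum>i\<in>{1..n N}. X N i \<xi>) - m N" for N \<xi>
  have ev: "\<forall>\<^sub>F N in sequentially. m N = sqrt (real (k N)) * (exp (- (s / sqrt (real (k N)))) - 1) \<and>
      (\<Sum>i\<in>{1..n N}. expectation (\<lambda>\<xi>. (X N i \<xi>)\<^sup>2)) = \<bar>exp (- (s / sqrt (real (k N)))) - 1\<bar>"
    using ev_u eventually_kn
  proof eventually_elim
    case (elim N)
    have k: "0 < real (k N)" "0 < real (n N)" using elim by auto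
    have eu: "exp (- u N) = real (k N) / real (n N) * exp (- (s / sqrt (real (k N))))"
      unfolding exp_t[OF elim(2), symmetric] u_def by (simp add: exp_add[symmetric])
    have iu: "has_bochner_integral M (\<lambda>\<xi>. indicator {u N<..} (e i \<xi>) - indicator {t N<..} (e i \<xi>) :: real)
        (real (k N) / real (n N) * (exp (- (s / sqrt (real (k N)))) - 1))" if "i \<in> {1..n N}" for i
      using has_bochner_integral_diff[OF prob_greater[of i "u N"] prob_greater[of i "t N"]] that elim
      unfolding eu exp_t[OF elim(2)] by (simp add: algebra_simps)
    have E1: "expectation (X N i) = real (k N) / real (n N) * (exp (- (s / sqrt (real (k N)))) - 1) / sqrt (real (k N))"
      if "i \<in> {1..n N}" for i
      using has_bochner_integral_integral_eq[OF iu[OF that]] by (simp add: X_def[abs_def])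
    have "m N = real (n N) * (real (k N) / real (n N) * (exp (- (s / sqrt (real (k N)))) - 1) / sqrt (real (k N)))"
      unfolding m_def using E1 by simp
    also have "\<dots> = (real (k N) / sqrt (real (k N))) * (exp (- (s / sqrt (real (k N)))) - 1)"
      using k by simp
    finally have 1: "m N = sqrt (real (k N)) * (exp (- (s / sqrt (real (k N)))) - 1)"
      using k by (simp add: real_div_sqrt)
    have E2: "expectation (\<lambda>\<xi>. (X N i \<xi>)\<^sup>2) = \<bar>exp (- (s / sqrt (real (k N)))) - 1\<bar> / real (n N)"
      if i: "i \<in> {1..n N}" for i
    proof -
      \<comment> \<open>The half-lines are nested, so the difference of the indicators has the
        constant sign \<open>\<sigma>\<close> and its square is its absolute value.\<close>
      define \<sigma> :: real where "\<sigma> = (if u N \<le> t N then 1 else - 1)"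
      have sq: "(X N i \<xi>)\<^sup>2 = \<sigma> * (indicator {u N<..} (e i \<xi>) - indicator {t N<..} (e i \<xi>)) / real (k N)" for \<xi>
        by (auto simp: X_def \<sigma>_def indicator_def power_divide)
      have \<sigma>: "\<sigma> * (exp (- (s / sqrt (real (k N)))) - 1) = \<bar>exp (- (s / sqrt (real (k N)))) - 1\<bar>"
        using k by (auto simp: \<sigma>_def u_def divide_le_0_iff zero_less_divide_iff zero_le_divide_iff not_le)
      have "expectation (\<lambda>\<xi>. (X N i \<xi>)\<^sup>2) =
          \<sigma> * (real (k N) / real (n N) * (exp (- (s / sqrt (real (k N)))) - 1)) / real (k N)"
        unfolding sq using has_bochner_integral_integral_eq[OF iu[OF i]] by simp
      also have "\<dots> = \<sigma> * (exp (- (s / sqrt (real (k N)))) - 1) / real (n N)" using k by simp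
      finally show ?thesis unfolding \<sigma> .
    qed
    show ?case using 1 E2 k by simp
  qed
  have lim_exp: "(\<lambda>N. exp (- (s / sqrt (real (k N)))) - 1) \<longlonglongrightarrow> 0"
    using tendsto_diff[OF tendsto_exp[OF tendsto_minus[OF lim_s]] tendsto_const, of 1] by simp
  have Z0: "((\<lambda>z. Z (fst z) (snd z)) \<longlongrightarrow> 0) high_prob"
    unfolding Z_def m_def
  proof (rule centred_sum_tendsto_0[OF indX X2])
    have "(\<lambda>N. \<bar>exp (- (s / sqrt (real (k N)))) - 1\<bar>) \<longlonglongrightarrow> 0"
      using tendsto_rabs[OF lim_exp] by simp
    then show "(\<lambda>N. \<Sum>i\<in>{1..n N}. expectation (\<lambda>\<xi>. (X N i \<xi>)\<^sup>2)) \<longlonglongrightarrow> 0"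
      by (rule Lim_transform_eventually) (use ev in eventually_elim, simp)
  qed
  have mlim: "m \<longlonglongrightarrow> - s"
  proof (rule Lim_transform_eventually)
    \<comment> \<open>The mean is a difference quotient of \<open>exp (- s * x)\<close> at 0 with
      increment \<open>1 / sqrt k\<close>.\<close>
    have "((\<lambda>x. (exp (- s * x) - 1) / x) \<longlongrightarrow> - s) (at_right 0)"
    proof -
      have "((\<lambda>x. exp (- s * x)) has_real_derivative - s) (at 0)"
        by (auto intro!: derivative_eq_intros)
      then have "((\<lambda>x. (exp (- s * x) - 1) / x) \<longlongrightarrow> - s) (at 0)"
        by (simp add: has_field_derivative_iff)
      then show ?thesis by (rule filterlim_mono) (auto simp: at_le)
    qed
    moreover have "filterlim (\<lambda>N. 1 / sqrt (real (k N))) (at_right 0) sequentially"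
      unfolding filterlim_at
    proof
      show "(\<lambda>N. 1 / sqrt (real (k N))) \<longlonglongrightarrow> 0"
        by (rule real_tendsto_divide_at_top[OF tendsto_const sqrt_k_top])
      show "\<forall>\<^sub>F N in sequentially. 1 / sqrt (real (k N)) \<in> {0<..} \<and> 1 / sqrt (real (k N)) \<noteq> 0"
        using eventually_kn by eventually_elim simp
    qed
    ultimately show "(\<lambda>N. (exp (- s * (1 / sqrt (real (k N)))) - 1) / (1 / sqrt (real (k N)))) \<longlonglongrightarrow> - s"
      by (rule filterlim_compose)
    show "\<forall>\<^sub>F N in sequentially. (exp (- s * (1 / sqrt (real (k N)))) - 1) / (1 / sqrt (real (k N))) = m N"
      using ev by eventually_elim (simp add: mult.commute)
  qed
  have "((\<lambda>z. Z (fst z) (snd z) + m (fst z)) \<longlongrightarrow> 0 + - s) high_prob"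
    by (intro tendsto_add Z0 filterlim_fst[OF mlim])
  moreover have "Z N \<xi> + m N = (count N s \<xi> - count N 0 \<xi>) / sqrt (real (k N))" for N \<xi>
    by (simp add: Z_def X_def count_eq u_def sum_divide_distrib[symmetric] sum_subtractf)
  ultimately show ?thesis by simp
qed

section \<open>Bahadur representation and the Hill score\<close>

definition Z where "Z N \<xi> = (count N 0 \<xi> - real (k N)) / sqrt (real (k N))"

lemma tight_Z: "tight (\<lambda>z. Z (fst z) (snd z))"
proof -
  define X where "X N i \<xi> = indicator {t N<..} (e i \<xi>) / sqrt (real (k N))" for N i \<xi>
  have indX: "indep_vars (\<lambda>_. borel) (X N) {1..n N}" for N
    unfolding X_def[abs_def]
    by (rule indep_vars_compose2[OF indep_sum, where Y = "\<lambda>i x. indicator {t N<..} x / sqrt (real (k N))"])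
      measurable
  have [measurable]: "i \<in> {1..n N} \<Longrightarrow> X N i \<in> borel_measurable M" for N i
    using indX[of N] by (auto simp: indep_vars_def)
  have X2: "integrable M (\<lambda>\<xi>. (X N i \<xi>)\<^sup>2)" if "i \<in> {1..n N}" for N i
  proof (rule integrable_const_bound)
    show "AE \<xi> in M. norm ((X N i \<xi>)\<^sup>2) \<le> 1 / real (k N)"
      by (auto simp: X_def indicator_def power_divide)
  qed (use that in measurable)
  define m where "m N = (\<Sum>i\<in>{1..n N}. expectation (X N i))" for N
  define W where "W N \<xi> = (\<Sum>i\<in>{1..n N}. X N i \<xi>) - m N" for N \<xi>
  have "\<forall>\<^sub>F N in sequentially. 0 \<le> t N" using t_top by (simp add: filterlim_at_top)
  then have ev: "\<forall>\<^sub>F N in sequentially. m N = sqrt (real (k N)) \<and>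
      (\<Sum>i\<in>{1..n N}. expectation (\<lambda>\<xi>. (X N i \<xi>)\<^sup>2)) = 1 \<and> 1 \<le> k N"
    using eventually_kn
  proof eventually_elim
    case (elim N)
    have k: "0 < real (k N)" "0 < real (n N)" using elim by auto
    have iu: "has_bochner_integral M (\<lambda>\<xi>. indicator {t N<..} (e i \<xi>) :: real) (real (k N) / real (n N))"
      if "i \<in> {1..n N}" for i
      using prob_greater[of i "t N"] that elim unfolding exp_t[OF elim(2)] by simp
    have E1: "expectation (X N i) = real (k N) / real (n N) / sqrt (real (k N))" if "i \<in> {1..n N}" for i
      using has_bochner_integral_integral_eq[OF iu[OF that]] by (simp add: X_def[abs_def])
    have sq: "(X N i \<xi>)\<^sup>2 = indicator {t N<..} (e i \<xi>) / real (k N)" for i \<xi>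
      by (auto simp: X_def indicator_def power_divide)
    have E2: "expectation (\<lambda>\<xi>. (X N i \<xi>)\<^sup>2) = 1 / real (n N)" if "i \<in> {1..n N}" for i
      unfolding sq using has_bochner_integral_integral_eq[OF iu[OF that]] k by simp
    have "m N = real (k N) / sqrt (real (k N))" using E1 k by (simp add: m_def)
    then show ?case using E2 k elim by (simp add: real_div_sqrt)
  qed
  have le1: "\<forall>\<^sub>F N in sequentially. (\<Sum>i\<in>{1..n N}. expectation (\<lambda>\<xi>. (X N i \<xi>)\<^sup>2)) \<le> 1"
    using ev by eventually_elim simp
  have "tight (\<lambda>z. W (fst z) (snd z))"
    unfolding W_def m_def
    by (rule centred_sum_tight[OF indX X2 le1])
  then show ?thesis
  proof (rule tight_mono)
    show "\<forall>\<^sub>F z in high_prob. norm (Z (fst z) (snd z)) \<le> norm (W (fst z) (snd z))"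
      using eventually_fst_high_prob[OF ev]
    proof eventually_elim
      case (elim z)
      have "Z (fst z) (snd z) = W (fst z) (snd z)"
        using elim by (simp add: Z_def W_def X_def count_eq sum_divide_distrib[symmetric] diff_divide_distrib real_div_sqrt)
      then show ?case by simp
    qed
  qed
qed

text \<open>The event \<open>T \<le> t + s / sqrt k\<close> says that at most \<open>k\<close>
  points exceed that level. With \<open>Z\<close> bounded, finitely many values of \<open>s\<close>
  suffice to locate \<open>T\<close>, so \<open>count_increment\<close> is applied on a finite grid
  and no uniformity in \<open>s\<close> is required of it.\<close>

lemma bahadur:
  "((\<lambda>z. sqrt (real (k (fst z))) * (T (fst z) (snd z) - t (fst z)) - Z (fst z) (snd z)) \<longlongrightarrow> 0) high_prob"
proof (rule tendstoI)
  fix \<epsilon> :: real assume \<epsilon>: "0 < \<epsilon>"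
  \<comment> \<open>Rounding to the grid and the grid error cost one mesh width each, and
    \<open>2 * h < \<epsilon>\<close>.\<close>
  define h where "h = \<epsilon> / 3"
  have h: "0 < h" using \<epsilon> by (simp add: h_def)
  show "\<forall>\<^sub>F z in high_prob. dist (sqrt (real (k (fst z))) * (T (fst z) (snd z) - t (fst z)) - Z (fst z) (snd z)) 0 < \<epsilon>"
  proof (rule tight_cases[OF tight_Z])
    fix B :: real
    \<comment> \<open>The grid covers \<open>|s| \<le> |B|\<close>; the extra 3 makes room for the
      indices two beyond the rounded position of \<open>Z\<close>.\<close>
    define J where "J = \<lceil>\<bar>B\<bar> / h\<rceil> + 3"
    have grid: "\<forall>\<^sub>F z in high_prob. \<forall>j\<in>{- J..J}.
        \<bar>(count (fst z) (of_int j * h) (snd z) - count (fst z) 0 (snd z)) / sqrt (real (k (fst z))) + of_int j * h\<bar> < h"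
    proof (rule eventually_ball_finite)
      show "\<forall>j\<in>{- J..J}. \<forall>\<^sub>F z in high_prob.
        \<bar>(count (fst z) (of_int j * h) (snd z) - count (fst z) 0 (snd z)) / sqrt (real (k (fst z))) + of_int j * h\<bar> < h"
        using tendstoD[OF count_increment h] by (simp add: dist_real_def)
    qed simp
    show "\<forall>\<^sub>F z in high_prob. norm (Z (fst z) (snd z)) \<le> B \<longrightarrow>
        dist (sqrt (real (k (fst z))) * (T (fst z) (snd z) - t (fst z)) - Z (fst z) (snd z)) 0 < \<epsilon>"
      using grid eventually_fst_high_prob[OF eventually_kn]
    proof (eventually_elim, safe)
      fix N :: nat and \<xi>
      assume "\<forall>j\<in>{- J..J}. \<bar>(count (fst (N, \<xi>)) (of_int j * h) (snd (N, \<xi>)) - count (fst (N, \<xi>)) 0 (snd (N, \<xi>))) /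
          sqrt (real (k (fst (N, \<xi>)))) + of_int j * h\<bar> < h"
        and "norm (Z (fst (N, \<xi>)) (snd (N, \<xi>))) \<le> B" and "1 \<le> k (fst (N, \<xi>))" "k (fst (N, \<xi>)) < n (fst (N, \<xi>))"
      then have near: "\<And>j. j \<in> {- J..J} \<Longrightarrow> \<bar>(count N (of_int j * h) \<xi> - count N 0 \<xi>) / sqrt (real (k N)) + of_int j * h\<bar> < h"
        and B: "\<bar>Z N \<xi>\<bar> \<le> B" and kn: "1 \<le> k N" "k N < n N" by auto
      define r where "r = sqrt (real (k N))"
      have r: "0 < r" using kn by (simp add: r_def)
      define a where "a = Z N \<xi> / h"
      have ah: "a * h = Z N \<xi>" using h by (simp add: a_def)
      have "\<bar>a\<bar> \<le> \<bar>B\<bar> / h" using B h by (simp add: a_def abs_divide divide_right_mono)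
      then have aJ: "\<bar>a\<bar> \<le> of_int J - 3" unfolding J_def by linarith
      have T_iff: "T N \<xi> \<le> t N + s / r \<longleftrightarrow> count N s \<xi> \<le> real (k N)" for s
        unfolding T_def count_def r_def using order_stat_top_le_iff[OF kn] by simp
      have cZ: "(count N s \<xi> - real (k N)) / r = (count N s \<xi> - count N 0 \<xi>) / r + Z N \<xi>" for s
        by (simp add: Z_def r_def diff_divide_distrib)
      have up: "r * (T N \<xi> - t N) \<le> Z N \<xi> + 2 * h"
      proof -
        \<comment> \<open>More than one mesh width above \<open>Z\<close>: the increment is below
          \<open>- j * h + h\<close>, so the count has already dropped below \<open>k\<close> at
          this level.\<close>
        define j where "j = \<lfloor>a\<rfloor> + 2"
        have j: "a + 1 < of_int j" "of_int j \<le> a + 2" unfolding j_def by linarith+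
        have "j \<in> {- J..J}" using j aJ unfolding atLeastAtMost_iff by linarith
        moreover have "(a + 1) * h < of_int j * h" "of_int j * h \<le> (a + 2) * h"
          using j h by auto
        ultimately have "(count N (of_int j * h) \<xi> - real (k N)) / r < 0" and jh: "of_int j * h \<le> Z N \<xi> + 2 * h"
          unfolding cZ using near[of j] ah by (auto simp: r_def algebra_simps)
        then have "count N (of_int j * h) \<xi> \<le> real (k N)" using r by (simp add: divide_less_0_iff)
        then have "T N \<xi> - t N \<le> of_int j * h / r" using T_iff[of "of_int j * h"] by simp
        then have "r * (T N \<xi> - t N) \<le> of_int j * h" using r by (simp add: field_simps)
        then show ?thesis using jh by simp
      qed
      have lo: "Z N \<xi> - 2 * h \<le> r * (T N \<xi> - t N)"
      proof -
        define j where "j = \<lceil>a\<rceil> - 2"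
        have j: "a - 2 \<le> of_int j" "of_int j < a - 1" unfolding j_def by linarith+
        have "j \<in> {- J..J}" using j aJ unfolding atLeastAtMost_iff by linarith
        moreover have "(a - 2) * h \<le> of_int j * h" "of_int j * h < (a - 1) * h"
          using j h by auto
        ultimately have "0 < (count N (of_int j * h) \<xi> - real (k N)) / r" and jh: "Z N \<xi> - 2 * h \<le> of_int j * h"
          unfolding cZ using near[of j] ah by (auto simp: r_def algebra_simps)
        then have "\<not> count N (of_int j * h) \<xi> \<le> real (k N)" using r by (simp add: zero_less_divide_iff)
        then have "of_int j * h / r \<le> T N \<xi> - t N" using T_iff[of "of_int j * h"] by simp
        then have "of_int j * h \<le> r * (T N \<xi> - t N)" using r by (simp add: field_simps)
        then show ?thesis using jh by simp
      qed
      have "\<bar>r * (T N \<xi> - t N) - Z N \<xi>\<bar> \<le> 2 * h" using up lo by linarith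
      also have "\<dots> < \<epsilon>" using \<epsilon> by (simp add: h_def)
      finally show "dist (sqrt (real (k (fst (N, \<xi>)))) * (T (fst (N, \<xi>)) (snd (N, \<xi>)) - t (fst (N, \<xi>))) - Z (fst (N, \<xi>)) (snd (N, \<xi>))) 0 < \<epsilon>"
        by (simp add: r_def)
    qed
  qed
qed

lemma tight_T: "tight (\<lambda>z. sqrt (real (k (fst z))) * (T (fst z) (snd z) - t (fst z)))"
  using tight_add[OF tendsto_imp_tight[OF bahadur] tight_Z] by simp

lemma T_minus_t: "((\<lambda>z. T (fst z) (snd z) - t (fst z)) \<longlongrightarrow> 0) high_prob"
proof -
  have "((\<lambda>z. 1 / sqrt (real (k (fst z)))) \<longlongrightarrow> 0) high_prob"
    by (rule filterlim_fst) (rule real_tendsto_divide_at_top[OF tendsto_const sqrt_k_top])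
  from tight_scaleR_tendsto_0[OF tight_T this]
  show ?thesis
  proof (rule Lim_transform_eventually)
    show "\<forall>\<^sub>F z in high_prob. (1 / sqrt (real (k (fst z)))) *\<^sub>R (sqrt (real (k (fst z))) * (T (fst z) (snd z) - t (fst z))) =
        T (fst z) (snd z) - t (fst z)"
      using eventually_fst_high_prob[OF eventually_kn] by eventually_elim simp
  qed
qed

definition top_excess where
  "top_excess N \<xi> = (\<Sum>i=1..k N. order_stat (\<lambda>i. e i \<xi>) (n N) (n N - i + 1) - T N \<xi>)"

text \<open>Shifting from the random to the deterministic threshold contributes
  \<open>- sqrt k * (T - t)\<close>, which by \<open>bahadur\<close> is \<open>- Z\<close>, the
  centred number of exceedances. This is where the indicator in \<open>hill_score\<close> comes
  from.\<close>

lemma top_excess_score: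
  "((\<lambda>z. (top_excess (fst z) (snd z) - real (k (fst z))) / sqrt (real (k (fst z))) - score (fst z) (snd z)) \<longlongrightarrow> 0) high_prob"
proof -
  define D where "D N \<xi> = (top_excess N \<xi> + real (k N) * (T N \<xi> - t N)) - (\<Sum>l\<in>{1..n N}. max 0 (e l \<xi> - t N))" for N \<xi>
  have D0: "((\<lambda>z. D (fst z) (snd z) / sqrt (real (k (fst z)))) \<longlongrightarrow> 0) high_prob"
  proof (rule Lim_null_comparison)
    show "((\<lambda>z. norm ((T (fst z) (snd z) - t (fst z)) *\<^sub>R Z (fst z) (snd z))) \<longlongrightarrow> 0) high_prob"
      by (rule tendsto_norm_zero[OF tight_scaleR_tendsto_0[OF tight_Z T_minus_t]])
    show "\<forall>\<^sub>F z in high_prob. norm (D (fst z) (snd z) / sqrt (real (k (fst z)))) \<le>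
        norm ((T (fst z) (snd z) - t (fst z)) *\<^sub>R Z (fst z) (snd z))"
      using eventually_fst_high_prob[OF eventually_kn]
    proof eventually_elim
      case (elim z)
      obtain N \<xi> where z: "z = (N, \<xi>)" by (cases z)
      have "\<bar>D N \<xi>\<bar> \<le> \<bar>count N 0 \<xi> - real (k N)\<bar> * \<bar>T N \<xi> - t N\<bar>"
        using top_excess_threshold[of "k N" "n N" "\<lambda>i. e i \<xi>" "t N"] elim
        by (simp add: z D_def count_def T_def top_excess_def)
      then have "\<bar>D N \<xi>\<bar> / sqrt (real (k N)) \<le> (\<bar>count N 0 \<xi> - real (k N)\<bar> * \<bar>T N \<xi> - t N\<bar>) / sqrt (real (k N))"
        by (rule divide_right_mono) simp
      then show ?case by (simp add: z Z_def abs_mult mult.commute)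
    qed
  qed
  have "((\<lambda>z. D (fst z) (snd z) / sqrt (real (k (fst z))) -
      (sqrt (real (k (fst z))) * (T (fst z) (snd z) - t (fst z)) - Z (fst z) (snd z))) \<longlongrightarrow> 0 - 0) high_prob"
    by (intro tendsto_diff D0 bahadur)
  then have lim: "((\<lambda>z. D (fst z) (snd z) / sqrt (real (k (fst z))) -
      (sqrt (real (k (fst z))) * (T (fst z) (snd z) - t (fst z)) - Z (fst z) (snd z))) \<longlongrightarrow> 0) high_prob" by simp
  show ?thesis
  proof (rule Lim_transform_eventually[OF lim])
    show "\<forall>\<^sub>F z in high_prob. D (fst z) (snd z) / sqrt (real (k (fst z))) -
      (sqrt (real (k (fst z))) * (T (fst z) (snd z) - t (fst z)) - Z (fst z) (snd z)) =
      (top_excess (fst z) (snd z) - real (k (fst z))) / sqrt (real (k (fst z))) - score (fst z) (snd z)"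
      using eventually_fst_high_prob[OF eventually_kn]
    proof eventually_elim
      case (elim z)
      obtain N \<xi> where z: "z = (N, \<xi>)" by (cases z)
      define r where "r = sqrt (real (k N))"
      have r: "0 < r" "real (k N) = r * r" using elim by (auto simp: r_def z)
      have sc: "score N \<xi> = ((\<Sum>l\<in>{1..n N}. max 0 (e l \<xi> - t N)) - count N 0 \<xi>) / r"
      proof -
        have "count N 0 \<xi> = (\<Sum>l\<in>{1..n N}. if t N < e l \<xi> then 1 else 0)"
          by (simp add: count_def sum.If_cases Int_def)
        then show ?thesis by (simp only: score_def hill_score_def sum_subtractf r_def)
      qed
      have "D N \<xi> / r - (r * (T N \<xi> - t N) - Z N \<xi>) = (top_excess N \<xi> - real (k N)) / r - score N \<xi>"
        unfolding sc D_def Z_def r_def[symmetric] using r by (simp add: field_simps)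
      then show ?case by (simp add: z r_def)
    qed
  qed
qed

lemma tight_score: "tight (\<lambda>z. score (fst z) (snd z))"
proof -
  \<comment> \<open>Set to 0 when \<open>t N\<close> is negative, because the moment formulas
    concern nonnegative thresholds and the array has to be square integrable for every
    \<open>N\<close>.\<close>
  define X where "X N i \<xi> = (if 0 \<le> t N then hill_score (t N) (e i \<xi>) / sqrt (real (k N)) else 0)" for N i \<xi>
  have indX: "indep_vars (\<lambda>_. borel) (X N) {1..n N}" for N
    unfolding X_def[abs_def]
    by (rule indep_vars_compose2[OF indep_sum, where Y = "\<lambda>i x. (if 0 \<le> t N then hill_score (t N) x / sqrt (real (k N)) else 0)"])
      measurable
  have X2: "has_bochner_integral M (\<lambda>\<xi>. (X N i \<xi>)\<^sup>2) (if 0 \<le> t N then exp (- t N) / real (k N) else 0)"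
    if "i \<in> {1..n N}" for N i
  proof (cases "0 \<le> t N")
    case True
    have "has_bochner_integral M (\<lambda>\<xi>. (hill_score (t N) (e i \<xi>))\<^sup>2 / real (k N)) (exp (- t N) / real (k N))"
      using hill_score_moments(2)[OF dist True, of i] that by (intro has_bochner_integral_divide_zero) auto
    then show ?thesis using True by (simp add: X_def power_divide)
  qed (simp add: X_def has_bochner_integral_zero)
  have X1: "expectation (X N i) = 0" if "i \<in> {1..n N}" for N i
    using has_bochner_integral_integral_eq[OF hill_score_moments(1)[OF dist, of i "t N"]] that
    by (cases "0 \<le> t N") (auto simp: X_def[abs_def])
  have evt: "\<forall>\<^sub>F N in sequentially. 0 \<le> t N" using t_top by (simp add: filterlim_at_top)
  have "tight (\<lambda>z. (\<Sum>i\<in>{1..n (fst z)}. X (fst z) i (snd z)) - (\<Sum>i\<in>{1..n (fst z)}. expectation (X (fst z) i)))"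
  proof (rule centred_sum_tight[OF indX integrable.intros[OF X2], where C = 1])
    show "\<forall>\<^sub>F N in sequentially. (\<Sum>i\<in>{1..n N}. expectation (\<lambda>\<xi>. (X N i \<xi>)\<^sup>2)) \<le> 1"
      using evt eventually_kn
    proof eventually_elim
      case (elim N)
      have "(\<Sum>i\<in>{1..n N}. expectation (\<lambda>\<xi>. (X N i \<xi>)\<^sup>2)) = (\<Sum>i\<in>{1..n N}. exp (- t N) / real (k N))"
        using has_bochner_integral_integral_eq[OF X2] elim by simp
      also have "\<dots> = 1" unfolding exp_t[OF elim(2)] using elim by simp
      finally show ?case by simp
    qed
  qed
  then have "tight (\<lambda>z. \<Sum>i\<in>{1..n (fst z)}. X (fst z) i (snd z))" using X1 by simp
  then show ?thesis
  proof (rule tight_mono)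
    show "\<forall>\<^sub>F z in high_prob. norm (score (fst z) (snd z)) \<le> norm (\<Sum>i\<in>{1..n (fst z)}. X (fst z) i (snd z))"
      using eventually_fst_high_prob[OF evt]
      by eventually_elim (simp add: score_def X_def sum_divide_distrib)
  qed
qed

end

section \<open>Tail copulas\<close>

locale tail_copula =
  fixes C R :: "real \<Rightarrow> real \<Rightarrow> real"
  assumes C_bounds: "\<And>u v. 0 \<le> u \<Longrightarrow> 0 \<le> v \<Longrightarrow> 0 \<le> C u v \<and> C u v \<le> u \<and> C u v \<le> v"
    and C_lipschitz: "\<And>u v u' v'. 0 \<le> u \<Longrightarrow> 0 \<le> v \<Longrightarrow> 0 \<le> u' \<Longrightarrow> 0 \<le> v' \<Longrightarrow>
      \<bar>C u v - C u' v'\<bar> \<le> \<bar>u - u'\<bar> + \<bar>v - v'\<bar>"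
    and C_limit: "\<And>x y. 0 \<le> x \<Longrightarrow> 0 \<le> y \<Longrightarrow> ((\<lambda>s. s * C (x / s) (y / s)) \<longlongrightarrow> R x y) at_top"
begin

text \<open>The rescaled functions \<open>s * C (x / s) (y / s)\<close> are 1-Lipschitz uniformly in
  \<open>s\<close>, so pointwise convergence extends to convergent arguments.\<close>

lemma C_limit_sequentially:
  assumes s: "filterlim s at_top sequentially" and x: "X \<longlonglongrightarrow> x" and y: "Y \<longlonglongrightarrow> y"
    and pos: "\<And>N. 0 \<le> X N" "\<And>N. 0 \<le> Y N"
  shows "(\<lambda>N. s N * C (X N / s N) (Y N / s N)) \<longlonglongrightarrow> R x y"
proof -
  have xy: "0 \<le> x" "0 \<le> y"
    using LIMSEQ_le_const[OF x] LIMSEQ_le_const[OF y] pos by blast+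
  have lim: "(\<lambda>N. s N * C (x / s N) (y / s N)) \<longlonglongrightarrow> R x y"
    by (rule filterlim_compose[OF C_limit[OF xy] s])
  have "(\<lambda>N. s N * C (X N / s N) (Y N / s N) - s N * C (x / s N) (y / s N)) \<longlonglongrightarrow> 0"
  proof (rule Lim_null_comparison)
    have "\<forall>\<^sub>F N in sequentially. 1 \<le> s N" using s by (simp add: filterlim_at_top)
    then show "\<forall>\<^sub>F N in sequentially. norm (s N * C (X N / s N) (Y N / s N) - s N * C (x / s N) (y / s N))
        \<le> \<bar>X N - x\<bar> + \<bar>Y N - y\<bar>"
    proof eventually_elim
      case (elim N)
      have "norm (s N * C (X N / s N) (Y N / s N) - s N * C (x / s N) (y / s N)) =
          s N * \<bar>C (X N / s N) (Y N / s N) - C (x / s N) (y / s N)\<bar>"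
        using elim by (simp add: right_diff_distrib[symmetric] abs_mult)
      also have "\<dots> \<le> s N * (\<bar>X N / s N - x / s N\<bar> + \<bar>Y N / s N - y / s N\<bar>)"
        using elim xy pos by (intro mult_left_mono C_lipschitz) auto
      also have "\<dots> = \<bar>X N - x\<bar> + \<bar>Y N - y\<bar>"
        using elim by (simp add: diff_divide_distrib[symmetric] distrib_left)
      finally show ?case .
    qed
    have "(\<lambda>N. \<bar>X N - x\<bar> + \<bar>Y N - y\<bar>) \<longlonglongrightarrow> \<bar>x - x\<bar> + \<bar>y - y\<bar>"
      by (intro tendsto_intros x y)
    then show "(\<lambda>N. \<bar>X N - x\<bar> + \<bar>Y N - y\<bar>) \<longlonglongrightarrow> 0" by simp
  qed
  from tendsto_add[OF this lim] show ?thesis by simp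
qed

text \<open>Substituting \<open>s / c\<close> for \<open>s\<close> in the defining limit leaves the
  limit point at infinity in place.\<close>

lemma R_homogeneous:
  assumes "0 < c" "0 \<le> x" "0 \<le> y"
  shows "R (c * x) (c * y) = c * R x y"
proof (rule tendsto_unique[OF trivial_limit_at_top_linorder])
  show "((\<lambda>s. s * C (c * x / s) (c * y / s)) \<longlongrightarrow> R (c * x) (c * y)) at_top"
    using assms by (intro C_limit) auto
  have fl: "filterlim (\<lambda>s. s / c) at_top at_top"
    using assms(1) filterlim_at_top_mult_tendsto_pos[OF tendsto_const[of "inverse c"] _ filterlim_ident]
    by (simp add: divide_inverse)
  have "((\<lambda>s. c * (s / c * C (x / (s / c)) (y / (s / c)))) \<longlongrightarrow> c * R x y) at_top"
    by (intro tendsto_intros filterlim_compose[OF C_limit fl] assms)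
  then show "((\<lambda>s. s * C (c * x / s) (c * y / s)) \<longlongrightarrow> c * R x y) at_top"
    using assms(1) by (simp add: mult.commute)
qed

lemma R_bounds:
  assumes "0 \<le> x" "0 \<le> y"
  shows "0 \<le> R x y" "R x y \<le> x" "R x y \<le> y"
proof -
  have ev: "\<forall>\<^sub>F s in at_top. 0 \<le> s * C (x / s) (y / s) \<and> s * C (x / s) (y / s) \<le> x \<and> s * C (x / s) (y / s) \<le> y"
    using eventually_gt_at_top[of 0]
  proof eventually_elim
    case (elim s)
    have "0 \<le> C (x / s) (y / s) \<and> C (x / s) (y / s) \<le> x / s \<and> C (x / s) (y / s) \<le> y / s"
      using elim assms by (intro C_bounds) auto
    then show ?case using elim by (auto simp: field_simps)
  qed
  note lim = C_limit[OF assms]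
  show "0 \<le> R x y"
    by (rule tendsto_lowerbound[OF lim]) (use ev in \<open>auto elim: eventually_mono\<close>)
  show "R x y \<le> x"
    by (rule tendsto_upperbound[OF lim]) (use ev in \<open>auto elim: eventually_mono\<close>)
  show "R x y \<le> y"
    by (rule tendsto_upperbound[OF lim]) (use ev in \<open>auto elim: eventually_mono\<close>)
qed

text \<open>\<open>R\<close> is a pointwise limit of rescalings of \<open>C\<close>, which is
  continuous on the closed quadrant by its Lipschitz bound.\<close>

lemma R_measurable:
  assumes [measurable]: "f \<in> borel_measurable N" "g \<in> borel_measurable N"
    and "\<And>x. 0 \<le> f x" "\<And>x. 0 \<le> g x"
  shows "(\<lambda>x. R (f x) (g x)) \<in> borel_measurable N"
proof -
  have "continuous_on {z. 0 \<le> fst z \<and> 0 \<le> snd z} (\<lambda>z. C (fst z) (snd z))"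
    unfolding continuous_on_def
  proof safe
    fix a b :: real assume ab: "0 \<le> fst (a, b)" "0 \<le> snd (a, b)"
    let ?S = "{z. 0 \<le> fst z \<and> 0 \<le> (snd z :: real)} :: (real \<times> real) set"
    have "((\<lambda>z. C (fst z) (snd z) - C a b) \<longlongrightarrow> 0) (at (a, b) within ?S)"
    proof (rule Lim_null_comparison)
      show "\<forall>\<^sub>F z in at (a, b) within ?S. norm (C (fst z) (snd z) - C a b) \<le> \<bar>fst z - a\<bar> + \<bar>snd z - b\<bar>"
        unfolding eventually_at_filter
        by (intro always_eventually allI impI) (use ab in \<open>auto intro!: C_lipschitz\<close>)
      have "((\<lambda>z. \<bar>fst z - a\<bar> + \<bar>snd z - b\<bar>) \<longlongrightarrow> \<bar>fst (a, b) - a\<bar> + \<bar>snd (a, b) - b\<bar>) (at (a, b) within ?S)"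
        by (intro tendsto_intros)
      then show "((\<lambda>z. \<bar>fst z - a\<bar> + \<bar>snd z - b\<bar>) \<longlongrightarrow> 0) (at (a, b) within ?S)" by simp
    qed
    then show "((\<lambda>z. C (fst z) (snd z)) \<longlongrightarrow> C (fst (a, b)) (snd (a, b))) (at (a, b) within ?S)"
      by (simp add: LIM_zero_cancel)
  qed
  moreover have "{z :: real \<times> real. 0 \<le> fst z \<and> 0 \<le> snd z} \<in> sets borel"
    by (intro borel_closed closed_Collect_conj closed_Collect_le continuous_intros)
  ultimately have m: "(\<lambda>z. indicator {z. 0 \<le> fst z \<and> 0 \<le> snd z} z *\<^sub>R C (fst z) (snd z)) \<in> borel_measurable borel"
    using borel_measurable_continuous_on_indicator by blast
  have "(\<lambda>x. real (Suc i) * C (f x / real (Suc i)) (g x / real (Suc i))) \<in> borel_measurable N" for i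
  proof -
    have "(\<lambda>x. (f x / real (Suc i), g x / real (Suc i))) \<in> N \<rightarrow>\<^sub>M borel"
      unfolding borel_prod[symmetric] by measurable
    from measurable_compose[OF this m] show ?thesis using assms(3,4) by simp
  qed
  then show ?thesis
  proof (rule borel_measurable_LIMSEQ_real[rotated])
    fix x
    show "(\<lambda>i. real (Suc i) * C (f x / real (Suc i)) (g x / real (Suc i))) \<longlonglongrightarrow> R (f x) (g x)"
      by (rule filterlim_compose[OF C_limit[OF assms(3,4)]])
        (rule filterlim_compose[OF filterlim_real_sequentially filterlim_Suc])
  qed
qed

text \<open>On the exponential scale, homogeneity makes \<open>R\<close> contract by \<open>exp (- h)\<close> along the
  diagonal; splitting the quadrant along the diagonal turns this into Euler's identity.\<close>

lemma R_euler_identity: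
  fixes r :: real
  assumes r: "0 < r"
  defines "g \<equiv> \<lambda>a b. ennreal (R (exp (- a)) (r * exp (- b)))"
  shows "(\<integral>\<^sup>+ a. \<integral>\<^sup>+ b. indicator {0..} a * indicator {0..} b * g a b \<partial>lborel \<partial>lborel) =
    (\<integral>\<^sup>+ a. indicator {0..} a * g a 0 \<partial>lborel) + (\<integral>\<^sup>+ b. indicator {0..} b * g 0 b \<partial>lborel)"
proof -
  have Rm: "(\<lambda>z. R (exp (- fst z)) (r * exp (- snd z))) \<in> borel_measurable (lborel \<Otimes>\<^sub>M lborel)"
    using r by (intro R_measurable) auto
  then have gm[measurable]: "(\<lambda>z. g (fst z) (snd z)) \<in> borel_measurable (lborel \<Otimes>\<^sub>M lborel)"
    unfolding g_def by measurable
  have gm1[measurable]: "(\<lambda>a. g a b) \<in> borel_measurable borel" for b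
    unfolding g_def using r by (intro measurable_compose[OF _ measurable_ennreal] R_measurable) auto
  have gm2[measurable]: "(\<lambda>b. g a b) \<in> borel_measurable borel" for a
    unfolding g_def using r by (intro measurable_compose[OF _ measurable_ennreal] R_measurable) auto
  have shift: "g (h + a) (h + b) = ennreal (exp (- h)) * g a b" for a b h
    unfolding g_def using r R_homogeneous[of "exp (- h)" "exp (- a)" "r * exp (- b)"] R_bounds(1)[of "exp (- a)" "r * exp (- b)"]
    by (simp add: exp_add exp_minus ennreal_mult'[symmetric] mult_ac inverse_eq_divide exp_diff)
  have exp1: "(\<integral>\<^sup>+ a. indicator {0..} a * ennreal (exp (- a)) \<partial>lborel) = 1"
    using nn_intergal_power_times_exp_Ici[of 0] by (simp add: mult.commute)
  have lower: "(\<integral>\<^sup>+ b. \<integral>\<^sup>+ a. indicator {0..} b * (indicator {b..} a * g a b) \<partial>lborel \<partial>lborel) =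
      (\<integral>\<^sup>+ a. indicator {0..} a * g a 0 \<partial>lborel)"
  proof -
    have "(\<integral>\<^sup>+ a. indicator {0..} b * (indicator {b..} a * g a b) \<partial>lborel) =
        indicator {0..} b * ennreal (exp (- b)) * (\<integral>\<^sup>+ a. indicator {0..} a * g a 0 \<partial>lborel)" for b
    proof -
      have "(\<integral>\<^sup>+ a. indicator {b..} a * g a b \<partial>lborel) = (\<integral>\<^sup>+ a. indicator {b..} (b + a) * g (b + a) b \<partial>lborel)"
        by (subst nn_integral_real_affine[where c = 1 and t = b]) auto
      also have "\<dots> = (\<integral>\<^sup>+ a. ennreal (exp (- b)) * (indicator {0..} a * g a 0) \<partial>lborel)"
        using shift[of b _ 0] by (intro nn_integral_cong) (auto simp: indicator_def)
      also have "\<dots> = ennreal (exp (- b)) * (\<integral>\<^sup>+ a. indicator {0..} a * g a 0 \<partial>lborel)"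
        by (rule nn_integral_cmult) measurable
      finally show ?thesis
        by (subst nn_integral_cmult) (auto simp: mult.assoc)
    qed
    then have "(\<integral>\<^sup>+ b. \<integral>\<^sup>+ a. indicator {0..} b * (indicator {b..} a * g a b) \<partial>lborel \<partial>lborel) =
        (\<integral>\<^sup>+ b. indicator {0..} b * ennreal (exp (- b)) \<partial>lborel) * (\<integral>\<^sup>+ a. indicator {0..} a * g a 0 \<partial>lborel)"
      by (simp add: nn_integral_multc)
    then show ?thesis by (simp add: exp1)
  qed
  have upper: "(\<integral>\<^sup>+ a. \<integral>\<^sup>+ b. indicator {0..} a * (indicator {a<..} b * g a b) \<partial>lborel \<partial>lborel) =
      (\<integral>\<^sup>+ b. indicator {0..} b * g 0 b \<partial>lborel)"
  proof -
    have "(\<integral>\<^sup>+ b. indicator {0..} a * (indicator {a<..} b * g a b) \<partial>lborel) =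
        indicator {0..} a * ennreal (exp (- a)) * (\<integral>\<^sup>+ b. indicator {0..} b * g 0 b \<partial>lborel)" for a
    proof -
      have "(\<integral>\<^sup>+ b. indicator {a<..} b * g a b \<partial>lborel) = (\<integral>\<^sup>+ b. indicator {a<..} (a + b) * g a (a + b) \<partial>lborel)"
        by (subst nn_integral_real_affine[where c = 1 and t = a]) auto
      also have "\<dots> = (\<integral>\<^sup>+ b. ennreal (exp (- a)) * (indicator {0..} b * g 0 b) \<partial>lborel)"
      proof (rule nn_integral_cong_AE)
        show "AE b in lborel. indicator {a<..} (a + b) * g a (a + b) = ennreal (exp (- a)) * (indicator {0..} b * g 0 b)"
          using AE_lborel_singleton[of 0] by eventually_elim (use shift[of a 0] in \<open>auto simp: indicator_def\<close>)
      qed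
      also have "\<dots> = ennreal (exp (- a)) * (\<integral>\<^sup>+ b. indicator {0..} b * g 0 b \<partial>lborel)"
        by (rule nn_integral_cmult) measurable
      finally show ?thesis
        by (subst nn_integral_cmult) (auto simp: mult.assoc)
    qed
    then have "(\<integral>\<^sup>+ a. \<integral>\<^sup>+ b. indicator {0..} a * (indicator {a<..} b * g a b) \<partial>lborel \<partial>lborel) =
        (\<integral>\<^sup>+ a. indicator {0..} a * ennreal (exp (- a)) \<partial>lborel) * (\<integral>\<^sup>+ b. indicator {0..} b * g 0 b \<partial>lborel)"
      by (simp add: nn_integral_multc)
    then show ?thesis by (simp add: exp1)
  qed
  have meas1: "(\<lambda>z. indicator {0..} (snd z) * (indicator {(snd z)..} (fst z) * g (fst z) (snd z))) \<in> borel_measurable (lborel \<Otimes>\<^sub>M lborel)"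
  proof -
    have "(\<lambda>z. indicator {z. snd z \<le> fst z} z * g (fst z) (snd z)) \<in> borel_measurable (lborel \<Otimes>\<^sub>M (lborel :: real measure))"
      by measurable
    then have "(\<lambda>z. indicator {0..} (snd z) * (indicator {z. snd z \<le> fst z} z * g (fst z) (snd z))) \<in> borel_measurable (lborel \<Otimes>\<^sub>M lborel)"
      by measurable
    then show ?thesis by (simp add: indicator_def)
  qed
  have meas2: "(\<lambda>z. indicator {0..} (fst z) * (indicator {(fst z)<..} (snd z) * g (fst z) (snd z))) \<in> borel_measurable (lborel \<Otimes>\<^sub>M lborel)"
  proof -
    have "(\<lambda>z. indicator {z. fst z < snd z} z * g (fst z) (snd z)) \<in> borel_measurable (lborel \<Otimes>\<^sub>M (lborel :: real measure))"
      by measurable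
    then have "(\<lambda>z. indicator {0..} (fst z) * (indicator {z. fst z < snd z} z * g (fst z) (snd z))) \<in> borel_measurable (lborel \<Otimes>\<^sub>M lborel)"
      by measurable
    then show ?thesis by (simp add: indicator_def)
  qed
  have "(\<integral>\<^sup>+ a. \<integral>\<^sup>+ b. indicator {0..} a * indicator {0..} b * g a b \<partial>lborel \<partial>lborel) =
      (\<integral>\<^sup>+ a. \<integral>\<^sup>+ b. indicator {0..} b * (indicator {b..} a * g a b) + indicator {0..} a * (indicator {a<..} b * g a b) \<partial>lborel \<partial>lborel)"
    by (intro nn_integral_cong) (auto simp: indicator_def)
  also have "\<dots> = (\<integral>\<^sup>+ z. indicator {0..} (snd z) * (indicator {(snd z)..} (fst z) * g (fst z) (snd z)) +
      indicator {0..} (fst z) * (indicator {(fst z)<..} (snd z) * g (fst z) (snd z)) \<partial>(lborel \<Otimes>\<^sub>M lborel))"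
    using meas1 meas2 by (subst lborel.nn_integral_fst[symmetric]) auto
  also have "\<dots> = (\<integral>\<^sup>+ z. indicator {0..} (snd z) * (indicator {(snd z)..} (fst z) * g (fst z) (snd z)) \<partial>(lborel \<Otimes>\<^sub>M lborel)) +
      (\<integral>\<^sup>+ z. indicator {0..} (fst z) * (indicator {(fst z)<..} (snd z) * g (fst z) (snd z)) \<partial>(lborel \<Otimes>\<^sub>M lborel))"
    by (rule nn_integral_add[OF meas1 meas2])
  also have "(\<integral>\<^sup>+ z. indicator {0..} (snd z) * (indicator {(snd z)..} (fst z) * g (fst z) (snd z)) \<partial>(lborel \<Otimes>\<^sub>M lborel)) =
      (\<integral>\<^sup>+ b. \<integral>\<^sup>+ a. indicator {0..} b * (indicator {b..} a * g a b) \<partial>lborel \<partial>lborel)"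
    using lborel_pair.nn_integral_snd[of "\<lambda>z. indicator {0..} (snd z) * (indicator {(snd z)..} (fst z) * g (fst z) (snd z))"] meas1
    by simp
  also have "(\<integral>\<^sup>+ z. indicator {0..} (fst z) * (indicator {(fst z)<..} (snd z) * g (fst z) (snd z)) \<partial>(lborel \<Otimes>\<^sub>M lborel)) =
      (\<integral>\<^sup>+ a. \<integral>\<^sup>+ b. indicator {0..} a * (indicator {a<..} b * g a b) \<partial>lborel \<partial>lborel)"
    using lborel.nn_integral_fst[OF meas2] by simp
  finally show ?thesis unfolding lower upper .
qed

end

section \<open>Limiting covariance of two Hill scores\<close>

locale exponential_pair = prob_space + tail_copula +
  fixes e1 e2 :: "'a \<Rightarrow> real"
  assumes dist1: "distributed M lborel e1 (exponential_density 1)"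
    and dist2: "distributed M lborel e2 (exponential_density 1)"
    and joint: "\<And>s t. 0 \<le> s \<Longrightarrow> 0 \<le> t \<Longrightarrow>
      prob {\<xi> \<in> space M. s < e1 \<xi> \<and> t < e2 \<xi>} = C (exp (- s)) (exp (- t))"
begin

lemma indicator_excess: "indicator {t + a<..} x = (indicator {..<x - t} a :: ennreal)" for a t x :: real
  by (auto simp: indicator_def)

text \<open>\<open>\<nu>1\<close> and \<open>\<nu>2\<close> range over Lebesgue measure, giving the excess over a threshold, and the
  point mass at zero, giving the indicator of exceeding it.\<close>

lemma joint_excess_limit:
  fixes \<nu>1 \<nu>2 :: "real measure" and s t1 t2 :: "nat \<Rightarrow> real"
  assumes \<nu>: "sigma_finite_measure \<nu>1" "sigma_finite_measure \<nu>2"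
    and [measurable_cong]: "sets \<nu>1 = sets borel" "sets \<nu>2 = sets borel"
    and fin: "(\<integral>\<^sup>+ a. indicator {0..} a * ennreal (exp (- a / 2)) \<partial>\<nu>1) < \<infinity>"
      "(\<integral>\<^sup>+ a. indicator {0..} a * ennreal (exp (- a / 2)) \<partial>\<nu>2) < \<infinity>"
    and s: "filterlim s at_top sequentially" "\<And>N. 0 < s N" "\<And>N. exp (- t1 N) = 1 / s N"
    and t: "\<And>N. 0 \<le> t1 N" "\<And>N. 0 \<le> t2 N"
    and r: "(\<lambda>N. s N * exp (- t2 N)) \<longlonglongrightarrow> r" "\<And>N. s N * exp (- t2 N) \<le> K"
  shows "(\<lambda>N. ennreal (s N) * (\<integral>\<^sup>+ \<xi>. (\<integral>\<^sup>+ a. indicator {0..} a * indicator {t1 N + a<..} (e1 \<xi>) \<partial>\<nu>1) *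
        (\<integral>\<^sup>+ b. indicator {0..} b * indicator {t2 N + b<..} (e2 \<xi>) \<partial>\<nu>2) \<partial>M))
    \<longlonglongrightarrow> (\<integral>\<^sup>+ a. \<integral>\<^sup>+ b. indicator {0..} a * indicator {0..} b * ennreal (R (exp (- a)) (r * exp (- b))) \<partial>\<nu>2 \<partial>\<nu>1)"
    and "(\<integral>\<^sup>+ a. \<integral>\<^sup>+ b. indicator {0..} a * indicator {0..} b * ennreal (R (exp (- a)) (r * exp (- b))) \<partial>\<nu>2 \<partial>\<nu>1) < \<infinity>"
proof -
  interpret n1: sigma_finite_measure \<nu>1 by fact
  interpret n2: sigma_finite_measure \<nu>2 by fact
  interpret n12: pair_sigma_finite \<nu>1 \<nu>2 ..
  interpret n: sigma_finite_measure "\<nu>1 \<Otimes>\<^sub>M \<nu>2" by (rule n12.P.sigma_finite_measure_axioms)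
  interpret Mn: pair_sigma_finite M "\<nu>1 \<Otimes>\<^sub>M \<nu>2" ..
  have [measurable]: "e1 \<in> borel_measurable M" "e2 \<in> borel_measurable M"
    using dist1 dist2 by (auto dest: distributed_measurable)
  have r0: "0 \<le> r" by (rule LIMSEQ_le_const[OF r(1)]) (use s(2) in \<open>auto intro!: exI[of _ 0] less_imp_le\<close>)
  have K0: "0 \<le> K" using r(2)[of 0] s(2)[of 0] by (meson exp_ge_zero less_imp_le mult_nonneg_nonneg order_trans)
  define H where "H N z = ennreal (s N) * (\<integral>\<^sup>+ \<xi>. indicator {0..} (fst z) * indicator {0..} (snd z) *
      indicator {\<xi> \<in> space M. t1 N + fst z < e1 \<xi> \<and> t2 N + snd z < e2 \<xi>} \<xi> \<partial>M)" for N and z :: "real \<times> real"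
  define h where "h z = indicator {0..} (fst z) * indicator {0..} (snd z) * ennreal (R (exp (- fst z)) (r * exp (- snd z)))"
    for z :: "real \<times> real"
  \<comment> \<open>The dominating function: a number below both \<open>x\<close> and
    \<open>y\<close> is below \<open>sqrt (x * y)\<close>. This decays in both excesses at half the
    exponential rate, hence the exponents \<open>- a / 2\<close> in the finiteness
    assumptions.\<close>
  define w where "w z = (indicator {0..} (fst z) * ennreal (exp (- fst z / 2))) *
      (ennreal (sqrt K) * (indicator {0..} (snd z) * ennreal (exp (- snd z / 2))))" for z :: "real \<times> real"
  have Heq: "H N z = indicator {0..} (fst z) * indicator {0..} (snd z) *
      ennreal (s N * C (exp (- fst z) / s N) ((s N * exp (- t2 N)) * exp (- snd z) / s N))" for N z
  proof (cases "0 \<le> fst z \<and> 0 \<le> snd z")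
    case True
    have "(\<integral>\<^sup>+ \<xi>. indicator {\<xi> \<in> space M. t1 N + fst z < e1 \<xi> \<and> t2 N + snd z < e2 \<xi>} \<xi> \<partial>M) =
        emeasure M {\<xi> \<in> space M. t1 N + fst z < e1 \<xi> \<and> t2 N + snd z < e2 \<xi>}"
      by (rule nn_integral_indicator) measurable
    also have "\<dots> = ennreal (C (exp (- (t1 N + fst z))) (exp (- (t2 N + snd z))))"
      using joint[of "t1 N + fst z" "t2 N + snd z"] True t by (simp add: emeasure_eq_measure)
    also have "exp (- (t1 N + fst z)) = exp (- fst z) / s N"
      using s(3)[of N] by (simp add: exp_add[symmetric] exp_diff exp_minus field_simps)
    also have "exp (- (t2 N + snd z)) = (s N * exp (- t2 N)) * exp (- snd z) / s N"
      using s(2)[of N] by (simp add: exp_add[symmetric])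
    finally show ?thesis using True s(2)[of N] by (simp add: H_def ennreal_mult')
  qed (auto simp: H_def indicator_def)
  have Hm[measurable]: "H N \<in> borel_measurable (\<nu>1 \<Otimes>\<^sub>M \<nu>2)" for N
  proof -
    have "(\<lambda>(z, \<xi>). indicator {0..} (fst z) * indicator {0..} (snd z) *
        (indicator {\<xi> \<in> space M. t1 N + fst z < e1 \<xi> \<and> t2 N + snd z < e2 \<xi>} \<xi> :: ennreal)) \<in> borel_measurable ((\<nu>1 \<Otimes>\<^sub>M \<nu>2) \<Otimes>\<^sub>M M)"
      unfolding split_beta indicator_def by measurable
    then show ?thesis unfolding H_def[abs_def] by (intro borel_measurable_times_ennreal borel_measurable_const borel_measurable_nn_integral)
  qed
  have hm[measurable]: "h \<in> borel_measurable (\<nu>1 \<Otimes>\<^sub>M \<nu>2)"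
  proof -
    have "(\<lambda>z. R (exp (- fst z)) (r * exp (- snd z))) \<in> borel_measurable (\<nu>1 \<Otimes>\<^sub>M \<nu>2)"
      using r0 by (intro R_measurable) auto
    then show ?thesis unfolding h_def[abs_def] by measurable
  qed
  have wm[measurable]: "w \<in> borel_measurable (\<nu>1 \<Otimes>\<^sub>M \<nu>2)" unfolding w_def[abs_def] by measurable
  have fub: "ennreal (s N) * (\<integral>\<^sup>+ \<xi>. (\<integral>\<^sup>+ a. indicator {0..} a * indicator {t1 N + a<..} (e1 \<xi>) \<partial>\<nu>1) *
        (\<integral>\<^sup>+ b. indicator {0..} b * indicator {t2 N + b<..} (e2 \<xi>) \<partial>\<nu>2) \<partial>M) = (\<integral>\<^sup>+ z. H N z \<partial>(\<nu>1 \<Otimes>\<^sub>M \<nu>2))" for N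
  proof -
    define f where "f \<xi> z = indicator {0..} (fst z) * indicator {0..} (snd z) *
      (indicator {\<xi> \<in> space M. t1 N + fst z < e1 \<xi> \<and> t2 N + snd z < e2 \<xi>} \<xi> :: ennreal)" for \<xi> and z :: "real \<times> real"
    have fm[measurable]: "(\<lambda>(\<xi>, z). f \<xi> z) \<in> borel_measurable (M \<Otimes>\<^sub>M (\<nu>1 \<Otimes>\<^sub>M \<nu>2))"
      unfolding f_def split_beta indicator_def by measurable
    have "(\<integral>\<^sup>+ a. indicator {0..} a * indicator {t1 N + a<..} (e1 \<xi>) \<partial>\<nu>1) *
        (\<integral>\<^sup>+ b. indicator {0..} b * indicator {t2 N + b<..} (e2 \<xi>) \<partial>\<nu>2) = (\<integral>\<^sup>+ z. f \<xi> z \<partial>(\<nu>1 \<Otimes>\<^sub>M \<nu>2))"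
      if \<xi>: "\<xi> \<in> space M" for \<xi>
    proof -
      have m1: "(\<lambda>a. indicator {0..} a * indicator {t1 N + a<..} (e1 \<xi>) :: ennreal) \<in> borel_measurable \<nu>1"
        unfolding indicator_excess by measurable
      have m2: "(\<lambda>b. indicator {0..} b * indicator {t2 N + b<..} (e2 \<xi>) :: ennreal) \<in> borel_measurable \<nu>2"
        unfolding indicator_excess by measurable
      have f\<xi>: "f \<xi> \<in> borel_measurable (\<nu>1 \<Otimes>\<^sub>M \<nu>2)"
        using measurable_Pair2[OF fm \<xi>] by simp
      have "(\<integral>\<^sup>+ z. f \<xi> z \<partial>(\<nu>1 \<Otimes>\<^sub>M \<nu>2)) = (\<integral>\<^sup>+ a. \<integral>\<^sup>+ b. f \<xi> (a, b) \<partial>\<nu>2 \<partial>\<nu>1)"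
        by (rule n2.nn_integral_fst[symmetric, OF f\<xi>])
      also have "\<dots> = (\<integral>\<^sup>+ a. \<integral>\<^sup>+ b. (indicator {0..} a * indicator {t1 N + a<..} (e1 \<xi>)) * (indicator {0..} b * indicator {t2 N + b<..} (e2 \<xi>)) \<partial>\<nu>2 \<partial>\<nu>1)"
        using \<xi> by (intro nn_integral_cong) (auto simp: f_def indicator_def)
      also have "\<dots> = (\<integral>\<^sup>+ a. (indicator {0..} a * indicator {t1 N + a<..} (e1 \<xi>)) * (\<integral>\<^sup>+ b. indicator {0..} b * indicator {t2 N + b<..} (e2 \<xi>) \<partial>\<nu>2) \<partial>\<nu>1)"
        by (intro nn_integral_cong nn_integral_cmult m2)
      also have "\<dots> = (\<integral>\<^sup>+ a. indicator {0..} a * indicator {t1 N + a<..} (e1 \<xi>) \<partial>\<nu>1) *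
        (\<integral>\<^sup>+ b. indicator {0..} b * indicator {t2 N + b<..} (e2 \<xi>) \<partial>\<nu>2)"
        by (rule nn_integral_multc[OF m1])
      finally show ?thesis by simp
    qed
    then have "(\<integral>\<^sup>+ \<xi>. (\<integral>\<^sup>+ a. indicator {0..} a * indicator {t1 N + a<..} (e1 \<xi>) \<partial>\<nu>1) *
        (\<integral>\<^sup>+ b. indicator {0..} b * indicator {t2 N + b<..} (e2 \<xi>) \<partial>\<nu>2) \<partial>M) =
        (\<integral>\<^sup>+ \<xi>. \<integral>\<^sup>+ z. f \<xi> z \<partial>(\<nu>1 \<Otimes>\<^sub>M \<nu>2) \<partial>M)"
      by (intro nn_integral_cong) auto
    also have "\<dots> = (\<integral>\<^sup>+ z. \<integral>\<^sup>+ \<xi>. f \<xi> z \<partial>M \<partial>(\<nu>1 \<Otimes>\<^sub>M \<nu>2))"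
      by (rule Mn.Fubini'[OF fm, symmetric])
    also have "ennreal (s N) * \<dots> = (\<integral>\<^sup>+ z. H N z \<partial>(\<nu>1 \<Otimes>\<^sub>M \<nu>2))"
    proof -
      have "(\<lambda>z. \<integral>\<^sup>+ \<xi>. f \<xi> z \<partial>M) \<in> borel_measurable (\<nu>1 \<Otimes>\<^sub>M \<nu>2)"
        using measurable_pair_swap[OF fm] by (intro borel_measurable_nn_integral) (simp add: split_beta)
      then show ?thesis by (simp add: H_def f_def nn_integral_cmult)
    qed
    finally show ?thesis .
  qed
  have Hw: "H N z \<le> w z" for N z
  proof (cases "0 \<le> fst z \<and> 0 \<le> snd z")
    case True
    define x y where "x = exp (- fst z)" and "y = (s N * exp (- t2 N)) * exp (- snd z)"
    have xy: "0 \<le> x" "0 \<le> y" using s(2)[of N] by (auto simp: x_def y_def)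
    have "C (x / s N) (y / s N) \<le> x / s N" "C (x / s N) (y / s N) \<le> y / s N" "0 \<le> C (x / s N) (y / s N)"
      using C_bounds[of "x / s N" "y / s N"] xy s(2)[of N] by auto
    then have c: "s N * C (x / s N) (y / s N) \<le> x" "s N * C (x / s N) (y / s N) \<le> y" "0 \<le> s N * C (x / s N) (y / s N)"
      using s(2)[of N] by (auto simp: field_simps)
    have "(s N * C (x / s N) (y / s N))\<^sup>2 \<le> x * y"
      unfolding power2_eq_square using c xy by (intro mult_mono) auto
    also have "\<dots> \<le> x * (K * exp (- snd z))"
      unfolding y_def using r(2)[of N] xy by (intro mult_left_mono mult_right_mono) auto
    also have "\<dots> = (exp (- fst z / 2) * (sqrt K * exp (- snd z / 2)))\<^sup>2"
      using K0 by (simp add: x_def power_mult_distrib power2_eq_square exp_add[symmetric] mult_ac)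
    finally have "s N * C (x / s N) (y / s N) \<le> exp (- fst z / 2) * (sqrt K * exp (- snd z / 2))"
      by (rule power2_le_imp_le) (use K0 in auto)
    then have "ennreal (s N * C (x / s N) (y / s N)) \<le> ennreal (exp (- fst z / 2) * (sqrt K * exp (- snd z / 2)))"
      by (rule ennreal_leI)
    also have "\<dots> = w z" using True K0 by (simp add: w_def ennreal_mult)
    finally show ?thesis unfolding Heq using True by (simp add: x_def y_def)
  qed (auto simp: Heq indicator_def)
  have wfin: "(\<integral>\<^sup>+ z. w z \<partial>(\<nu>1 \<Otimes>\<^sub>M \<nu>2)) < \<infinity>"
  proof -
    have "(\<integral>\<^sup>+ z. w z \<partial>(\<nu>1 \<Otimes>\<^sub>M \<nu>2)) = (\<integral>\<^sup>+ a. \<integral>\<^sup>+ b. w (a, b) \<partial>\<nu>2 \<partial>\<nu>1)"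
      by (rule n2.nn_integral_fst[symmetric, OF wm])
    also have "\<dots> = (\<integral>\<^sup>+ a. indicator {0..} a * ennreal (exp (- a / 2)) \<partial>\<nu>1) *
        (ennreal (sqrt K) * (\<integral>\<^sup>+ a. indicator {0..} a * ennreal (exp (- a / 2)) \<partial>\<nu>2))"
      unfolding w_def fst_conv snd_conv by (simp add: nn_integral_cmult nn_integral_multc)
    finally show ?thesis using fin by (simp add: ennreal_mult_less_top)
  qed
  have Hlim: "(\<lambda>N. H N z) \<longlonglongrightarrow> h z" for z
  proof -
    have "(\<lambda>N. s N * C (exp (- fst z) / s N) ((s N * exp (- t2 N)) * exp (- snd z) / s N)) \<longlonglongrightarrow>
        R (exp (- fst z)) (r * exp (- snd z))"
      using s(2) by (intro C_limit_sequentially s(1) tendsto_intros r(1)) (auto intro: less_imp_le)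
    then have "(\<lambda>N. ennreal (s N * C (exp (- fst z) / s N) ((s N * exp (- t2 N)) * exp (- snd z) / s N))) \<longlonglongrightarrow>
        ennreal (R (exp (- fst z)) (r * exp (- snd z)))"
      by (rule tendsto_ennrealI)
    then show ?thesis unfolding Heq h_def by (auto simp: indicator_def)
  qed
  have lim: "(\<lambda>N. \<integral>\<^sup>+ z. H N z \<partial>(\<nu>1 \<Otimes>\<^sub>M \<nu>2)) \<longlonglongrightarrow> (\<integral>\<^sup>+ z. h z \<partial>(\<nu>1 \<Otimes>\<^sub>M \<nu>2))"
    by (rule nn_integral_dominated_convergence[where w = w]) (use Hw Hlim wfin in auto)
  have heq: "(\<integral>\<^sup>+ z. h z \<partial>(\<nu>1 \<Otimes>\<^sub>M \<nu>2)) =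
      (\<integral>\<^sup>+ a. \<integral>\<^sup>+ b. indicator {0..} a * indicator {0..} b * ennreal (R (exp (- a)) (r * exp (- b))) \<partial>\<nu>2 \<partial>\<nu>1)"
  proof -
    have "(\<integral>\<^sup>+ z. h z \<partial>(\<nu>1 \<Otimes>\<^sub>M \<nu>2)) = (\<integral>\<^sup>+ a. \<integral>\<^sup>+ b. h (a, b) \<partial>\<nu>2 \<partial>\<nu>1)"
      by (rule n2.nn_integral_fst[symmetric, OF hm])
    then show ?thesis by (simp only: h_def fst_conv snd_conv)
  qed
  show "(\<lambda>N. ennreal (s N) * (\<integral>\<^sup>+ \<xi>. (\<integral>\<^sup>+ a. indicator {0..} a * indicator {t1 N + a<..} (e1 \<xi>) \<partial>\<nu>1) *
        (\<integral>\<^sup>+ b. indicator {0..} b * indicator {t2 N + b<..} (e2 \<xi>) \<partial>\<nu>2) \<partial>M))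
    \<longlonglongrightarrow> (\<integral>\<^sup>+ a. \<integral>\<^sup>+ b. indicator {0..} a * indicator {0..} b * ennreal (R (exp (- a)) (r * exp (- b))) \<partial>\<nu>2 \<partial>\<nu>1)"
    unfolding fub heq[symmetric] by (rule lim)
  have "h z \<le> w z" for z
    by (rule LIMSEQ_le_const2[OF Hlim]) (use Hw in auto)
  then have "(\<integral>\<^sup>+ z. h z \<partial>(\<nu>1 \<Otimes>\<^sub>M \<nu>2)) \<le> (\<integral>\<^sup>+ z. w z \<partial>(\<nu>1 \<Otimes>\<^sub>M \<nu>2))"
    by (intro nn_integral_mono) auto
  then show "(\<integral>\<^sup>+ a. \<integral>\<^sup>+ b. indicator {0..} a * indicator {0..} b * ennreal (R (exp (- a)) (r * exp (- b))) \<partial>\<nu>2 \<partial>\<nu>1) < \<infinity>"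
    unfolding heq[symmetric] using wfin by (rule order.strict_trans1)
qed

lemma excess_layer_cake:
  "(\<integral>\<^sup>+ a. indicator {0..} a * indicator {t + a<..} x \<partial>lborel) = ennreal (max 0 (x - t))"
  "(\<integral>\<^sup>+ a. indicator {0..} a * indicator {t + a<..} x \<partial>return borel 0) = ennreal (if t < x then 1 else 0)"
proof -
  have "(\<integral>\<^sup>+ a. indicator {0..} a * indicator {t + a<..} x \<partial>lborel) = (\<integral>\<^sup>+ a. indicator {0..<x - t} a \<partial>lborel)"
    by (intro nn_integral_cong) (auto simp: indicator_def)
  also have "\<dots> = emeasure lborel {0..<x - t}" by (rule nn_integral_indicator) simp
  also have "\<dots> = ennreal (max 0 (x - t))" by (cases "0 \<le> x - t") (auto simp: max_def)
  finally show "(\<integral>\<^sup>+ a. indicator {0..} a * indicator {t + a<..} x \<partial>lborel) = ennreal (max 0 (x - t))" .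
  have "(\<lambda>a. indicator {0..} a * indicator {t + a<..} x :: ennreal) \<in> borel_measurable borel"
    unfolding indicator_excess by measurable
  then show "(\<integral>\<^sup>+ a. indicator {0..} a * indicator {t + a<..} x \<partial>return borel 0) = ennreal (if t < x then 1 else 0)"
    by (subst nn_integral_return) (auto simp: indicator_def)
qed

text \<open>The product of two scores expands into four terms, excess or indicator in each
  coordinate, with limits \<open>J11\<close>, \<open>J10\<close>, \<open>J01\<close>,
  \<open>J00\<close>. By \<open>R_euler_identity\<close> the first is the sum of the next two, which
  enter with opposite sign, so only the joint exceedance probability \<open>J00 = R 1 r\<close> is
  left.\<close>

lemma hill_score_covariance_aux:
  fixes s t1 t2 :: "nat \<Rightarrow> real"
  assumes s: "filterlim s at_top sequentially" "\<And>N. 0 < s N" "\<And>N. exp (- t1 N) = 1 / s N"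
    and t: "\<And>N. 0 \<le> t1 N" "\<And>N. 0 \<le> t2 N"
    and r: "(\<lambda>N. s N * exp (- t2 N)) \<longlonglongrightarrow> r" "\<And>N. s N * exp (- t2 N) \<le> K" "0 < r"
  shows "(\<lambda>N. s N * expectation (\<lambda>\<xi>. hill_score (t1 N) (e1 \<xi>) * hill_score (t2 N) (e2 \<xi>))) \<longlonglongrightarrow> R 1 r"
proof -
  have [measurable]: "e1 \<in> borel_measurable M" "e2 \<in> borel_measurable M"
    using dist1 dist2 by (auto dest: distributed_measurable)
  define p1 p2 where "p1 N \<xi> = max 0 (e1 \<xi> - t1 N)" and "p2 N \<xi> = max 0 (e2 \<xi> - t2 N)" for N \<xi>
  define i1 i2 where "i1 N \<xi> = (if t1 N < e1 \<xi> then 1 else 0 :: real)"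
    and "i2 N \<xi> = (if t2 N < e2 \<xi> then 1 else 0 :: real)" for N \<xi>
  have nn: "0 \<le> p1 N \<xi>" "0 \<le> p2 N \<xi>" "0 \<le> i1 N \<xi>" "0 \<le> i2 N \<xi>" for N \<xi>
    by (auto simp: p1_def p2_def i1_def i2_def)
  have [measurable]: "p1 N \<in> borel_measurable M" "p2 N \<in> borel_measurable M"
      "i1 N \<in> borel_measurable M" "i2 N \<in> borel_measurable M" for N
    unfolding p1_def[abs_def] p2_def[abs_def] i1_def[abs_def] i2_def[abs_def] by measurable
  have sf: "sigma_finite_measure (lborel :: real measure)" ..
  have sr: "sigma_finite_measure (return borel (0 :: real))"
    by (intro prob_space_imp_sigma_finite prob_space_return) simp
  have fl: "(\<integral>\<^sup>+ a. indicator {0..} a * ennreal (exp (- a / 2)) \<partial>lborel) < \<infinity>"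
  proof -
    have "(\<integral>\<^sup>+ a. indicator {0..} a * ennreal (exp (- a / 2)) \<partial>lborel) =
        ennreal 2 * (\<integral>\<^sup>+ a. indicator {0..} (0 + 2 * a) * ennreal (exp (- (0 + 2 * a) / 2)) \<partial>lborel)"
      using nn_integral_real_affine[of "\<lambda>a. indicator {0..} a * ennreal (exp (- a / 2))" 2 0] by simp
    also have "(\<integral>\<^sup>+ a. indicator {0..} (0 + 2 * a) * ennreal (exp (- (0 + 2 * a) / 2)) \<partial>lborel) =
        (\<integral>\<^sup>+ a. ennreal (a ^ 0 * exp (- a)) * indicator {0..} a \<partial>lborel)"
      by (intro nn_integral_cong) (auto simp: indicator_def)
    also have "\<dots> = 1" using nn_intergal_power_times_exp_Ici[of 0] by simp
    finally show ?thesis by (simp add: ennreal_mult_less_top)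
  qed
  have fr: "(\<integral>\<^sup>+ a. indicator {0..} a * ennreal (exp (- a / 2)) \<partial>return borel 0) < \<infinity>"
    by (subst nn_integral_return) auto
  note sets_eq = sets_lborel sets_return[of borel "0::real"]
  define J11 where "J11 = (\<integral>\<^sup>+ a. \<integral>\<^sup>+ b. indicator {0..} a * indicator {0..} b * ennreal (R (exp (- a)) (r * exp (- b))) \<partial>lborel \<partial>lborel)"
  define J10 where "J10 = (\<integral>\<^sup>+ a. \<integral>\<^sup>+ b. indicator {0..} a * indicator {0..} b * ennreal (R (exp (- a)) (r * exp (- b))) \<partial>return borel 0 \<partial>lborel)"
  define J01 where "J01 = (\<integral>\<^sup>+ a. \<integral>\<^sup>+ b. indicator {0..} a * indicator {0..} b * ennreal (R (exp (- a)) (r * exp (- b))) \<partial>lborel \<partial>return borel 0)"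
  define J00 where "J00 = (\<integral>\<^sup>+ a. \<integral>\<^sup>+ b. indicator {0..} a * indicator {0..} b * ennreal (R (exp (- a)) (r * exp (- b))) \<partial>return borel 0 \<partial>return borel 0)"
  have l11: "(\<lambda>N. ennreal (s N) * (\<integral>\<^sup>+ \<xi>. ennreal (p1 N \<xi>) * ennreal (p2 N \<xi>) \<partial>M)) \<longlonglongrightarrow> J11" "J11 < \<infinity>"
    using joint_excess_limit[OF sf sf sets_eq(1) sets_eq(1) fl fl s t r(1,2)]
    unfolding excess_layer_cake p1_def p2_def J11_def by simp_all
  have l10: "(\<lambda>N. ennreal (s N) * (\<integral>\<^sup>+ \<xi>. ennreal (p1 N \<xi>) * ennreal (i2 N \<xi>) \<partial>M)) \<longlonglongrightarrow> J10" "J10 < \<infinity>"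
    using joint_excess_limit[OF sf sr sets_eq(1) sets_eq(2) fl fr s t r(1,2)]
    unfolding excess_layer_cake p1_def i2_def J10_def by simp_all
  have l01: "(\<lambda>N. ennreal (s N) * (\<integral>\<^sup>+ \<xi>. ennreal (i1 N \<xi>) * ennreal (p2 N \<xi>) \<partial>M)) \<longlonglongrightarrow> J01" "J01 < \<infinity>"
    using joint_excess_limit[OF sr sf sets_eq(2) sets_eq(1) fr fl s t r(1,2)]
    unfolding excess_layer_cake i1_def p2_def J01_def by simp_all
  have l00: "(\<lambda>N. ennreal (s N) * (\<integral>\<^sup>+ \<xi>. ennreal (i1 N \<xi>) * ennreal (i2 N \<xi>) \<partial>M)) \<longlonglongrightarrow> J00" "J00 < \<infinity>"
    using joint_excess_limit[OF sr sr sets_eq(2) sets_eq(2) fr fr s t r(1,2)]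
    unfolding excess_layer_cake i1_def i2_def J00_def by simp_all
  have m1: "(\<lambda>b. indicator {0..} a * indicator {0..} b * ennreal (R (exp (- a)) (r * exp (- b)))) \<in> borel_measurable borel" for a
  proof -
    have [measurable]: "(\<lambda>b. R (exp (- a)) (r * exp (- b))) \<in> borel_measurable borel"
      using r(3) by (intro R_measurable) auto
    show ?thesis by measurable
  qed
  have m2: "(\<lambda>a. indicator {0..} a * ennreal (R (exp (- a)) r)) \<in> borel_measurable borel"
  proof -
    have [measurable]: "(\<lambda>a. R (exp (- a)) r) \<in> borel_measurable borel"
      using r(3) by (intro R_measurable) auto
    show ?thesis by measurable
  qed
  have j10: "J10 = (\<integral>\<^sup>+ a. indicator {0..} a * ennreal (R (exp (- a)) (r * exp (- 0))) \<partial>lborel)"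
    unfolding J10_def using m1 by (subst nn_integral_return) auto
  have j01: "J01 = (\<integral>\<^sup>+ b. indicator {0..} b * ennreal (R (exp (- 0)) (r * exp (- b))) \<partial>lborel)"
  proof -
    have mz: "(\<lambda>z. indicator {0..} (fst z) * indicator {0..} (snd z) * ennreal (R (exp (- fst z)) (r * exp (- snd z)))) \<in> borel_measurable (borel \<Otimes>\<^sub>M lborel)"
    proof -
      have [measurable]: "(\<lambda>z. R (exp (- fst z)) (r * exp (- snd z))) \<in> borel_measurable (borel \<Otimes>\<^sub>M lborel)"
        using r(3) by (intro R_measurable) auto
      show ?thesis by measurable
    qed
    have "(\<lambda>a. \<integral>\<^sup>+ b. indicator {0..} a * indicator {0..} b * ennreal (R (exp (- a)) (r * exp (- b))) \<partial>lborel) \<in> borel_measurable borel"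
      using lborel.borel_measurable_nn_integral_fst[OF mz] by simp
    then show ?thesis unfolding J01_def by (subst nn_integral_return) auto
  qed
  have j00: "J00 = ennreal (R 1 r)"
  proof -
    have "(\<integral>\<^sup>+ b. indicator {0..} a * indicator {0..} b * ennreal (R (exp (- a)) (r * exp (- b))) \<partial>return borel 0) =
        indicator {0..} a * ennreal (R (exp (- a)) r)" for a
      using nn_integral_return[OF _ m1[of a], of 0] by simp
    then show ?thesis unfolding J00_def using nn_integral_return[OF _ m2, of 0] by simp
  qed
  have euler: "J11 = J10 + J01"
    unfolding j10 j01 J11_def using R_euler_identity[OF r(3)] by simp
  have mom: "integrable M (\<lambda>\<xi>. indicator {u<..} (e \<xi>) * (e \<xi> - u) ^ q)"
    if "distributed M lborel e (exponential_density 1)" "0 \<le> u" for e u q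
    using exponential_excess_moments[OF that] by (auto simp: has_bochner_integral_iff)
  have pow: "(max 0 (e - u))\<^sup>2 = indicator {u<..} e * (e - u) ^ 2"
    "(if u < e then 1 else 0)\<^sup>2 = indicator {u<..} e * (e - u) ^ 0" for e u :: real
    by (auto simp: indicator_def)
  have sqs: "integrable M (\<lambda>\<xi>. (p1 N \<xi>)\<^sup>2)" "integrable M (\<lambda>\<xi>. (p2 N \<xi>)\<^sup>2)"
    "integrable M (\<lambda>\<xi>. (i1 N \<xi>)\<^sup>2)" "integrable M (\<lambda>\<xi>. (i2 N \<xi>)\<^sup>2)" for N
    unfolding p1_def p2_def i1_def i2_def pow
    by (rule mom[OF dist1 t(1)] mom[OF dist2 t(2)])+
  have prod: "integrable M (\<lambda>\<xi>. f N \<xi> * g N \<xi>)" if "f \<in> {p1, i1}" "g \<in> {p2, i2}" for f g N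
    using that sqs[of N] by (auto intro!: integrable_mult_squares)
  have conv: "(\<lambda>N. s N * expectation (\<lambda>\<xi>. f N \<xi> * g N \<xi>)) \<longlonglongrightarrow> enn2real J"
    if "(\<lambda>N. ennreal (s N) * (\<integral>\<^sup>+ \<xi>. ennreal (f N \<xi>) * ennreal (g N \<xi>) \<partial>M)) \<longlonglongrightarrow> J" "J < \<infinity>"
      "f \<in> {p1, i1}" "g \<in> {p2, i2}" for f g J
  proof -
    have nnf: "0 \<le> f N \<xi>" "0 \<le> g N \<xi>" for N \<xi> using that(3,4) nn by auto
    have "ennreal (s N) * (\<integral>\<^sup>+ \<xi>. ennreal (f N \<xi>) * ennreal (g N \<xi>) \<partial>M) = ennreal (s N * expectation (\<lambda>\<xi>. f N \<xi> * g N \<xi>))" for N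
    proof -
      have "(\<integral>\<^sup>+ \<xi>. ennreal (f N \<xi>) * ennreal (g N \<xi>) \<partial>M) = (\<integral>\<^sup>+ \<xi>. ennreal (f N \<xi> * g N \<xi>) \<partial>M)"
        by (intro nn_integral_cong) (simp add: ennreal_mult nnf)
      also have "\<dots> = ennreal (expectation (\<lambda>\<xi>. f N \<xi> * g N \<xi>))"
        by (rule nn_integral_eq_integral[OF prod[OF that(3,4)]]) (simp add: nnf)
      finally show ?thesis by (simp only: ennreal_mult'[OF less_imp_le[OF s(2)]])
    qed
    moreover have "J = ennreal (enn2real J)" using that(2) by simp
    ultimately have "(\<lambda>N. ennreal (s N * expectation (\<lambda>\<xi>. f N \<xi> * g N \<xi>))) \<longlonglongrightarrow> ennreal (enn2real J)"
      using that(1) by simp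
    then show ?thesis
      by (rule tendsto_ennrealD) (use s(2) nnf in \<open>auto intro!: always_eventually mult_nonneg_nonneg less_imp_le[OF s(2)]\<close>)
  qed
  have eq: "s N * expectation (\<lambda>\<xi>. hill_score (t1 N) (e1 \<xi>) * hill_score (t2 N) (e2 \<xi>)) =
      s N * expectation (\<lambda>\<xi>. p1 N \<xi> * p2 N \<xi>) - s N * expectation (\<lambda>\<xi>. p1 N \<xi> * i2 N \<xi>)
      - s N * expectation (\<lambda>\<xi>. i1 N \<xi> * p2 N \<xi>) + s N * expectation (\<lambda>\<xi>. i1 N \<xi> * i2 N \<xi>)" for N
  proof -
    have "hill_score (t1 N) (e1 \<xi>) * hill_score (t2 N) (e2 \<xi>) =
        p1 N \<xi> * p2 N \<xi> - p1 N \<xi> * i2 N \<xi> - i1 N \<xi> * p2 N \<xi> + i1 N \<xi> * i2 N \<xi>" for \<xi>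
      unfolding hill_score_def p1_def p2_def i1_def i2_def by (simp add: algebra_simps)
    then have "expectation (\<lambda>\<xi>. hill_score (t1 N) (e1 \<xi>) * hill_score (t2 N) (e2 \<xi>)) =
        expectation (\<lambda>\<xi>. p1 N \<xi> * p2 N \<xi> - p1 N \<xi> * i2 N \<xi> - i1 N \<xi> * p2 N \<xi> + i1 N \<xi> * i2 N \<xi>)"
      by simp
    also have "\<dots> = expectation (\<lambda>\<xi>. p1 N \<xi> * p2 N \<xi>) - expectation (\<lambda>\<xi>. p1 N \<xi> * i2 N \<xi>)
        - expectation (\<lambda>\<xi>. i1 N \<xi> * p2 N \<xi>) + expectation (\<lambda>\<xi>. i1 N \<xi> * i2 N \<xi>)"
      using prod[of p1 p2 N] prod[of p1 i2 N] prod[of i1 p2 N] prod[of i1 i2 N] by simp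
    finally show ?thesis by (simp only: right_diff_distrib distrib_left)
  qed
  have "(\<lambda>N. s N * expectation (\<lambda>\<xi>. p1 N \<xi> * p2 N \<xi>) - s N * expectation (\<lambda>\<xi>. p1 N \<xi> * i2 N \<xi>)
      - s N * expectation (\<lambda>\<xi>. i1 N \<xi> * p2 N \<xi>) + s N * expectation (\<lambda>\<xi>. i1 N \<xi> * i2 N \<xi>)) \<longlonglongrightarrow>
      enn2real J11 - enn2real J10 - enn2real J01 + enn2real J00"
    by (intro tendsto_add tendsto_diff conv l11 l10 l01 l00) auto
  moreover have "enn2real J11 = enn2real J10 + enn2real J01"
    unfolding euler using l10(2) l01(2) by (intro enn2real_plus) auto
  moreover have "enn2real J00 = R 1 r" unfolding j00 using R_bounds(1)[of 1 r] r(3) by simp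
  ultimately show ?thesis unfolding eq by simp
qed

text \<open>Eventual hypotheses reduce to the previous lemma by shifting the sequences past a finite
  stage.\<close>

lemma hill_score_covariance:
  fixes s t1 t2 :: "nat \<Rightarrow> real"
  assumes s: "filterlim s at_top sequentially" "\<forall>\<^sub>F N in sequentially. exp (- t1 N) = 1 / s N"
    and t: "\<forall>\<^sub>F N in sequentially. 0 \<le> t1 N" "\<forall>\<^sub>F N in sequentially. 0 \<le> t2 N"
    and r: "(\<lambda>N. s N * exp (- t2 N)) \<longlonglongrightarrow> r" "0 < r"
  shows "(\<lambda>N. s N * expectation (\<lambda>\<xi>. hill_score (t1 N) (e1 \<xi>) * hill_score (t2 N) (e2 \<xi>))) \<longlonglongrightarrow> R 1 r"
proof -
  have "\<forall>\<^sub>F N in sequentially. 0 < s N" using s(1) by (simp add: filterlim_at_top_dense)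
  moreover have "\<forall>\<^sub>F N in sequentially. s N * exp (- t2 N) < r + 1"
    by (rule order_tendstoD(2)[OF r(1)]) simp
  ultimately have "\<forall>\<^sub>F N in sequentially. 0 < s N \<and> exp (- t1 N) = 1 / s N \<and> 0 \<le> t1 N \<and> 0 \<le> t2 N \<and> s N * exp (- t2 N) \<le> r + 1"
    using s(2) t by eventually_elim simp
  then obtain N0 where N0: "\<And>N. N0 \<le> N \<Longrightarrow> 0 < s N \<and> exp (- t1 N) = 1 / s N \<and> 0 \<le> t1 N \<and> 0 \<le> t2 N \<and> s N * exp (- t2 N) \<le> r + 1"
    unfolding eventually_sequentially by blast
  have "filterlim (\<lambda>N. s (N + N0)) at_top sequentially"
    by (rule filterlim_compose[OF s(1) filterlim_add_const_nat_at_top])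
  then have "(\<lambda>N. s (N + N0) * expectation (\<lambda>\<xi>. hill_score (t1 (N + N0)) (e1 \<xi>) * hill_score (t2 (N + N0)) (e2 \<xi>))) \<longlonglongrightarrow> R 1 r"
    using N0 LIMSEQ_ignore_initial_segment[OF r(1), of N0] r(2)
    by (intro hill_score_covariance_aux[where K = "r + 1"]) auto
  then show ?thesis by (rule LIMSEQ_offset)
qed

end

section \<open>Generalised least squares\<close>

lemma matrix_inv_works:
  fixes A :: "real ^ 'm ^ 'm"
  assumes "invertible A"
  shows "A ** matrix_inv A = mat 1" "matrix_inv A ** A = mat 1"
  using someI_ex[OF assms[unfolded invertible_def]] by (auto simp: matrix_inv_def)

lemma matrix_inv_vector:
  fixes A :: "real ^ 'm ^ 'm"
  assumes "invertible A"
  shows "A *v (matrix_inv A *v x) = x" "matrix_inv A *v (A *v x) = x"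
  using matrix_inv_works[OF assms] by (simp_all add: matrix_vector_mul_assoc)

text \<open>Cramer's rule makes the entries of the inverse rational functions of the entries of the
  matrix, which settles both continuity and measurability of \<open>matrix_inv\<close>.\<close>

lemma matrix_inv_component:
  fixes A :: "real ^ 'm ^ 'm"
  assumes "det A \<noteq> 0"
  shows "matrix_inv A $ i $ j = det (\<chi> a b. if b = i then axis j 1 $ a else A $ a $ b) / det A"
proof -
  have "invertible A" using assms by (simp add: invertible_det_nz)
  then have "A *v (matrix_inv A *v axis j 1) = axis j 1" by (rule matrix_inv_vector)
  then have "matrix_inv A *v axis j 1 = (\<chi> k. det (\<chi> a b. if b = k then axis j 1 $ a else A $ a $ b) / det A)"
    using cramer[OF assms] by blast
  moreover have "(matrix_inv A *v axis j 1) $ i = matrix_inv A $ i $ j"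
    by (simp add: matrix_vector_mul_component inner_axis)
  ultimately show ?thesis by simp
qed

lemma tendsto_det:
  fixes A :: "'b \<Rightarrow> real ^ 'm ^ 'm"
  assumes "\<And>i j. ((\<lambda>z. A z $ i $ j) \<longlongrightarrow> A0 $ i $ j) F"
  shows "((\<lambda>z. det (A z)) \<longlongrightarrow> det A0) F"
  unfolding det_def by (intro tendsto_sum tendsto_mult tendsto_prod tendsto_const assms)

lemma tendsto_matrix_inv:
  fixes A :: "'b \<Rightarrow> real ^ 'm ^ 'm"
  assumes A: "(A \<longlongrightarrow> A0) F" and A0: "invertible A0"
  shows "((\<lambda>z. matrix_inv (A z)) \<longlongrightarrow> matrix_inv A0) F"
proof (intro vec_tendstoI)
  fix i j
  have comp: "((\<lambda>z. A z $ i $ j) \<longlongrightarrow> A0 $ i $ j) F" for i j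
    by (intro tendsto_vec_nth A)
  have d0: "det A0 \<noteq> 0" using A0 by (simp add: invertible_det_nz)
  have "((\<lambda>z. det (\<chi> a b. if b = i then axis j 1 $ a else A z $ a $ b) / det (A z)) \<longlongrightarrow>
      det (\<chi> a b. if b = i then axis j 1 $ a else A0 $ a $ b) / det A0) F"
    by (intro tendsto_divide tendsto_det comp d0) (auto intro: comp)
  then show "((\<lambda>z. matrix_inv (A z) $ i $ j) \<longlongrightarrow> matrix_inv A0 $ i $ j) F"
    unfolding matrix_inv_component[OF d0]
  proof (rule Lim_transform_eventually)
    have "\<forall>\<^sub>F z in F. det (A z) \<noteq> 0"
      using tendsto_imp_eventually_ne[OF tendsto_det[OF comp] d0] .
    then show "\<forall>\<^sub>F z in F. det (\<chi> a b. if b = i then axis j 1 $ a else A z $ a $ b) / det (A z) = matrix_inv (A z) $ i $ j"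
      by eventually_elim (simp add: matrix_inv_component)
  qed
qed

lemma borel_measurable_det:
  fixes A :: "'a \<Rightarrow> real ^ 'm ^ 'm"
  assumes [measurable]: "\<And>i j. (\<lambda>\<xi>. A \<xi> $ i $ j) \<in> borel_measurable M"
  shows "(\<lambda>\<xi>. det (A \<xi>)) \<in> borel_measurable M"
  unfolding det_def by measurable

lemma borel_measurable_matrix_inv:
  fixes A :: "'a \<Rightarrow> real ^ 'm ^ 'm"
  assumes [measurable]: "\<And>i j. (\<lambda>\<xi>. A \<xi> $ i $ j) \<in> borel_measurable M"
  shows "(\<lambda>\<xi>. matrix_inv (A \<xi>) $ i $ j) \<in> borel_measurable M"
proof -
  \<comment> \<open>For a singular matrix the predicate under the choice operator is empty, so
    \<open>matrix_inv\<close> takes one fixed default value.\<close>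
  have sing: "matrix_inv B = (SOME A'. False)" if "det B = 0" for B :: "real ^ 'm ^ 'm"
  proof -
    have "\<not> invertible B" using that by (simp add: invertible_det_nz)
    then have "(\<lambda>A'. B ** A' = mat 1 \<and> A' ** B = mat 1) = (\<lambda>A'. False)"
      by (auto simp: invertible_def)
    then show ?thesis by (simp add: matrix_inv_def)
  qed
  have eq: "matrix_inv (A \<xi>) $ i $ j = (if det (A \<xi>) = 0 then (SOME A'. False) $ i $ j
      else det (\<chi> a b. if b = i then axis j 1 $ a else A \<xi> $ a $ b) / det (A \<xi>))" for \<xi>
    by (simp add: sing matrix_inv_component)
  have [measurable]: "(\<lambda>\<xi>. det (A \<xi>)) \<in> borel_measurable M"
    by (rule borel_measurable_det) measurable
  have [measurable]: "(\<lambda>\<xi>. det (\<chi> a b. if b = i then axis j 1 $ a else A \<xi> $ a $ b)) \<in> borel_measurable M"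
  proof (rule borel_measurable_det)
    fix a b
    show "(\<lambda>\<xi>. (\<chi> a b. if b = i then axis j 1 $ a else A \<xi> $ a $ b) $ a $ b) \<in> borel_measurable M"
      by (cases "b = i") simp_all
  qed
  show ?thesis unfolding eq by measurable
qed

lemma tendsto_matrix_vector_mult:
  fixes A :: "'b \<Rightarrow> real ^ 'm ^ 'm"
  assumes "(A \<longlongrightarrow> A0) F" "(x \<longlongrightarrow> x0) F"
  shows "((\<lambda>z. A z *v x z) \<longlongrightarrow> A0 *v x0) F"
  by (rule vec_tendstoI) (auto simp: matrix_vector_mult_def intro!: tendsto_intros assms)

text \<open>The residual sum of squares of the generalised least squares fit of a constant, with
  error covariance \<open>V\<close>.\<close>

definition gls :: "real ^ 'm ^ 'm \<Rightarrow> real ^ 'm \<Rightarrow> real" where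
  "gls V x = (let W = matrix_inv V; z = (1 \<bullet> (W *v x)) / (1 \<bullet> (W *v 1)); D = x - z *\<^sub>R 1
     in D \<bullet> (W *v D))"

text \<open>A shift along the vector of ones is absorbed by the fitted constant. This removes the
  unknown common centre of the log-quantile estimates and lets the normalisation move in and out of
  the form.\<close>

lemma gls_affine:
  assumes "1 \<bullet> (matrix_inv V *v 1) \<noteq> 0"
  shows "gls V (a *\<^sub>R 1 + s *\<^sub>R x) = s\<^sup>2 * gls V x"
proof -
  let ?W = "matrix_inv V"
  have "(1 \<bullet> (?W *v (a *\<^sub>R 1 + s *\<^sub>R x))) / (1 \<bullet> (?W *v 1)) = a + s * ((1 \<bullet> (?W *v x)) / (1 \<bullet> (?W *v 1)))"
    using assms by (simp add: matrix_vector_right_distrib matrix_vector_mult_scaleR inner_add_right add_divide_distrib)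
  then have "(a *\<^sub>R 1 + s *\<^sub>R x) - ((1 \<bullet> (?W *v (a *\<^sub>R 1 + s *\<^sub>R x))) / (1 \<bullet> (?W *v 1))) *\<^sub>R 1 =
      s *\<^sub>R (x - ((1 \<bullet> (?W *v x)) / (1 \<bullet> (?W *v 1))) *\<^sub>R 1)"
    by (simp add: algebra_simps)
  then show ?thesis
    by (simp add: gls_def Let_def matrix_vector_mult_scaleR power2_eq_square)
qed

lemma tendsto_gls:
  assumes V: "(V \<longlongrightarrow> V0) F" and x: "(x \<longlongrightarrow> x0) F"
    and V0: "invertible V0" "1 \<bullet> (matrix_inv V0 *v 1) \<noteq> 0"
  shows "((\<lambda>z. gls (V z) (x z)) \<longlongrightarrow> gls V0 x0) F"
  unfolding gls_def Let_def
  by (intro tendsto_inner tendsto_matrix_vector_mult tendsto_matrix_inv tendsto_diff tendsto_scaleR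
      tendsto_divide tendsto_const V x V0)

lemma borel_measurable_gls:
  fixes V :: "'a \<Rightarrow> real ^ 'm ^ 'm"
  assumes [measurable]: "\<And>i j. (\<lambda>\<xi>. V \<xi> $ i $ j) \<in> borel_measurable M" "\<And>i. (\<lambda>\<xi>. x \<xi> $ i) \<in> borel_measurable M"
  shows "(\<lambda>\<xi>. gls (V \<xi>) (x \<xi>)) \<in> borel_measurable M"
proof -
  have [measurable]: "(\<lambda>\<xi>. matrix_inv (V \<xi>) $ i $ j) \<in> borel_measurable M" for i j
    by (rule borel_measurable_matrix_inv) measurable
  show ?thesis
    unfolding gls_def Let_def inner_vec_def matrix_vector_mult_def by simp
qed

section \<open>Positive definite forms and orthonormal systems\<close>

lemma positive_definite_symmetric:
  assumes "positive_definite V"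
  shows "x \<bullet> (V *v y) = y \<bullet> (V *v x)"
  using assms dot_lmul_matrix[of x V y]
  by (simp add: positive_definite_def inner_commute transpose_matrix_vector[symmetric])

lemma positive_definite_invertible:
  assumes "positive_definite (V :: real ^ 'm ^ 'm)"
  shows "invertible V"
proof -
  have "\<forall>x. V *v x = 0 \<longrightarrow> x = 0"
  proof safe
    fix x assume "V *v x = 0"
    then have "x \<bullet> (V *v x) = 0" by simp
    then show "x = 0" using assms unfolding positive_definite_def by force
  qed
  then show ?thesis
    by (simp add: invertible_left_inverse matrix_left_invertible_ker)
qed

lemma positive_definite_inverse:
  assumes "positive_definite (V :: real ^ 'm ^ 'm)" and x: "x \<noteq> 0"
  shows "0 < x \<bullet> (matrix_inv V *v x)"
proof -
  let ?y = "matrix_inv V *v x"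
  have Vy: "V *v ?y = x" by (rule matrix_inv_vector[OF positive_definite_invertible[OF assms(1)]])
  then have "?y \<noteq> 0" using x by auto
  then have "0 < ?y \<bullet> (V *v ?y)" using assms(1) unfolding positive_definite_def by blast
  then show ?thesis unfolding Vy by (simp add: inner_commute)
qed

lemma one_vec_nonzero: "(1 :: real ^ 'm) \<noteq> 0"
  by (simp add: vec_eq_iff)

lemma gls_pos:
  assumes "positive_definite V" and "x $ i \<noteq> x $ j"
  shows "0 < gls V x"
proof -
  define z where "z = (1 \<bullet> (matrix_inv V *v x)) / (1 \<bullet> (matrix_inv V *v 1))"
  have "x - z *\<^sub>R 1 \<noteq> 0"
  proof
    assume "x - z *\<^sub>R 1 = 0"
    then have "x = z *\<^sub>R 1" by simp
    then show False using assms(2) by simp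
  qed
  from positive_definite_inverse[OF assms(1) this] show ?thesis
    by (simp add: gls_def Let_def z_def)
qed

text \<open>Gram-Schmidt for the inner product \<open>x \<bullet> (V *v y)\<close> inside
  \<open>S\<close>. Independence and cardinality are carried through the induction so that a
  dimension count yields a vector of \<open>S\<close> outside the current span.\<close>

lemma orthonormal_system:
  fixes V :: "real ^ 'm ^ 'm"
  assumes V: "positive_definite V" and S: "subspace S"
  shows "d \<le> dim S \<Longrightarrow> \<exists>v :: nat \<Rightarrow> real ^ 'm. (\<forall>r<d. v r \<in> S) \<and>
    (\<forall>r<d. \<forall>s<d. v r \<bullet> (V *v v s) = (if r = s then 1 else 0)) \<and>
    independent (v ` {..<d}) \<and> card (v ` {..<d}) = d"
proof (induction d)
  case 0
  show ?case by (auto simp: independent_empty)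
next
  case (Suc d)
  then obtain v :: "nat \<Rightarrow> real ^ 'm" where v: "\<And>r. r < d \<Longrightarrow> v r \<in> S"
    "\<And>r s. r < d \<Longrightarrow> s < d \<Longrightarrow> v r \<bullet> (V *v v s) = (if r = s then 1 else 0)"
    "independent (v ` {..<d})" "card (v ` {..<d}) = d" by auto
  have "\<not> S \<subseteq> span (v ` {..<d})"
  proof
    assume "S \<subseteq> span (v ` {..<d})"
    then have "dim S \<le> card (v ` {..<d})" by (intro dim_le_card) auto
    then show False using v(4) Suc.prems by simp
  qed
  then obtain y where y: "y \<in> S" "y \<notin> span (v ` {..<d})" by blast
  define p where "p = (\<Sum>r<d. (v r \<bullet> (V *v y)) *\<^sub>R v r)"
  define u where "u = y - p"
  have ps: "p \<in> span (v ` {..<d})"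
    unfolding p_def by (intro span_sum span_scale span_base) auto
  have pS: "p \<in> S" unfolding p_def by (intro subspace_sum[OF S] subspace_scale[OF S] v(1)) auto
  have us: "u \<notin> span (v ` {..<d})"
    using span_add[OF _ ps, of u] y(2) by (auto simp: u_def)
  have uS: "u \<in> S" unfolding u_def by (intro subspace_diff[OF S] y(1) pS)
  have "u \<noteq> 0" using us span_zero by blast
  then have pos: "0 < u \<bullet> (V *v u)" using V unfolding positive_definite_def by blast
  have orth: "v s \<bullet> (V *v u) = 0" if s: "s < d" for s
  proof -
    have "v s \<bullet> (V *v p) = (\<Sum>r<d. (v r \<bullet> (V *v y)) * (v s \<bullet> (V *v v r)))"
      unfolding p_def by (simp add: linear_sum[OF matrix_vector_mul_linear] inner_sum_right matrix_vector_mult_scaleR)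
    also have "\<dots> = (\<Sum>r<d. if r = s then v s \<bullet> (V *v y) else 0)"
      using v(2)[OF s] by (intro sum.cong) auto
    also have "\<dots> = v s \<bullet> (V *v y)" using s by simp
    finally show ?thesis by (simp add: u_def matrix_vector_mult_diff_distrib inner_diff_right)
  qed
  define c where "c = 1 / sqrt (u \<bullet> (V *v u))"
  have c: "c \<noteq> 0" "c * c * (u \<bullet> (V *v u)) = 1" using pos by (auto simp: c_def)
  define v' where "v' = v(d := c *\<^sub>R u)"
  have v'd: "v' d = c *\<^sub>R u" and v'r: "\<And>r. r < d \<Longrightarrow> v' r = v r" by (auto simp: v'_def)
  have img: "v' ` {..<Suc d} = insert (c *\<^sub>R u) (v ` {..<d})"
    by (auto simp: lessThan_Suc v'd v'r image_iff)
  have cu: "c *\<^sub>R u \<notin> span (v ` {..<d})"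
  proof
    assume "c *\<^sub>R u \<in> span (v ` {..<d})"
    from span_scale[OF this, of "1 / c"] show False using c(1) us by simp
  qed
  show ?case
  proof (intro exI[of _ v'] conjI allI impI)
    show "v' r \<in> S" if "r < Suc d" for r
      using that uS v(1) by (auto simp: less_Suc_eq v'd v'r intro!: subspace_scale[OF S])
    show "v' r \<bullet> (V *v v' s) = (if r = s then 1 else 0)" if "r < Suc d" "s < Suc d" for r s
    proof -
      consider "r < d" "s < d" | "r < d" "s = d" | "r = d" "s < d" | "r = d" "s = d"
        using \<open>r < Suc d\<close> \<open>s < Suc d\<close> by (auto simp: less_Suc_eq)
      then show ?thesis
      proof cases
        case 1
        then show ?thesis using v(2) by (simp add: v'r)
      next
        case 2
        then show ?thesis using orth by (simp add: v'd v'r matrix_vector_mult_scaleR)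
      next
        case 3
        have "u \<bullet> (V *v v s) = 0" using orth[OF 3(2)] positive_definite_symmetric[OF V, of u "v s"] by simp
        then show ?thesis using 3 by (simp add: v'd v'r)
      next
        case 4
        then show ?thesis using c(2) by (simp add: v'd matrix_vector_mult_scaleR mult.assoc)
      qed
    qed
    show "independent (v' ` {..<Suc d})" unfolding img by (rule independent_insertI[OF cu v(3)])
    have "c *\<^sub>R u \<notin> v ` {..<d}" using cu span_base[of "c *\<^sub>R u" "v ` {..<d}"] by (rule contrapos_nn)
    then show "card (v' ` {..<Suc d}) = Suc d" unfolding img using v(4) by simp
  qed
qed

text \<open>Parseval's identity in the hyperplane orthogonal to the vector of ones. The weighted
  residual \<open>?W *v D\<close> lies there by the choice of the fitted constant, and its
  coefficients in a \<open>V\<close>-orthonormal basis are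
  \<open>v r \<bullet> D = v r \<bullet> x\<close>. Orthonormality with respect to \<open>V\<close>
  also makes the forms \<open>v r \<bullet> x\<close> uncorrelated with unit variance when
  \<open>x\<close> has covariance \<open>V\<close>.\<close>

lemma gls_sum_squares:
  fixes V :: "real ^ 'm ^ 'm"
  assumes V: "positive_definite V"
  shows "\<exists>v :: nat \<Rightarrow> real ^ 'm.
    (\<forall>r<CARD('m) - 1. \<forall>s<CARD('m) - 1. v r \<bullet> (V *v v s) = (if r = s then 1 else 0)) \<and>
    (\<forall>x. gls V x = (\<Sum>r<CARD('m) - 1. (v r \<bullet> x)\<^sup>2))"
proof -
  define d where "d = CARD('m) - 1"
  define S where "S = {x :: real ^ 'm. 1 \<bullet> x = 0}"
  have S: "subspace S" unfolding S_def by (rule subspace_hyperplane)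
  have dimS: "dim S = d" using dim_hyperplane[OF one_vec_nonzero] by (simp add: S_def d_def)
  obtain v :: "nat \<Rightarrow> real ^ 'm" where v: "\<And>r. r < d \<Longrightarrow> v r \<in> S"
    "\<And>r s. r < d \<Longrightarrow> s < d \<Longrightarrow> v r \<bullet> (V *v v s) = (if r = s then 1 else 0)"
    "independent (v ` {..<d})" "card (v ` {..<d}) = d"
    using orthonormal_system[OF V S, of d] dimS by auto
  have spanS: "S \<subseteq> span (v ` {..<d})"
    using v dimS by (intro card_ge_dim_independent) auto
  let ?W = "matrix_inv V"
  have inv: "invertible V" by (rule positive_definite_invertible[OF V])
  have w1: "1 \<bullet> (?W *v 1) \<noteq> 0" using positive_definite_inverse[OF V one_vec_nonzero] by simp
  have "gls V x = (\<Sum>r<d. (v r \<bullet> x)\<^sup>2)" for x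
  proof -
    define z where "z = (1 \<bullet> (?W *v x)) / (1 \<bullet> (?W *v 1))"
    define D where "D = x - z *\<^sub>R 1"
    have "1 \<bullet> (?W *v D) = 0"
      using w1 by (simp add: D_def z_def matrix_vector_mult_diff_distrib matrix_vector_mult_scaleR inner_diff_right)
    then have WS: "?W *v D \<in> S" by (simp add: S_def)
    \<comment> \<open>The error of the expansion: it lies in the span of the basis and is
      \<open>V\<close>-orthogonal to it, hence zero.\<close>
    define u where "u = ?W *v D - (\<Sum>r<d. (v r \<bullet> D) *\<^sub>R v r)"
    have uS: "u \<in> S" unfolding u_def
      by (intro subspace_diff[OF S] WS subspace_sum[OF S] subspace_scale[OF S] v(1)) auto
    have orth: "v s \<bullet> (V *v u) = 0" if s: "s < d" for s
    proof -
      have "v s \<bullet> (V *v (\<Sum>r<d. (v r \<bullet> D) *\<^sub>R v r)) = (\<Sum>r<d. (v r \<bullet> D) * (v s \<bullet> (V *v v r)))"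
        by (simp add: linear_sum[OF matrix_vector_mul_linear] inner_sum_right matrix_vector_mult_scaleR)
      also have "\<dots> = (\<Sum>r<d. if r = s then v s \<bullet> D else 0)"
        using v(2)[OF s] by (intro sum.cong) auto
      also have "\<dots> = v s \<bullet> D" using s by simp
      finally show ?thesis
        by (simp add: u_def matrix_vector_mult_diff_distrib inner_diff_right matrix_inv_vector[OF inv])
    qed
    have "y \<bullet> (V *v u) = 0" if "y \<in> span (v ` {..<d})" for y
      using that
    proof (induction rule: span_induct)
      case base
      show ?case by (auto simp: subspace_def inner_add_left)
    next
      case (step y)
      then show ?case using orth by auto
    qed
    then have "u \<bullet> (V *v u) = 0" using uS spanS by blast
    then have "u = 0" using V unfolding positive_definite_def by force
    then have WD: "?W *v D = (\<Sum>r<d. (v r \<bullet> D) *\<^sub>R v r)" by (simp add: u_def)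
    have vD: "v r \<bullet> D = v r \<bullet> x" if "r < d" for r
    proof -
      have "v r \<bullet> 1 = 0" using v(1)[OF that] by (simp add: S_def inner_commute)
      then show ?thesis by (simp add: D_def inner_diff_right)
    qed
    have "gls V x = D \<bullet> (?W *v D)" by (simp add: gls_def Let_def D_def z_def)
    also have "\<dots> = (\<Sum>r<d. (v r \<bullet> D) * (v r \<bullet> D))"
      unfolding WD by (simp add: inner_sum_right inner_commute)
    also have "\<dots> = (\<Sum>r<d. (v r \<bullet> x)\<^sup>2)" using vD by (simp add: power2_eq_square)
    finally show ?thesis .
  qed
  then show ?thesis using v(2) unfolding d_def[symmetric] by blast
qed

lemma L_stat_eq_gls:
  "L_stat x n k p = real (total k) / (ln (real (total k) / (real (total n) * p)))\<^sup>2 *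
    gls (V_bar x n k) (\<chi> j. ln (weissman_at x n k p j))"
  by (simp add: L_stat_def gls_def Let_def)

section \<open>Consistency of the tail copula estimator\<close>

lemma borel_measurable_nth: "(\<lambda>x :: real ^ 'm. x $ i) \<in> borel_measurable borel"
  by (intro borel_measurable_continuous_onI continuous_on_component continuous_on_id)

text \<open>The quantity \<open>n + 1 - rank\<close> is the number of observations strictly above
  \<open>x i\<close>, plus one for \<open>x i\<close> itself. If \<open>w i \<le> \<rho>\<close>,
  all of these points are counted by \<open>w l \<le> \<rho>\<close>; if not, every counted point
  lies strictly above. Ties cause no difficulty, as only weak antitonicity of \<open>w\<close> in
  \<open>x\<close> is involved.\<close>

lemma rank_condition:
  fixes x w :: "nat \<Rightarrow> real"
  assumes w: "\<And>i l. x i \<le> x l \<Longrightarrow> w l \<le> w i" and i: "i \<in> {1..n}"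
  shows "w i \<le> \<rho> \<Longrightarrow> real (card {l \<in> {1..n}. w l \<le> \<rho>}) \<le> K \<Longrightarrow> real n + 1 - real (rank_of x n i) \<le> K"
    and "real n + 1 - real (rank_of x n i) \<le> K \<Longrightarrow> K \<le> real (card {l \<in> {1..n}. w l \<le> \<rho>}) \<Longrightarrow> w i \<le> \<rho>"
proof -
  let ?above = "{l \<in> {1..n}. x i < x l}"
  have eq: "{l \<in> {1..n}. x l \<le> x i} \<union> ?above = {1..n}" by auto
  have "card ({l \<in> {1..n}. x l \<le> x i} \<union> ?above) = card {l \<in> {1..n}. x l \<le> x i} + card ?above"
    by (rule card_Un_disjoint) auto
  then have "card {1..n} = rank_of x n i + card ?above" unfolding eq rank_of_def .
  then have rank: "real n - real (rank_of x n i) = real (card ?above)" by simp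
  {
    assume *: "w i \<le> \<rho>" "real (card {l \<in> {1..n}. w l \<le> \<rho>}) \<le> K"
    have "insert i ?above \<subseteq> {l \<in> {1..n}. w l \<le> \<rho>}"
    proof
      fix l assume "l \<in> insert i ?above"
      then have "l \<in> {1..n}" "w l \<le> w i" using i w[of i l] by auto
      then show "l \<in> {l \<in> {1..n}. w l \<le> \<rho>}" using *(1) by simp
    qed
    then have "card (insert i ?above) \<le> card {l \<in> {1..n}. w l \<le> \<rho>}" by (intro card_mono) auto
    then have "real (card ?above) + 1 \<le> K" using *(2) by simp
    then show "real n + 1 - real (rank_of x n i) \<le> K" using rank by simp
  }
  {
    assume *: "real n + 1 - real (rank_of x n i) \<le> K" "K \<le> real (card {l \<in> {1..n}. w l \<le> \<rho>})"
    show "w i \<le> \<rho>"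
    proof (rule ccontr)
      assume "\<not> w i \<le> \<rho>"
      have "{l \<in> {1..n}. w l \<le> \<rho>} \<subseteq> ?above"
      proof
        fix l assume l: "l \<in> {l \<in> {1..n}. w l \<le> \<rho>}"
        with \<open>\<not> w i \<le> \<rho>\<close> have "\<not> w i \<le> w l" by simp
        then have "\<not> x l \<le> x i" using w by blast
        then show "l \<in> ?above" using l by simp
      qed
      then have "card {l \<in> {1..n}. w l \<le> \<rho>} \<le> card ?above" by (intro card_mono) auto
      then show False using * rank by simp
    qed
  }
qed

context prob_space begin

text \<open>The sets \<open>B N\<close> may shrink so that about \<open>c * k\<close> out of
  \<open>n\<close> points fall into them; the normalised count then has variance of order
  \<open>1 / k\<close>.\<close>

lemma count_law_of_large_numbers:
  fixes D :: "nat \<Rightarrow> 'a \<Rightarrow> 'b"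
  assumes ind: "indep_vars (\<lambda>_. L) D {1..}"
    and B: "\<And>N. B N \<in> sets L" and p: "\<And>i N. 1 \<le> i \<Longrightarrow> prob {\<xi> \<in> space M. D i \<xi> \<in> B N} = pr N"
    and k: "filterlim k at_top sequentially"
    and lim: "(\<lambda>N. real (n N) * pr N / real (k N)) \<longlonglongrightarrow> c"
  shows "((\<lambda>z. real (card {i \<in> {1..n (fst z)}. D i (snd z) \<in> B (fst z)}) / real (k (fst z))) \<longlongrightarrow> c) high_prob"
proof -
  define X where "X N i \<xi> = (indicator (B N) (D i \<xi>) / real (k N) :: real)" for N i \<xi>
  have ind': "indep_vars (\<lambda>_. L) D {1..n N}" for N by (rule indep_vars_subset[OF ind]) auto
  have indX: "indep_vars (\<lambda>_. borel) (X N) {1..n N}" for N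
    unfolding X_def[abs_def]
    by (rule indep_vars_compose2[OF ind', where Y = "\<lambda>i x. indicator (B N) x / real (k N)"]) (use B in measurable)
  have ev: "{\<xi> \<in> space M. D i \<xi> \<in> B N} \<in> events" if "1 \<le> i" for i N
  proof -
    have "D i \<in> measurable M L" using ind that by (simp add: indep_vars_def)
    from measurable_sets[OF this B[of N]] show ?thesis by (simp add: vimage_def Int_def conj_commute)
  qed
  have ind_int: "has_bochner_integral M (\<lambda>\<xi>. indicator (B N) (D i \<xi>) :: real) (pr N)" if "1 \<le> i" for i N
  proof -
    have "has_bochner_integral M (indicator {\<xi> \<in> space M. D i \<xi> \<in> B N} :: _ \<Rightarrow> real) (pr N)"
      using has_bochner_integral_real_indicator[OF ev[OF that], of N] p[OF that]
      by (simp add: emeasure_eq_measure)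
    then show ?thesis
      by (rule has_bochner_integral_cong[THEN iffD1, rotated -1]) (auto simp: indicator_def)
  qed
  have E1: "expectation (X N i) = pr N / real (k N)" if "i \<in> {1..n N}" for N i
    using has_bochner_integral_integral_eq[OF ind_int[of i N]] that by (simp add: X_def[abs_def])
  have sq: "(X N i \<xi>)\<^sup>2 = indicator (B N) (D i \<xi>) / (real (k N))\<^sup>2" for N i \<xi>
    by (auto simp: X_def indicator_def power_divide)
  have E2: "expectation (\<lambda>\<xi>. (X N i \<xi>)\<^sup>2) = pr N / (real (k N))\<^sup>2" if "i \<in> {1..n N}" for N i
    unfolding sq using has_bochner_integral_integral_eq[OF ind_int[of i N]] that by simp
  have X2: "integrable M (\<lambda>\<xi>. (X N i \<xi>)\<^sup>2)" if "i \<in> {1..n N}" for N i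
    unfolding sq using ind_int[of i N] that by (auto simp: has_bochner_integral_iff)
  define m where "m N = (\<Sum>i\<in>{1..n N}. expectation (X N i))" for N
  have m: "m N = real (n N) * pr N / real (k N)" for N using E1 by (simp add: m_def)
  define W where "W N \<xi> = (\<Sum>i\<in>{1..n N}. X N i \<xi>) - m N" for N \<xi>
  have "((\<lambda>z. W (fst z) (snd z)) \<longlongrightarrow> 0) high_prob"
    unfolding W_def m_def
  proof (rule centred_sum_tendsto_0[OF indX X2])
    have "(\<Sum>i\<in>{1..n N}. expectation (\<lambda>\<xi>. (X N i \<xi>)\<^sup>2)) = (real (n N) * pr N / real (k N)) / real (k N)" for N
      using E2 by (simp add: power2_eq_square)
    then show "(\<lambda>N. \<Sum>i\<in>{1..n N}. expectation (\<lambda>\<xi>. (X N i \<xi>)\<^sup>2)) \<longlonglongrightarrow> 0"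
      using real_tendsto_divide_at_top[OF lim filterlim_compose[OF filterlim_real_sequentially k]] by simp
  qed
  from tendsto_add[OF this filterlim_fst[OF lim]]
  have "((\<lambda>z. W (fst z) (snd z) + m (fst z)) \<longlongrightarrow> c) high_prob" by (simp add: m)
  moreover have "W N \<xi> + m N = real (card {i \<in> {1..n N}. D i \<xi> \<in> B N}) / real (k N)" for N \<xi>
    by (simp add: W_def X_def sum_divide_distrib[symmetric] indicator_def sum.If_cases Int_def)
  ultimately show ?thesis by simp
qed

text \<open>Ranks are compared with the unobservable uniform variables \<open>w\<close> at thresholds off by a factor
  \<open>1 \<plusminus> \<delta>\<close>; homogeneity of \<open>R\<close> makes the resulting error of order \<open>\<delta>\<close>.\<close>

lemma R_hat_consistent:
  fixes x :: "nat \<Rightarrow> 'a \<Rightarrow> real ^ 'm" and g1 g2 :: "real \<Rightarrow> real" and u v :: "nat \<Rightarrow> real"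
    and n k :: "nat \<Rightarrow> 'm \<Rightarrow> nat" and j l :: 'm
  assumes tc: "tail_copula C R"
    and ind: "indep_vars (\<lambda>_. borel) x {1..}"
    and gm: "g1 \<in> borel_measurable borel" "g2 \<in> borel_measurable borel"
    and anti: "antimono g1" "antimono g2"
    and unif1: "\<And>i a. 1 \<le> i \<Longrightarrow> 0 \<le> a \<Longrightarrow> a \<le> 1 \<Longrightarrow> prob {\<xi> \<in> space M. g1 (x i \<xi> $ j) \<le> a} = a"
    and unif2: "\<And>i a. 1 \<le> i \<Longrightarrow> 0 \<le> a \<Longrightarrow> a \<le> 1 \<Longrightarrow> prob {\<xi> \<in> space M. g2 (x i \<xi> $ l) \<le> a} = a"
    and joint: "\<And>i a b. 1 \<le> i \<Longrightarrow> 0 \<le> a \<Longrightarrow> 0 \<le> b \<Longrightarrow>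
      prob {\<xi> \<in> space M. g1 (x i \<xi> $ j) \<le> a \<and> g2 (x i \<xi> $ l) \<le> b} = C a b"
    and n': "\<And>N. n' N = min (n N j) (n N l)"
    and k': "\<And>N. k' N = (if n N j < n N l then k N j else k N l)"
    and n_top: "filterlim n' at_top sequentially" and k_top: "filterlim k' at_top sequentially"
    and kn: "(\<lambda>N. real (k' N) / real (n' N)) \<longlonglongrightarrow> 0"
    and u: "u \<longlonglongrightarrow> u0" "0 < u0" and v: "v \<longlonglongrightarrow> v0" "0 < v0"
  shows "((\<lambda>z. R_hat (\<lambda>i. x i (snd z)) (n (fst z)) (k (fst z)) j l (u (fst z)) (v (fst z))) \<longlongrightarrow> R u0 v0) high_prob"
proof -
  interpret tail_copula C R by fact
  define w1 w2 where "w1 i \<xi> = g1 (x i \<xi> $ j)" and "w2 i \<xi> = g2 (x i \<xi> $ l)" for i \<xi>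
  define s where "s N = real (n' N) / real (k' N)" for N
  have ev_pos: "\<forall>\<^sub>F N in sequentially. 1 \<le> k' N \<and> 1 \<le> n' N"
    using k_top n_top by (auto simp: filterlim_at_top eventually_conj_iff)
  have s_top: "filterlim s at_top sequentially"
  proof -
    have "filterlim (\<lambda>N. inverse (real (k' N) / real (n' N))) at_top sequentially"
      by (rule filterlim_inverse_at_top[OF kn]) (use ev_pos in eventually_elim, simp)
    then show ?thesis by (simp add: s_def[abs_def])
  qed
  \<comment> \<open>For small \<open>N\<close> the levels could be negative, where \<open>C\<close>
    is not controlled; the positive parts agree with them eventually.\<close>
  define up vp where "up N = max 0 (u N)" and "vp N = max 0 (v N)" for N
  have up: "up \<longlonglongrightarrow> u0" "\<And>N. 0 \<le> up N" "\<forall>\<^sub>F N in sequentially. up N = u N \<and> 0 < u N"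
    and vp: "vp \<longlonglongrightarrow> v0" "\<And>N. 0 \<le> vp N" "\<forall>\<^sub>F N in sequentially. vp N = v N \<and> 0 < v N"
  proof -
    show "up \<longlonglongrightarrow> u0" unfolding up_def using tendsto_max[OF tendsto_const u(1), of 0] u(2) by simp
    show "vp \<longlonglongrightarrow> v0" unfolding vp_def using tendsto_max[OF tendsto_const v(1), of 0] v(2) by simp
    show "\<forall>\<^sub>F N in sequentially. up N = u N \<and> 0 < u N"
      using order_tendstoD(1)[OF u] by eventually_elim (simp add: up_def)
    show "\<forall>\<^sub>F N in sequentially. vp N = v N \<and> 0 < v N"
      using order_tendstoD(1)[OF v] by eventually_elim (simp add: vp_def)
  qed (auto simp: up_def vp_def)
  have xm: "x i \<in> borel_measurable M" if "1 \<le> i" for i using ind that by (auto simp: indep_vars_def)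
  define c where "c \<theta> N \<xi> = real (card {i \<in> {1..n' N}. w1 i \<xi> \<le> \<theta> * up N / s N \<and> w2 i \<xi> \<le> \<theta> * vp N / s N})"
    for \<theta> N \<xi>
  define c1 where "c1 \<theta> N \<xi> = real (card {i \<in> {1..n' N}. w1 i \<xi> \<le> \<theta> * up N / s N})" for \<theta> N \<xi>
  define c2 where "c2 \<theta> N \<xi> = real (card {i \<in> {1..n' N}. w2 i \<xi> \<le> \<theta> * vp N / s N})" for \<theta> N \<xi>
  have s0: "0 \<le> s N" for N by (simp add: s_def)
  have gv: "(\<lambda>y :: real ^ 'm. g1 (y $ j)) \<in> borel_measurable borel" "(\<lambda>y :: real ^ 'm. g2 (y $ l)) \<in> borel_measurable borel"
    by (rule measurable_compose[OF borel_measurable_nth gm(1)] measurable_compose[OF borel_measurable_nth gm(2)])+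
  have c_lim: "((\<lambda>z. c \<theta> (fst z) (snd z) / real (k' (fst z))) \<longlongrightarrow> \<theta> * R u0 v0) high_prob" if \<theta>: "0 < \<theta>" for \<theta>
  proof -
    have "((\<lambda>z. real (card {i \<in> {1..n' (fst z)}. x i (snd z) \<in> {y. g1 (y $ j) \<le> \<theta> * up (fst z) / s (fst z) \<and> g2 (y $ l) \<le> \<theta> * vp (fst z) / s (fst z)}})
        / real (k' (fst z))) \<longlongrightarrow> R (\<theta> * u0) (\<theta> * v0)) high_prob"
    proof (rule count_law_of_large_numbers[OF ind _ _ k_top, where pr = "\<lambda>N. C (\<theta> * up N / s N) (\<theta> * vp N / s N)"])
      show "{y. g1 (y $ j) \<le> \<theta> * up N / s N \<and> g2 (y $ l) \<le> \<theta> * vp N / s N} \<in> sets borel" for N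
        using gv by measurable
      show "prob {\<xi> \<in> space M. x i \<xi> \<in> {y. g1 (y $ j) \<le> \<theta> * up N / s N \<and> g2 (y $ l) \<le> \<theta> * vp N / s N}}
          = C (\<theta> * up N / s N) (\<theta> * vp N / s N)" if "1 \<le> i" for i N
        using joint[OF that, of "\<theta> * up N / s N" "\<theta> * vp N / s N"] up(2)[of N] vp(2)[of N] \<theta> s0[of N] by simp
      have "(\<lambda>N. s N * C (\<theta> * up N / s N) (\<theta> * vp N / s N)) \<longlonglongrightarrow> R (\<theta> * u0) (\<theta> * v0)"
        using \<theta> up(2) vp(2) by (intro C_limit_sequentially s_top tendsto_intros up(1) vp(1)) auto
      then show "(\<lambda>N. real (n' N) * C (\<theta> * up N / s N) (\<theta> * vp N / s N) / real (k' N)) \<longlonglongrightarrow> R (\<theta> * u0) (\<theta> * v0)"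
        by (simp add: s_def)
    qed
    then show ?thesis using R_homogeneous[OF \<theta>, of u0 v0] u(2) v(2) by (simp add: c_def w1_def w2_def)
  qed
  have small: "(\<lambda>N. \<theta> * up N / s N) \<longlonglongrightarrow> 0" "(\<lambda>N. \<theta> * vp N / s N) \<longlonglongrightarrow> 0" for \<theta>
    by (rule real_tendsto_divide_at_top[OF tendsto_mult[OF tendsto_const up(1)] s_top]
        real_tendsto_divide_at_top[OF tendsto_mult[OF tendsto_const vp(1)] s_top])+
  have marg: "((\<lambda>z. real (card {i \<in> {1..n' (fst z)}. g (x i (snd z) $ q) \<le> \<theta> * a (fst z) / s (fst z)}) / real (k' (fst z))) \<longlongrightarrow> \<theta> * a0) high_prob"
    if \<theta>: "0 < \<theta>" and a: "a \<longlonglongrightarrow> a0" "\<And>N. 0 \<le> a N"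
      and g: "g \<in> borel_measurable borel"
      and un: "\<And>i b. 1 \<le> i \<Longrightarrow> 0 \<le> b \<Longrightarrow> b \<le> 1 \<Longrightarrow> prob {\<xi> \<in> space M. g (x i \<xi> $ q) \<le> b} = b"
    for \<theta> a a0 g q
  proof -
    \<comment> \<open>Uniformity is available for levels in the unit interval, and the level tends
      to 0, so the truncation is eventually void.\<close>
    define B where "B N = min 1 (\<theta> * a N / s N)" for N
    have "(\<lambda>N. \<theta> * a N / s N) \<longlonglongrightarrow> 0"
      by (rule real_tendsto_divide_at_top[OF tendsto_mult[OF tendsto_const a(1)] s_top])
    then have evB: "\<forall>\<^sub>F N in sequentially. \<theta> * a N / s N < 1" by (rule order_tendstoD) simp
    have gv: "(\<lambda>y :: real ^ 'm. g (y $ q)) \<in> borel_measurable borel"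
      by (rule measurable_compose[OF borel_measurable_nth g])
    have B01: "0 \<le> B N" "B N \<le> 1" for N using a(2)[of N] \<theta> s0[of N] by (auto simp: B_def)
    have "((\<lambda>z. real (card {i \<in> {1..n' (fst z)}. x i (snd z) \<in> {y. g (y $ q) \<le> B (fst z)}}) / real (k' (fst z))) \<longlongrightarrow> \<theta> * a0) high_prob"
    proof (rule count_law_of_large_numbers[OF ind _ _ k_top, where pr = B])
      show "{y. g (y $ q) \<le> B N} \<in> sets borel" for N using gv by measurable
      show "prob {\<xi> \<in> space M. x i \<xi> \<in> {y. g (y $ q) \<le> B N}} = B N" if "1 \<le> i" for i N
        using un[OF that B01] by simp
      show "(\<lambda>N. real (n' N) * B N / real (k' N)) \<longlonglongrightarrow> \<theta> * a0"
      proof (rule Lim_transform_eventually[OF tendsto_mult[OF tendsto_const a(1), of \<theta>]])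
        show "\<forall>\<^sub>F N in sequentially. \<theta> * a N = real (n' N) * B N / real (k' N)"
          using evB ev_pos by eventually_elim (simp add: B_def s_def)
      qed
    qed
    then show ?thesis
    proof (rule Lim_transform_eventually)
      show "\<forall>\<^sub>F z in high_prob. real (card {i \<in> {1..n' (fst z)}. x i (snd z) \<in> {y. g (y $ q) \<le> B (fst z)}}) / real (k' (fst z)) =
          real (card {i \<in> {1..n' (fst z)}. g (x i (snd z) $ q) \<le> \<theta> * a (fst z) / s (fst z)}) / real (k' (fst z))"
        using eventually_fst_high_prob[OF evB] by eventually_elim (simp add: B_def)
    qed
  qed
  have c1_lim: "((\<lambda>z. c1 \<theta> (fst z) (snd z) / real (k' (fst z))) \<longlongrightarrow> \<theta> * u0) high_prob" if \<theta>: "0 < \<theta>" for \<theta>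
    unfolding c1_def w1_def by (rule marg[OF \<theta> up(1,2) gm(1) unif1])
  have c2_lim: "((\<lambda>z. c2 \<theta> (fst z) (snd z) / real (k' (fst z))) \<longlongrightarrow> \<theta> * v0) high_prob" if \<theta>: "0 < \<theta>" for \<theta>
    unfolding c2_def w2_def by (rule marg[OF \<theta> vp(1,2) gm(2) unif2])
  have n1: "(\<lambda>N. (real (n' N) + 1) / real (n' N)) \<longlonglongrightarrow> 1"
  proof -
    have "(\<lambda>N. 1 + 1 / real (n' N)) \<longlonglongrightarrow> 1 + 0"
      by (intro tendsto_intros real_tendsto_divide_at_top[OF tendsto_const filterlim_compose[OF filterlim_real_sequentially n_top]])
    then have "(\<lambda>N. 1 + 1 / real (n' N)) \<longlonglongrightarrow> 1" by simp
    then show ?thesis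
    proof (rule Lim_transform_eventually)
      show "\<forall>\<^sub>F N in sequentially. 1 + 1 / real (n' N) = (real (n' N) + 1) / real (n' N)"
        using ev_pos by eventually_elim (simp add: field_simps)
    qed
  qed
  define Rn where "Rn N \<xi> = R_hat (\<lambda>i. x i \<xi>) (n N) (k N) j l (u N) (v N)" for N \<xi>
  \<comment> \<open>The bounds on the reversed ranks after clearing the denominator of the
    estimator; the correction \<open>(n' + 1) / n'\<close> tends to 1.\<close>
  define K1 K2 where "K1 N = u N * (real (k' N) * (real (n' N) + 1) / real (n' N))"
    and "K2 N = v N * (real (k' N) * (real (n' N) + 1) / real (n' N))" for N
  have K1_lim: "(\<lambda>N. K1 N / real (k' N)) \<longlonglongrightarrow> u0" and K2_lim: "(\<lambda>N. K2 N / real (k' N)) \<longlonglongrightarrow> v0"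
  proof -
    show "(\<lambda>N. K1 N / real (k' N)) \<longlonglongrightarrow> u0"
    proof (rule Lim_transform_eventually)
      show "(\<lambda>N. u N * ((real (n' N) + 1) / real (n' N))) \<longlonglongrightarrow> u0" using tendsto_mult[OF u(1) n1] by simp
      show "\<forall>\<^sub>F N in sequentially. u N * ((real (n' N) + 1) / real (n' N)) = K1 N / real (k' N)"
        using ev_pos by eventually_elim (simp add: K1_def)
    qed
    show "(\<lambda>N. K2 N / real (k' N)) \<longlonglongrightarrow> v0"
    proof (rule Lim_transform_eventually)
      show "(\<lambda>N. v N * ((real (n' N) + 1) / real (n' N))) \<longlonglongrightarrow> v0" using tendsto_mult[OF v(1) n1] by simp
      show "\<forall>\<^sub>F N in sequentially. v N * ((real (n' N) + 1) / real (n' N)) = K2 N / real (k' N)"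
        using ev_pos by eventually_elim (simp add: K2_def)
    qed
  qed
  have Rn: "Rn N \<xi> = real (card {i \<in> {1..n' N}. real (n' N) + 1 - real (rank_of (\<lambda>i. x i \<xi> $ j) (n' N) i) \<le> K1 N \<and>
      real (n' N) + 1 - real (rank_of (\<lambda>i. x i \<xi> $ l) (n' N) i) \<le> K2 N}) / real (k' N)"
    if "1 \<le> k' N \<and> 1 \<le> n' N" for N \<xi>
  proof -
    have pos: "0 < real (k' N) * (real (n' N) + 1) / real (n' N)" using that by simp
    have "Rn N \<xi> = 1 / real (k' N) * (\<Sum>i=1..n' N. if
        (real (n' N) + 1 - real (rank_of (\<lambda>i. x i \<xi> $ j) (n' N) i)) / (real (k' N) * (real (n' N) + 1) / real (n' N)) \<le> u N \<and>
        (real (n' N) + 1 - real (rank_of (\<lambda>i. x i \<xi> $ l) (n' N) i)) / (real (k' N) * (real (n' N) + 1) / real (n' N)) \<le> v N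
        then 1 else 0)"
      unfolding Rn_def R_hat_def Let_def n' k' by simp
    then show ?thesis
      unfolding K1_def K2_def pos_divide_le_eq[OF pos] by (simp add: sum.If_cases Int_def)
  qed
  have sandwich: "\<forall>\<^sub>F z in high_prob. c (1 - \<delta>) (fst z) (snd z) / real (k' (fst z)) \<le> Rn (fst z) (snd z) \<and>
      Rn (fst z) (snd z) \<le> c (1 + \<delta>) (fst z) (snd z) / real (k' (fst z))" if \<delta>: "0 < \<delta>" "\<delta> < 1" for \<delta>
  proof -
    have lt: "\<forall>\<^sub>F z in high_prob. 0 < f z - h z" if "(f \<longlongrightarrow> a) high_prob" "(h \<longlongrightarrow> b) high_prob" "b < a"
      for f h :: "nat \<times> 'a \<Rightarrow> real" and a b
      by (rule order_tendstoD(1)[OF tendsto_diff[OF that(1,2)]]) (use that(3) in simp)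
    have e1: "\<forall>\<^sub>F z in high_prob. 0 < K1 (fst z) / real (k' (fst z)) - c1 (1 - \<delta>) (fst z) (snd z) / real (k' (fst z))"
      using \<delta> u(2) by (intro lt[OF filterlim_fst[OF K1_lim] c1_lim]) auto
    have e2: "\<forall>\<^sub>F z in high_prob. 0 < K2 (fst z) / real (k' (fst z)) - c2 (1 - \<delta>) (fst z) (snd z) / real (k' (fst z))"
      using \<delta> v(2) by (intro lt[OF filterlim_fst[OF K2_lim] c2_lim]) auto
    have e3: "\<forall>\<^sub>F z in high_prob. 0 < c1 (1 + \<delta>) (fst z) (snd z) / real (k' (fst z)) - K1 (fst z) / real (k' (fst z))"
      using \<delta> u(2) by (intro lt[OF c1_lim filterlim_fst[OF K1_lim]]) auto
    have e4: "\<forall>\<^sub>F z in high_prob. 0 < c2 (1 + \<delta>) (fst z) (snd z) / real (k' (fst z)) - K2 (fst z) / real (k' (fst z))"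
      using \<delta> v(2) by (intro lt[OF c2_lim filterlim_fst[OF K2_lim]]) auto
    from e1 e2 e3 e4 eventually_fst_high_prob[OF ev_pos] show ?thesis
    proof eventually_elim
      case (elim z)
      obtain N \<xi> where z: "z = (N, \<xi>)" by (cases z)
      have kp: "0 < real (k' N)" using elim(5) by (simp add: z)
      have b: "c1 (1 - \<delta>) N \<xi> \<le> K1 N" "c2 (1 - \<delta>) N \<xi> \<le> K2 N" "K1 N \<le> c1 (1 + \<delta>) N \<xi>" "K2 N \<le> c2 (1 + \<delta>) N \<xi>"
        using elim(1-4) kp unfolding z fst_conv snd_conv diff_divide_distrib[symmetric]
        by (auto simp: zero_less_divide_iff)
      have m1: "\<And>i l'. x i \<xi> $ j \<le> x l' \<xi> $ j \<Longrightarrow> w1 l' \<xi> \<le> w1 i \<xi>"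
        and m2: "\<And>i l'. x i \<xi> $ l \<le> x l' \<xi> $ l \<Longrightarrow> w2 l' \<xi> \<le> w2 i \<xi>"
        using anti by (auto simp: w1_def w2_def antimono_def)
      note r1 = rank_condition[where x = "\<lambda>i. x i \<xi> $ j" and w = "\<lambda>i. w1 i \<xi>" and n = "n' N" and K = "K1 N", OF m1]
      note r2 = rank_condition[where x = "\<lambda>i. x i \<xi> $ l" and w = "\<lambda>i. w2 i \<xi>" and n = "n' N" and K = "K2 N", OF m2]
      have "c (1 - \<delta>) N \<xi> / real (k' N) \<le> Rn N \<xi>"
        unfolding Rn[OF elim(5)[unfolded z fst_conv]] c_def
        using b(1,2) unfolding c1_def c2_def
        by (intro divide_right_mono of_nat_mono card_mono) (auto intro: r1(1) r2(1))
      moreover have "Rn N \<xi> \<le> c (1 + \<delta>) N \<xi> / real (k' N)"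
        unfolding Rn[OF elim(5)[unfolded z fst_conv]] c_def
        using b(3,4) unfolding c1_def c2_def
        by (intro divide_right_mono of_nat_mono card_mono) (auto intro: r1(2) r2(2))
      ultimately show ?case by (simp add: z)
    qed
  qed
  have R0: "0 \<le> R u0 v0" using R_bounds(1) u(2) v(2) by simp
  have "((\<lambda>z. Rn (fst z) (snd z)) \<longlongrightarrow> R u0 v0) high_prob"
  proof (rule tendstoI)
    fix e :: real assume e: "0 < e"
    \<comment> \<open>Makes the homogeneity error \<open>\<delta> * R u0 v0\<close> at most
      \<open>e / 2\<close>; the added 1 avoids a division by zero when the limit is 0.\<close>
    define \<delta> where "\<delta> = min (1 / 2) (e / (2 * (R u0 v0 + 1)))"
    have d1: "0 < \<delta>" "\<delta> < 1" using e R0 by (auto simp: \<delta>_def)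
    have "\<delta> * R u0 v0 \<le> e / (2 * (R u0 v0 + 1)) * (R u0 v0 + 1)"
      using R0 d1(1) by (intro mult_mono) (auto simp: \<delta>_def e less_imp_le)
    also have "\<dots> = e / 2"
    proof -
      have "R u0 v0 + 1 \<noteq> 0" using R0 by simp
      then show ?thesis by (simp add: field_simps)
    qed
    finally have d2: "\<delta> * R u0 v0 \<le> e / 2" .
    have e2: "0 < e / 2" using e by simp
    have "0 < 1 - \<delta>" "0 < 1 + \<delta>" using d1 by auto
    from tendstoD[OF c_lim[OF this(1)] e2] tendstoD[OF c_lim[OF this(2)] e2] sandwich[OF d1]
    show "\<forall>\<^sub>F z in high_prob. dist (Rn (fst z) (snd z)) (R u0 v0) < e"
    proof eventually_elim
      case (elim z)
      then show ?case using d2 unfolding dist_real_def left_diff_distrib distrib_right by linarith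
    qed
  qed
  then show ?thesis by (simp add: Rn_def)
qed

end

section \<open>Pooled samples\<close>

locale pooled_samples = prob_space M for M :: "'a measure" +
  fixes Y :: "'a \<Rightarrow> real ^ ('m::{finite,linorder})"
    and X :: "nat \<Rightarrow> 'a \<Rightarrow> real ^ ('m::{finite,linorder})"
    and \<gamma> :: real
    and \<rho> \<beta> b c :: "'m \<Rightarrow> real"
    and A :: "'m \<Rightarrow> real \<Rightarrow> real"
    and R :: "'m \<Rightarrow> 'm \<Rightarrow> ennreal \<Rightarrow> ennreal \<Rightarrow> real"
    and n k :: "nat \<Rightarrow> 'm \<Rightarrow> nat"
    and p :: "nat \<Rightarrow> real"
  assumes Y[measurable]: "Y \<in> borel_measurable M"
    and indep: "indep_vars (\<lambda>_. borel) X {1..}"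
    and copies: "\<And>i. 1 \<le> i \<Longrightarrow> distr M borel (X i) = distr M borel Y"
    and cont: "\<And>j x. isCont (marginal_cdf M Y j) x"
    and C2: "cond_C2 (\<lambda>j. tail_quantile (marginal_cdf M Y j)) (\<lambda>_. \<gamma>) \<rho> A"
    and J: "cond_J M Y R"
    and rho_neg: "\<And>j. \<rho> j < 0"
    and A: "\<And>j t. 0 < t \<Longrightarrow> A j t = \<gamma> * \<beta> j * t powr \<rho> j"
    and n_sum: "\<And>N. (\<Sum>j\<in>UNIV. n N j) = N"
    and n_mono: "\<And>N j l. j \<le> l \<Longrightarrow> n N j \<le> n N l"
    and n_lim: "\<And>j. filterlim (\<lambda>N. n N j) at_top sequentially"
    and k_lim: "\<And>j. filterlim (\<lambda>N. k N j) at_top sequentially"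
    and k_n: "\<And>j. (\<lambda>N. real (k N j) / real (n N j)) \<longlonglongrightarrow> 0"
    and b_lim: "\<And>j. (\<lambda>N. real (n N (Min UNIV)) / real (n N j)) \<longlonglongrightarrow> b j"
    and b_pos: "\<And>j. 0 < b j"
    and c_lim: "\<And>j. (\<lambda>N. real (k N (Min UNIV)) / real (k N j)) \<longlonglongrightarrow> c j"
    and c_pos: "\<And>j. 0 < c j"
    and bias: "\<And>j. (\<lambda>N. sqrt (real (k N j)) * A j (real (n N j) / real (k N j))) \<longlonglongrightarrow> 0"
    and V_pd: "positive_definite (V_matrix (\<lambda>_. \<gamma>) c b R)"
    and p_lim: "p \<longlonglongrightarrow> 0"
    and np_lim: "filterlim (\<lambda>N. real (total (k N)) / (real N * p N)) at_top sequentially"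
    and rate: "filterlim (\<lambda>N. sqrt (real (total (k N))) /
                 ln (real (total (k N)) / (real N * p N))) at_top sequentially"
begin

section \<open>Probability integral transforms and their copulas\<close>

abbreviation F :: "'m \<Rightarrow> real \<Rightarrow> real" where "F \<equiv> marginal_cdf M Y"

definition w :: "'m \<Rightarrow> real \<Rightarrow> real" where "w j y = 1 - F j y"
definition \<epsilon> :: "'m \<Rightarrow> real \<Rightarrow> real" where "\<epsilon> j y = - ln (w j y)"

lemma marginal_distribution: "real_distribution (distr M borel (\<lambda>\<xi>. Y \<xi> $ j))"
  by (rule real_distribution_distr) (simp add: measurable_compose[OF Y borel_measurable_nth])

lemma distribution_fun_F: "distribution_fun (F j)"
proof -
  interpret D: real_distribution "distr M borel (\<lambda>\<xi>. Y \<xi> $ j)" by (rule marginal_distribution)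
  show ?thesis
  proof
    show "mono (F j)" unfolding marginal_cdf_def by (intro monoI D.cdf_nondecreasing)
    show "(F j \<longlongrightarrow> 0) at_bot" unfolding marginal_cdf_def by (rule D.cdf_lim_at_bot)
    show "(F j \<longlongrightarrow> 1) at_top" unfolding marginal_cdf_def by (rule D.cdf_lim_at_top_prob)
  qed (rule cont)
qed

sublocale F: distribution_fun "F j" for j by (rule distribution_fun_F)

lemma Y_component[measurable]: "(\<lambda>\<xi>. Y \<xi> $ j) \<in> borel_measurable M"
  by (rule measurable_compose[OF Y borel_measurable_nth])

lemma X_measurable: "1 \<le> i \<Longrightarrow> X i \<in> borel_measurable M"
  using indep by (simp add: indep_vars_def)

lemma prob_X_eq:
  assumes "1 \<le> i" and B: "{y. P y} \<in> sets borel"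
  shows "prob {\<xi> \<in> space M. P (X i \<xi>)} = prob {\<xi> \<in> space M. P (Y \<xi>)}"
proof -
  have "measure (distr M borel (X i)) {y. P y} = measure (distr M borel Y) {y. P y}"
    using copies[OF assms(1)] by simp
  then show ?thesis
    using X_measurable[OF assms(1)] B by (simp add: measure_distr vimage_def Int_def conj_commute)
qed

lemma expectation_X_eq:
  fixes f :: "real ^ ('m::{finite,linorder}) \<Rightarrow> real"
  assumes "1 \<le> i" and [measurable]: "f \<in> borel_measurable borel"
  shows "expectation (\<lambda>\<xi>. f (X i \<xi>)) = expectation (\<lambda>\<xi>. f (Y \<xi>))"
proof -
  have "integral\<^sup>L (distr M borel (X i)) f = integral\<^sup>L (distr M borel Y) f"
    using copies[OF assms(1)] by simp
  then show ?thesis using X_measurable[OF assms(1)] by (simp add: integral_distr)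
qed

lemma w_antimono: "antimono (w j)"
  by (auto simp: w_def antimono_def intro: monoD[OF F.mono_F])

lemma w_measurable[measurable]: "w j \<in> borel_measurable borel"
proof -
  have "F j \<in> borel_measurable borel" by (rule borel_measurable_mono[OF F.mono_F])
  then show ?thesis unfolding w_def[abs_def] by measurable
qed

lemma \<epsilon>_measurable[measurable]: "\<epsilon> j \<in> borel_measurable borel"
  unfolding \<epsilon>_def[abs_def] by measurable

lemma w_bounds: "0 \<le> w j y" "w j y \<le> 1"
  using F.F_nonneg F.F_le_1 by (auto simp: w_def)

text \<open>Inside the unit interval the event is \<open>Q \<le> Y \<xi> $ j\<close> for a quantile
  \<open>Q\<close>, and continuity excludes an atom at \<open>Q\<close>. The quantile calculus stops
  short of the endpoints, so 0 is reached by approximation from above.\<close>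

lemma prob_w_le:
  assumes "0 \<le> a" "a \<le> 1"
  shows "prob {\<xi> \<in> space M. w j (Y \<xi> $ j) \<le> a} = a"
proof -
  interpret D: real_distribution "distr M borel (\<lambda>\<xi>. Y \<xi> $ j)" by (rule marginal_distribution)
  have inner: "prob {\<xi> \<in> space M. w j (Y \<xi> $ j) \<le> a} = a" if a: "0 < a" "a < 1" for a
  proof -
    define Q where "Q = quantile (F j) (1 - a)"
    have "F j Q = 1 - a" unfolding Q_def using a by (intro F.F_quantile) auto
    have iff: "w j y \<le> a \<longleftrightarrow> Q \<le> y" for y
    proof
      assume "w j y \<le> a"
      then show "Q \<le> y" unfolding Q_def w_def using a by (intro F.quantile_le) auto
    next
      assume "Q \<le> y"
      from monoD[OF F.mono_F[of j] this] show "w j y \<le> a" using \<open>F j Q = 1 - a\<close> by (simp add: w_def)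
    qed
    have "D.prob {Q} = 0" using cont[where j = j and x = Q] unfolding marginal_cdf_def by (simp add: D.isCont_cdf)
    have "D.prob {Q..} = D.prob {Q} + D.prob {Q<..}"
    proof -
      have "{Q..} = {Q} \<union> {Q<..}" by auto
      then show ?thesis using D.finite_measure_Union[of "{Q}" "{Q<..}"] by simp
    qed
    also have "D.prob {Q<..} = 1 - D.prob {..Q}"
    proof -
      have "{Q<..} = space (distr M borel (\<lambda>\<xi>. Y \<xi> $ j)) - {..Q}" by auto
      then show ?thesis by (simp only:) (rule D.prob_compl, simp)
    qed
    also have "D.prob {..Q} = 1 - a" using \<open>F j Q = 1 - a\<close> by (simp add: marginal_cdf_def cdf_def)
    finally have "D.prob {Q..} = a" using \<open>D.prob {Q} = 0\<close> by simp
    then show ?thesis unfolding iff by (simp add: measure_distr vimage_def Int_def conj_commute)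
  qed
  show ?thesis
  proof (cases "a = 1 \<or> a = 0")
    case True
    then show ?thesis
    proof
      assume "a = 1"
      then show ?thesis using w_bounds by (simp add: prob_space)
    next
      assume "a = 0"
      have "prob {\<xi> \<in> space M. w j (Y \<xi> $ j) \<le> 0} \<le> e" if "0 < e" for e
      proof -
        have "prob {\<xi> \<in> space M. w j (Y \<xi> $ j) \<le> 0} \<le> prob {\<xi> \<in> space M. w j (Y \<xi> $ j) \<le> min e (1 / 2)}"
          using that by (intro finite_measure_mono) auto
        also have "\<dots> = min e (1 / 2)" using that by (intro inner) auto
        finally show ?thesis by simp
      qed
      then have "prob {\<xi> \<in> space M. w j (Y \<xi> $ j) \<le> 0} \<le> 0" by (rule field_le_epsilon[of _ 0, simplified])
      then show ?thesis using \<open>a = 0\<close> by (simp add: measure_le_0_iff)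
    qed
  qed (use assms inner in auto)
qed

lemma prob_w_le_ge0:
  assumes "0 \<le> a"
  shows "prob {\<xi> \<in> space M. w j (Y \<xi> $ j) \<le> a} = min a 1"
proof (cases "a \<le> 1")
  case False
  then have "{\<xi> \<in> space M. w j (Y \<xi> $ j) \<le> a} = space M"
    using w_bounds(2)[of j] by (auto intro: order_trans[of _ 1])
  then show ?thesis using False by (simp add: prob_space)
qed (use assms prob_w_le in auto)

lemma prob_w_eq: "prob {\<xi> \<in> space M. w j (Y \<xi> $ j) = a} = 0"
proof (cases "0 \<le> a")
  case True
  have "prob {\<xi> \<in> space M. w j (Y \<xi> $ j) = a} \<le> e" if e: "0 < e" for e
  proof (cases "a = 0")
    case True
    have "prob {\<xi> \<in> space M. w j (Y \<xi> $ j) = a} \<le> prob {\<xi> \<in> space M. w j (Y \<xi> $ j) \<le> 0}"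
      using True by (intro finite_measure_mono) auto
    then show ?thesis using prob_w_le[of 0 j] e by simp
  next
    case False
    define a' where "a' = max 0 (a - e)"
    have a': "0 \<le> a'" "a' < a" using \<open>0 \<le> a\<close> False e by (auto simp: a'_def)
    have "prob ({\<xi> \<in> space M. w j (Y \<xi> $ j) \<le> a} - {\<xi> \<in> space M. w j (Y \<xi> $ j) \<le> a'}) = min a 1 - min a' 1"
      using a' prob_w_le_ge0[of a j] prob_w_le_ge0[of a' j] by (subst finite_measure_Diff) auto
    moreover have "prob {\<xi> \<in> space M. w j (Y \<xi> $ j) = a} \<le>
        prob ({\<xi> \<in> space M. w j (Y \<xi> $ j) \<le> a} - {\<xi> \<in> space M. w j (Y \<xi> $ j) \<le> a'})"
      using a' by (intro finite_measure_mono) auto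
    moreover have "min a 1 - min a' 1 \<le> e" using e by (auto simp: a'_def min_def max_def)
    ultimately show ?thesis by simp
  qed
  then have "prob {\<xi> \<in> space M. w j (Y \<xi> $ j) = a} \<le> 0" by (rule field_le_epsilon[of _ 0, simplified])
  then show ?thesis by (simp add: measure_le_0_iff)
next
  case False
  then have "{\<xi> \<in> space M. w j (Y \<xi> $ j) = a} = {}" using w_bounds(1)[of j] by auto
  then show ?thesis by (simp only: measure_empty)
qed

lemma AE_w_ne: "AE \<xi> in M. w j (Y \<xi> $ j) \<noteq> a"
proof (rule AE_I)
  show "{\<xi> \<in> space M. \<not> w j (Y \<xi> $ j) \<noteq> a} \<subseteq> {\<xi> \<in> space M. w j (Y \<xi> $ j) = a}" by auto
  show "emeasure M {\<xi> \<in> space M. w j (Y \<xi> $ j) = a} = 0" by (simp only: emeasure_eq_measure prob_w_eq ennreal_0)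
qed measurable

text \<open>The exclusions concern null events, by \<open>AE_w_ne\<close>: the first avoids the
  default \<open>ln 0 = 0\<close>, the second turns the strict inequality from the logarithm into
  the weak one of the copula.\<close>

lemma \<epsilon>_greater_iff:
  assumes "0 \<le> s" "w j y \<noteq> 0" "w j y \<noteq> exp (- s)"
  shows "s < \<epsilon> j y \<longleftrightarrow> w j y \<le> exp (- s)"
proof -
  have "0 < w j y" using w_bounds(1)[of j y] assms(2) by simp
  then have "s < \<epsilon> j y \<longleftrightarrow> w j y < exp (- s)"
    using ln_less_cancel_iff[of "w j y" "exp (- s)"] by (auto simp: \<epsilon>_def)
  then show ?thesis using assms(3) by auto
qed

definition Cop :: "'m \<Rightarrow> 'm \<Rightarrow> real \<Rightarrow> real \<Rightarrow> real" where
  "Cop j l u v = prob {\<xi> \<in> space M. w j (Y \<xi> $ j) \<le> u \<and> w l (Y \<xi> $ l) \<le> v}"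

definition Rr :: "'m \<Rightarrow> 'm \<Rightarrow> real \<Rightarrow> real \<Rightarrow> real" where
  "Rr j l x y = R j l (ennreal x) (ennreal y)"

lemma distributed_\<epsilon>Y: "distributed M lborel (\<lambda>\<xi>. \<epsilon> j (Y \<xi> $ j)) (exponential_density 1)"
  unfolding exponential_distributed_iff[OF zero_less_one]
proof safe
  fix a :: real assume a: "0 \<le> a"
  have "prob {\<xi> \<in> space M. a < \<epsilon> j (Y \<xi> $ j)} = prob {\<xi> \<in> space M. w j (Y \<xi> $ j) \<le> exp (- a)}"
  proof (rule measure_eq_AE)
    show "AE \<xi> in M. \<xi> \<in> {\<xi> \<in> space M. a < \<epsilon> j (Y \<xi> $ j)} \<longleftrightarrow> \<xi> \<in> {\<xi> \<in> space M. w j (Y \<xi> $ j) \<le> exp (- a)}"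
      using AE_w_ne[of j 0] AE_w_ne[of j "exp (- a)"] AE_space
      by eventually_elim (simp add: \<epsilon>_greater_iff a)
  qed measurable
  also have "\<dots> = exp (- a)" using a by (intro prob_w_le) auto
  finally have "prob {\<xi> \<in> space M. \<not> a < \<epsilon> j (Y \<xi> $ j)} = 1 - exp (- a)"
    by (subst prob_neg) auto
  then show "prob {\<xi> \<in> space M. \<epsilon> j (Y \<xi> $ j) \<le> a} = 1 - exp (- a * 1)"
    by (simp add: not_less)
qed measurable

lemma exponential_pair_\<epsilon>Y:
  assumes "j \<noteq> l"
  shows "exponential_pair M (Cop j l) (Rr j l) (\<lambda>\<xi>. \<epsilon> j (Y \<xi> $ j)) (\<lambda>\<xi>. \<epsilon> l (Y \<xi> $ l))"
proof
  \<comment> \<open>Because the margins are uniform, whatever is lost in passing from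
    \<open>(u, v)\<close> to \<open>(u', v')\<close> lies in two strips of probability at most
    \<open>|u - u'|\<close> and \<open>|v - v'|\<close>.\<close>
  have le: "Cop j l u v \<le> Cop j l u' v' + (\<bar>u - u'\<bar> + \<bar>v - v'\<bar>)" if "0 \<le> u" "0 \<le> v" "0 \<le> u'" "0 \<le> v'" for u v u' v'
  proof -
    have d: "prob ({\<xi> \<in> space M. w q (Y \<xi> $ q) \<le> a} - {\<xi> \<in> space M. w q (Y \<xi> $ q) \<le> a'}) \<le> \<bar>a - a'\<bar>"
      if "0 \<le> a" "0 \<le> a'" for q a a'
    proof (cases "a' \<le> a")
      case True
      have "prob ({\<xi> \<in> space M. w q (Y \<xi> $ q) \<le> a} - {\<xi> \<in> space M. w q (Y \<xi> $ q) \<le> a'}) = min a 1 - min a' 1"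
        using True prob_w_le_ge0[OF that(1), of q] prob_w_le_ge0[OF that(2), of q]
        by (subst finite_measure_Diff) auto
      then show ?thesis by (auto simp: min_def)
    next
      case False
      then have "{\<xi> \<in> space M. w q (Y \<xi> $ q) \<le> a} - {\<xi> \<in> space M. w q (Y \<xi> $ q) \<le> a'} = {}" by auto
      then show ?thesis by (simp only: measure_empty abs_ge_zero)
    qed
    have "Cop j l u v \<le> prob ({\<xi> \<in> space M. w j (Y \<xi> $ j) \<le> u' \<and> w l (Y \<xi> $ l) \<le> v'} \<union>
        (({\<xi> \<in> space M. w j (Y \<xi> $ j) \<le> u} - {\<xi> \<in> space M. w j (Y \<xi> $ j) \<le> u'}) \<union>
        ({\<xi> \<in> space M. w l (Y \<xi> $ l) \<le> v} - {\<xi> \<in> space M. w l (Y \<xi> $ l) \<le> v'})))"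
      unfolding Cop_def by (intro finite_measure_mono) auto
    also have "\<dots> \<le> Cop j l u' v' + prob (({\<xi> \<in> space M. w j (Y \<xi> $ j) \<le> u} - {\<xi> \<in> space M. w j (Y \<xi> $ j) \<le> u'}) \<union>
        ({\<xi> \<in> space M. w l (Y \<xi> $ l) \<le> v} - {\<xi> \<in> space M. w l (Y \<xi> $ l) \<le> v'}))"
      unfolding Cop_def by (intro measure_Un_le) auto
    also have "prob (({\<xi> \<in> space M. w j (Y \<xi> $ j) \<le> u} - {\<xi> \<in> space M. w j (Y \<xi> $ j) \<le> u'}) \<union>
        ({\<xi> \<in> space M. w l (Y \<xi> $ l) \<le> v} - {\<xi> \<in> space M. w l (Y \<xi> $ l) \<le> v'})) \<le>
        prob ({\<xi> \<in> space M. w j (Y \<xi> $ j) \<le> u} - {\<xi> \<in> space M. w j (Y \<xi> $ j) \<le> u'}) +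
        prob ({\<xi> \<in> space M. w l (Y \<xi> $ l) \<le> v} - {\<xi> \<in> space M. w l (Y \<xi> $ l) \<le> v'})"
      by (intro measure_Un_le) auto
    also have "\<dots> \<le> \<bar>u - u'\<bar> + \<bar>v - v'\<bar>" using that by (intro add_mono d) auto
    finally show ?thesis by simp
  qed
  show "\<bar>Cop j l u v - Cop j l u' v'\<bar> \<le> \<bar>u - u'\<bar> + \<bar>v - v'\<bar>" if "0 \<le> u" "0 \<le> v" "0 \<le> u'" "0 \<le> v'" for u v u' v'
    using le[OF that] le[OF that(3,4,1,2)] by (simp add: abs_le_iff abs_minus_commute)
  show "0 \<le> Cop j l u v \<and> Cop j l u v \<le> u \<and> Cop j l u v \<le> v" if "0 \<le> u" "0 \<le> v" for u v
  proof -
    have "Cop j l u v \<le> prob {\<xi> \<in> space M. w j (Y \<xi> $ j) \<le> u}" "Cop j l u v \<le> prob {\<xi> \<in> space M. w l (Y \<xi> $ l) \<le> v}"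
      unfolding Cop_def by (intro finite_measure_mono; auto)+
    then show ?thesis using prob_w_le_ge0[OF that(1), of j] prob_w_le_ge0[OF that(2), of l]
      by (simp add: Cop_def)
  qed
  show "((\<lambda>s. s * Cop j l (x / s) (y / s)) \<longlongrightarrow> Rr j l x y) at_top" if xy: "0 \<le> x" "0 \<le> y" for x y
  proof -
    have "((\<lambda>s. s * survival_copula M Y j l (ennreal x / ennreal s) (ennreal y / ennreal s)) \<longlongrightarrow> Rr j l x y) at_top"
      using J assms unfolding cond_J_def Rr_def by simp
    then show ?thesis
    proof (rule Lim_transform_eventually)
      show "\<forall>\<^sub>F s in at_top. s * survival_copula M Y j l (ennreal x / ennreal s) (ennreal y / ennreal s) = s * Cop j l (x / s) (y / s)"
        using eventually_gt_at_top[of 0]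
      proof eventually_elim
        case (elim s)
        then show ?case using xy
          by (simp add: survival_copula_def Cop_def divide_ennreal ennreal_le_iff w_def)
      qed
    qed
  qed
  show "prob {\<xi> \<in> space M. s < \<epsilon> j (Y \<xi> $ j) \<and> t < \<epsilon> l (Y \<xi> $ l)} = Cop j l (exp (- s)) (exp (- t))"
    if st: "0 \<le> s" "0 \<le> t" for s t
    unfolding Cop_def
  proof (rule measure_eq_AE)
    show "AE \<xi> in M. \<xi> \<in> {\<xi> \<in> space M. s < \<epsilon> j (Y \<xi> $ j) \<and> t < \<epsilon> l (Y \<xi> $ l)} \<longleftrightarrow>
        \<xi> \<in> {\<xi> \<in> space M. w j (Y \<xi> $ j) \<le> exp (- s) \<and> w l (Y \<xi> $ l) \<le> exp (- t)}"
      using AE_w_ne[of j 0] AE_w_ne[of j "exp (- s)"] AE_w_ne[of l 0] AE_w_ne[of l "exp (- t)"]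
      by eventually_elim (simp add: \<epsilon>_greater_iff st)
  qed measurable
qed (rule distributed_\<epsilon>Y)+

lemma tail_copula_Cop: "j \<noteq> l \<Longrightarrow> tail_copula (Cop j l) (Rr j l)"
  using exponential_pair_\<epsilon>Y exponential_pair_def by blast

lemma \<epsilon>_nth_measurable[measurable]: "(\<lambda>y :: real ^ ('m::{finite,linorder}). \<epsilon> j (y $ j)) \<in> borel_measurable borel"
  and w_nth_measurable[measurable]: "(\<lambda>y :: real ^ ('m::{finite,linorder}). w j (y $ j)) \<in> borel_measurable borel"
  by (rule measurable_compose[OF borel_measurable_nth]; measurable)+

lemma prob_w_X:
  assumes "1 \<le> i"
  shows "0 \<le> a \<Longrightarrow> a \<le> 1 \<Longrightarrow> prob {\<xi> \<in> space M. w j (X i \<xi> $ j) \<le> a} = a"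
    and "prob {\<xi> \<in> space M. w j (X i \<xi> $ j) \<le> u \<and> w l (X i \<xi> $ l) \<le> v} = Cop j l u v"
proof -
  show "prob {\<xi> \<in> space M. w j (X i \<xi> $ j) \<le> a} = a" if "0 \<le> a" "a \<le> 1"
  proof -
    have "{y :: real ^ ('m::{finite,linorder}). w j (y $ j) \<le> a} \<in> sets borel" by measurable
    from prob_X_eq[OF assms this] show ?thesis using prob_w_le[OF that] by simp
  qed
  have "{y :: real ^ ('m::{finite,linorder}). w j (y $ j) \<le> u \<and> w l (y $ l) \<le> v} \<in> sets borel" by measurable
  from prob_X_eq[OF assms this]
  show "prob {\<xi> \<in> space M. w j (X i \<xi> $ j) \<le> u \<and> w l (X i \<xi> $ l) \<le> v} = Cop j l u v"
    by (simp add: Cop_def)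
qed

lemma AE_w_X_pos: "1 \<le> i \<Longrightarrow> AE \<xi> in M. 0 < w j (X i \<xi> $ j)"
proof -
  assume i: "1 \<le> i"
  have [measurable]: "X i \<in> borel_measurable M" by (rule X_measurable[OF i])
  show ?thesis
  proof (rule AE_I)
    show "{\<xi> \<in> space M. \<not> 0 < w j (X i \<xi> $ j)} \<subseteq> {\<xi> \<in> space M. w j (X i \<xi> $ j) \<le> 0}" by auto
    show "emeasure M {\<xi> \<in> space M. w j (X i \<xi> $ j) \<le> 0} = 0"
      using prob_w_X(1)[OF i, of 0 j] by (simp add: emeasure_eq_measure)
    have "(\<lambda>\<xi>. w j (X i \<xi> $ j)) \<in> borel_measurable M"
      by (rule measurable_compose[OF _ w_nth_measurable]) measurable
    then show "{\<xi> \<in> space M. w j (X i \<xi> $ j) \<le> 0} \<in> events" by measurable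
  qed
qed

lemma distributed_\<epsilon>X:
  assumes i: "1 \<le> i"
  shows "distributed M lborel (\<lambda>\<xi>. \<epsilon> j (X i \<xi> $ j)) (exponential_density 1)"
  unfolding exponential_distributed_iff[OF zero_less_one]
proof safe
  show "(\<lambda>\<xi>. \<epsilon> j (X i \<xi> $ j)) \<in> borel_measurable M"
    by (rule measurable_compose[OF X_measurable[OF i] \<epsilon>_nth_measurable])
  fix a :: real assume a: "0 \<le> a"
  have "{y :: real ^ ('m::{finite,linorder}). \<epsilon> j (y $ j) \<le> a} \<in> sets borel" by measurable
  from prob_X_eq[OF i this]
  have "prob {\<xi> \<in> space M. \<epsilon> j (X i \<xi> $ j) \<le> a} = prob {\<xi> \<in> space M. \<epsilon> j (Y \<xi> $ j) \<le> a}" .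
  also have "\<dots> = 1 - exp (- a * 1)"
    using exponential_distributedD_le[OF distributed_\<epsilon>Y a] by simp
  finally show "prob {\<xi> \<in> space M. \<epsilon> j (X i \<xi> $ j) \<le> a} = 1 - exp (- a * 1)" .
qed

sublocale S: exponential_sample M "\<lambda>i \<xi>. \<epsilon> j (X i \<xi> $ j)" "\<lambda>N. n N j" "\<lambda>N. k N j" for j
proof
  show "indep_vars (\<lambda>_. borel) (\<lambda>i \<xi>. \<epsilon> j (X i \<xi> $ j)) {1..}"
    by (rule indep_vars_compose2[OF indep, where Y = "\<lambda>_ y. \<epsilon> j (y $ j)"]) measurable
qed (simp_all add: distributed_\<epsilon>X n_lim k_lim k_n)

end

section \<open>Central limit theorem for the vector of scores\<close>

lemma abs_sum_cube_le:
  fixes x :: "'m::finite \<Rightarrow> real"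
  shows "\<bar>\<Sum>j\<in>UNIV. x j\<bar> ^ 3 \<le> real CARD('m) ^ 3 * (\<Sum>j\<in>UNIV. \<bar>x j\<bar> ^ 3)"
proof -
  define B where "B = Max (range (\<lambda>j. \<bar>x j\<bar>))"
  have B: "\<bar>x j\<bar> \<le> B" for j unfolding B_def by (intro Max_ge) auto
  have "B \<in> range (\<lambda>j. \<bar>x j\<bar>)" unfolding B_def by (intro Max_in) auto
  then obtain j0 where j0: "B = \<bar>x j0\<bar>" by blast
  have "\<bar>\<Sum>j\<in>UNIV. x j\<bar> \<le> (\<Sum>j\<in>UNIV. \<bar>x j\<bar>)" by (rule sum_abs)
  also have "\<dots> \<le> real CARD('m) * B" using sum_bounded_above[of UNIV "\<lambda>j. \<bar>x j\<bar>" B] B by simp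
  finally have "\<bar>\<Sum>j\<in>UNIV. x j\<bar> ^ 3 \<le> (real CARD('m) * B) ^ 3" by (intro power_mono) auto
  also have "\<dots> = real CARD('m) ^ 3 * \<bar>x j0\<bar> ^ 3" by (simp add: power_mult_distrib j0)
  also have "\<dots> \<le> real CARD('m) ^ 3 * (\<Sum>j\<in>UNIV. \<bar>x j\<bar> ^ 3)"
    by (intro mult_left_mono member_le_sum) auto
  finally show ?thesis .
qed

context pooled_samples
begin

lemma gamma_pos: "0 < \<gamma>"
  using C2 by (simp add: cond_C2_def)

lemma k_ratio: "(\<lambda>N. real (k N j) / real (k N l)) \<longlonglongrightarrow> c l / c j"
proof (rule Lim_transform_eventually)
  show "(\<lambda>N. (real (k N (Min UNIV)) / real (k N l)) / (real (k N (Min UNIV)) / real (k N j))) \<longlonglongrightarrow> c l / c j"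
    using c_pos[of j] by (intro tendsto_divide c_lim) auto
  show "\<forall>\<^sub>F N in sequentially. (real (k N (Min UNIV)) / real (k N l)) / (real (k N (Min UNIV)) / real (k N j)) = real (k N j) / real (k N l)"
    using S.eventually_kn[of "Min UNIV"] S.eventually_kn[of j] by eventually_elim simp
qed

lemma n_ratio: "(\<lambda>N. real (n N j) / real (n N l)) \<longlonglongrightarrow> b l / b j"
proof (rule Lim_transform_eventually)
  show "(\<lambda>N. (real (n N (Min UNIV)) / real (n N l)) / (real (n N (Min UNIV)) / real (n N j))) \<longlonglongrightarrow> b l / b j"
    using b_pos[of j] by (intro tendsto_divide b_lim) auto
  show "\<forall>\<^sub>F N in sequentially. (real (n N (Min UNIV)) / real (n N l)) / (real (n N (Min UNIV)) / real (n N j)) = real (n N j) / real (n N l)"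
    using S.eventually_kn[of "Min UNIV"] S.eventually_kn[of j] by eventually_elim simp
qed

abbreviation V :: "real ^ ('m::{finite,linorder}) ^ ('m::{finite,linorder})" where
  "V \<equiv> V_matrix (\<lambda>_. \<gamma>) c b R"

lemma V_diag: "V $ j $ j = \<gamma>\<^sup>2"
  by (simp add: V_matrix_def sym_matrix_def)

lemma V_less: "j < l \<Longrightarrow> V $ j $ l = \<gamma>\<^sup>2 * (sqrt (c j / c l) * Rr j l (c l / c j) (b l / b j))"
  by (simp add: V_matrix_def sym_matrix_def Rr_def power2_eq_square mult_ac)

lemma V_sym: "V $ j $ l = V $ l $ j"
  by (auto simp: V_matrix_def sym_matrix_def)

text \<open>Marks the \<open>N\<close> for which the threshold has a valid index in every sample.
  Moment formulas and measurability are claimed under it, and it holds eventually.\<close>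

definition good where "good N \<longleftrightarrow> (\<forall>j. 1 \<le> k N j \<and> k N j < n N j)"

lemma eventually_good: "eventually good sequentially"
  unfolding good_def[abs_def] by (rule eventually_all_finite) (rule S.eventually_kn)

lemma good_t:
  assumes "good N"
  shows "0 \<le> S.t j N"
proof -
  have "1 \<le> k N j \<and> k N j < n N j" using assms by (simp add: good_def)
  then have "1 \<le> real (n N j) / real (k N j)" by (simp add: le_divide_eq)
  then show ?thesis unfolding S.t_def by (rule ln_ge_zero)
qed

text \<open>The covariance of the normalised scores of samples \<open>j\<close> and
  \<open>l\<close>, which have \<open>min (n N j) (n N l)\<close> independent vectors in
  common.\<close>

definition \<psi> where
  "\<psi> j l N = real (min (n N j) (n N l)) / (sqrt (real (k N j)) * sqrt (real (k N l))) *
     expectation (\<lambda>\<xi>. hill_score (S.t j N) (\<epsilon> j (Y \<xi> $ j)) * hill_score (S.t l N) (\<epsilon> l (Y \<xi> $ l)))"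

text \<open>For \<open>j < l\<close> the smaller sample is the \<open>j\<close>th, so the overlap is
  \<open>n N j\<close>. Homogeneity of the tail copula trades the arguments \<open>(1, r)\<close> of
  the limit for those in \<open>V\<close>, and the factor released combines with the ratio of the
  square roots of the \<open>k\<close>.\<close>

lemma score_covariance_less:
  assumes jl: "j < l"
  shows "(\<lambda>N. \<gamma>\<^sup>2 * \<psi> j l N) \<longlonglongrightarrow> V $ j $ l"
proof -
  \<comment> \<open>The limit of \<open>(n j / k j) * (k l / n l)\<close>, the ratio of the two tail
    probabilities at the thresholds.\<close>
  define r where "r = c j / c l * (b l / b j)"
  have r: "0 < r" using c_pos b_pos by (simp add: r_def)
  interpret tail_copula "Cop j l" "Rr j l" using jl by (intro tail_copula_Cop) auto
  have ne: "j \<noteq> l" using jl by simp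
  have "(\<lambda>N. real (n N j) / real (k N j) * expectation (\<lambda>\<xi>. hill_score (S.t j N) (\<epsilon> j (Y \<xi> $ j)) * hill_score (S.t l N) (\<epsilon> l (Y \<xi> $ l))))
      \<longlonglongrightarrow> Rr j l 1 r"
  proof (rule exponential_pair.hill_score_covariance[OF exponential_pair_\<epsilon>Y[OF ne] S.n_over_k_top])
    show "\<forall>\<^sub>F N in sequentially. exp (- S.t j N) = 1 / (real (n N j) / real (k N j))"
      using S.eventually_kn[of j] by eventually_elim (simp add: S.exp_t)
    show "\<forall>\<^sub>F N in sequentially. 0 \<le> S.t j N"
      using eventually_good by eventually_elim (rule good_t)
    show "\<forall>\<^sub>F N in sequentially. 0 \<le> S.t l N"
      using eventually_good by eventually_elim (rule good_t)
    show "(\<lambda>N. real (n N j) / real (k N j) * exp (- S.t l N)) \<longlonglongrightarrow> r"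
    proof (rule Lim_transform_eventually)
      show "(\<lambda>N. real (k N l) / real (k N j) * (real (n N j) / real (n N l))) \<longlonglongrightarrow> r"
        unfolding r_def by (intro tendsto_mult k_ratio n_ratio)
      show "\<forall>\<^sub>F N in sequentially. real (k N l) / real (k N j) * (real (n N j) / real (n N l)) =
          real (n N j) / real (k N j) * exp (- S.t l N)"
        using S.eventually_kn[of l] by eventually_elim (simp add: S.exp_t)
    qed
  qed (rule r)
  then have lim: "(\<lambda>N. \<gamma>\<^sup>2 * (sqrt (real (k N j) / real (k N l)) * (real (n N j) / real (k N j) *
      expectation (\<lambda>\<xi>. hill_score (S.t j N) (\<epsilon> j (Y \<xi> $ j)) * hill_score (S.t l N) (\<epsilon> l (Y \<xi> $ l))))))
      \<longlonglongrightarrow> \<gamma>\<^sup>2 * (sqrt (c l / c j) * Rr j l 1 r)"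
    by (intro tendsto_mult tendsto_const tendsto_real_sqrt k_ratio)
  have "Rr j l 1 r = c j / c l * Rr j l (c l / c j) (b l / b j)"
    using R_homogeneous[of "c j / c l" "c l / c j" "b l / b j"] c_pos[of j] c_pos[of l] b_pos[of j] b_pos[of l]
    by (simp add: r_def less_imp_le)
  moreover have "sqrt (c l / c j) * (c j / c l) = sqrt (c j / c l)"
  proof -
    have "c j / c l = sqrt (c j / c l) * sqrt (c j / c l)" using c_pos[of j] c_pos[of l] by (simp add: less_imp_le)
    moreover have "sqrt (c l / c j) * sqrt (c j / c l) = 1"
      using c_pos[of j] c_pos[of l] by (simp add: real_sqrt_mult[symmetric])
    ultimately show ?thesis by (metis mult.assoc mult_1)
  qed
  ultimately have "\<gamma>\<^sup>2 * (sqrt (c l / c j) * Rr j l 1 r) = V $ j $ l"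
    unfolding V_less[OF jl] by (metis mult.assoc)
  with lim have lim': "(\<lambda>N. \<gamma>\<^sup>2 * (sqrt (real (k N j) / real (k N l)) * (real (n N j) / real (k N j) *
      expectation (\<lambda>\<xi>. hill_score (S.t j N) (\<epsilon> j (Y \<xi> $ j)) * hill_score (S.t l N) (\<epsilon> l (Y \<xi> $ l)))))) \<longlonglongrightarrow> V $ j $ l"
    by simp
  show ?thesis
  proof (rule Lim_transform_eventually[OF lim'])
    show "\<forall>\<^sub>F N in sequentially. \<gamma>\<^sup>2 * (sqrt (real (k N j) / real (k N l)) * (real (n N j) / real (k N j) *
      expectation (\<lambda>\<xi>. hill_score (S.t j N) (\<epsilon> j (Y \<xi> $ j)) * hill_score (S.t l N) (\<epsilon> l (Y \<xi> $ l))))) = \<gamma>\<^sup>2 * \<psi> j l N"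
      using S.eventually_kn[of j]
    proof eventually_elim
      case (elim N)
      have "min (n N j) (n N l) = n N j" using n_mono[of j l N] jl by simp
      moreover have coef: "sqrt (real (k N j) / real (k N l)) * (real (n N j) / real (k N j)) =
          real (n N j) / (sqrt (real (k N j)) * sqrt (real (k N l)))"
      proof -
        define r where "r = sqrt (real (k N j))"
        have r: "r \<noteq> 0" "real (k N j) = r * r" using elim by (auto simp: r_def)
        show ?thesis unfolding real_sqrt_divide r_def[symmetric] unfolding r(2) using r(1) by simp
      qed
      ultimately show ?case unfolding \<psi>_def by (simp only: mult.assoc[of "sqrt (real (k N j) / real (k N l))", symmetric])
    qed
  qed
qed

lemma score_covariance: "(\<lambda>N. \<gamma>\<^sup>2 * \<psi> j l N) \<longlonglongrightarrow> V $ j $ l"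
proof -
  consider "j < l" | "l < j" | "j = l" by (rule linorder_cases)
  then show ?thesis
  proof cases
    case 1
    then show ?thesis by (rule score_covariance_less)
  next
    case 2
    have "\<psi> j l = \<psi> l j" by (auto simp: \<psi>_def fun_eq_iff min.commute mult.commute)
    then show ?thesis using score_covariance_less[OF 2] V_sym[of j l] by simp
  next
    case 3
    have "\<forall>\<^sub>F N in sequentially. V $ j $ j = \<gamma>\<^sup>2 * \<psi> j j N"
      using eventually_good
    proof eventually_elim
      case (elim N)
      have kn: "1 \<le> k N j \<and> k N j < n N j" using elim by (simp add: good_def)
      have "expectation (\<lambda>\<xi>. hill_score (S.t j N) (\<epsilon> j (Y \<xi> $ j)) * hill_score (S.t j N) (\<epsilon> j (Y \<xi> $ j))) = exp (- S.t j N)"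
        using has_bochner_integral_integral_eq[OF hill_score_moments(2)[OF distributed_\<epsilon>Y good_t[OF elim]], of j]
        by (simp add: power2_eq_square)
      then have "\<psi> j j N = 1" using kn unfolding \<psi>_def by (simp add: S.exp_t)
      then show ?case by (simp add: V_diag)
    qed
    then show ?thesis using 3 by (simp add: tendsto_eventually eventually_mono)
  qed
qed

definition score_vec where "score_vec N \<xi> = (\<chi> j. \<gamma> * S.score j N \<xi>)"

lemma score_clt:
  "(\<lambda>N. CLINT \<xi>|M. iexp (a \<bullet> score_vec N \<xi>)) \<longlonglongrightarrow> complex_of_real (exp (- (a \<bullet> (V *v a)) / 2))"
proof -
  \<comment> \<open>Guarded by \<open>good N\<close>, since the central limit theorem asks for
    integrable, centred entries at every \<open>N\<close>.\<close>
  define hs where "hs N j y = (if good N then hill_score (S.t j N) (\<epsilon> j (y $ j)) else 0)"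
    for N j and y :: "real ^ ('m::{finite,linorder})"
  \<comment> \<open>The cut-off at \<open>n N j\<close> puts samples of different lengths into one
    array of length \<open>N\<close>; the independent summands are whole vectors, so dependence
    between coordinates stays inside a summand.\<close>
  define \<alpha> where "\<alpha> N i j = (if i \<le> n N j then a $ j * \<gamma> / sqrt (real (k N j)) else 0)" for N i j
  define \<eta> where "\<eta> N i \<xi> = (\<Sum>j\<in>UNIV. \<alpha> N i j * hs N j (X i \<xi>))" for N i \<xi>
  have hsm[measurable]: "hs N j \<in> borel_measurable borel" for N j
  proof (cases "good N")
    case True
    have "(\<lambda>y. hill_score (S.t j N) (\<epsilon> j (y $ j))) \<in> borel_measurable borel"
      by (rule measurable_compose[OF \<epsilon>_nth_measurable borel_measurable_hill_score])
    then show ?thesis using True by (simp add: hs_def[abs_def])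
  qed (simp add: hs_def[abs_def])
  have nN: "n N j \<le> N" for N j
    using member_le_sum[of j UNIV "n N"] n_sum[of N] by simp
  have hX[measurable]: "(\<lambda>\<xi>. hs N j (X i \<xi>)) \<in> borel_measurable M" if "1 \<le> i" for N i j
    by (rule measurable_compose[OF X_measurable[OF that] hsm])
  have m1: "integrable M (\<lambda>\<xi>. hs N j (X i \<xi>)) \<and> expectation (\<lambda>\<xi>. hs N j (X i \<xi>)) = 0" if "1 \<le> i" for N i j
    using hill_score_moments(1)[OF distributed_\<epsilon>X[OF that] good_t, of N j j]
    by (cases "good N") (auto simp: hs_def has_bochner_integral_iff)
  have m2: "integrable M (\<lambda>\<xi>. (hs N j (X i \<xi>))\<^sup>2) \<and>
      expectation (\<lambda>\<xi>. (hs N j (X i \<xi>))\<^sup>2) = (if good N then exp (- S.t j N) else 0)" if "1 \<le> i" for N i j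
    using hill_score_moments(2)[OF distributed_\<epsilon>X[OF that] good_t, of N j j]
    by (cases "good N") (auto simp: hs_def has_bochner_integral_iff)
  have m3: "integrable M (\<lambda>\<xi>. \<bar>hs N j (X i \<xi>)\<bar> ^ 3) \<and>
      expectation (\<lambda>\<xi>. \<bar>hs N j (X i \<xi>)\<bar> ^ 3) \<le> (if good N then 16 * exp (- S.t j N) else 0)" if "1 \<le> i" for N i j
    using hill_score_moments(3,4)[OF distributed_\<epsilon>X[OF that] good_t, of N j j]
    by (cases "good N") (auto simp: hs_def)
  have m11: "integrable M (\<lambda>\<xi>. hs N j (X i \<xi>) * hs N l (X i \<xi>))" if "1 \<le> i" for N i j l
    using m2[OF that] hX[OF that] by (intro integrable_mult_squares) auto
  have E11: "expectation (\<lambda>\<xi>. hs N j (X i \<xi>) * hs N l (X i \<xi>)) = expectation (\<lambda>\<xi>. hs N j (Y \<xi>) * hs N l (Y \<xi>))"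
    if i: "1 \<le> i" for N i j l
    by (rule expectation_X_eq[OF i, of "\<lambda>y. hs N j y * hs N l y"]) measurable
  have "(\<lambda>N. CLINT \<xi>|M. iexp (\<Sum>i\<in>{1..N}. \<eta> N i \<xi>)) \<longlonglongrightarrow> complex_of_real (exp (- (a \<bullet> (V *v a)) / 2))"
  proof (rule triangular_array_clt)
    show "indep_vars (\<lambda>_. borel) (\<eta> N) {1..N}" for N
      unfolding \<eta>_def[abs_def]
      by (rule indep_vars_compose2[OF indep_vars_subset[OF indep], where Y = "\<lambda>i y. \<Sum>j\<in>UNIV. \<alpha> N i j * hs N j y"]) auto
    have cube: "\<bar>\<eta> N i \<xi>\<bar> ^ 3 \<le> real CARD('m) ^ 3 * (\<Sum>j\<in>UNIV. \<bar>\<alpha> N i j\<bar> ^ 3 * \<bar>hs N j (X i \<xi>)\<bar> ^ 3)" for N i \<xi>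
      using abs_sum_cube_le[of "\<lambda>j. \<alpha> N i j * hs N j (X i \<xi>)"]
      by (simp add: \<eta>_def abs_mult power_mult_distrib)
    have \<eta>m: "\<eta> N i \<in> borel_measurable M" if "1 \<le> i" for N i
      unfolding \<eta>_def[abs_def] using that by measurable
    have icube: "integrable M (\<lambda>\<xi>. real CARD('m) ^ 3 * (\<Sum>j\<in>UNIV. \<bar>\<alpha> N i j\<bar> ^ 3 * \<bar>hs N j (X i \<xi>)\<bar> ^ 3))" if "1 \<le> i" for N i
      using m3[OF that] by auto
    show int3: "integrable M (\<lambda>\<xi>. \<bar>\<eta> N i \<xi>\<bar> ^ 3)" if "i \<in> {1..N}" for N i
    proof (rule Bochner_Integration.integrable_bound[OF icube])
      show "(\<lambda>\<xi>. \<bar>\<eta> N i \<xi>\<bar> ^ 3) \<in> borel_measurable M" using \<eta>m[of i N] that by simp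
      show "AE \<xi> in M. norm (\<bar>\<eta> N i \<xi>\<bar> ^ 3) \<le> norm (real CARD('m) ^ 3 * (\<Sum>j\<in>UNIV. \<bar>\<alpha> N i j\<bar> ^ 3 * \<bar>hs N j (X i \<xi>)\<bar> ^ 3))"
        using order_trans[OF cube abs_ge_self] by simp
    qed (use that in simp)
    show "expectation (\<eta> N i) = 0" if "i \<in> {1..N}" for N i
      using m1[of i N] that by (simp add: \<eta>_def[abs_def])
    have E\<eta>2: "expectation (\<lambda>\<xi>. (\<eta> N i \<xi>)\<^sup>2) = (\<Sum>j\<in>UNIV. \<Sum>l\<in>UNIV. \<alpha> N i j * \<alpha> N i l * expectation (\<lambda>\<xi>. hs N j (Y \<xi>) * hs N l (Y \<xi>)))"
      if i: "1 \<le> i" for N i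
    proof -
      have "(\<eta> N i \<xi>)\<^sup>2 = (\<Sum>j\<in>UNIV. \<Sum>l\<in>UNIV. \<alpha> N i j * \<alpha> N i l * (hs N j (X i \<xi>) * hs N l (X i \<xi>)))" for \<xi>
        by (simp add: \<eta>_def power2_eq_square sum_product mult_ac)
      then show ?thesis using m11[OF i] E11[OF i] by simp
    qed
    show "(\<lambda>N. \<Sum>i\<in>{1..N}. expectation (\<lambda>\<xi>. (\<eta> N i \<xi>)\<^sup>2)) \<longlonglongrightarrow> a \<bullet> (V *v a)"
    proof (rule Lim_transform_eventually)
      have "(\<lambda>N. \<Sum>j\<in>UNIV. \<Sum>l\<in>UNIV. a $ j * a $ l * (\<gamma>\<^sup>2 * \<psi> j l N)) \<longlonglongrightarrow> (\<Sum>j\<in>UNIV. \<Sum>l\<in>UNIV. a $ j * a $ l * V $ j $ l)"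
        by (intro tendsto_sum tendsto_mult tendsto_const score_covariance)
      also have "(\<Sum>j\<in>UNIV. \<Sum>l\<in>UNIV. a $ j * a $ l * V $ j $ l) = a \<bullet> (V *v a)"
        by (simp add: inner_vec_def matrix_vector_mult_def sum_distrib_left mult_ac)
      finally show "(\<lambda>N. \<Sum>j\<in>UNIV. \<Sum>l\<in>UNIV. a $ j * a $ l * (\<gamma>\<^sup>2 * \<psi> j l N)) \<longlonglongrightarrow> a \<bullet> (V *v a)" .
      show "\<forall>\<^sub>F N in sequentially. (\<Sum>j\<in>UNIV. \<Sum>l\<in>UNIV. a $ j * a $ l * (\<gamma>\<^sup>2 * \<psi> j l N)) =
          (\<Sum>i\<in>{1..N}. expectation (\<lambda>\<xi>. (\<eta> N i \<xi>)\<^sup>2))"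
        using eventually_good
      proof eventually_elim
        case (elim N)
        have cnt: "(\<Sum>i\<in>{1..N}. \<alpha> N i j * \<alpha> N i l) =
            a $ j * a $ l * \<gamma>\<^sup>2 * real (min (n N j) (n N l)) / (sqrt (real (k N j)) * sqrt (real (k N l)))" for j l
        proof -
          have "(\<Sum>i\<in>{1..N}. \<alpha> N i j * \<alpha> N i l) = (\<Sum>i\<in>{1..N}. if i \<in> {1..min (n N j) (n N l)} then
              (a $ j * \<gamma> / sqrt (real (k N j))) * (a $ l * \<gamma> / sqrt (real (k N l))) else 0)"
            by (intro sum.cong) (auto simp: \<alpha>_def)
          also have "\<dots> = (\<Sum>i\<in>{1..min (n N j) (n N l)}. (a $ j * \<gamma> / sqrt (real (k N j))) * (a $ l * \<gamma> / sqrt (real (k N l))))"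
          proof -
            have "{1..N} \<inter> {1..min (n N j) (n N l)} = {1..min (n N j) (n N l)}" using nN[of N j] by auto
            then show ?thesis by (subst sum.inter_restrict[symmetric]) (simp, simp only:)
          qed
          also have "\<dots> = a $ j * a $ l * \<gamma>\<^sup>2 * real (min (n N j) (n N l)) / (sqrt (real (k N j)) * sqrt (real (k N l)))"
            by (simp add: power2_eq_square mult_ac)
          finally show ?thesis .
        qed
        have "(\<Sum>i\<in>{1..N}. expectation (\<lambda>\<xi>. (\<eta> N i \<xi>)\<^sup>2)) =
            (\<Sum>i\<in>{1..N}. \<Sum>j\<in>UNIV. \<Sum>l\<in>UNIV. \<alpha> N i j * \<alpha> N i l * expectation (\<lambda>\<xi>. hs N j (Y \<xi>) * hs N l (Y \<xi>)))"
          using E\<eta>2 by (intro sum.cong) auto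
        also have "\<dots> = (\<Sum>j\<in>UNIV. \<Sum>i\<in>{1..N}. \<Sum>l\<in>UNIV. \<alpha> N i j * \<alpha> N i l * expectation (\<lambda>\<xi>. hs N j (Y \<xi>) * hs N l (Y \<xi>)))"
          by (rule sum.swap)
        also have "\<dots> = (\<Sum>j\<in>UNIV. \<Sum>l\<in>UNIV. \<Sum>i\<in>{1..N}. \<alpha> N i j * \<alpha> N i l * expectation (\<lambda>\<xi>. hs N j (Y \<xi>) * hs N l (Y \<xi>)))"
          by (intro sum.cong refl sum.swap)
        also have "\<dots> = (\<Sum>j\<in>UNIV. \<Sum>l\<in>UNIV. a $ j * a $ l * (\<gamma>\<^sup>2 * \<psi> j l N))"
          unfolding sum_distrib_right[symmetric] cnt using elim
          by (intro sum.cong refl) (simp add: \<psi>_def hs_def mult_ac)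
        finally show ?case by simp
      qed
    qed
    \<comment> \<open>Cauchy-Schwarz over the coordinates bounds one summand; each coordinate
      contributes \<open>exp (- t) / k\<close>, which is \<open>1 / n\<close>.\<close>
    define \<delta> where "\<delta> N = real CARD('m) * (\<Sum>j\<in>UNIV. (a $ j * \<gamma>)\<^sup>2 / real (n N j))" for N
    have "(\<lambda>N. real CARD('m) * (\<Sum>j\<in>UNIV. (a $ j * \<gamma>)\<^sup>2 / real (n N j))) \<longlonglongrightarrow> real CARD('m) * (\<Sum>j\<in>(UNIV :: 'm set). 0)"
      by (intro tendsto_mult tendsto_sum tendsto_const
          real_tendsto_divide_at_top[OF tendsto_const filterlim_compose[OF filterlim_real_sequentially n_lim]])
    then show "\<delta> \<longlonglongrightarrow> 0" by (simp add: \<delta>_def[abs_def])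
    show "expectation (\<lambda>\<xi>. (\<eta> N i \<xi>)\<^sup>2) \<le> \<delta> N" if "i \<in> {1..N}" for N i
    proof -
      have i: "1 \<le> i" using that by simp
      have sq: "(\<eta> N i \<xi>)\<^sup>2 \<le> real CARD('m) * (\<Sum>j\<in>UNIV. (\<alpha> N i j)\<^sup>2 * (hs N j (X i \<xi>))\<^sup>2)" for \<xi>
        using sum_squared_le_sum_of_squares[of "\<lambda>j. \<alpha> N i j * hs N j (X i \<xi>)" UNIV]
        by (simp add: \<eta>_def power_mult_distrib mult.commute)
      have "expectation (\<lambda>\<xi>. (\<eta> N i \<xi>)\<^sup>2) \<le> expectation (\<lambda>\<xi>. real CARD('m) * (\<Sum>j\<in>UNIV. (\<alpha> N i j)\<^sup>2 * (hs N j (X i \<xi>))\<^sup>2))"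
      proof (rule integral_mono)
        have "(\<eta> N i \<xi>)\<^sup>2 = (\<Sum>j\<in>UNIV. \<Sum>l\<in>UNIV. \<alpha> N i j * \<alpha> N i l * (hs N j (X i \<xi>) * hs N l (X i \<xi>)))" for \<xi>
          by (simp add: \<eta>_def power2_eq_square sum_product mult_ac)
        then show "integrable M (\<lambda>\<xi>. (\<eta> N i \<xi>)\<^sup>2)" using m11[OF i] by simp
        show "integrable M (\<lambda>\<xi>. real CARD('m) * (\<Sum>j\<in>UNIV. (\<alpha> N i j)\<^sup>2 * (hs N j (X i \<xi>))\<^sup>2))" using m2[OF i] by simp
      qed (rule sq)
      also have "\<dots> = real CARD('m) * (\<Sum>j\<in>UNIV. (\<alpha> N i j)\<^sup>2 * (if good N then exp (- S.t j N) else 0))"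
        using m2[OF i] by simp
      also have "\<dots> \<le> \<delta> N"
        unfolding \<delta>_def
      proof (intro mult_left_mono sum_mono)
        fix j
        show "(\<alpha> N i j)\<^sup>2 * (if good N then exp (- S.t j N) else 0) \<le> (a $ j * \<gamma>)\<^sup>2 / real (n N j)"
        proof (cases "good N \<and> i \<le> n N j")
          case True
          then have kn: "1 \<le> k N j \<and> k N j < n N j" by (simp add: good_def)
          show ?thesis using True kn by (simp add: \<alpha>_def S.exp_t power_divide)
        qed (auto simp: \<alpha>_def)
      qed simp
      finally show ?thesis .
    qed
    show "(\<lambda>N. \<Sum>i\<in>{1..N}. expectation (\<lambda>\<xi>. \<bar>\<eta> N i \<xi>\<bar> ^ 3)) \<longlonglongrightarrow> 0"
    proof (rule tendsto_sandwich[where f = "\<lambda>_. 0"])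
      show "\<forall>\<^sub>F N in sequentially. 0 \<le> (\<Sum>i\<in>{1..N}. expectation (\<lambda>\<xi>. \<bar>\<eta> N i \<xi>\<bar> ^ 3))"
        by (intro always_eventually allI sum_nonneg) simp
      \<comment> \<open>Lyapunov's sum: \<open>n\<close> terms of size
        \<open>(k / n) * k powr (- 3 / 2)\<close>, hence of order \<open>1 / sqrt k\<close>.\<close>
      have "(\<lambda>N. real CARD('m) ^ 3 * (\<Sum>j\<in>UNIV. 16 * \<bar>a $ j * \<gamma>\<bar> ^ 3 / sqrt (real (k N j)))) \<longlonglongrightarrow>
          real CARD('m) ^ 3 * (\<Sum>j\<in>(UNIV :: 'm set). 0)"
        by (intro tendsto_mult tendsto_sum tendsto_const real_tendsto_divide_at_top[OF tendsto_const S.sqrt_k_top])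
      then show "(\<lambda>N. real CARD('m) ^ 3 * (\<Sum>j\<in>UNIV. 16 * \<bar>a $ j * \<gamma>\<bar> ^ 3 / sqrt (real (k N j)))) \<longlonglongrightarrow> 0" by simp
      show "\<forall>\<^sub>F N in sequentially. (\<Sum>i\<in>{1..N}. expectation (\<lambda>\<xi>. \<bar>\<eta> N i \<xi>\<bar> ^ 3)) \<le>
          real CARD('m) ^ 3 * (\<Sum>j\<in>UNIV. 16 * \<bar>a $ j * \<gamma>\<bar> ^ 3 / sqrt (real (k N j)))"
        using eventually_good
      proof eventually_elim
        case (elim N)
        have b: "expectation (\<lambda>\<xi>. \<bar>\<eta> N i \<xi>\<bar> ^ 3) \<le> real CARD('m) ^ 3 * (\<Sum>j\<in>UNIV. \<bar>\<alpha> N i j\<bar> ^ 3 * (16 * exp (- S.t j N)))"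
          if i: "i \<in> {1..N}" for i
        proof -
          have i1: "1 \<le> i" using i by simp
          have "expectation (\<lambda>\<xi>. \<bar>\<eta> N i \<xi>\<bar> ^ 3) \<le> expectation (\<lambda>\<xi>. real CARD('m) ^ 3 * (\<Sum>j\<in>UNIV. \<bar>\<alpha> N i j\<bar> ^ 3 * \<bar>hs N j (X i \<xi>)\<bar> ^ 3))"
            by (rule integral_mono[OF int3[OF i] icube[OF i1] cube])
          also have "\<dots> = real CARD('m) ^ 3 * (\<Sum>j\<in>UNIV. \<bar>\<alpha> N i j\<bar> ^ 3 * expectation (\<lambda>\<xi>. \<bar>hs N j (X i \<xi>)\<bar> ^ 3))"
            using m3[OF i1] by simp
          also have "\<dots> \<le> real CARD('m) ^ 3 * (\<Sum>j\<in>UNIV. \<bar>\<alpha> N i j\<bar> ^ 3 * (16 * exp (- S.t j N)))"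
            using m3[OF i1, of N] elim by (intro mult_left_mono sum_mono) auto
          finally show ?thesis .
        qed
        have s: "(\<Sum>i\<in>{1..N}. \<bar>\<alpha> N i j\<bar> ^ 3 * (16 * exp (- S.t j N))) = 16 * \<bar>a $ j * \<gamma>\<bar> ^ 3 / sqrt (real (k N j))" for j
        proof -
          have kn: "1 \<le> k N j \<and> k N j < n N j" using elim by (simp add: good_def)
          define r where "r = sqrt (real (k N j))"
          have r: "0 < r" "real (k N j) = r * r" using kn by (auto simp: r_def)
          have "(\<Sum>i\<in>{1..N}. \<bar>\<alpha> N i j\<bar> ^ 3 * (16 * exp (- S.t j N))) =
              (\<Sum>i\<in>{1..N}. if i \<in> {1..n N j} then (\<bar>a $ j * \<gamma>\<bar> / r) ^ 3 * (16 * exp (- S.t j N)) else 0)"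
            using r by (intro sum.cong) (auto simp: \<alpha>_def r_def[symmetric] abs_divide)
          also have "\<dots> = (\<Sum>i\<in>{1..n N j}. (\<bar>a $ j * \<gamma>\<bar> / r) ^ 3 * (16 * exp (- S.t j N)))"
          proof -
            have "{1..N} \<inter> {1..n N j} = {1..n N j}" using nN[of N j] by auto
            then show ?thesis by (subst sum.inter_restrict[symmetric]) (simp, simp only:)
          qed
          also have "\<dots> = 16 * \<bar>a $ j * \<gamma>\<bar> ^ 3 / r"
            using kn r unfolding S.exp_t[OF kn] by (simp add: power_divide power3_eq_cube field_simps)
          finally show ?thesis by (simp add: r_def)
        qed
        have "(\<Sum>i\<in>{1..N}. expectation (\<lambda>\<xi>. \<bar>\<eta> N i \<xi>\<bar> ^ 3)) \<le>
            (\<Sum>i\<in>{1..N}. real CARD('m) ^ 3 * (\<Sum>j\<in>UNIV. \<bar>\<alpha> N i j\<bar> ^ 3 * (16 * exp (- S.t j N))))"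
          by (intro sum_mono b)
        also have "\<dots> = real CARD('m) ^ 3 * (\<Sum>j\<in>UNIV. \<Sum>i\<in>{1..N}. \<bar>\<alpha> N i j\<bar> ^ 3 * (16 * exp (- S.t j N)))"
          unfolding sum_distrib_left[symmetric] by (subst sum.swap) (rule refl)
        finally show ?case unfolding s .
      qed
    qed simp
  qed
  then show ?thesis
  proof (rule Lim_transform_eventually)
    show "\<forall>\<^sub>F N in sequentially. (CLINT \<xi>|M. iexp (\<Sum>i\<in>{1..N}. \<eta> N i \<xi>)) = (CLINT \<xi>|M. iexp (a \<bullet> score_vec N \<xi>))"
      using eventually_good
    proof eventually_elim
      case (elim N)
      have "(\<Sum>i\<in>{1..N}. \<eta> N i \<xi>) = a \<bullet> score_vec N \<xi>" for \<xi>
      proof -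
        have "(\<Sum>i\<in>{1..N}. \<eta> N i \<xi>) = (\<Sum>j\<in>UNIV. \<Sum>i\<in>{1..N}. \<alpha> N i j * hs N j (X i \<xi>))"
          unfolding \<eta>_def by (rule sum.swap)
        also have "\<dots> = (\<Sum>j\<in>UNIV. a $ j * (\<gamma> * S.score j N \<xi>))"
        proof (intro sum.cong refl)
          fix j
          have "(\<Sum>i\<in>{1..N}. \<alpha> N i j * hs N j (X i \<xi>)) =
              (\<Sum>i\<in>{1..N}. if i \<in> {1..n N j} then a $ j * \<gamma> / sqrt (real (k N j)) * hill_score (S.t j N) (\<epsilon> j (X i \<xi> $ j)) else 0)"
            using elim by (intro sum.cong) (auto simp: \<alpha>_def hs_def)
          also have "\<dots> = (\<Sum>i\<in>{1..n N j}. a $ j * \<gamma> / sqrt (real (k N j)) * hill_score (S.t j N) (\<epsilon> j (X i \<xi> $ j)))"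
          proof -
            have "{1..N} \<inter> {1..n N j} = {1..n N j}" using nN[of N j] by auto
            then show ?thesis by (subst sum.inter_restrict[symmetric]) (simp, simp only:)
          qed
          also have "\<dots> = a $ j * (\<gamma> * S.score j N \<xi>)"
            by (simp add: S.score_def sum_distrib_left sum_divide_distrib mult_ac)
          finally show "(\<Sum>i\<in>{1..N}. \<alpha> N i j * hs N j (X i \<xi>)) = a $ j * (\<gamma> * S.score j N \<xi>)" .
        qed
        finally show ?thesis by (simp add: score_vec_def inner_vec_def)
      qed
      then show ?case by simp
    qed
  qed
qed

end

section \<open>Scale constants of the tails and linearised estimators\<close>

context pooled_samples
begin

lemma tail_expansion:
  "\<exists>lc K t0. 1 < t0 \<and> 0 \<le> K \<and> (\<forall>t\<ge>t0. 0 < tail_quantile (F j) t \<and>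
     \<bar>ln (tail_quantile (F j) t) - lc - \<gamma> * ln t\<bar> \<le> K * t powr \<rho> j)"
  and beta_nonzero: "\<gamma> * \<beta> j \<noteq> 0"
proof -
  have lim: "((\<lambda>t. 1 / A j t * (tail_quantile (F j) (t * x) / tail_quantile (F j) t - x powr \<gamma>)) \<longlongrightarrow>
      x powr \<gamma> * ((x powr \<rho> j - 1) / \<rho> j)) at_top" if "0 < x" for x
    using C2 that rho_neg[of j] unfolding cond_C2_def by (auto split: if_splits dest: spec[of _ j])
  note * = log_tail_expansion[OF F.tail_quantile_mono gamma_pos rho_neg A lim]
  show "\<exists>lc K t0. 1 < t0 \<and> 0 \<le> K \<and> (\<forall>t\<ge>t0. 0 < tail_quantile (F j) t \<and>
     \<bar>ln (tail_quantile (F j) t) - lc - \<gamma> * ln t\<bar> \<le> K * t powr \<rho> j)"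
    by (rule *(2))
  show "\<gamma> * \<beta> j \<noteq> 0" by (rule *(1))
qed

text \<open>\<open>exp (lc j)\<close> is the scale constant of the \<open>j\<close>th tail: \<open>U j t \<sim> exp (lc j) * t powr \<gamma>\<close>.\<close>

definition lc :: "'m \<Rightarrow> real" where
  "lc j = (SOME lc. \<exists>K t0. 1 < t0 \<and> 0 \<le> K \<and> (\<forall>t\<ge>t0. 0 < tail_quantile (F j) t \<and>
     \<bar>ln (tail_quantile (F j) t) - lc - \<gamma> * ln t\<bar> \<le> K * t powr \<rho> j))"

lemma lc: "\<exists>K t0. 1 < t0 \<and> 0 \<le> K \<and> (\<forall>t\<ge>t0. 0 < tail_quantile (F j) t \<and>
     \<bar>ln (tail_quantile (F j) t) - lc j - \<gamma> * ln t\<bar> \<le> K * t powr \<rho> j)"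
  unfolding lc_def by (rule someI_ex) (rule tail_expansion)

lemma ln_tail_limit: "((\<lambda>t. ln (tail_quantile (F j) t) - \<gamma> * ln t) \<longlongrightarrow> lc j) at_top"
  and tail_quantile_pos: "\<forall>\<^sub>F t in at_top. 0 < tail_quantile (F j) t"
proof -
  obtain K t0 where K: "1 < t0" "\<And>t. t0 \<le> t \<Longrightarrow> 0 < tail_quantile (F j) t \<and>
     \<bar>ln (tail_quantile (F j) t) - lc j - \<gamma> * ln t\<bar> \<le> K * t powr \<rho> j" using lc[of j] by blast
  show "\<forall>\<^sub>F t in at_top. 0 < tail_quantile (F j) t"
    using eventually_ge_at_top[of t0] by eventually_elim (use K in blast)
  have "((\<lambda>t. ln (tail_quantile (F j) t) - \<gamma> * ln t - lc j) \<longlongrightarrow> 0) at_top"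
  proof (rule Lim_null_comparison)
    show "\<forall>\<^sub>F t in at_top. norm (ln (tail_quantile (F j) t) - \<gamma> * ln t - lc j) \<le> K * t powr \<rho> j"
      using eventually_ge_at_top[of t0]
    proof eventually_elim
      case (elim t)
      have "ln (tail_quantile (F j) t) - \<gamma> * ln t - lc j = ln (tail_quantile (F j) t) - lc j - \<gamma> * ln t" by simp
      then show ?case using K(2)[OF elim] by (simp only: real_norm_def)
    qed
    show "((\<lambda>t. K * t powr \<rho> j) \<longlongrightarrow> 0) at_top"
      using tendsto_mult[OF tendsto_const tendsto_neg_powr[OF rho_neg[of j] filterlim_ident], of K] by simp
  qed
  then show "((\<lambda>t. ln (tail_quantile (F j) t) - \<gamma> * ln t) \<longlongrightarrow> lc j) at_top" by (rule LIM_zero_cancel)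
qed

lemma tails_equivalent_lc:
  assumes "tails_equivalent (\<lambda>j. tail_quantile (F j))"
  shows "lc j = lc l"
proof (cases "j = l")
  case False
  have r: "((\<lambda>t. ln (tail_quantile (F j) t / tail_quantile (F l) t)) \<longlongrightarrow> ln 1) at_top"
    using assms False unfolding tails_equivalent_def by (intro tendsto_ln) auto
  have "((\<lambda>t. (ln (tail_quantile (F j) t) - \<gamma> * ln t) - (ln (tail_quantile (F l) t) - \<gamma> * ln t)) \<longlongrightarrow> lc j - lc l) at_top"
    by (intro tendsto_diff ln_tail_limit)
  moreover have "\<forall>\<^sub>F t in at_top. ln (tail_quantile (F j) t / tail_quantile (F l) t) =
      (ln (tail_quantile (F j) t) - \<gamma> * ln t) - (ln (tail_quantile (F l) t) - \<gamma> * ln t)"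
    using tail_quantile_pos[of j] tail_quantile_pos[of l] by eventually_elim (simp add: ln_div)
  ultimately have "lc j - lc l = ln 1"
    using tendsto_unique[OF trivial_limit_at_top_linorder _ Lim_transform_eventually[OF r]] by blast
  then show ?thesis by simp
qed simp

text \<open>By contraposition: equal scale constants make all ratios of tail quantiles tend to 1,
  and \<open>\<tau> = 1 - 1 / t\<close> carries this over to quantiles near 1.\<close>

lemma tails_different_lc:
  assumes "tails_different (\<lambda>j. quantile (F j))"
  shows "\<exists>j l. lc j \<noteq> lc l"
proof (rule ccontr)
  assume "\<not> ?thesis"
  then have eq: "lc j = lc l" for j l by blast
  have "((\<lambda>\<tau>. quantile (F j) \<tau> / quantile (F l) \<tau>) \<longlongrightarrow> 1) (at_left 1)" for j l
  proof -
    have "((\<lambda>t. exp ((ln (tail_quantile (F j) t) - \<gamma> * ln t) - (ln (tail_quantile (F l) t) - \<gamma> * ln t))) \<longlongrightarrow> exp (lc j - lc l)) at_top"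
      by (intro tendsto_exp tendsto_diff ln_tail_limit)
    then have "((\<lambda>t. exp ((ln (tail_quantile (F j) t) - \<gamma> * ln t) - (ln (tail_quantile (F l) t) - \<gamma> * ln t))) \<longlongrightarrow> 1) at_top"
      using eq[of j l] by simp
    then have lim: "((\<lambda>t. tail_quantile (F j) t / tail_quantile (F l) t) \<longlongrightarrow> 1) at_top"
    proof (rule Lim_transform_eventually)
      show "\<forall>\<^sub>F t in at_top. exp ((ln (tail_quantile (F j) t) - \<gamma> * ln t) - (ln (tail_quantile (F l) t) - \<gamma> * ln t)) =
          tail_quantile (F j) t / tail_quantile (F l) t"
        using tail_quantile_pos[of j] tail_quantile_pos[of l] by eventually_elim (simp add: exp_diff)
    qed
    have "filterlim (\<lambda>\<tau>::real. inverse (1 - \<tau>)) at_top (at_left 1)"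
    proof (rule filterlim_inverse_at_top)
      have "((\<lambda>\<tau>::real. 1 - \<tau>) \<longlongrightarrow> 1 - 1) (at_left 1)" by (intro tendsto_intros)
      then show "((\<lambda>\<tau>::real. 1 - \<tau>) \<longlongrightarrow> 0) (at_left 1)" by simp
      show "\<forall>\<^sub>F \<tau>::real in at_left 1. 0 < 1 - \<tau>" by (simp add: eventually_at_filter)
    qed
    from filterlim_compose[OF lim this]
    show ?thesis
    proof (rule Lim_transform_eventually)
      have "\<forall>\<^sub>F \<tau>::real in at_left 1. \<tau> < 1" by (simp add: eventually_at_filter)
      then show "\<forall>\<^sub>F \<tau> in at_left 1. tail_quantile (F j) (inverse (1 - \<tau>)) / tail_quantile (F l) (inverse (1 - \<tau>)) =
          quantile (F j) \<tau> / quantile (F l) \<tau>"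
        by eventually_elim (simp add: F.tail_quantile_eq divide_inverse)
    qed
  qed
  then show False using assms unfolding tails_different_def by blast
qed

text \<open>At the threshold \<open>A j (n / k)\<close> is
  \<open>\<gamma> * \<beta> j * exp (\<rho> j * t)\<close> with a nonzero factor, so the bias
  condition bounds the remainder of the tail expansion there.\<close>

lemma sqrt_k_bias: "(\<lambda>N. sqrt (real (k N j)) * exp (\<rho> j * S.t j N)) \<longlonglongrightarrow> 0"
proof -
  have "(\<lambda>N. (sqrt (real (k N j)) * A j (real (n N j) / real (k N j))) / (\<gamma> * \<beta> j)) \<longlonglongrightarrow> 0 / (\<gamma> * \<beta> j)"
    by (intro tendsto_divide bias tendsto_const beta_nonzero)
  then have "(\<lambda>N. (sqrt (real (k N j)) * A j (real (n N j) / real (k N j))) / (\<gamma> * \<beta> j)) \<longlonglongrightarrow> 0" by simp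
  then show ?thesis
  proof (rule Lim_transform_eventually)
    show "\<forall>\<^sub>F N in sequentially. (sqrt (real (k N j)) * A j (real (n N j) / real (k N j))) / (\<gamma> * \<beta> j) =
        sqrt (real (k N j)) * exp (\<rho> j * S.t j N)"
      using S.eventually_kn[of j]
    proof eventually_elim
      case (elim N)
      have pos: "0 < real (n N j) / real (k N j)" using elim by simp
      then show ?case unfolding A[OF pos] S.t_def using beta_nonzero[of j] elim by (simp add: powr_def)
    qed
  qed
qed

text \<open>The random threshold differs from \<open>t\<close> by a null sequence, which changes the
  exponential by a factor tending to 1.\<close>

lemma sqrt_k_bias_T:
  "((\<lambda>z. sqrt (real (k (fst z) j)) * exp (\<rho> j * S.T j (fst z) (snd z))) \<longlongrightarrow> 0) high_prob"
proof -
  have "((\<lambda>z. (sqrt (real (k (fst z) j)) * exp (\<rho> j * S.t j (fst z))) *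
      exp (\<rho> j * (S.T j (fst z) (snd z) - S.t j (fst z)))) \<longlongrightarrow> 0 * exp (\<rho> j * 0)) high_prob"
    by (intro tendsto_mult tendsto_exp tendsto_const S.T_minus_t filterlim_fst[OF sqrt_k_bias])
  moreover have "(sqrt (real (k N j)) * exp (\<rho> j * S.t j N)) * exp (\<rho> j * (S.T j N \<xi> - S.t j N)) =
      sqrt (real (k N j)) * exp (\<rho> j * S.T j N \<xi>)" for N \<xi>
    by (simp add: exp_add[symmetric] algebra_simps)
  ultimately show ?thesis by simp
qed

abbreviation Xo where "Xo j N \<xi> r \<equiv> order_stat (\<lambda>i. X i \<xi> $ j) (n N j) r"
abbreviation Eo where "Eo j N \<xi> r \<equiv> order_stat (\<lambda>i. \<epsilon> j (X i \<xi> $ j)) (n N j) r"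

text \<open>The expansion error decreases in the exponential variable because
  \<open>\<rho> j < 0\<close>. It is therefore largest at the threshold, and one bound at
  \<open>S.T\<close> serves all the order statistics from the threshold upwards.\<close>

lemma order_stat_expansion:
  obtains K where "0 \<le> K"
    "\<forall>\<^sub>F z in high_prob. \<forall>r\<in>{n (fst z) j - k (fst z) j..n (fst z) j}. 0 < Xo j (fst z) (snd z) r \<and>
       \<bar>ln (Xo j (fst z) (snd z) r) - lc j - \<gamma> * Eo j (fst z) (snd z) r\<bar> \<le> K * exp (\<rho> j * S.T j (fst z) (snd z))"
proof -
  obtain K t0 where K: "1 < t0" "0 \<le> K" "\<And>t. t0 \<le> t \<Longrightarrow> 0 < tail_quantile (F j) t \<and>
     \<bar>ln (tail_quantile (F j) t) - lc j - \<gamma> * ln t\<bar> \<le> K * t powr \<rho> j" using lc[of j] by blast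
  \<comment> \<open>The threshold diverges, so everything above it eventually lies in the range
    where the expansion is valid.\<close>
  have T: "\<forall>\<^sub>F z in high_prob. ln t0 \<le> S.T j (fst z) (snd z)"
  proof -
    have "\<forall>\<^sub>F z in high_prob. ln t0 + 1 \<le> S.t j (fst z)"
      using S.t_top[of j] by (intro eventually_fst_high_prob) (simp add: filterlim_at_top)
    moreover have "\<forall>\<^sub>F z in high_prob. - 1 < S.T j (fst z) (snd z) - S.t j (fst z)"
      by (rule order_tendstoD(1)[OF S.T_minus_t]) simp
    ultimately show ?thesis by eventually_elim simp
  qed
  have pos: "\<forall>\<^sub>F z in high_prob. \<forall>i\<in>{1..n (fst z) j}. 0 < w j (X i (snd z) $ j)"
    by (rule AE_high_prob) (auto intro!: AE_finite_allI AE_w_X_pos)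
  show ?thesis
  proof (rule that[OF K(2)])
    show "\<forall>\<^sub>F z in high_prob. \<forall>r\<in>{n (fst z) j - k (fst z) j..n (fst z) j}. 0 < Xo j (fst z) (snd z) r \<and>
       \<bar>ln (Xo j (fst z) (snd z) r) - lc j - \<gamma> * Eo j (fst z) (snd z) r\<bar> \<le> K * exp (\<rho> j * S.T j (fst z) (snd z))"
      using T pos eventually_fst_high_prob[OF S.eventually_kn[of j]]
    proof (eventually_elim, intro ballI)
      fix z r
      assume z: "ln t0 \<le> S.T j (fst z) (snd z)" "\<forall>i\<in>{1..n (fst z) j}. 0 < w j (X i (snd z) $ j)"
        and kn: "1 \<le> k (fst z) j \<and> k (fst z) j < n (fst z) j" and r: "r \<in> {n (fst z) j - k (fst z) j..n (fst z) j}"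
      obtain N \<xi> where N: "z = (N, \<xi>)" by (cases z)
      define y where "y = Xo j N \<xi> r"
      have r1: "1 \<le> r" "r \<le> n N j" using r kn by (auto simp: N)
      have "y \<in> (\<lambda>i. X i \<xi> $ j) ` {1..n N j}" unfolding y_def by (rule order_stat_in[OF r1])
      then have wy: "0 < w j y" using z(2) by (auto simp: N)
      have mono: "mono_on ((\<lambda>i. X i \<xi> $ j) ` {1..n N j}) (\<epsilon> j)"
      proof (rule mono_onI)
        fix u v assume uv: "u \<in> (\<lambda>i. X i \<xi> $ j) ` {1..n N j}" "v \<in> (\<lambda>i. X i \<xi> $ j) ` {1..n N j}" "u \<le> v"
        have "0 < w j v" using uv(2) z(2) by (auto simp: N)
        moreover have "w j v \<le> w j u" using w_antimono[of j] uv(3) by (simp add: antimono_def)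
        ultimately show "\<epsilon> j u \<le> \<epsilon> j v" by (simp add: \<epsilon>_def)
      qed
      have Ey: "Eo j N \<xi> r = \<epsilon> j y" unfolding y_def by (rule order_stat_comp[OF mono r1])
      have Tle: "S.T j N \<xi> \<le> \<epsilon> j y"
        unfolding Ey[symmetric] S.T_def using r kn by (intro order_stat_mono) (auto simp: N)
      have "ln t0 \<le> \<epsilon> j y" using z(1) Tle by (simp add: N)
      then have "ln (w j y) \<le> ln (1 / t0)" using K(1) by (simp add: \<epsilon>_def ln_div)
      then have wt: "w j y \<le> 1 / t0" using wy K(1) by simp
      have "0 < y \<and> \<bar>ln y - lc j + \<gamma> * ln (1 - F j y)\<bar> \<le> K * (1 - F j y) powr (- \<rho> j)"
        using F.log_observation_expansion[OF rho_neg[of j] K(2,1) K(3), where y = y] wy wt by (simp add: w_def)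
      moreover have "(1 - F j y) powr (- \<rho> j) = exp (\<rho> j * \<epsilon> j y)"
        using wy by (simp add: \<epsilon>_def powr_def w_def[symmetric])
      moreover have "exp (\<rho> j * \<epsilon> j y) \<le> exp (\<rho> j * S.T j N \<xi>)"
        using Tle rho_neg[of j] by (simp add: mult_left_mono_neg less_imp_le)
      moreover have "ln y - lc j + \<gamma> * ln (1 - F j y) = ln y - lc j - \<gamma> * \<epsilon> j y"
        by (simp add: \<epsilon>_def w_def)
      ultimately have "0 < y \<and> \<bar>ln y - lc j - \<gamma> * \<epsilon> j y\<bar> \<le> K * exp (\<rho> j * S.T j N \<xi>)"
        using K(2) by (auto intro: order_trans mult_left_mono)
      then show "0 < Xo j (fst z) (snd z) r \<and>
         \<bar>ln (Xo j (fst z) (snd z) r) - lc j - \<gamma> * Eo j (fst z) (snd z) r\<bar> \<le> K * exp (\<rho> j * S.T j (fst z) (snd z))"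
        by (simp add: N y_def Ey[unfolded y_def])
    qed
  qed
qed

text \<open>Each log-spacing differs from its exponential counterpart by at most twice the error at
  the threshold, and so does their mean; the bias condition makes this negligible after
  multiplication by \<open>sqrt k\<close>. The constant \<open>lc j\<close> cancels in the
  spacings.\<close>

lemma hill_linearisation:
  "((\<lambda>z. sqrt (real (k (fst z) j)) * (hill_at (\<lambda>i. X i (snd z)) (n (fst z)) (k (fst z)) j - \<gamma>) -
      \<gamma> * S.score j (fst z) (snd z)) \<longlongrightarrow> 0) high_prob"
proof -
  obtain K where K: "0 \<le> K"
    "\<forall>\<^sub>F z in high_prob. \<forall>r\<in>{n (fst z) j - k (fst z) j..n (fst z) j}. 0 < Xo j (fst z) (snd z) r \<and>
       \<bar>ln (Xo j (fst z) (snd z) r) - lc j - \<gamma> * Eo j (fst z) (snd z) r\<bar> \<le> K * exp (\<rho> j * S.T j (fst z) (snd z))"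
    by (rule order_stat_expansion)
  define H where "H N \<xi> = hill_at (\<lambda>i. X i \<xi>) (n N) (k N) j" for N \<xi>
  have "((\<lambda>z. sqrt (real (k (fst z) j)) * (H (fst z) (snd z) - \<gamma> * (S.top_excess j (fst z) (snd z) / real (k (fst z) j)))) \<longlongrightarrow> 0) high_prob"
  proof (rule Lim_null_comparison)
    have "((\<lambda>z. 2 * K * (sqrt (real (k (fst z) j)) * exp (\<rho> j * S.T j (fst z) (snd z)))) \<longlongrightarrow> 2 * K * 0) high_prob"
      by (intro tendsto_mult tendsto_const sqrt_k_bias_T)
    then show "((\<lambda>z. 2 * K * (sqrt (real (k (fst z) j)) * exp (\<rho> j * S.T j (fst z) (snd z)))) \<longlongrightarrow> 0) high_prob" by simp
    show "\<forall>\<^sub>F z in high_prob. norm (sqrt (real (k (fst z) j)) * (H (fst z) (snd z) - \<gamma> * (S.top_excess j (fst z) (snd z) / real (k (fst z) j))))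
        \<le> 2 * K * (sqrt (real (k (fst z) j)) * exp (\<rho> j * S.T j (fst z) (snd z)))"
      using K(2) eventually_fst_high_prob[OF S.eventually_kn[of j]]
    proof eventually_elim
      case (elim z)
      obtain N \<xi> where N: "z = (N, \<xi>)" by (cases z)
      define kk where "kk = k N j"
      define D where "D = K * exp (\<rho> j * S.T j N \<xi>)"
      have kn: "1 \<le> kk" "kk < n N j" using elim(2) by (auto simp: N kk_def)
      have b: "0 < Xo j N \<xi> r" "\<bar>ln (Xo j N \<xi> r) - lc j - \<gamma> * Eo j N \<xi> r\<bar> \<le> D" if "r \<in> {n N j - kk..n N j}" for r
        using elim(1) that by (auto simp: N kk_def D_def)
      define d where "d i = ln (Xo j N \<xi> (n N j - i + 1) / Xo j N \<xi> (n N j - kk)) -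
          \<gamma> * (Eo j N \<xi> (n N j - i + 1) - Eo j N \<xi> (n N j - kk))" for i
      have d: "\<bar>d i\<bar> \<le> 2 * D" if i: "i \<in> {1..kk}" for i
      proof -
        have r1: "n N j - i + 1 \<in> {n N j - kk..n N j}" and r2: "n N j - kk \<in> {n N j - kk..n N j}"
          using i kn by auto
        have "d i = (ln (Xo j N \<xi> (n N j - i + 1)) - lc j - \<gamma> * Eo j N \<xi> (n N j - i + 1)) -
            (ln (Xo j N \<xi> (n N j - kk)) - lc j - \<gamma> * Eo j N \<xi> (n N j - kk))"
          unfolding d_def using b(1)[OF r1] b(1)[OF r2] by (simp add: ln_div algebra_simps)
        then show ?thesis using b(2)[OF r1] b(2)[OF r2] by linarith
      qed
      have "H N \<xi> - \<gamma> * (S.top_excess j N \<xi> / real kk) = (\<Sum>i=1..kk. d i) / real kk"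
      proof -
        have "(\<Sum>i=1..kk. d i) = (\<Sum>i=1..kk. ln (Xo j N \<xi> (n N j - i + 1) / Xo j N \<xi> (n N j - kk))) -
            \<gamma> * (\<Sum>i=1..kk. Eo j N \<xi> (n N j - i + 1) - Eo j N \<xi> (n N j - kk))"
          unfolding d_def by (simp only: sum_subtractf[of "\<lambda>i. ln (Xo j N \<xi> (n N j - i + 1) / Xo j N \<xi> (n N j - kk))"] sum_distrib_left)
        moreover have "H N \<xi> = (\<Sum>i=1..kk. ln (Xo j N \<xi> (n N j - i + 1) / Xo j N \<xi> (n N j - kk))) / real kk"
          unfolding H_def hill_at_def hill_def kk_def[symmetric] by simp
        moreover have "S.top_excess j N \<xi> = (\<Sum>i=1..kk. Eo j N \<xi> (n N j - i + 1) - Eo j N \<xi> (n N j - kk))"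
          unfolding S.top_excess_def S.T_def kk_def[symmetric] by (rule refl)
        ultimately show ?thesis by (simp only: diff_divide_distrib times_divide_eq_right)
      qed
      also have "\<bar>\<dots>\<bar> \<le> (\<Sum>i=1..kk. 2 * D) / real kk"
        unfolding abs_divide using d by (intro divide_mono order_trans[OF sum_abs sum_mono]) (use kn in auto)
      also have "\<dots> = 2 * D" using kn by simp
      finally have "\<bar>H N \<xi> - \<gamma> * (S.top_excess j N \<xi> / real kk)\<bar> \<le> 2 * D" .
      then have "sqrt (real kk) * \<bar>H N \<xi> - \<gamma> * (S.top_excess j N \<xi> / real kk)\<bar> \<le> sqrt (real kk) * (2 * D)"
        by (rule mult_left_mono) simp
      then show ?case by (simp add: N abs_mult kk_def D_def mult_ac)
    qed
  qed
  from tendsto_add[OF this tendsto_mult[OF tendsto_const S.top_excess_score, of \<gamma> j]]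
  have lim: "((\<lambda>z. sqrt (real (k (fst z) j)) * (H (fst z) (snd z) - \<gamma> * (S.top_excess j (fst z) (snd z) / real (k (fst z) j))) +
      \<gamma> * ((S.top_excess j (fst z) (snd z) - real (k (fst z) j)) / sqrt (real (k (fst z) j)) - S.score j (fst z) (snd z))) \<longlongrightarrow> 0) high_prob"
    by simp
  show ?thesis
  proof (rule Lim_transform_eventually[OF lim])
    show "\<forall>\<^sub>F z in high_prob. sqrt (real (k (fst z) j)) * (H (fst z) (snd z) - \<gamma> * (S.top_excess j (fst z) (snd z) / real (k (fst z) j))) +
      \<gamma> * ((S.top_excess j (fst z) (snd z) - real (k (fst z) j)) / sqrt (real (k (fst z) j)) - S.score j (fst z) (snd z)) =
      sqrt (real (k (fst z) j)) * (hill_at (\<lambda>i. X i (snd z)) (n (fst z)) (k (fst z)) j - \<gamma>) - \<gamma> * S.score j (fst z) (snd z)"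
      using eventually_fst_high_prob[OF S.eventually_kn[of j]]
    proof eventually_elim
      case (elim z)
      define r where "r = sqrt (real (k (fst z) j))"
      have r: "0 < r" "real (k (fst z) j) = r * r" using elim by (auto simp: r_def)
      show ?case unfolding H_def r_def[symmetric] unfolding r(2) using r(1) by (simp add: field_simps)
    qed
  qed
qed

lemma hill_consistent:
  "((\<lambda>z. hill_at (\<lambda>i. X i (snd z)) (n (fst z)) (k (fst z)) j) \<longlongrightarrow> \<gamma>) high_prob"
proof -
  define H where "H z = hill_at (\<lambda>i. X i (snd z)) (n (fst z)) (k (fst z)) j" for z
  have "tight (\<lambda>z. (sqrt (real (k (fst z) j)) * (H z - \<gamma>) - \<gamma> * S.score j (fst z) (snd z)) + \<gamma> * S.score j (fst z) (snd z))"
    unfolding H_def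
    by (intro tight_add tendsto_imp_tight[OF hill_linearisation] tight_bounded_mult[OF S.tight_score tendsto_const])
  then have t: "tight (\<lambda>z. sqrt (real (k (fst z) j)) * (H z - \<gamma>))" by simp
  have "((\<lambda>z. 1 / sqrt (real (k (fst z) j))) \<longlongrightarrow> 0) high_prob"
    by (rule filterlim_fst) (rule real_tendsto_divide_at_top[OF tendsto_const S.sqrt_k_top])
  from tight_scaleR_tendsto_0[OF t this]
  have "((\<lambda>z. H z - \<gamma>) \<longlongrightarrow> 0) high_prob"
  proof (rule Lim_transform_eventually)
    show "\<forall>\<^sub>F z in high_prob. (1 / sqrt (real (k (fst z) j))) *\<^sub>R (sqrt (real (k (fst z) j)) * (H z - \<gamma>)) = H z - \<gamma>"
      using eventually_fst_high_prob[OF S.eventually_kn[of j]] by eventually_elim simp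
  qed
  then show ?thesis unfolding H_def by (rule LIM_zero_cancel)
qed

lemma order_stat_tight:
  "tight (\<lambda>z. sqrt (real (k (fst z) j)) * (ln (Xo j (fst z) (snd z) (n (fst z) j - k (fst z) j)) - lc j - \<gamma> * S.t j (fst z)))"
  and order_stat_pos: "\<forall>\<^sub>F z in high_prob. 0 < Xo j (fst z) (snd z) (n (fst z) j - k (fst z) j)"
proof -
  obtain K where K: "0 \<le> K"
    "\<forall>\<^sub>F z in high_prob. \<forall>r\<in>{n (fst z) j - k (fst z) j..n (fst z) j}. 0 < Xo j (fst z) (snd z) r \<and>
       \<bar>ln (Xo j (fst z) (snd z) r) - lc j - \<gamma> * Eo j (fst z) (snd z) r\<bar> \<le> K * exp (\<rho> j * S.T j (fst z) (snd z))"
    by (rule order_stat_expansion)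
  have ev: "\<forall>\<^sub>F z in high_prob. 0 < Xo j (fst z) (snd z) (n (fst z) j - k (fst z) j) \<and>
       \<bar>ln (Xo j (fst z) (snd z) (n (fst z) j - k (fst z) j)) - lc j - \<gamma> * S.T j (fst z) (snd z)\<bar> \<le> K * exp (\<rho> j * S.T j (fst z) (snd z))"
    using K(2)
  proof eventually_elim
    case (elim z)
    then show ?case using elim[THEN bspec, of "n (fst z) j - k (fst z) j"] by (simp add: S.T_def)
  qed
  then show "\<forall>\<^sub>F z in high_prob. 0 < Xo j (fst z) (snd z) (n (fst z) j - k (fst z) j)"
    by eventually_elim simp
  define E where "E z = sqrt (real (k (fst z) j)) * (ln (Xo j (fst z) (snd z) (n (fst z) j - k (fst z) j)) - lc j - \<gamma> * S.T j (fst z) (snd z))" for z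
  have "(E \<longlongrightarrow> 0) high_prob"
  proof (rule Lim_null_comparison)
    have "((\<lambda>z. K * (sqrt (real (k (fst z) j)) * exp (\<rho> j * S.T j (fst z) (snd z)))) \<longlongrightarrow> K * 0) high_prob"
      by (intro tendsto_mult tendsto_const sqrt_k_bias_T)
    then show "((\<lambda>z. K * (sqrt (real (k (fst z) j)) * exp (\<rho> j * S.T j (fst z) (snd z)))) \<longlongrightarrow> 0) high_prob" by simp
    show "\<forall>\<^sub>F z in high_prob. norm (E z) \<le> K * (sqrt (real (k (fst z) j)) * exp (\<rho> j * S.T j (fst z) (snd z)))"
      using ev
    proof eventually_elim
      case (elim z)
      then have "sqrt (real (k (fst z) j)) * \<bar>ln (Xo j (fst z) (snd z) (n (fst z) j - k (fst z) j)) - lc j - \<gamma> * S.T j (fst z) (snd z)\<bar>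
          \<le> sqrt (real (k (fst z) j)) * (K * exp (\<rho> j * S.T j (fst z) (snd z)))"
        by (intro mult_left_mono) auto
      then show ?case by (simp add: E_def abs_mult mult_ac)
    qed
  qed
  then have "tight (\<lambda>z. E z + \<gamma> * (sqrt (real (k (fst z) j)) * (S.T j (fst z) (snd z) - S.t j (fst z))))"
    by (intro tight_add tendsto_imp_tight[of E] tight_bounded_mult[OF S.tight_T tendsto_const])
  then show "tight (\<lambda>z. sqrt (real (k (fst z) j)) * (ln (Xo j (fst z) (snd z) (n (fst z) j - k (fst z) j)) - lc j - \<gamma> * S.t j (fst z)))"
    by (simp add: E_def algebra_simps)
qed

end

section \<open>Limits of the test statistic and of the confidence interval\<close>

lemma distribution_fun_cdf:
  assumes "prob_space \<mu>" "sets \<mu> = sets borel" "\<And>x. measure \<mu> {x} = 0"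
  shows "distribution_fun (cdf \<mu>)"
proof -
  interpret prob_space \<mu> by fact
  interpret real_distribution \<mu> by standard (fact assms(2))
  show ?thesis
    by standard (auto intro: monoI cdf_nondecreasing cdf_lim_at_bot cdf_lim_at_top_prob simp: isCont_cdf assms(3))
qed

lemma measure_above_quantile:
  assumes "prob_space \<mu>" "sets \<mu> = sets borel" "\<And>x. measure \<mu> {x} = 0" "0 < \<tau>" "\<tau> < 1"
  shows "measure \<mu> {quantile (cdf \<mu>) \<tau><..} = 1 - \<tau>"
proof -
  interpret prob_space \<mu> by fact
  interpret D: distribution_fun "cdf \<mu>" by (rule distribution_fun_cdf[OF assms(1-3)])
  have sp: "space \<mu> = UNIV" using sets_eq_imp_space_eq[OF assms(2)] by simp
  have "measure \<mu> (space \<mu> - {..quantile (cdf \<mu>) \<tau>}) = 1 - cdf \<mu> (quantile (cdf \<mu>) \<tau>)"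
    unfolding cdf_def by (rule prob_compl) (simp add: assms(2))
  moreover have "space \<mu> - {..quantile (cdf \<mu>) \<tau>} = {quantile (cdf \<mu>) \<tau><..}" by (auto simp: sp)
  ultimately show ?thesis using D.F_quantile[OF assms(4,5)] by simp
qed

lemma std_normal_singleton: "measure std_normal {x} = 0"
proof -
  have "{x} \<in> null_sets lborel" by (rule finite_imp_null_set_lborel) simp
  moreover have "absolutely_continuous lborel std_normal"
    unfolding std_normal_def by (rule absolutely_continuousI_density) simp
  ultimately have "{x} \<in> null_sets std_normal" by (auto simp: absolutely_continuous_def)
  then show ?thesis by (simp add: measure_eq_0_null_sets)
qed

lemma std_normal_symmetric: "measure std_normal {..<- x} = measure std_normal {x<..}"
proof -
  have "emeasure std_normal {..<- x} = (\<integral>\<^sup>+ y. ennreal (std_normal_density y) * indicator {..<- x} y \<partial>lborel)"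
    unfolding std_normal_def by (rule emeasure_density) auto
  also have "\<dots> = (\<integral>\<^sup>+ y. ennreal (std_normal_density (- y)) * indicator {..<- x} (- y) \<partial>lborel)"
    by (subst nn_integral_real_affine[where c = "- 1" and t = 0]) auto
  also have "\<dots> = (\<integral>\<^sup>+ y. ennreal (std_normal_density y) * indicator {x<..} y \<partial>lborel)"
    by (intro nn_integral_cong) (auto simp: indicator_def normal_density_def)
  also have "\<dots> = emeasure std_normal {x<..}"
    unfolding std_normal_def by (rule emeasure_density[symmetric]) auto
  finally show ?thesis by (simp add: measure_def)
qed

text \<open>If \<open>z \<le> 0\<close>, symmetry would give both tails at \<open>z\<close> mass at
  most \<open>1 - \<tau>\<close>, less than 1/2 each, and the total mass would stay below 1.\<close>

lemma std_normal_quantile_pos: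
  assumes "1 / 2 < \<tau>" "\<tau> < 1"
  shows "0 < quantile (cdf std_normal) \<tau>"
proof (rule ccontr)
  define z where "z = quantile (cdf std_normal) \<tau>"
  assume "\<not> 0 < quantile (cdf std_normal) \<tau>"
  then have "z \<le> - z" by (simp add: z_def)
  then have "measure std_normal {- z<..} \<le> measure std_normal {z<..}"
    by (intro std_normal.finite_measure_mono) auto
  moreover have "measure std_normal {z<..} = 1 - \<tau>"
    unfolding z_def using assms
    by (intro measure_above_quantile prob_space_std_normal std_normal_singleton) auto
  moreover have "measure std_normal {..<z} = measure std_normal {- z<..}"
    using std_normal_symmetric[of "- z"] by simp
  moreover have "measure std_normal UNIV = measure std_normal {..<z} + measure std_normal {z} + measure std_normal {z<..}"
  proof -
    have "UNIV = ({..<z} \<union> {z}) \<union> {z<..}" by auto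
    moreover have "measure std_normal (({..<z} \<union> {z}) \<union> {z<..}) = measure std_normal ({..<z} \<union> {z}) + measure std_normal {z<..}"
      by (intro std_normal.finite_measure_Union) auto
    moreover have "measure std_normal ({..<z} \<union> {z}) = measure std_normal {..<z} + measure std_normal {z}"
      by (intro std_normal.finite_measure_Union) auto
    ultimately show ?thesis by simp
  qed
  ultimately show False
    using std_normal.prob_space std_normal_singleton[of z] assms by simp
qed

text \<open>With one degree of freedom the law is that of a squared Gaussian. As the quantile is
  positive, exceeding its square means falling into one of two symmetric tails of mass
  \<open>\<alpha> / 2\<close>.\<close>

lemma chi_square_1_tail:
  assumes "0 < \<alpha>" "\<alpha> < 1"
  shows "measure (chi_square 1) {(quantile (cdf std_normal) (1 - \<alpha> / 2))\<^sup>2<..} = \<alpha>"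
proof -
  define z where "z = quantile (cdf std_normal) (1 - \<alpha> / 2)"
  have z: "0 < z" unfolding z_def using assms by (intro std_normal_quantile_pos) auto
  have tail: "measure std_normal {z<..} = \<alpha> / 2"
    using measure_above_quantile[OF prob_space_std_normal sets_std_normal std_normal_singleton, of "1 - \<alpha> / 2"] assms
    by (simp add: z_def)
  have comp: "distr (Pi\<^sub>M {..<1::nat} (\<lambda>_. std_normal)) std_normal (\<lambda>g. g 0) = std_normal"
    by (rule distr_PiM_component) (auto intro: prob_space_std_normal)
  have "chi_square 1 = distr (Pi\<^sub>M {..<1::nat} (\<lambda>_. std_normal)) borel ((\<lambda>x. x\<^sup>2) \<circ> (\<lambda>g. g 0))"
    unfolding chi_square_def by (intro distr_cong) auto
  also have "\<dots> = distr (distr (Pi\<^sub>M {..<1::nat} (\<lambda>_. std_normal)) std_normal (\<lambda>g. g 0)) borel (\<lambda>x. x\<^sup>2)"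
    by (intro distr_distr[symmetric]) auto
  finally have chi: "chi_square 1 = distr std_normal borel (\<lambda>x. x\<^sup>2)" unfolding comp .
  have "measure (chi_square 1) {z\<^sup>2<..} = measure std_normal ((\<lambda>x. x\<^sup>2) -` {z\<^sup>2<..})"
    unfolding chi by (subst measure_distr) auto
  also have "(\<lambda>x. x\<^sup>2) -` {z\<^sup>2<..} = {..<- z} \<union> {z<..}"
  proof (rule set_eqI)
    fix x :: real
    have "z\<^sup>2 < x\<^sup>2 \<longleftrightarrow> z < \<bar>x\<bar>"
      using z power2_less_imp_less[of z "\<bar>x\<bar>"] power_strict_mono[of z "\<bar>x\<bar>" 2] by auto
    then show "x \<in> (\<lambda>x. x\<^sup>2) -` {z\<^sup>2<..} \<longleftrightarrow> x \<in> {..<- z} \<union> {z<..}" by auto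
  qed
  also have "measure std_normal ({..<- z} \<union> {z<..}) = measure std_normal {..<- z} + measure std_normal {z<..}"
    using z by (intro std_normal.finite_measure_Union) auto
  finally show ?thesis using std_normal_symmetric[of z] tail by (simp add: z_def)
qed

context prob_space begin

text \<open>Properness of the filter gives uniqueness of limits in probability.\<close>

lemma high_prob_neq_bot: "high_prob \<noteq> bot"
proof
  assume "high_prob = bot"
  then have "eventually (\<lambda>_. False) high_prob" by simp
  then obtain A where A: "\<And>N. A N = {}" "(\<lambda>N. prob (A N)) \<longlonglongrightarrow> 1"
    unfolding eventually_high_prob by blast
  then have "(\<lambda>N. 0 :: real) \<longlonglongrightarrow> 1" by simp
  from LIMSEQ_unique[OF this tendsto_const] show False by simp
qed

end

context pooled_samples
begin

section \<open>Measurability of the statistics\<close>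

lemma X_nth_measurable: "1 \<le> i \<Longrightarrow> (\<lambda>\<xi>. X i \<xi> $ j) \<in> borel_measurable M"
  by (rule measurable_compose[OF X_measurable borel_measurable_nth])

lemma order_stat_measurable:
  "1 \<le> r \<Longrightarrow> r \<le> n N j \<Longrightarrow> (\<lambda>\<xi>. Xo j N \<xi> r) \<in> borel_measurable M"
  by (intro borel_measurable_order_stat X_nth_measurable) auto

lemma hill_measurable:
  assumes "good N"
  shows "(\<lambda>\<xi>. hill_at (\<lambda>i. X i \<xi>) (n N) (k N) j) \<in> borel_measurable M"
proof -
  have kn: "1 \<le> k N j" "k N j < n N j" using assms by (auto simp: good_def)
  have [measurable]: "(\<lambda>\<xi>. Xo j N \<xi> (n N j - k N j)) \<in> borel_measurable M"
    using kn by (intro order_stat_measurable) auto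
  have [measurable]: "(\<lambda>\<xi>. Xo j N \<xi> (n N j - i + 1)) \<in> borel_measurable M" if "i \<in> {1..k N j}" for i
    using kn that by (intro order_stat_measurable) auto
  show ?thesis unfolding hill_at_def hill_def by measurable
qed

lemma weissman_measurable:
  assumes "good N"
  shows "(\<lambda>\<xi>. weissman_at (\<lambda>i. X i \<xi>) (n N) (k N) (p N) j) \<in> borel_measurable M"
proof -
  have kn: "1 \<le> k N j" "k N j < n N j" using assms by (auto simp: good_def)
  have [measurable]: "(\<lambda>\<xi>. Xo j N \<xi> (n N j - k N j)) \<in> borel_measurable M"
    using kn by (intro order_stat_measurable) auto
  have [measurable]: "(\<lambda>\<xi>. hill (\<lambda>i. X i \<xi> $ j) (n N j) (k N j)) \<in> borel_measurable M"
    using hill_measurable[OF assms, of j] by (simp add: hill_at_def)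
  show ?thesis unfolding weissman_at_def weissman_def by measurable
qed

lemma R_hat_measurable: "(\<lambda>\<xi>. R_hat (\<lambda>i. X i \<xi>) (n N) (k N) j l u v) \<in> borel_measurable M"
proof -
  have [measurable]: "(\<lambda>\<xi>. real (rank_of (\<lambda>i. X i \<xi> $ h) n' i)) \<in> borel_measurable M" if "i \<in> {1..n'}" for h n' i
  proof -
    have [measurable]: "(\<lambda>\<xi>. X i' \<xi> $ h) \<in> borel_measurable M" if "i' \<in> {1..n'}" for i'
      using that by (intro X_nth_measurable) auto
    have "real (rank_of (\<lambda>i. X i \<xi> $ h) n' i) = (\<Sum>i'\<in>{1..n'}. if X i' \<xi> $ h \<le> X i \<xi> $ h then 1 else 0)" for \<xi>
      by (simp add: rank_of_def sum.If_cases Int_def)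
    then show ?thesis using that by simp
  qed
  show ?thesis unfolding R_hat_def Let_def by measurable
qed

lemma V_bar_measurable:
  assumes "good N"
  shows "(\<lambda>\<xi>. V_bar (\<lambda>i. X i \<xi>) (n N) (k N) $ j $ l) \<in> borel_measurable M"
proof -
  note [measurable] = hill_measurable[OF assms] R_hat_measurable
  show ?thesis unfolding V_bar_def sym_matrix_def by (cases "j = l"; cases "j < l") simp_all
qed

lemma V_hat_measurable:
  assumes "good N"
  shows "(\<lambda>\<xi>. V_hat (\<lambda>i. X i \<xi>) (n N) (k N) \<omega>0 $ j $ l) \<in> borel_measurable M"
proof -
  note [measurable] = hill_measurable[OF assms] R_hat_measurable
  have [measurable]: "(\<lambda>\<xi>. pooled_hill (\<lambda>i. X i \<xi>) (n N) (k N) \<omega>0) \<in> borel_measurable M"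
    unfolding pooled_hill_def by measurable
  show ?thesis unfolding V_hat_def sym_matrix_def by (cases "j = l"; cases "j < l") simp_all
qed

lemma L_stat_measurable:
  assumes "good N"
  shows "(\<lambda>\<xi>. L_stat (\<lambda>i. X i \<xi>) (n N) (k N) (p N)) \<in> borel_measurable M"
proof -
  note [measurable] = weissman_measurable[OF assms]
  have [measurable]: "(\<lambda>\<xi>. gls (V_bar (\<lambda>i. X i \<xi>) (n N) (k N)) (\<chi> j. ln (weissman_at (\<lambda>i. X i \<xi>) (n N) (k N) (p N) j))) \<in> borel_measurable M"
    by (intro borel_measurable_gls V_bar_measurable assms) simp
  show ?thesis unfolding L_stat_eq_gls by measurable
qed

lemma conf_interval_measurable:
  assumes "good N" and [measurable]: "\<omega> \<in> borel_measurable M"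
  shows "{\<xi> \<in> space M. x \<in> conf_interval (\<lambda>i. X i \<xi>) (n N) (k N) (p N) \<omega>0 (\<omega> \<xi>) \<alpha>} \<in> events"
proof -
  note [measurable] = weissman_measurable[OF assms(1)] V_hat_measurable[OF assms(1)]
  have [measurable]: "(\<lambda>\<xi>. \<omega> \<xi> $ j) \<in> borel_measurable M" for j
    by (rule measurable_compose[OF assms(2) borel_measurable_nth])
  have [measurable]: "(\<lambda>\<xi>. pooled_weissman (\<lambda>i. X i \<xi>) (n N) (k N) (p N) (\<omega> \<xi>)) \<in> borel_measurable M"
    unfolding pooled_weissman_def by measurable
  have [measurable]: "(\<lambda>\<xi>. \<omega> \<xi> \<bullet> (V_hat (\<lambda>i. X i \<xi>) (n N) (k N) \<omega>0 *v \<omega> \<xi>)) \<in> borel_measurable M"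
    unfolding inner_vec_def matrix_vector_mult_def by simp
  show ?thesis unfolding conf_interval_def Let_def atLeastAtMost_iff by measurable
qed

section \<open>Limits of the covariance estimators\<close>

lemma R_hat_limit:
  assumes jl: "j < l"
  shows "((\<lambda>z. R_hat (\<lambda>i. X i (snd z)) (n (fst z)) (k (fst z)) j l (real (k (fst z) j) / real (k (fst z) l))
      (real (n (fst z) j) / real (n (fst z) l))) \<longlongrightarrow> Rr j l (c l / c j) (b l / b j)) high_prob"
proof -
  \<comment> \<open>When the two sample sizes coincide the estimator is normalised by
    \<open>k l\<close>, otherwise by \<open>k j\<close>; which case occurs may vary with
    \<open>N\<close>, so \<open>k'\<close> is bounded by both candidates together.\<close>
  define k' where "k' N = (if n N j < n N l then k N j else k N l)" for N
  have k'_top: "filterlim k' at_top sequentially"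
    unfolding filterlim_at_top
  proof safe
    fix B
    have "\<forall>\<^sub>F N in sequentially. B \<le> k N j" "\<forall>\<^sub>F N in sequentially. B \<le> k N l"
      using k_lim by (auto simp: filterlim_at_top)
    then show "\<forall>\<^sub>F N in sequentially. B \<le> k' N" by eventually_elim (simp add: k'_def)
  qed
  have minn: "min (n N j) (n N l) = n N j" for N using n_mono[of j l N] jl by simp
  have k'n: "(\<lambda>N. real (k' N) / real (n N j)) \<longlonglongrightarrow> 0"
  proof (rule tendsto_sandwich[where f = "\<lambda>_. 0"])
    have "(\<lambda>N. real (k N j) / real (n N j) + real (k N l) / real (k N j) * (real (k N j) / real (n N j))) \<longlonglongrightarrow> 0 + c j / c l * 0"
      by (intro tendsto_add tendsto_mult k_n k_ratio)
    then show "(\<lambda>N. real (k N j) / real (n N j) + real (k N l) / real (k N j) * (real (k N j) / real (n N j))) \<longlonglongrightarrow> 0" by simp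
    show "\<forall>\<^sub>F N in sequentially. real (k' N) / real (n N j) \<le>
        real (k N j) / real (n N j) + real (k N l) / real (k N j) * (real (k N j) / real (n N j))"
      using S.eventually_kn[of j] by eventually_elim (simp add: k'_def)
  qed auto
  show ?thesis
    by (rule R_hat_consistent[OF tail_copula_Cop indep w_measurable w_measurable w_antimono w_antimono prob_w_X(1) prob_w_X(1)
        prob_w_X(2) minn[symmetric] k'_def n_lim k'_top k'n k_ratio _ n_ratio])
      (use jl c_pos b_pos in auto)
qed

text \<open>The limit of \<open>total (k N) / k N j\<close>, since \<open>c j / c i\<close> is the
  limit of \<open>k N i / k N j\<close>.\<close>

definition \<kappa> :: "'m \<Rightarrow> real" where "\<kappa> j = (\<Sum>i\<in>UNIV. c j / c i)"

lemma kappa_pos: "0 < \<kappa> j"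
  unfolding \<kappa>_def using c_pos by (intro sum_pos) auto

lemma total_k_ratio: "(\<lambda>N. real (total (k N)) / real (k N j)) \<longlonglongrightarrow> \<kappa> j"
proof -
  have "(\<lambda>N. \<Sum>i\<in>UNIV. real (k N i) / real (k N j)) \<longlonglongrightarrow> \<kappa> j"
    unfolding \<kappa>_def by (intro tendsto_sum k_ratio)
  then show ?thesis by (simp add: sum_divide_distrib)
qed

text \<open>The matrix \<open>V\<close> belongs to errors scaled by their own
  \<open>sqrt (k j)\<close>; the factors \<open>sqrt (\<kappa> j)\<close> change this to the common
  scale \<open>sqrt (total k)\<close>.\<close>

definition Vc :: "real ^ ('m::{finite,linorder}) ^ ('m::{finite,linorder})" where
  "Vc = (\<chi> j l. sqrt (\<kappa> j) * sqrt (\<kappa> l) * V $ j $ l)"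

lemma Vc_quadratic: "x \<bullet> (Vc *v y) = (\<chi> j. sqrt (\<kappa> j) * x $ j) \<bullet> (V *v (\<chi> j. sqrt (\<kappa> j) * y $ j))"
  by (simp add: Vc_def inner_vec_def matrix_vector_mult_def sum_distrib_left mult_ac)

lemma Vc_positive_definite: "positive_definite Vc"
  unfolding positive_definite_def
proof (intro conjI allI impI)
  show "transpose Vc = Vc" by (simp add: Vc_def transpose_def vec_eq_iff V_sym mult_ac)
  fix x :: "real ^ ('m::{finite,linorder})"
  assume "x \<noteq> 0"
  then obtain j where "x $ j \<noteq> 0" by (auto simp: vec_eq_iff)
  then have "(\<chi> j. sqrt (\<kappa> j) * x $ j) \<noteq> 0" using kappa_pos[of j] by (auto simp: vec_eq_iff intro!: exI[of _ j])
  then show "0 < x \<bullet> (Vc *v x)" unfolding Vc_quadratic using V_pd by (simp add: positive_definite_def)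
qed

lemma Vc_diag: "Vc $ j $ j = \<kappa> j * \<gamma>\<^sup>2"
  using kappa_pos[of j] by (simp add: Vc_def V_diag)

text \<open>The estimators divide by \<open>k j\<close> alone although \<open>Vc\<close> is
  symmetric in its scaling. The two agree because \<open>\<kappa>\<close> is proportional to
  \<open>c\<close>, so the factor \<open>sqrt (c j / c l)\<close> in \<open>V\<close> turns the
  geometric mean of \<open>\<kappa> j\<close> and \<open>\<kappa> l\<close> into
  \<open>\<kappa> j\<close>.\<close>

lemma Vc_less:
  assumes "j < l"
  shows "Vc $ j $ l = \<kappa> j * \<gamma>\<^sup>2 * Rr j l (c l / c j) (b l / b j)"
proof -
  define G where "G = (\<Sum>i\<in>UNIV. 1 / c i)"
  have G: "0 < G" unfolding G_def using c_pos by (intro sum_pos) auto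
  have \<kappa>: "\<kappa> i = c i * G" for i unfolding \<kappa>_def G_def by (simp add: sum_distrib_left)
  have "sqrt (\<kappa> j) * sqrt (\<kappa> l) * sqrt (c j / c l) = sqrt ((c j * G) * (c l * G) * (c j / c l))"
    by (simp only: \<kappa> real_sqrt_mult)
  also have "(c j * G) * (c l * G) * (c j / c l) = (c j * G)\<^sup>2"
    using c_pos[of l] by (simp add: power2_eq_square)
  also have "sqrt ((c j * G)\<^sup>2) = \<kappa> j" using G c_pos[of j] by (simp add: \<kappa> less_imp_le)
  finally have e: "sqrt (\<kappa> j) * sqrt (\<kappa> l) * sqrt (c j / c l) = \<kappa> j" .
  have "Vc $ j $ l = \<gamma>\<^sup>2 * ((sqrt (\<kappa> j) * sqrt (\<kappa> l) * sqrt (c j / c l)) * Rr j l (c l / c j) (b l / b j))"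
    unfolding Vc_def using V_less[OF assms] by (simp add: mult_ac)
  then show ?thesis unfolding e by simp
qed

text \<open>Serves both covariance estimators, which differ in the consistent estimates of
  \<open>\<gamma>\<close> that they plug in.\<close>

lemma sym_matrix_tendsto_Vc:
  assumes d: "\<And>j. ((\<lambda>z. d z j) \<longlongrightarrow> \<kappa> j * \<gamma>\<^sup>2) high_prob"
    and f: "\<And>j l. j < l \<Longrightarrow> ((\<lambda>z. f z j l) \<longlongrightarrow> \<kappa> j * \<gamma>\<^sup>2 * Rr j l (c l / c j) (b l / b j)) high_prob"
  shows "((\<lambda>z. sym_matrix (d z) (f z)) \<longlongrightarrow> Vc) high_prob"
proof (intro vec_tendstoI)
  fix j l :: 'm
  have sym: "Vc $ j $ l = Vc $ l $ j" by (simp add: Vc_def V_sym mult_ac)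
  consider "j < l" | "l < j" | "j = l" by (rule linorder_cases)
  then show "((\<lambda>z. sym_matrix (d z) (f z) $ j $ l) \<longlongrightarrow> Vc $ j $ l) high_prob"
  proof cases
    case 1
    then have "j \<noteq> l" by simp
    then show ?thesis using f[OF 1] 1 by (simp add: sym_matrix_def Vc_less[OF 1])
  next
    case 2
    then have "j \<noteq> l" "\<not> j < l" by auto
    then show ?thesis using f[OF 2] by (simp add: sym_matrix_def sym Vc_less[OF 2])
  next
    case 3
    then show ?thesis using d[of j] by (simp add: sym_matrix_def Vc_diag)
  qed
qed

lemma V_bar_limit: "((\<lambda>z. V_bar (\<lambda>i. X i (snd z)) (n (fst z)) (k (fst z))) \<longlongrightarrow> Vc) high_prob"
  unfolding V_bar_def
proof (rule sym_matrix_tendsto_Vc)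
  fix j
  have "((\<lambda>z. real (total (k (fst z))) / real (k (fst z) j) * (hill_at (\<lambda>i. X i (snd z)) (n (fst z)) (k (fst z)) j)\<^sup>2) \<longlongrightarrow> \<kappa> j * \<gamma>\<^sup>2) high_prob"
    by (intro tendsto_mult tendsto_power hill_consistent filterlim_fst[OF total_k_ratio])
  then show "((\<lambda>z. real (total (k (fst z))) * (hill_at (\<lambda>i. X i (snd z)) (n (fst z)) (k (fst z)) j)\<^sup>2 / real (k (fst z) j)) \<longlongrightarrow> \<kappa> j * \<gamma>\<^sup>2) high_prob"
    by simp
next
  fix j l :: 'm assume jl: "j < l"
  have "((\<lambda>z. real (total (k (fst z))) / real (k (fst z) j) * (hill_at (\<lambda>i. X i (snd z)) (n (fst z)) (k (fst z)) j *
      hill_at (\<lambda>i. X i (snd z)) (n (fst z)) (k (fst z)) l) * R_hat (\<lambda>i. X i (snd z)) (n (fst z)) (k (fst z)) j l (real (k (fst z) j) / real (k (fst z) l))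
      (real (n (fst z) j) / real (n (fst z) l))) \<longlongrightarrow> \<kappa> j * (\<gamma> * \<gamma>) * Rr j l (c l / c j) (b l / b j)) high_prob"
    by (intro tendsto_mult hill_consistent filterlim_fst[OF total_k_ratio] R_hat_limit[OF jl])
  then show "((\<lambda>z. real (total (k (fst z))) * hill_at (\<lambda>i. X i (snd z)) (n (fst z)) (k (fst z)) j *
      hill_at (\<lambda>i. X i (snd z)) (n (fst z)) (k (fst z)) l / real (k (fst z) j) * R_hat (\<lambda>i. X i (snd z)) (n (fst z)) (k (fst z)) j l (real (k (fst z) j) / real (k (fst z) l))
      (real (n (fst z) j) / real (n (fst z) l))) \<longlongrightarrow> \<kappa> j * \<gamma>\<^sup>2 * Rr j l (c l / c j) (b l / b j)) high_prob"
    by (simp add: power2_eq_square mult.assoc)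
qed

lemma V_hat_limit:
  assumes pilot: "\<omega>0 \<bullet> 1 = 1"
  shows "((\<lambda>z. V_hat (\<lambda>i. X i (snd z)) (n (fst z)) (k (fst z)) \<omega>0) \<longlongrightarrow> Vc) high_prob"
proof -
  have "((\<lambda>z. \<Sum>j\<in>UNIV. \<omega>0 $ j * hill_at (\<lambda>i. X i (snd z)) (n (fst z)) (k (fst z)) j) \<longlongrightarrow> (\<Sum>j\<in>UNIV. \<omega>0 $ j * \<gamma>)) high_prob"
    by (intro tendsto_sum tendsto_mult tendsto_const hill_consistent)
  moreover have "(\<Sum>j\<in>UNIV. \<omega>0 $ j * \<gamma>) = \<gamma>"
    using pilot by (simp add: inner_vec_def sum_distrib_right[symmetric])
  ultimately have ph: "((\<lambda>z. pooled_hill (\<lambda>i. X i (snd z)) (n (fst z)) (k (fst z)) \<omega>0) \<longlongrightarrow> \<gamma>) high_prob"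
    by (simp add: pooled_hill_def)
  show ?thesis
    unfolding V_hat_def
  proof (rule sym_matrix_tendsto_Vc)
    fix j
    have "((\<lambda>z. real (total (k (fst z))) / real (k (fst z) j) * (pooled_hill (\<lambda>i. X i (snd z)) (n (fst z)) (k (fst z)) \<omega>0)\<^sup>2) \<longlongrightarrow> \<kappa> j * \<gamma>\<^sup>2) high_prob"
      by (intro tendsto_mult tendsto_power ph filterlim_fst[OF total_k_ratio])
    then show "((\<lambda>z. real (total (k (fst z))) * (pooled_hill (\<lambda>i. X i (snd z)) (n (fst z)) (k (fst z)) \<omega>0)\<^sup>2 / real (k (fst z) j)) \<longlongrightarrow> \<kappa> j * \<gamma>\<^sup>2) high_prob"
      by simp
  next
    fix j l :: 'm assume jl: "j < l"
    have "((\<lambda>z. real (total (k (fst z))) / real (k (fst z) j) * (pooled_hill (\<lambda>i. X i (snd z)) (n (fst z)) (k (fst z)) \<omega>0)\<^sup>2 *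
        R_hat (\<lambda>i. X i (snd z)) (n (fst z)) (k (fst z)) j l (real (k (fst z) j) / real (k (fst z) l))
        (real (n (fst z) j) / real (n (fst z) l))) \<longlongrightarrow> \<kappa> j * \<gamma>\<^sup>2 * Rr j l (c l / c j) (b l / b j)) high_prob"
      by (intro tendsto_mult tendsto_power ph filterlim_fst[OF total_k_ratio] R_hat_limit[OF jl])
    then show "((\<lambda>z. real (total (k (fst z))) * (pooled_hill (\<lambda>i. X i (snd z)) (n (fst z)) (k (fst z)) \<omega>0)\<^sup>2 / real (k (fst z) j) *
        R_hat (\<lambda>i. X i (snd z)) (n (fst z)) (k (fst z)) j l (real (k (fst z) j) / real (k (fst z) l))
        (real (n (fst z) j) / real (n (fst z) l))) \<longlongrightarrow> \<kappa> j * \<gamma>\<^sup>2 * Rr j l (c l / c j) (b l / b j)) high_prob"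
      by simp
  qed
qed

section \<open>Normalised logarithms of the extreme quantile estimators\<close>

definition D where "D N = real (total (k N)) / (real N * p N)"
definition ratio where "ratio N = sqrt (real (total (k N))) / ln (D N)"

lemma D_top: "filterlim D at_top sequentially"
  using np_lim by (simp add: D_def[abs_def])

lemma ln_D_top: "filterlim (\<lambda>N. ln (D N)) at_top sequentially"
  by (rule filterlim_compose[OF ln_at_top D_top])

lemma ratio_top: "filterlim ratio at_top sequentially"
  using rate by (simp add: ratio_def[abs_def] D_def)

lemma eventually_p_pos: "\<forall>\<^sub>F N in sequentially. 0 < p N \<and> 0 < real N \<and> 0 < D N"
proof -
  have "\<forall>\<^sub>F N in sequentially. 0 < D N" using D_top by (simp add: filterlim_at_top_dense)
  then show ?thesis
  proof eventually_elim
    case (elim N)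
    have "\<not> real (total (k N)) < 0" "\<not> real N < 0" by (simp_all only: not_less of_nat_0_le_iff)
    with elim show ?case unfolding D_def zero_less_divide_iff zero_less_mult_iff by linarith
  qed
qed

definition Dj where "Dj j N = real (k N j) / (real (n N j) * p N)"

lemma Dj_over_D: "\<exists>L>0. (\<lambda>N. Dj j N / D N) \<longlonglongrightarrow> L"
proof (intro exI conjI)
  have "(\<lambda>N. real (\<Sum>i\<in>UNIV. n N i) / real (n N j)) \<longlonglongrightarrow> (\<Sum>i\<in>UNIV. b j / b i)"
    using tendsto_sum[of UNIV "\<lambda>i N. real (n N i) / real (n N j)" "\<lambda>i. b j / b i" sequentially] n_ratio
    by (simp add: sum_divide_distrib)
  then have nN: "(\<lambda>N. real N / real (n N j)) \<longlonglongrightarrow> (\<Sum>i\<in>UNIV. b j / b i)" unfolding n_sum .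
  show "0 < inverse (\<kappa> j) * (\<Sum>i\<in>UNIV. b j / b i)"
    using kappa_pos[of j] b_pos by (intro mult_pos_pos sum_pos) auto
  show "(\<lambda>N. Dj j N / D N) \<longlonglongrightarrow> inverse (\<kappa> j) * (\<Sum>i\<in>UNIV. b j / b i)"
  proof (rule Lim_transform_eventually)
    show "(\<lambda>N. inverse (real (total (k N)) / real (k N j)) * (real N / real (n N j))) \<longlonglongrightarrow> inverse (\<kappa> j) * (\<Sum>i\<in>UNIV. b j / b i)"
      using kappa_pos[of j] by (intro tendsto_mult tendsto_inverse total_k_ratio nN) auto
    show "\<forall>\<^sub>F N in sequentially. inverse (real (total (k N)) / real (k N j)) * (real N / real (n N j)) = Dj j N / D N"
      using eventually_p_pos by eventually_elim (simp add: Dj_def D_def)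
  qed
qed

text \<open>The extrapolation factors of the single samples differ from the pooled one by a
  convergent positive factor, which becomes an additive constant under the logarithm and is lost
  against a diverging denominator.\<close>

lemma ln_Dj_over_ln_D: "(\<lambda>N. ln (Dj j N) / ln (D N)) \<longlonglongrightarrow> 1"
  and Dj_top: "filterlim (Dj j) at_top sequentially"
proof -
  obtain L where L: "0 < L" "(\<lambda>N. Dj j N / D N) \<longlonglongrightarrow> L" using Dj_over_D by blast
  have "filterlim (\<lambda>N. Dj j N / D N * D N) at_top sequentially"
    by (rule filterlim_tendsto_pos_mult_at_top[OF L(2,1) D_top])
  moreover have "\<forall>\<^sub>F N in sequentially. Dj j N / D N * D N = Dj j N"
    using eventually_p_pos by eventually_elim simp
  ultimately show top: "filterlim (Dj j) at_top sequentially"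
    using filterlim_cong[of at_top at_top sequentially sequentially "\<lambda>N. Dj j N / D N * D N" "Dj j"] by simp
  have "(\<lambda>N. 1 + ln (Dj j N / D N) / ln (D N)) \<longlonglongrightarrow> 1 + 0"
    using L by (intro tendsto_add tendsto_const real_tendsto_divide_at_top[OF tendsto_ln[OF L(2)] ln_D_top]) auto
  then have "(\<lambda>N. 1 + ln (Dj j N / D N) / ln (D N)) \<longlonglongrightarrow> 1" by simp
  then show "(\<lambda>N. ln (Dj j N) / ln (D N)) \<longlonglongrightarrow> 1"
  proof (rule Lim_transform_eventually)
    have "\<forall>\<^sub>F N in sequentially. 0 < Dj j N" using top by (simp add: filterlim_at_top_dense)
    moreover have "\<forall>\<^sub>F N in sequentially. 0 < ln (D N)" using ln_D_top by (simp add: filterlim_at_top_dense)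
    ultimately show "\<forall>\<^sub>F N in sequentially. 1 + ln (Dj j N / D N) / ln (D N) = ln (Dj j N) / ln (D N)"
      using eventually_p_pos by eventually_elim (simp add: ln_div field_simps)
  qed
qed

definition logW where "logW z = (\<chi> j. ln (weissman_at (\<lambda>i. X i (snd z)) (n (fst z)) (k (fst z)) (p (fst z)) j))"

text \<open>Centred at \<open>lc j + \<gamma> * ln (1 / p)\<close>, the leading part of the
  logarithm of the true quantile of order \<open>1 - p\<close>.\<close>

definition Tst where
  "Tst z = (\<chi> j. ratio (fst z) * (logW z $ j - lc j - \<gamma> * ln (1 / p (fst z))))"

definition G where "G N \<xi> = (\<chi> j. sqrt (\<kappa> j) * score_vec N \<xi> $ j)"

lemma weissman_pos: "\<forall>\<^sub>F z in high_prob. 0 < weissman_at (\<lambda>i. X i (snd z)) (n (fst z)) (k (fst z)) (p (fst z)) j"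
  using order_stat_pos[of j] eventually_fst_high_prob[OF eventually_p_pos] eventually_fst_high_prob[OF S.eventually_kn[of j]]
  by eventually_elim (simp add: weissman_at_def weissman_def)

text \<open>The three null terms are the mismatch between \<open>Dj\<close> and \<open>D\<close>
  acting on a tight score, the linearisation error of the Hill estimator, and the tight threshold
  error divided by the diverging \<open>ln D\<close>.\<close>

lemma Tst_limit: "((\<lambda>z. Tst z - G (fst z) (snd z)) \<longlongrightarrow> 0) high_prob"
proof (rule vec_tendstoI)
  fix j
  define H where "H z = sqrt (real (k (fst z) j)) * (hill_at (\<lambda>i. X i (snd z)) (n (fst z)) (k (fst z)) j - \<gamma>)" for z
  define sc where "sc z = \<gamma> * S.score j (fst z) (snd z)" for z
  define O' where "O' z = sqrt (real (k (fst z) j)) * (ln (Xo j (fst z) (snd z) (n (fst z) j - k (fst z) j)) - lc j - \<gamma> * S.t j (fst z))" for z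
  define r where "r N = sqrt (real (total (k N)) / real (k N j))" for N
  define a where "a N = r N * (ln (Dj j N) / ln (D N))" for N
  have r: "r \<longlonglongrightarrow> sqrt (\<kappa> j)" unfolding r_def by (intro tendsto_real_sqrt total_k_ratio)
  have a: "a \<longlonglongrightarrow> sqrt (\<kappa> j)" using tendsto_mult[OF r ln_Dj_over_ln_D[of j]] by (simp add: a_def[abs_def])
  have tsc: "tight sc" unfolding sc_def by (rule tight_bounded_mult[OF S.tight_score tendsto_const])
  have H: "((\<lambda>z. H z - sc z) \<longlongrightarrow> 0) high_prob" unfolding H_def sc_def by (rule hill_linearisation)
  have "((\<lambda>z. a (fst z) - sqrt (\<kappa> j)) \<longlongrightarrow> 0) high_prob"
    by (rule filterlim_fst) (use a in \<open>simp add: LIM_zero\<close>)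
  from tight_scaleR_tendsto_0[OF tsc this]
  have 1: "((\<lambda>z. (a (fst z) - sqrt (\<kappa> j)) * sc z) \<longlongrightarrow> 0) high_prob" by simp
  have 2: "((\<lambda>z. a (fst z) * (H z - sc z)) \<longlongrightarrow> 0) high_prob"
    using tendsto_mult[OF filterlim_fst[OF a] H] by simp
  have "((\<lambda>z. r (fst z) / ln (D (fst z))) \<longlongrightarrow> 0) high_prob"
    by (rule filterlim_fst) (rule real_tendsto_divide_at_top[OF r ln_D_top])
  from tight_scaleR_tendsto_0[OF order_stat_tight[of j] this]
  have 3: "((\<lambda>z. r (fst z) / ln (D (fst z)) * O' z) \<longlongrightarrow> 0) high_prob" by (simp add: O'_def)
  from tendsto_add[OF tendsto_add[OF 1 2] 3]
  have lim: "((\<lambda>z. (a (fst z) - sqrt (\<kappa> j)) * sc z + a (fst z) * (H z - sc z) + r (fst z) / ln (D (fst z)) * O' z) \<longlongrightarrow> 0) high_prob"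
    by simp
  have evD: "\<forall>\<^sub>F N in sequentially. 0 < Dj j N" using Dj_top[of j] by (simp add: filterlim_at_top_dense)
  have "((\<lambda>z. (Tst z - G (fst z) (snd z)) $ j) \<longlongrightarrow> 0) high_prob"
  proof (rule Lim_transform_eventually[OF lim])
    show "\<forall>\<^sub>F z in high_prob. (a (fst z) - sqrt (\<kappa> j)) * sc z + a (fst z) * (H z - sc z) + r (fst z) / ln (D (fst z)) * O' z =
        (Tst z - G (fst z) (snd z)) $ j"
      using order_stat_pos[of j] eventually_fst_high_prob[OF evD] eventually_fst_high_prob[OF eventually_p_pos]
        eventually_fst_high_prob[OF S.eventually_kn[of j]]
    proof eventually_elim
      case (elim z)
      obtain N \<xi> where z: "z = (N, \<xi>)" by (cases z)
      define h where "h = hill_at (\<lambda>i. X i \<xi>) (n N) (k N) j"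
      define x where "x = ln (Xo j N \<xi> (n N j - k N j))"
      have kn: "0 < real (k N j)" "0 < real (n N j)" "0 < p N" "0 < Dj j N" using elim by (auto simp: z)
      have lw: "logW z $ j = h * ln (Dj j N) + x"
        using elim kn unfolding logW_def h_def x_def
        by (simp add: z weissman_at_def weissman_def hill_at_def Dj_def ln_mult ln_powr)
      \<comment> \<open>The threshold \<open>ln (n / k)\<close> falls short of
        \<open>ln (1 / p)\<close> by \<open>ln Dj\<close>, so the centre splits into a part matched
        with the Hill estimate and a part matched with the order statistic.\<close>
      have t: "S.t j N = ln (1 / p N) - ln (Dj j N)"
        using kn by (simp add: S.t_def Dj_def ln_div ln_mult)
      have rk: "r N * sqrt (real (k N j)) = sqrt (real (total (k N)))"
        unfolding r_def real_sqrt_mult[symmetric] using kn by simp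
      have "(a N - sqrt (\<kappa> j)) * sc z + a N * (H z - sc z) + r N / ln (D N) * O' z =
          (r N * sqrt (real (k N j))) / ln (D N) * (ln (Dj j N) * (h - \<gamma>) + (x - lc j - \<gamma> * S.t j N)) - sqrt (\<kappa> j) * sc z"
        unfolding a_def H_def O'_def z fst_conv snd_conv h_def[symmetric] x_def[symmetric]
        by (simp add: algebra_simps add_divide_distrib diff_divide_distrib)
      also have "\<dots> = ratio N * (logW z $ j - lc j - \<gamma> * ln (1 / p N)) - sqrt (\<kappa> j) * sc z"
        unfolding rk ratio_def lw t by (simp add: algebra_simps)
      also have "\<dots> = (Tst z - G (fst z) (snd z)) $ j"
        by (simp add: Tst_def G_def score_vec_def sc_def z)
      finally show ?case by (simp add: z)
    qed
  qed
  then show "((\<lambda>z. (Tst z - G (fst z) (snd z)) $ j) \<longlongrightarrow> 0 $ j) high_prob" by simp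
qed

lemma tight_G: "tight (\<lambda>z. G (fst z) (snd z))"
proof (rule tight_vec)
  fix j
  have "tight (\<lambda>z. sqrt (\<kappa> j) * (\<gamma> * S.score j (fst z) (snd z)))"
    by (intro tight_bounded_mult[OF _ tendsto_const] S.tight_score)
  then show "tight (\<lambda>z. G (fst z) (snd z) $ j)" by (simp add: G_def score_vec_def)
qed

lemma G_clt: "(\<lambda>N. CLINT \<xi>|M. iexp (a \<bullet> G N \<xi>)) \<longlonglongrightarrow> complex_of_real (exp (- (a \<bullet> (Vc *v a)) / 2))"
proof -
  have "a \<bullet> G N \<xi> = (\<chi> j. sqrt (\<kappa> j) * a $ j) \<bullet> score_vec N \<xi>" for N \<xi>
    by (simp add: G_def inner_vec_def mult_ac)
  then show ?thesis using score_clt[of "\<chi> j. sqrt (\<kappa> j) * a $ j"] unfolding Vc_quadratic by simp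
qed

lemma G_measurable: "(\<lambda>\<xi>. v \<bullet> G N \<xi>) \<in> borel_measurable M"
proof -
  have [measurable]: "(\<lambda>\<xi>. \<epsilon> j (X i \<xi> $ j)) \<in> borel_measurable M" if "1 \<le> i" for i j
    by (rule S.e_measurable[OF that])
  have [measurable]: "S.score j N \<in> borel_measurable M" for j
    unfolding S.score_def[abs_def] by measurable
  show ?thesis unfolding G_def inner_vec_def score_vec_def by simp
qed

text \<open>For a \<open>Vc\<close>-orthonormal system the quadratic form of a linear combination is
  its sum of squared coefficients. Hence the forms \<open>v r \<bullet> G\<close> have the joint
  limiting characteristic function of independent standard Gaussian variables.\<close>

lemma orthonormal_limit:
  fixes v :: "nat \<Rightarrow> real ^ ('m::{finite,linorder})"
  assumes v: "\<And>r s. r < d \<Longrightarrow> s < d \<Longrightarrow> v r \<bullet> (Vc *v v s) = (if r = s then 1 else 0)" and d: "0 < d"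
    and Yz: "((\<lambda>z. Yz z - (\<Sum>r<d. (v r \<bullet> G (fst z) (snd z))\<^sup>2)) \<longlongrightarrow> 0) high_prob"
    and E: "\<forall>\<^sub>F N in sequentially. E N \<in> events"
    and EY: "\<forall>\<^sub>F z in high_prob. snd z \<in> E (fst z) \<longleftrightarrow> x < Yz z"
  shows "(\<lambda>N. prob (E N)) \<longlonglongrightarrow> measure (chi_square d) {x<..}"
proof (rule chi_square_limit[OF _ _ d Yz E EY])
  show "(\<lambda>\<xi>. v r \<bullet> G N \<xi>) \<in> borel_measurable M" for N r by (rule G_measurable)
  fix a :: "nat \<Rightarrow> real"
  define u where "u = (\<Sum>r<d. a r *\<^sub>R v r)"
  have "u \<bullet> (Vc *v u) = (\<Sum>r<d. \<Sum>s<d. a r * a s * (v r \<bullet> (Vc *v v s)))"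
  proof -
    have Vu: "Vc *v u = (\<Sum>s<d. a s *\<^sub>R (Vc *v v s))"
      by (simp add: u_def linear_sum[OF matrix_vector_mul_linear] matrix_vector_mult_scaleR)
    show ?thesis
      unfolding Vu unfolding u_def inner_sum_left inner_sum_right by (subst sum.swap) (simp add: mult_ac)
  qed
  also have "\<dots> = (\<Sum>r<d. \<Sum>s<d. if s = r then (a r)\<^sup>2 else 0)"
    using v by (intro sum.cong) (auto simp: power2_eq_square)
  also have "\<dots> = (\<Sum>r<d. (a r)\<^sup>2)" by simp
  finally have q: "u \<bullet> (Vc *v u) = (\<Sum>r<d. (a r)\<^sup>2)" .
  have "u \<bullet> G N \<xi> = (\<Sum>r<d. a r * (v r \<bullet> G N \<xi>))" for N \<xi>
    unfolding u_def by (simp add: inner_sum_left)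
  then show "(\<lambda>N. CLINT \<xi>|M. iexp (\<Sum>r<d. a r * (v r \<bullet> G N \<xi>))) \<longlonglongrightarrow> complex_of_real (exp (- (\<Sum>r<d. (a r)\<^sup>2) / 2))"
    using G_clt[of u] unfolding q by simp
qed

section \<open>Level and power of the test\<close>

lemma Vc_invertible: "invertible Vc"
  by (rule positive_definite_invertible[OF Vc_positive_definite])

lemma Vc_one: "1 \<bullet> (matrix_inv Vc *v 1) \<noteq> 0"
  using positive_definite_inverse[OF Vc_positive_definite one_vec_nonzero] by simp

lemma V_bar_one:
  "\<forall>\<^sub>F z in high_prob. 1 \<bullet> (matrix_inv (V_bar (\<lambda>i. X i (snd z)) (n (fst z)) (k (fst z))) *v 1) \<noteq> 0"
  by (rule tendsto_imp_eventually_ne[OF _ Vc_one])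
    (intro tendsto_inner tendsto_const tendsto_matrix_vector_mult tendsto_matrix_inv V_bar_limit Vc_invertible)

lemma L_stat_gls:
  "L_stat (\<lambda>i. X i \<xi>) (n N) (k N) (p N) = (ratio N)\<^sup>2 * gls (V_bar (\<lambda>i. X i \<xi>) (n N) (k N)) (logW (N, \<xi>))"
proof -
  have "(sqrt (real (total (k N))))\<^sup>2 = real (total (k N))"
    by (rule real_sqrt_pow2) (rule of_nat_0_le_iff)
  then show ?thesis unfolding L_stat_eq_gls n_sum logW_def ratio_def D_def power_divide by (simp only: fst_conv snd_conv)
qed

lemma L_stat_measurable_events:
  "\<forall>\<^sub>F N in sequentially. {\<xi> \<in> space M. x < L_stat (\<lambda>i. X i \<xi>) (n N) (k N) (p N)} \<in> events"
  using eventually_good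
proof eventually_elim
  case (elim N)
  note [measurable] = L_stat_measurable[OF elim]
  show ?case by measurable
qed

theorem L_stat_level:
  assumes m: "2 \<le> CARD('m)" and H0: "tails_equivalent (\<lambda>j. tail_quantile (F j))"
    and \<alpha>: "0 < \<alpha>" "\<alpha> < 1"
  shows "(\<lambda>N. prob {\<xi> \<in> space M. quantile (cdf (chi_square (CARD('m) - 1))) (1 - \<alpha>)
      < L_stat (\<lambda>i. X i \<xi>) (n N) (k N) (p N)}) \<longlonglongrightarrow> \<alpha>"
proof -
  define q where "q = quantile (cdf (chi_square (CARD('m) - 1))) (1 - \<alpha>)"
  obtain v :: "nat \<Rightarrow> real ^ ('m::{finite,linorder})" where
    v: "\<And>r s. r < CARD('m) - 1 \<Longrightarrow> s < CARD('m) - 1 \<Longrightarrow> v r \<bullet> (Vc *v v s) = (if r = s then 1 else 0)"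
    and gls: "\<And>x. gls Vc x = (\<Sum>r<CARD('m) - 1. (v r \<bullet> x)\<^sup>2)"
    using gls_sum_squares[OF Vc_positive_definite] by blast
  have d: "0 < CARD('m) - 1" using m by simp
  \<comment> \<open>Slutsky's theorem is applied once to the pair of estimated covariance and
    remainder \<open>Tst - G\<close>, which converges, with the tight vector \<open>G\<close> as the
    other argument.\<close>
  define f where "f w = gls (fst (fst w)) (snd w + snd (fst w))"
    for w :: "((real ^ ('m::{finite,linorder}) ^ ('m::{finite,linorder})) \<times> (real ^ ('m::{finite,linorder}))) \<times> (real ^ ('m::{finite,linorder}))"
  have cont_f: "isCont f ((Vc, 0), y)" for y
    unfolding isCont_def f_def fst_conv snd_conv
    by (rule tendsto_gls[OF _ _ Vc_invertible Vc_one]) (auto intro!: tendsto_eq_intros)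
  have "((\<lambda>z. f ((V_bar (\<lambda>i. X i (snd z)) (n (fst z)) (k (fst z)), Tst z - G (fst z) (snd z)), G (fst z) (snd z)) -
      f ((Vc, 0), G (fst z) (snd z))) \<longlongrightarrow> 0) high_prob"
    by (rule tendsto_continuous_tight[OF tendsto_Pair[OF V_bar_limit Tst_limit] tight_G cont_f])
  then have Yz: "((\<lambda>z. gls (V_bar (\<lambda>i. X i (snd z)) (n (fst z)) (k (fst z))) (Tst z) -
      (\<Sum>r<CARD('m) - 1. (v r \<bullet> G (fst z) (snd z))\<^sup>2)) \<longlongrightarrow> 0) high_prob"
    by (simp add: f_def gls)
  have "(\<lambda>N. prob {\<xi> \<in> space M. q < L_stat (\<lambda>i. X i \<xi>) (n N) (k N) (p N)}) \<longlonglongrightarrow> measure (chi_square (CARD('m) - 1)) {q<..}"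
  proof (rule orthonormal_limit[OF v d Yz L_stat_measurable_events])
    have "\<forall>\<^sub>F N in sequentially. 0 < ratio N" using ratio_top by (simp add: filterlim_at_top_dense)
    from space_high_prob V_bar_one eventually_fst_high_prob[OF this]
    show "\<forall>\<^sub>F z in high_prob. (snd z \<in> {\<xi> \<in> space M. q < L_stat (\<lambda>i. X i \<xi>) (n (fst z)) (k (fst z)) (p (fst z))}) =
        (q < gls (V_bar (\<lambda>i. X i (snd z)) (n (fst z)) (k (fst z))) (Tst z))"
    proof eventually_elim
      case (elim z)
      \<comment> \<open>Here \<open>undefined\<close> stands for an arbitrary index: under the null
        hypothesis all the \<open>lc j\<close> agree.\<close>
      define c0 where "c0 = lc undefined + \<gamma> * ln (1 / p (fst z))"
      have "Tst z = (- ratio (fst z) * c0) *\<^sub>R 1 + ratio (fst z) *\<^sub>R logW z"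
      proof (rule vec_eq_iff[THEN iffD2], rule allI)
        fix j
        show "Tst z $ j = ((- ratio (fst z) * c0) *\<^sub>R 1 + ratio (fst z) *\<^sub>R logW z) $ j"
          using tails_equivalent_lc[OF H0, of j undefined] by (simp add: Tst_def c0_def algebra_simps)
      qed
      then have "gls (V_bar (\<lambda>i. X i (snd z)) (n (fst z)) (k (fst z))) (Tst z) =
          L_stat (\<lambda>i. X i (snd z)) (n (fst z)) (k (fst z)) (p (fst z))"
        by (simp only: gls_affine[OF elim(2)] L_stat_gls prod.collapse)
      then show ?case using elim(1) by simp
    qed
  qed auto
  moreover have "measure (chi_square (CARD('m) - 1)) {q<..} = \<alpha>"
    unfolding q_def
    using measure_above_quantile[OF prob_space_chi_square sets_chi_square chi_square_singleton[OF d], of "1 - \<alpha>"] \<alpha> by simp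
  ultimately show ?thesis by (simp add: q_def)
qed

text \<open>Divided by the diverging normalisation, the fluctuation \<open>Tst\<close> vanishes and
  the vector \<open>lcv\<close> of scale constants remains. The statistic is thus the squared
  normalisation times a quantity tending to \<open>gls Vc lcv\<close>, which is positive because two
  components of \<open>lcv\<close> differ.\<close>

theorem L_stat_power:
  assumes H1: "tails_different (\<lambda>j. quantile (F j))"
  shows "diverges_in_prob M (\<lambda>N \<xi>. L_stat (\<lambda>i. X i \<xi>) (n N) (k N) (p N))"
proof -
  obtain j l where jl: "lc j \<noteq> lc l" using tails_different_lc[OF H1] by blast
  define lcv where "lcv = (\<chi> j. lc j)"
  have "((\<lambda>z. inverse (ratio (fst z))) \<longlongrightarrow> 0) high_prob"
    by (rule filterlim_fst) (rule tendsto_inverse_0_at_top[OF ratio_top])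
  have tT: "tight Tst"
    using tight_add[OF tendsto_imp_tight[OF Tst_limit] tight_G] by simp
  have "((\<lambda>z. inverse (ratio (fst z)) *\<^sub>R Tst z) \<longlongrightarrow> 0) high_prob"
    by (rule tight_scaleR_tendsto_0[OF tT]) fact
  then have c: "((\<lambda>z. inverse (ratio (fst z)) *\<^sub>R Tst z + lcv) \<longlongrightarrow> lcv) high_prob"
    using tendsto_add[OF _ tendsto_const[of lcv]] by fastforce
  have g: "((\<lambda>z. gls (V_bar (\<lambda>i. X i (snd z)) (n (fst z)) (k (fst z))) (inverse (ratio (fst z)) *\<^sub>R Tst z + lcv)) \<longlongrightarrow> gls Vc lcv) high_prob"
    by (rule tendsto_gls[OF V_bar_limit c Vc_invertible Vc_one])
  have pos: "0 < gls Vc lcv"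
    by (rule gls_pos[OF Vc_positive_definite, of _ j l]) (simp add: lcv_def jl)
  have r2: "filterlim (\<lambda>z. (ratio (fst z))\<^sup>2) at_top high_prob"
    by (rule filterlim_fst) (rule filterlim_pow_at_top[OF _ ratio_top], simp)
  have "filterlim (\<lambda>z. gls (V_bar (\<lambda>i. X i (snd z)) (n (fst z)) (k (fst z))) (inverse (ratio (fst z)) *\<^sub>R Tst z + lcv) * (ratio (fst z))\<^sup>2) at_top high_prob"
    by (rule filterlim_tendsto_pos_mult_at_top[OF g pos r2])
  moreover have "\<forall>\<^sub>F z in high_prob. gls (V_bar (\<lambda>i. X i (snd z)) (n (fst z)) (k (fst z))) (inverse (ratio (fst z)) *\<^sub>R Tst z + lcv) * (ratio (fst z))\<^sup>2 =
      L_stat (\<lambda>i. X i (snd z)) (n (fst z)) (k (fst z)) (p (fst z))"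
  proof -
    have "\<forall>\<^sub>F N in sequentially. 0 < ratio N" using ratio_top by (simp add: filterlim_at_top_dense)
    from V_bar_one eventually_fst_high_prob[OF this] show ?thesis
    proof eventually_elim
      case (elim z)
      have "inverse (ratio (fst z)) *\<^sub>R Tst z + lcv = (- \<gamma> * ln (1 / p (fst z))) *\<^sub>R 1 + 1 *\<^sub>R logW z"
        using elim(2) by (simp add: vec_eq_iff Tst_def lcv_def mult.assoc[symmetric])
      then show ?case using gls_affine[OF elim(1), of "- \<gamma> * ln (1 / p (fst z))" 1 "logW z"] L_stat_gls[of "snd z" "fst z"]
        by (simp add: mult.commute)
    qed
  qed
  ultimately have top: "filterlim (\<lambda>z. L_stat (\<lambda>i. X i (snd z)) (n (fst z)) (k (fst z)) (p (fst z))) at_top high_prob"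
    by (subst (asm) filterlim_cong[OF refl refl])
  show ?thesis
    unfolding diverges_in_prob_def
  proof
    fix B
    have "\<forall>\<^sub>F z in high_prob. B < L_stat (\<lambda>i. X i (snd z)) (n (fst z)) (k (fst z)) (p (fst z))"
      using top by (simp add: filterlim_at_top_dense)
    then show "(\<lambda>N. prob {\<xi> \<in> space M. B < L_stat (\<lambda>i. X i \<xi>) (n N) (k N) (p N)}) \<longlonglongrightarrow> 1"
      by (rule high_prob_tendsto_1[OF _ L_stat_measurable_events]) simp
  qed
qed

end

section \<open>Coverage of the confidence interval\<close>

context pooled_samples
begin

text \<open>The target quantile lies further out in the tail than the threshold, where the expansion
  error is smaller still; its bound at the threshold is already negligible on the scale
  \<open>sqrt k\<close>.\<close>

lemma ln_quantile_bias:
  "(\<lambda>N. ratio N * (ln (quantile (F j) (1 - p N)) - lc j - \<gamma> * ln (1 / p N))) \<longlonglongrightarrow> 0"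
  and quantile_pos: "\<forall>\<^sub>F N in sequentially. 0 < quantile (F j) (1 - p N)"
proof -
  obtain K t0 where K: "1 < t0" "0 \<le> K" "\<And>t. t0 \<le> t \<Longrightarrow> 0 < tail_quantile (F j) t \<and>
     \<bar>ln (tail_quantile (F j) t) - lc j - \<gamma> * ln t\<bar> \<le> K * t powr \<rho> j" using lc[of j] by blast
  have "\<forall>\<^sub>F N in sequentially. p N < 1 / t0"
    using K(1) by (intro order_tendstoD(2)[OF p_lim]) simp
  then have ev: "\<forall>\<^sub>F N in sequentially. 0 < p N \<and> t0 \<le> 1 / p N \<and> quantile (F j) (1 - p N) = tail_quantile (F j) (1 / p N)"
    using eventually_p_pos
  proof eventually_elim
    case (elim N)
    then show ?case using K(1) by (simp add: F.tail_quantile_eq field_simps)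
  qed
  then show "\<forall>\<^sub>F N in sequentially. 0 < quantile (F j) (1 - p N)"
    by eventually_elim (use K(3) in simp)
  show "(\<lambda>N. ratio N * (ln (quantile (F j) (1 - p N)) - lc j - \<gamma> * ln (1 / p N))) \<longlonglongrightarrow> 0"
  proof (rule Lim_null_comparison)
    have "(\<lambda>N. K * (sqrt (real (total (k N)) / real (k N j)) * (sqrt (real (k N j)) * exp (\<rho> j * S.t j N)))) \<longlonglongrightarrow> K * (sqrt (\<kappa> j) * 0)"
      by (intro tendsto_mult tendsto_const tendsto_real_sqrt total_k_ratio sqrt_k_bias)
    from real_tendsto_divide_at_top[OF this ln_D_top]
    show "(\<lambda>N. K * (sqrt (real (total (k N)) / real (k N j)) * (sqrt (real (k N j)) * exp (\<rho> j * S.t j N))) / ln (D N)) \<longlonglongrightarrow> 0" .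
    have "\<forall>\<^sub>F N in sequentially. 1 \<le> Dj j N" using Dj_top[of j] by (simp add: filterlim_at_top)
    moreover have "\<forall>\<^sub>F N in sequentially. 0 < ln (D N)" using ln_D_top by (simp add: filterlim_at_top_dense)
    ultimately show "\<forall>\<^sub>F N in sequentially. norm (ratio N * (ln (quantile (F j) (1 - p N)) - lc j - \<gamma> * ln (1 / p N))) \<le>
        K * (sqrt (real (total (k N)) / real (k N j)) * (sqrt (real (k N j)) * exp (\<rho> j * S.t j N))) / ln (D N)"
      using ev S.eventually_kn[of j]
    proof eventually_elim
      case (elim N)
      have pos: "0 < real (k N j)" "0 < real (n N j)" "0 < p N" using elim by auto
      \<comment> \<open>Extrapolation goes outwards because the factor \<open>Dj\<close> is
        eventually at least 1.\<close>
      have "S.t j N \<le> ln (1 / p N)"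
      proof -
        have "ln (1 / p N) = S.t j N + ln (Dj j N)" using pos by (simp add: S.t_def Dj_def ln_div ln_mult)
        then show ?thesis using elim(1) by simp
      qed
      then have "\<rho> j * ln (1 / p N) \<le> \<rho> j * S.t j N" using rho_neg[of j] by (simp add: mult_left_mono_neg)
      then have "(1 / p N) powr \<rho> j \<le> exp (\<rho> j * S.t j N)" using pos by (simp add: powr_def)
      then have "K * (1 / p N) powr \<rho> j \<le> K * exp (\<rho> j * S.t j N)" by (intro mult_left_mono K(2))
      moreover have "\<bar>ln (tail_quantile (F j) (1 / p N)) - lc j - \<gamma> * ln (1 / p N)\<bar> \<le> K * (1 / p N) powr \<rho> j"
        using K(3)[of "1 / p N"] elim(3) by blast
      ultimately have "\<bar>ln (quantile (F j) (1 - p N)) - lc j - \<gamma> * ln (1 / p N)\<bar> \<le> K * exp (\<rho> j * S.t j N)"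
        using elim(3) by simp
      then have "\<bar>ratio N\<bar> * \<bar>ln (quantile (F j) (1 - p N)) - lc j - \<gamma> * ln (1 / p N)\<bar> \<le> \<bar>ratio N\<bar> * (K * exp (\<rho> j * S.t j N))"
        by (rule mult_left_mono) simp
      moreover have "\<bar>ratio N\<bar> = sqrt (real (total (k N)) / real (k N j)) * sqrt (real (k N j)) / ln (D N)"
      proof -
        have "sqrt (real (total (k N)) / real (k N j)) * sqrt (real (k N j)) = sqrt (real (total (k N)))"
          unfolding real_sqrt_mult[symmetric] using pos by simp
        moreover have "0 \<le> sqrt (real (total (k N)))" by (rule real_sqrt_ge_zero) (rule of_nat_0_le_iff)
        ultimately show ?thesis using elim(2) by (simp only: ratio_def abs_divide abs_of_nonneg abs_of_pos)
      qed
      ultimately show ?case by (simp add: abs_mult mult_ac)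
    qed
  qed
qed

text \<open>On the logarithmic scale the interval is missed exactly when the squared studentised
  error \<open>Yz\<close> exceeds \<open>z0\<^sup>2\<close>. Weights with sum one cancel the common
  centre, and the limit of \<open>Yz\<close> is the square of a single standardised Gaussian form, a
  chi-square law with one degree of freedom.\<close>

theorem conf_interval_coverage:
  assumes H0: "tails_equivalent (\<lambda>j. tail_quantile (F j))" and pilot: "\<omega>0 \<bullet> 1 = 1"
    and \<omega>_meas: "\<And>N. \<omega>h N \<in> borel_measurable M" and \<omega>_one: "\<And>N. AE \<xi> in M. \<omega>h N \<xi> \<bullet> 1 = 1"
    and \<omega>_lim: "tendsto_in_prob M \<omega>h \<omega>"
    and \<alpha>: "0 < \<alpha>" "\<alpha> < 1"
  shows "(\<lambda>N. prob {\<xi> \<in> space M. quantile (F j) (1 - p N) \<in>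
      conf_interval (\<lambda>i. X i \<xi>) (n N) (k N) (p N) \<omega>0 (\<omega>h N \<xi>) \<alpha>}) \<longlonglongrightarrow> 1 - \<alpha>"
proof -
  define z0 where "z0 = quantile (cdf std_normal) (1 - \<alpha> / 2)"
  have z0: "0 < z0" unfolding z0_def using \<alpha> by (intro std_normal_quantile_pos) auto
  define Q where "Q N = quantile (F j) (1 - p N)" for N
  define \<delta> where "\<delta> N = ratio N * (ln (Q N) - lc j - \<gamma> * ln (1 / p N))" for N
  have \<delta>: "\<delta> \<longlonglongrightarrow> 0" unfolding \<delta>_def[abs_def] Q_def by (rule ln_quantile_bias)
  define wz where "wz z = \<omega>h (fst z) (snd z)" for z
  have wl: "(wz \<longlongrightarrow> \<omega>) high_prob"
    unfolding wz_def by (rule tendsto_high_probI[OF \<omega>_lim \<omega>_meas])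
  have w1: "\<forall>\<^sub>F z in high_prob. wz z \<bullet> 1 = 1"
    unfolding wz_def by (rule AE_high_prob[OF \<omega>_one])
  \<comment> \<open>The constraint passes to the limit, which keeps \<open>\<omega>\<close> away
    from zero and the limiting variance positive.\<close>
  have "\<omega> \<bullet> 1 = 1"
  proof (rule tendsto_unique[OF high_prob_neq_bot])
    show "((\<lambda>z. wz z \<bullet> 1) \<longlongrightarrow> \<omega> \<bullet> 1) high_prob" by (intro tendsto_inner wl tendsto_const)
    show "((\<lambda>z. wz z \<bullet> 1) \<longlongrightarrow> 1) high_prob" by (rule tendsto_eventually[OF w1])
  qed
  then have \<omega>0: "\<omega> \<noteq> 0" by auto
  then have spos: "0 < \<omega> \<bullet> (Vc *v \<omega>)" using Vc_positive_definite by (simp add: positive_definite_def)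
  define \<sigma> where "\<sigma> = sqrt (\<omega> \<bullet> (Vc *v \<omega>))"
  have \<sigma>: "0 < \<sigma>" "\<sigma> * \<sigma> = \<omega> \<bullet> (Vc *v \<omega>)" using spos by (auto simp: \<sigma>_def)
  \<comment> \<open>Scaled to unit length in the form \<open>Vc\<close>, so that it is an
    orthonormal system with one element.\<close>
  define v where "v = (1 / \<sigma>) *\<^sub>R \<omega>"
  define Vh where "Vh z = V_hat (\<lambda>i. X i (snd z)) (n (fst z)) (k (fst z)) \<omega>0" for z
  have Vh: "(Vh \<longlongrightarrow> Vc) high_prob" unfolding Vh_def by (rule V_hat_limit[OF pilot])
  \<comment> \<open>Collects the remainder of \<open>Tst_limit\<close> and the bias of the true
    quantile, so that \<open>G + e\<close> is the normalised error relative to \<open>Q N\<close>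
    itself.\<close>
  define e where "e z = Tst z - \<delta> (fst z) *\<^sub>R 1 - G (fst z) (snd z)" for z
  have el: "(e \<longlongrightarrow> 0) high_prob"
  proof -
    have "((\<lambda>z. (Tst z - G (fst z) (snd z)) - \<delta> (fst z) *\<^sub>R 1) \<longlongrightarrow> 0 - 0 *\<^sub>R 1) high_prob"
      by (intro tendsto_diff Tst_limit tendsto_scaleR filterlim_fst[OF \<delta>] tendsto_const)
    then show ?thesis by (simp add: e_def[abs_def] algebra_simps)
  qed
  \<comment> \<open>The squared error over its estimated variance, as a function of the converging
    triple (weights, covariance estimate, remainder) and of the tight vector \<open>G\<close>. It is
    continuous at the limit because the denominator there is
    \<open>\<omega> \<bullet> (Vc *v \<omega>) > 0\<close>.\<close>
  define f where "f u = (fst (fst u) \<bullet> (snd u + snd (snd (fst u))))\<^sup>2 / (fst (fst u) \<bullet> (fst (snd (fst u)) *v fst (fst u)))"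
    for u :: "((real ^ ('m::{finite,linorder})) \<times> ((real ^ ('m::{finite,linorder}) ^ ('m::{finite,linorder})) \<times> (real ^ ('m::{finite,linorder})))) \<times> (real ^ ('m::{finite,linorder}))"
  have id: "((\<lambda>u. u) \<longlongrightarrow> a) (at a)" for a :: "((real ^ ('m::{finite,linorder})) \<times> ((real ^ ('m::{finite,linorder}) ^ ('m::{finite,linorder})) \<times> (real ^ ('m::{finite,linorder})))) \<times> (real ^ ('m::{finite,linorder}))"
    by (rule tendsto_ident_at)
  have cont_f: "isCont f ((\<omega>, (Vc, 0)), y)" for y
    unfolding isCont_def f_def
    by (intro tendsto_divide tendsto_power tendsto_inner tendsto_add tendsto_matrix_vector_mult tendsto_fst tendsto_snd id)
      (use spos in simp)
  define Yz where "Yz z = (wz z \<bullet> (G (fst z) (snd z) + e z))\<^sup>2 / (wz z \<bullet> (Vh z *v wz z))" for z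
  have "((\<lambda>z. f ((wz z, (Vh z, e z)), G (fst z) (snd z)) - f ((\<omega>, (Vc, 0)), G (fst z) (snd z))) \<longlongrightarrow> 0) high_prob"
    by (rule tendsto_continuous_tight[OF tendsto_Pair[OF wl tendsto_Pair[OF Vh el]] tight_G cont_f])
  moreover have "f ((\<omega>, (Vc, 0)), y) = (\<Sum>r<1::nat. (v \<bullet> y)\<^sup>2)" for y
    using \<sigma> by (simp add: f_def v_def power_divide power2_eq_square[of \<sigma>])
  ultimately have Yl: "((\<lambda>z. Yz z - (\<Sum>r<1::nat. (v \<bullet> G (fst z) (snd z))\<^sup>2)) \<longlongrightarrow> 0) high_prob"
    by (simp add: f_def Yz_def)
  define CI where "CI N = {\<xi> \<in> space M. Q N \<in> conf_interval (\<lambda>i. X i \<xi>) (n N) (k N) (p N) \<omega>0 (\<omega>h N \<xi>) \<alpha>}" for N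
  have CI: "\<forall>\<^sub>F N in sequentially. CI N \<in> events"
    using eventually_good by eventually_elim (auto simp: CI_def intro!: conf_interval_measurable \<omega>_meas)
  \<comment> \<open>The complement is used because \<open>orthonormal_limit\<close> speaks of
    exceeding a level.\<close>
  have out: "(\<lambda>N. prob (space M - CI N)) \<longlonglongrightarrow> measure (chi_square 1) {z0\<^sup>2<..}"
  proof (rule orthonormal_limit[where v = "\<lambda>_. v", OF _ _ Yl])
    show "v \<bullet> (Vc *v v) = (if r = s then 1 else 0)" if "r < 1" "s < 1" for r s :: nat
      using that spos \<sigma>(1) by (simp add: v_def matrix_vector_mult_scaleR \<sigma>(2)[symmetric])
    show "\<forall>\<^sub>F N in sequentially. space M - CI N \<in> events" using CI by eventually_elim auto
    have ev1: "\<forall>\<^sub>F N in sequentially. 0 < ln (D N)" using ln_D_top by (simp add: filterlim_at_top_dense)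
    have ev2: "\<forall>\<^sub>F z in high_prob. 0 < wz z \<bullet> (Vh z *v wz z)"
      by (rule order_tendstoD(1)[OF _ spos]) (intro tendsto_inner tendsto_matrix_vector_mult wl Vh)
    have ev3: "\<forall>\<^sub>F z in high_prob. \<forall>l. 0 < weissman_at (\<lambda>i. X i (snd z)) (n (fst z)) (k (fst z)) (p (fst z)) l"
      by (rule eventually_all_finite) (rule weissman_pos)
    have ev4: "\<forall>\<^sub>F N in sequentially. 0 < real (total (k N))"
    proof -
      have "\<forall>\<^sub>F N in sequentially. 0 < ratio N" using ratio_top by (simp add: filterlim_at_top_dense)
      then show ?thesis
      proof eventually_elim
        case (elim N)
        then have "sqrt (real (total (k N))) \<noteq> 0" by (auto simp: ratio_def)
        then show ?case by (metis of_nat_0_le_iff order_le_less real_sqrt_zero)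
      qed
    qed
    show "\<forall>\<^sub>F z in high_prob. (snd z \<in> space M - CI (fst z)) = (z0\<^sup>2 < Yz z)"
      using space_high_prob w1 ev2 ev3 eventually_fst_high_prob[OF ev1] eventually_fst_high_prob[OF ev4]
        eventually_fst_high_prob[OF quantile_pos[of j]]
    proof eventually_elim
      case (elim z)
      obtain N \<xi> where z: "z = (N, \<xi>)" by (cases z)
      define kk where "kk = real (total (k N))"
      define S2 where "S2 = wz z \<bullet> (Vh z *v wz z)"
      define PW where "PW = pooled_weissman (\<lambda>i. X i \<xi>) (n N) (k N) (p N) (wz z)"
      define h where "h = z0 * ln (D N) * sqrt (S2 / kk)"
      have kk: "0 < kk" and lD: "0 < ln (D N)" and S2: "0 < S2" and Qp: "0 < Q N"
        using elim by (auto simp: z kk_def S2_def Q_def simp del: of_nat_sum)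
      have rat: "ratio N = sqrt kk / ln (D N)" "0 < ratio N" using kk lD by (auto simp: ratio_def kk_def)
      have "pooled_weissman (\<lambda>i. X i \<xi>) (n N) (k N) (p N) (wz z) = exp (\<Sum>l\<in>UNIV. wz z $ l * logW z $ l)"
        unfolding pooled_weissman_def exp_sum[OF finite_class.finite_UNIV]
      proof (intro prod.cong refl)
        fix l
        have "0 < weissman_at (\<lambda>i. X i \<xi>) (n N) (k N) (p N) l" using elim(4) by (simp add: z)
        then show "weissman_at (\<lambda>i. X i \<xi>) (n N) (k N) (p N) l powr (wz z $ l) = exp (wz z $ l * logW z $ l)"
          by (simp add: powr_def logW_def z)
      qed
      also have "(\<Sum>l\<in>UNIV. wz z $ l * logW z $ l) = wz z \<bullet> logW z" by (simp add: inner_vec_def)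
      finally have PW: "PW = exp (wz z \<bullet> logW z)" by (simp add: PW_def)
      have mem: "\<xi> \<in> CI N \<longleftrightarrow> \<bar>wz z \<bullet> logW z - ln (Q N)\<bar> \<le> h"
      proof -
        have "\<xi> \<in> CI N \<longleftrightarrow> PW * exp (- h) \<le> Q N \<and> Q N \<le> PW * exp h"
          using elim(1) unfolding CI_def conf_interval_def Let_def PW_def h_def S2_def kk_def D_def z0_def Vh_def wz_def n_sum
          by (simp add: z)
        also have "\<dots> \<longleftrightarrow> exp (wz z \<bullet> logW z - h) \<le> exp (ln (Q N)) \<and> exp (ln (Q N)) \<le> exp (wz z \<bullet> logW z + h)"
          unfolding PW using Qp by (simp only: exp_add[symmetric] exp_ln) simp
        also have "\<dots> \<longleftrightarrow> \<bar>wz z \<bullet> logW z - ln (Q N)\<bar> \<le> h"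
          unfolding exp_le_cancel_iff by linarith
        finally show ?thesis .
      qed
      have lcj: "lc l = lc j" for l by (rule tails_equivalent_lc[OF H0])
      have Ge: "G N \<xi> + e z = ratio N *\<^sub>R logW z - (ratio N * ln (Q N)) *\<^sub>R 1"
      proof (rule vec_eq_iff[THEN iffD2], rule allI)
        fix l
        show "(G N \<xi> + e z) $ l = (ratio N *\<^sub>R logW z - (ratio N * ln (Q N)) *\<^sub>R 1) $ l"
          using lcj[of l] by (simp add: e_def z Tst_def \<delta>_def algebra_simps)
      qed
      have wGe: "wz z \<bullet> (G N \<xi> + e z) = ratio N * (wz z \<bullet> logW z - ln (Q N))"
        unfolding Ge using elim(2) by (simp add: inner_diff_right algebra_simps)
      have hr: "ratio N * h = z0 * sqrt S2"
        using kk lD by (simp add: rat(1) h_def real_sqrt_divide)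
      have "\<bar>wz z \<bullet> logW z - ln (Q N)\<bar> \<le> h \<longleftrightarrow> ratio N * \<bar>wz z \<bullet> logW z - ln (Q N)\<bar> \<le> ratio N * h"
        using rat(2) by simp
      also have "\<dots> \<longleftrightarrow> \<bar>wz z \<bullet> (G N \<xi> + e z)\<bar> \<le> z0 * sqrt S2"
        unfolding wGe hr abs_mult using rat(2) by simp
      also have "\<dots> \<longleftrightarrow> (wz z \<bullet> (G N \<xi> + e z))\<^sup>2 \<le> (z0 * sqrt S2)\<^sup>2"
        using z0 S2 abs_le_square_iff[of "wz z \<bullet> (G N \<xi> + e z)" "z0 * sqrt S2"] by simp
      also have "\<dots> \<longleftrightarrow> (wz z \<bullet> (G N \<xi> + e z))\<^sup>2 \<le> z0\<^sup>2 * S2"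
        using S2 by (simp add: power_mult_distrib)
      also have "\<dots> \<longleftrightarrow> Yz z \<le> z0\<^sup>2"
        unfolding Yz_def S2_def[symmetric] pos_divide_le_eq[OF S2] by (simp add: z)
      finally have "\<xi> \<in> CI N \<longleftrightarrow> Yz z \<le> z0\<^sup>2" using mem by simp
      then show ?case using elim(1) by (auto simp: z)
    qed
  qed simp
  have "measure (chi_square 1) {z0\<^sup>2<..} = \<alpha>"
    unfolding z0_def by (rule chi_square_1_tail[OF \<alpha>])
  with out have "(\<lambda>N. 1 - prob (space M - CI N)) \<longlonglongrightarrow> 1 - \<alpha>" by (intro tendsto_diff tendsto_const) simp
  then have "(\<lambda>N. prob (CI N)) \<longlonglongrightarrow> 1 - \<alpha>"
  proof (rule Lim_transform_eventually)
    show "\<forall>\<^sub>F N in sequentially. 1 - prob (space M - CI N) = prob (CI N)"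
      using CI by eventually_elim (simp add: prob_compl)
  qed
  then show ?thesis by (simp add: CI_def Q_def)
qed

end

section \<open>Assembly of the three assertions\<close>

theorem corollary4:
  fixes M :: "'a measure"
    and Y :: "'a \<Rightarrow> real ^ ('m::{finite,linorder})"
    and X :: "nat \<Rightarrow> 'a \<Rightarrow> real ^ ('m::{finite,linorder})"
    and F q U :: "'m \<Rightarrow> real \<Rightarrow> real"
    and \<gamma> :: real
    and \<rho> \<beta> b c :: "'m \<Rightarrow> real"
    and A :: "'m \<Rightarrow> real \<Rightarrow> real"
    and R :: "'m \<Rightarrow> 'm \<Rightarrow> ennreal \<Rightarrow> ennreal \<Rightarrow> real"
    and n k :: "nat \<Rightarrow> 'm \<Rightarrow> nat"
    and p :: "nat \<Rightarrow> real"
    and \<beta>_hat \<rho>_hat :: "nat \<Rightarrow> 'm \<Rightarrow> 'a \<Rightarrow> real"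
    and \<omega>\<^sub>0 :: "real ^ ('m::{finite,linorder})"
  defines "F \<equiv> marginal_cdf M Y"
    and "q \<equiv> \<lambda>j. quantile (F j)"
    and "U \<equiv> \<lambda>j. tail_quantile (F j)"
  assumes prob: "prob_space M"
    and Y: "Y \<in> borel_measurable M"
    and indep: "prob_space.indep_vars M (\<lambda>_. borel) X {1..}"
    and copies: "\<And>i. 1 \<le> i \<Longrightarrow> distr M borel (X i) = distr M borel Y"
    and cont: "\<And>j x. isCont (F j) x"
    and C2: "cond_C2 U (\<lambda>_. \<gamma>) \<rho> A"
    and J: "cond_J M Y R"
    and rho_neg: "\<And>j. \<rho> j < 0"
    and A: "\<And>j t. 0 < t \<Longrightarrow> A j t = \<gamma> * \<beta> j * t powr \<rho> j"
    and n_sum: "\<And>N. (\<Sum>j\<in>UNIV. n N j) = N"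
    and n_mono: "\<And>N j l. j \<le> l \<Longrightarrow> n N j \<le> n N l"
    and n_lim: "\<And>j. filterlim (\<lambda>N. n N j) at_top sequentially"
    and k_lim: "\<And>j. filterlim (\<lambda>N. k N j) at_top sequentially"
    and k_n: "\<And>j. (\<lambda>N. real (k N j) / real (n N j)) \<longlonglongrightarrow> 0"
    and b_lim: "\<And>j. (\<lambda>N. real (n N (Min UNIV)) / real (n N j)) \<longlonglongrightarrow> b j"
    and b_range: "\<And>j. 0 < b j \<and> b j \<le> 1"
    and b_mono: "b (Min UNIV) = 1" "\<And>j l. j \<le> l \<Longrightarrow> b l \<le> b j"
    and c_lim: "\<And>j. (\<lambda>N. real (k N (Min UNIV)) / real (k N j)) \<longlonglongrightarrow> c j"
    and c_range: "\<And>j. 0 < c j" "c (Min UNIV) = 1"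
    and bias: "\<And>j. (\<lambda>N. sqrt (real (k N j)) * A j (real (n N j) / real (k N j))) \<longlonglongrightarrow> 0"
    and V_pd: "positive_definite (V_matrix (\<lambda>_. \<gamma>) c b R)"
    and beta_hat: "\<And>N j. \<beta>_hat N j \<in> borel_measurable M"
      "\<And>j. tendsto_in_prob M (\<lambda>N. \<beta>_hat N j) (\<beta> j)"
    and rho_hat: "\<And>N j. \<rho>_hat N j \<in> borel_measurable M"
      "\<And>j. tendsto_in_prob M (\<lambda>N \<xi>. (\<rho>_hat N j \<xi> - \<rho> j) * ln (real (n N j))) 0"
    and p_lim: "p \<longlonglongrightarrow> 0"
    and np_lim: "filterlim (\<lambda>N. real (total (k N)) / (real N * p N)) at_top sequentially"
    and rate: "filterlim (\<lambda>N. sqrt (real (total (k N))) /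
                 ln (real (total (k N)) / (real N * p N))) at_top sequentially"
    and pilot: "\<omega>\<^sub>0 \<bullet> 1 = 1"
  shows "(2 \<le> CARD('m) \<longrightarrow> tails_equivalent U \<longrightarrow>
            (\<forall>\<alpha>. 0 < \<alpha> \<and> \<alpha> < 1 \<longrightarrow>
              (\<lambda>N. measure M {\<xi> \<in> space M.
                 quantile (cdf (chi_square (CARD('m) - 1))) (1 - \<alpha>)
                   < L_stat (\<lambda>i. X i \<xi>) (n N) (k N) (p N)}) \<longlonglongrightarrow> \<alpha>))
       \<and> (tails_different q \<longrightarrow>
            diverges_in_prob M (\<lambda>N \<xi>. L_stat (\<lambda>i. X i \<xi>) (n N) (k N) (p N)))
       \<and> (tails_equivalent U \<longrightarrow>
            (\<forall>(\<omega>_hat :: nat \<Rightarrow> 'a \<Rightarrow> real ^ ('m::{finite,linorder})) \<omega>.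
               (\<forall>N. \<omega>_hat N \<in> borel_measurable M) \<and>
               (\<forall>N. AE \<xi> in M. \<omega>_hat N \<xi> \<bullet> 1 = 1) \<and>
               tendsto_in_prob M \<omega>_hat \<omega> \<longrightarrow>
               (\<forall>\<alpha> j. 0 < \<alpha> \<and> \<alpha> < 1 \<longrightarrow>
                 (\<lambda>N. measure M {\<xi> \<in> space M.
                    q j (1 - p N) \<in>
                      conf_interval (\<lambda>i. X i \<xi>) (n N) (k N) (p N) \<omega>\<^sub>0 (\<omega>_hat N \<xi>) \<alpha>})
                 \<longlonglongrightarrow> 1 - \<alpha>)))"
proof -
  interpret pooled_samples M Y X \<gamma> \<rho> \<beta> b c A R n k p
    using prob Y indep copies cont C2 J rho_neg A n_sum n_mono n_lim k_lim k_n b_lim b_range c_lim c_range(1)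
      bias V_pd p_lim np_lim rate
    unfolding F_def U_def
    by (intro pooled_samples.intro pooled_samples_axioms.intro) auto
  show ?thesis
    unfolding q_def U_def F_def
    using L_stat_level L_stat_power conf_interval_coverage[OF _ pilot] by blast
qed

end
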